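(* No finitely generated torsion-free 2-step nilpotent group $G$ with Hirsch length $h(G)\leq 6$ has the $R_\infty$-property. Moreover, this upper bound is sharp: there exists a finitely generated torsion-free 2-step nilpotent group $G$ with Hirsch length $h(G)=7$ that has the $R_\infty$-property.
   Context: For a group $G$ put $\gamma_1(G)=G$ and $\gamma_{i+1}(G)=[\gamma_i(G),G]$. The group $G$ is 2-step nilpotent if $\gamma_2(G)\neq 1$ and $\gamma_3(G)=1$ (so abelian groups are not 2-step nilpotent). Every finitely generated nilpotent group $G$ admits a subnormal series $1=G_1\lhd G_2\lhd\dots\lhd G_s=G$ with cyclic factors $G_{i+1}/G_i$; the Hirsch length $h(G)$ is the number of infinite cyclic factors in such a series (it is independent of the chosen series). For $\varphi\in\mathrm{Aut}(G)$, elements $a,b\in G$ are $\varphi$-conjugate if there is $c\in G$ with $a=cb\varphi(c)^{-1}$; this is an equivalence relation, and the Reidemeister number $R(\varphi)\in\mathbb{N}_{>0}\cup\{\infty\}$ is the number of its equivalence classes ($R(\varphi)=\infty$ if there are infinitely many). $G$ has the $R_\infty$-property if $R(\varphi)=\infty$ for every $\varphi\in\mathrm{Aut}(G)$. *)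

theory Defs
  imports "HOL-Algebra.Algebra" "HOL-Library.Extended_Nat"
begin

definition finitely_generated :: "('a, 'b) monoid_scheme \<Rightarrow> bool" where
  "finitely_generated G \<longleftrightarrow>
     (\<exists>S. finite S \<and> S \<subseteq> carrier G \<and> generate G S = carrier G)"

definition torsion_free :: "('a, 'b) monoid_scheme \<Rightarrow> bool" where
  "torsion_free G \<longleftrightarrow>
     (\<forall>x \<in> carrier G. \<forall>n::nat. n > 0 \<and> x [^]\<^bsub>G\<^esub> n = \<one>\<^bsub>G\<^esub> \<longrightarrow> x = \<one>\<^bsub>G\<^esub>)"

(* The mutual commutator subgroup [H, K], with the commutator convention of
   HOL-Algebra, so that derived G H = commutator_subgroup G H H. *)
definition commutator_subgroup :: "('a, 'b) monoid_scheme \<Rightarrow> 'a set \<Rightarrow> 'a set \<Rightarrow> 'a set" where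
  "commutator_subgroup G H K =
     generate G (\<Union>h \<in> H. \<Union>k \<in> K. {h \<otimes>\<^bsub>G\<^esub> k \<otimes>\<^bsub>G\<^esub> inv\<^bsub>G\<^esub> h \<otimes>\<^bsub>G\<^esub> inv\<^bsub>G\<^esub> k})"

(* The numbering starts at 1; the value at 0 is a dummy. *)
fun lower_central :: "('a, 'b) monoid_scheme \<Rightarrow> nat \<Rightarrow> 'a set" where
  "lower_central G 0 = carrier G"
| "lower_central G (Suc 0) = carrier G"
| "lower_central G (Suc (Suc i)) = commutator_subgroup G (lower_central G (Suc i)) (carrier G)"

definition two_step_nilpotent :: "('a, 'b) monoid_scheme \<Rightarrow> bool" where
  "two_step_nilpotent G \<longleftrightarrow>
     lower_central G 2 \<noteq> {\<one>\<^bsub>G\<^esub>} \<and> lower_central G 3 = {\<one>\<^bsub>G\<^esub>}"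

definition series_factor ::
    "('a, 'b) monoid_scheme \<Rightarrow> 'a set list \<Rightarrow> nat \<Rightarrow> 'a set monoid" where
  "series_factor G Hs i = G\<lparr>carrier := Hs ! Suc i\<rparr> Mod (Hs ! i)"

(* The finite factors of the series may be cyclic of any order, including 1. *)
definition cyclic_series :: "('a, 'b) monoid_scheme \<Rightarrow> 'a set list \<Rightarrow> bool" where
  "cyclic_series G Hs \<longleftrightarrow>
     Hs \<noteq> [] \<and> hd Hs = {\<one>\<^bsub>G\<^esub>} \<and> last Hs = carrier G \<and>
     (\<forall>H \<in> set Hs. subgroup H G) \<and>
     (\<forall>i. Suc i < length Hs \<longrightarrow>
        (Hs ! i) \<lhd> G\<lparr>carrier := Hs ! Suc i\<rparr> \<and> cyclic_group (series_factor G Hs i))"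

definition num_infinite_factors :: "('a, 'b) monoid_scheme \<Rightarrow> 'a set list \<Rightarrow> nat" where
  "num_infinite_factors G Hs =
     card {i. Suc i < length Hs \<and> infinite (carrier (series_factor G Hs i))}"

(* Only meaningful for groups that have a cyclic series, such as finitely generated
   nilpotent groups; for these the number does not depend on the series. *)
definition hirsch_length :: "('a, 'b) monoid_scheme \<Rightarrow> nat" where
  "hirsch_length G = (THE n. \<exists>Hs. cyclic_series G Hs \<and> num_infinite_factors G Hs = n)"

definition twisted_conj :: "('a, 'b) monoid_scheme \<Rightarrow> ('a \<Rightarrow> 'a) \<Rightarrow> ('a \<times> 'a) set" where
  "twisted_conj G \<phi> = {(a, b). a \<in> carrier G \<and> b \<in> carrier G \<and>
     (\<exists>c \<in> carrier G. a = c \<otimes>\<^bsub>G\<^esub> b \<otimes>\<^bsub>G\<^esub> inv\<^bsub>G\<^esub> (\<phi> c))}"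

definition reidemeister_number :: "('a, 'b) monoid_scheme \<Rightarrow> ('a \<Rightarrow> 'a) \<Rightarrow> enat" where
  "reidemeister_number G \<phi> =
     (if finite (carrier G // twisted_conj G \<phi>)
      then enat (card (carrier G // twisted_conj G \<phi>)) else \<infinity>)"

definition R_infinity :: "('a, 'b) monoid_scheme \<Rightarrow> bool" where
  "R_infinity G \<longleftrightarrow> (\<forall>\<phi> \<in> auto G. reidemeister_number G \<phi> = \<infinity>)"

end

theory Submission
  imports Defs "HOL-Library.Function_Algebras" "HOL-Library.Countable_Set"
begin

text \<open>A finitely generated torsion-free class two group is a central extension of \<open>\<int>\<^sup>n\<close> by its
  centre \<open>\<int>\<^sup>m\<close>, given by a bilinear cocycle whose antisymmetrisation \<open>\<omega>\<close> is the commutator pairing,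
  and \<open>h(G) = n + m\<close>. Automorphisms \<open>A\<close> of \<open>\<int>\<^sup>n\<close> and \<open>B\<close> of \<open>\<int>\<^sup>m\<close> with \<open>\<omega>(A x, A y) = B \<omega>(x, y)\<close> lift
  to \<open>G\<close>, because a symmetric bilinear cocycle on \<open>\<int>\<^sup>n\<close> is a coboundary. If neither \<open>A\<close> nor \<open>B\<close> has a
  nonzero fixed vector, then the images of \<open>1 - A\<close> and \<open>1 - B\<close> have finite index, and the lift has finite
  Reidemeister number. As \<open>\<omega>\<close> is nondegenerate, \<open>n + m \<le> 6\<close> leaves \<open>n = 2, 3, 4\<close>: an alternating form on
  \<open>\<int>\<^sup>5\<close> has a radical. For \<open>n = 3\<close> there is a suitable \<open>A\<close> which is congruent to a diagonal matrix with
  entries \<open>\<plusminus>1\<close> modulo a multiple of the index of the image of \<open>\<omega>\<close>, so that the automorphism it induces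
  there extends to \<open>\<int>\<^sup>m\<close>. For \<open>n = 4\<close> two independent forms span, after saturation, a pencil for which
  some \<open>v\<close> satisfies \<open>\<omega>(v, \<int>\<^sup>4) = \<int>\<^sup>2\<close>. This yields two complementary planes that are isotropic
  for both forms, and an \<open>A\<close> which reverses the sign of the forms, so that \<open>B = -1\<close>.

  The group of Hirsch length 7 is the integral quaternionic Heisenberg group, where
  \<open>\<omega>(x, y) = Im(x\<^sup>* y)\<close>. Comparing the Pfaffians of the forms \<open>v \<bullet> \<omega>\<close> shows that each \<open>B\<close> is orthogonal,
  and an orientation argument that it is a rotation of \<open>\<int>\<^sup>3\<close>, so \<open>B\<close> has an axis and fixes a functional \<open>f\<close>.
  If \<open>A\<close> has no nonzero fixed vector, then \<open>f\<close> separates infinitely many twisted classes of central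
  elements. If \<open>A x = x \<noteq> 0\<close>, then the functional \<open>f(\<omega>(x, _))\<close>, which is nonzero, does so modulo the centre.\<close>

section \<open>Integer vectors\<close>

text \<open>As simplification rules these would rewrite eta-expanded sums of functions, which higher-order
  unification produces, to abstractions.\<close>
declare plus_fun_apply [simp del] zero_fun_apply [simp del] uminus_apply [simp del] minus_apply [simp del]

lemmas vec_apply = plus_fun_apply zero_fun_apply uminus_apply minus_apply

text \<open>What constrains \<open>A\<close> is the centre: \<open>A\<close> determines
  \<open>B\<close> only on the subgroup spanned by the values of \<open>\<omega>\<close>, while
  \<open>B\<close> has to act on all of \<open>\<int>\<^sup>m\<close>. The choice
  \<open>B = -1\<close> always extends and serves for \<open>n = 2\<close> and \<open>n = 4\<close>,
  but it is out of reach for \<open>n = 3\<close>. If the three values of \<open>\<omega>\<close> on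
  basis vectors are independent, \<open>A\<close> induces its cofactor matrix, whose determinant is
  1. If they satisfy a relation, \<open>A\<close> has to keep a plane, and inducing
  \<open>-1\<close> then forces an eigenvalue 1 of \<open>A\<close>. This is why congruences enter
  there.

  For \<open>n = 4\<close> the two forms have to be normalised over the integers. The vector
  \<open>v\<close> must therefore be suitable modulo all primes at once; it is found by moving along
  lines on which only finitely many known primes can cause trouble.

  In Hirsch length 7, orthogonality alone would still allow \<open>B = -1\<close>, which fixes no
  functional; hence the orientation. Both arguments rest on definiteness: the Pfaffian is minus the
  norm, and the orientation determinant is minus a Gram determinant.\<close>

text \<open>All ranks share one function type. Vectors are padded by zeros, so that smaller ranks
  are subsets of larger ones and the rank stays an ordinary variable.\<close>

definition int_vecs :: "nat \<Rightarrow> (nat \<Rightarrow> int) set" where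
  "int_vecs n = {x. \<forall>i\<ge>n. x i = 0}"

definition unit_vec :: "nat \<Rightarrow> nat \<Rightarrow> int" where
  "unit_vec i j = (if j = i then 1 else 0)"

definition smul :: "int \<Rightarrow> (nat \<Rightarrow> int) \<Rightarrow> nat \<Rightarrow> int" where
  "smul c x = (\<lambda>k. c * x k)"

definition lin_comb :: "nat \<Rightarrow> (nat \<Rightarrow> nat \<Rightarrow> int) \<Rightarrow> (nat \<Rightarrow> int) \<Rightarrow> nat \<Rightarrow> int" where
  "lin_comb n b x = (\<lambda>k. \<Sum>i<n. x i * b i k)"

text \<open>Additivity is relative to a set because many of the maps come from choice operators and
  inverse functions, about whose values elsewhere nothing is known.\<close>

definition additive_on :: "'a::plus set \<Rightarrow> ('a \<Rightarrow> 'b::plus) \<Rightarrow> bool" where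
  "additive_on S f \<longleftrightarrow> (\<forall>x\<in>S. \<forall>y\<in>S. f (x + y) = f x + f y)"

lemma int_vecs_zero [simp]: "0 \<in> int_vecs n"
  and int_vecs_add [simp]: "x \<in> int_vecs n \<Longrightarrow> y \<in> int_vecs n \<Longrightarrow> x + y \<in> int_vecs n"
  and int_vecs_uminus [simp]: "x \<in> int_vecs n \<Longrightarrow> - x \<in> int_vecs n"
  and int_vecs_diff [simp]: "x \<in> int_vecs n \<Longrightarrow> y \<in> int_vecs n \<Longrightarrow> x - y \<in> int_vecs n"
  and int_vecs_smul [simp]: "x \<in> int_vecs n \<Longrightarrow> smul c x \<in> int_vecs n"
  and int_vecs_unit [simp]: "i < n \<Longrightarrow> unit_vec i \<in> int_vecs n"
  by (auto simp: int_vecs_def smul_def unit_vec_def vec_apply)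

lemma int_vecs_eqI:
  assumes "x \<in> int_vecs n" "y \<in> int_vecs n" "\<And>i. i < n \<Longrightarrow> x i = y i"
  shows "x = y"
proof
  fix i show "x i = y i" using assms by (cases "i < n") (auto simp: int_vecs_def)
qed

lemma int_vecs_mono: "n \<le> m \<Longrightarrow> int_vecs n \<subseteq> int_vecs m"
  by (auto simp: int_vecs_def)

lemma int_vecs_0: "int_vecs 0 = {0}"
  by (auto simp: int_vecs_def vec_apply)

lemma lin_comb_in:
  "(\<And>i. i < n \<Longrightarrow> b i \<in> int_vecs m) \<Longrightarrow> lin_comb n b x \<in> int_vecs m"
  by (auto simp: int_vecs_def lin_comb_def intro!: sum.neutral)

lemma lin_comb_add: "lin_comb n b (x + y) = lin_comb n b x + lin_comb n b y"
  by (simp add: lin_comb_def fun_eq_iff vec_apply sum.distrib distrib_right)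

lemma lin_comb_zero [simp]: "lin_comb n b 0 = 0"
  by (simp add: lin_comb_def fun_eq_iff vec_apply)

lemma lin_comb_Suc: "lin_comb (Suc n) b x = lin_comb n b x + smul (x n) (b n)"
  by (simp add: lin_comb_def smul_def fun_eq_iff vec_apply)

lemma additive_lin_comb: "additive_on S (lin_comb n b)"
  by (simp add: additive_on_def lin_comb_add)

lemma lin_comb_unit_vec: "x \<in> int_vecs n \<Longrightarrow> lin_comb n unit_vec x = x"
proof (rule int_vecs_eqI[of _ n])
  fix i assume "i < n"
  have "(\<Sum>j<n. x j * unit_vec j i) = (\<Sum>j<n. if j = i then x j else 0)"
    by (rule sum.cong) (auto simp: unit_vec_def)
  then show "lin_comb n unit_vec x i = x i"
    using \<open>i < n\<close> by (simp add: lin_comb_def)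
qed (simp_all add: lin_comb_in)

lemma additive_on_zero:
  fixes f :: "(nat \<Rightarrow> int) \<Rightarrow> 'b::group_add"
  assumes "additive_on (int_vecs n) f" shows "f 0 = 0"
proof -
  have "f (0 + 0) = f 0 + f 0" using assms int_vecs_zero unfolding additive_on_def by blast
  then have "f 0 + f 0 = f 0 + 0" by simp
  then show ?thesis by (rule add_left_imp_eq)
qed

lemma additive_on_uminus:
  fixes f :: "(nat \<Rightarrow> int) \<Rightarrow> 'b::group_add"
  assumes "additive_on (int_vecs n) f" "x \<in> int_vecs n" shows "f (- x) = - f x"
proof -
  have "f (x + - x) = f x + f (- x)"
    using assms int_vecs_uminus[OF assms(2)] unfolding additive_on_def by blast
  then have "f x + f (- x) = 0" using additive_on_zero[OF assms(1)] by simp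
  then show ?thesis by (rule minus_unique[symmetric])
qed

lemma additive_on_diff:
  fixes f :: "(nat \<Rightarrow> int) \<Rightarrow> 'b::group_add"
  assumes "additive_on (int_vecs n) f" "x \<in> int_vecs n" "y \<in> int_vecs n"
  shows "f (x - y) = f x - f y"
proof -
  have "f (x + - y) = f x + f (- y)"
    using assms int_vecs_uminus[OF assms(3)] unfolding additive_on_def by blast
  then show ?thesis using additive_on_uminus[OF assms(1,3)] by simp
qed

lemma smul_simps [simp]: "smul 0 x = 0" "smul 1 x = x" "smul (-1) x = - x" "smul c 0 = 0"
  by (auto simp: smul_def fun_eq_iff vec_apply)

lemma smul_add: "smul (c + d) x = smul c x + smul d x"
  and smul_diff: "smul (c - d) x = smul c x - smul d x"
  and smul_uminus: "smul (- c) x = - smul c x"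
  and smul_add_right: "smul c (x + y) = smul c x + smul c y"
  and smul_smul: "smul c (smul d x) = smul (c * d) x"
  by (auto simp: smul_def fun_eq_iff vec_apply algebra_simps)

lemma smul_eq_0_iff: "smul c x = 0 \<longleftrightarrow> c = 0 \<or> x = 0"
  by (auto simp: smul_def fun_eq_iff vec_apply)

lemma additive_on_add:
  "additive_on S f \<Longrightarrow> x \<in> S \<Longrightarrow> y \<in> S \<Longrightarrow> f (x + y) = f x + f y"
  unfolding additive_on_def by blast

lemma additive_on_smul:
  fixes f :: "(nat \<Rightarrow> int) \<Rightarrow> nat \<Rightarrow> int"
  assumes f: "additive_on (int_vecs n) f" and x: "x \<in> int_vecs n"
  shows "f (smul c x) = smul c (f x)"
proof (induction c rule: int_induct[of _ 0])
  case base
  show ?case by (simp only: smul_simps additive_on_zero[OF f])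
next
  case (step1 i)
  have "f (smul i x + x) = f (smul i x) + f x"
    using f x by (intro additive_on_add[OF f]) simp_all
  then show ?case by (simp only: smul_add smul_simps step1.IH)
next
  case (step2 i)
  have "f (smul i x - x) = f (smul i x) - f x"
    using x by (intro additive_on_diff[OF f]) simp_all
  then show ?case by (simp only: smul_diff smul_simps step2.IH)
qed

lemma additive_on_smul_int:
  fixes f :: "(nat \<Rightarrow> int) \<Rightarrow> int"
  assumes f: "additive_on (int_vecs n) f" and x: "x \<in> int_vecs n"
  shows "f (smul c x) = c * f x"
proof -
  have "additive_on (int_vecs n) (\<lambda>x (_::nat). f x)"
    using additive_on_add[OF f] by (auto simp: additive_on_def fun_eq_iff vec_apply)
  from fun_cong[OF additive_on_smul[OF this x], of c 0] show ?thesis by (simp add: smul_def)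
qed

lemma additive_on_lin_comb:
  fixes f :: "(nat \<Rightarrow> int) \<Rightarrow> nat \<Rightarrow> int"
  assumes f: "additive_on (int_vecs m) f" and b: "\<And>i. i < n \<Longrightarrow> b i \<in> int_vecs m"
  shows "f (lin_comb n b x) = lin_comb n (\<lambda>i. f (b i)) x"
  using b
proof (induction n)
  case 0
  have "lin_comb 0 b x = 0" for b :: "nat \<Rightarrow> nat \<Rightarrow> int"
    by (simp add: lin_comb_def fun_eq_iff vec_apply)
  then show ?case by (simp only: additive_on_zero[OF f])
next
  case (Suc n)
  have "lin_comb n b x \<in> int_vecs m" using Suc.prems by (intro lin_comb_in) auto
  then have "f (lin_comb n b x + smul (x n) (b n)) = f (lin_comb n b x) + f (smul (x n) (b n))"
    using Suc.prems by (intro additive_on_add[OF f]) simp_all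
  then show ?case using Suc.IH Suc.prems
    by (simp only: lin_comb_Suc additive_on_smul[OF f] less_Suc_eq simp_thms)
qed

lemma additive_on_expand:
  fixes f :: "(nat \<Rightarrow> int) \<Rightarrow> nat \<Rightarrow> int"
  assumes "additive_on (int_vecs n) f" "x \<in> int_vecs n"
  shows "f x = lin_comb n (\<lambda>i. f (unit_vec i)) x"
  using additive_on_lin_comb[OF assms(1), of n unit_vec x] assms(2)
  by (simp add: lin_comb_unit_vec)

text \<open>Fraction-free Gaussian elimination: a pivot with nonzero last coordinate clears this
  coordinate from the other vectors, which are multiplied by the pivot entry instead of divided by
  it.\<close>

lemma ex_int_relation:
  assumes "finite I" "card I > n" "\<And>i. i \<in> I \<Longrightarrow> b i \<in> int_vecs n"
  shows "\<exists>t::'i \<Rightarrow> int. (\<exists>i\<in>I. t i \<noteq> 0) \<and> (\<forall>k. (\<Sum>i\<in>I. t i * b i k) = 0)"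
  using assms
proof (induction n arbitrary: I b)
  case 0
  then obtain i where "i \<in> I" by fastforce
  then show ?case using 0 by (intro exI[of _ "\<lambda>_. 1"]) (auto simp: int_vecs_0 vec_apply)
next
  case (Suc n)
  show ?case
  proof (cases "\<forall>i\<in>I. b i n = 0")
    case True
    have "b i \<in> int_vecs n" if "i \<in> I" for i
    proof -
      have "b i k = 0" if "n \<le> k" for k
        using that True Suc.prems(3)[OF \<open>i \<in> I\<close>] \<open>i \<in> I\<close> by (cases "k = n") (auto simp: int_vecs_def)
      then show ?thesis by (simp add: int_vecs_def)
    qed
    with Suc show ?thesis by simp
  next
    case False
    then obtain p where p: "p \<in> I" "b p n \<noteq> 0" by blast
    define J where "J = I - {p}"
    define c where "c i = smul (b p n) (b i) - smul (b i n) (b p)" for i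
    have J: "finite J" "card J > n" "I = insert p J" "p \<notin> J"
      using Suc.prems p by (auto simp: J_def)
    have "c i \<in> int_vecs n" if "i \<in> J" for i
    proof -
      have "b i \<in> int_vecs (Suc n)" "b p \<in> int_vecs (Suc n)" using Suc.prems J that by auto
      then have "c i k = 0" if "n \<le> k" for k
        using that by (cases "k = n") (auto simp: int_vecs_def c_def smul_def vec_apply)
      then show ?thesis by (simp add: int_vecs_def)
    qed
    from Suc.IH[OF J(1,2) this] obtain t
      where "(\<exists>i\<in>J. t i \<noteq> 0) \<and> (\<forall>k. (\<Sum>i\<in>J. t i * c i k) = 0)" by (rule exE)
    then have t: "\<exists>i\<in>J. t i \<noteq> 0" "\<And>k. (\<Sum>i\<in>J. t i * c i k) = 0" by simp_all
    \<comment> \<open>A relation among the reduced vectors \<open>c i\<close> unfolds to one among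
      the \<open>b i\<close>; the pivot receives the coefficient that collects all
      corrections.\<close>
    define s where "s i = (if i = p then - (\<Sum>i\<in>J. t i * b i n) else t i * b p n)" for i
    have "(\<Sum>i\<in>I. s i * b i k) = 0" for k
    proof -
      have "(\<Sum>i\<in>I. s i * b i k) = s p * b p k + (\<Sum>i\<in>J. s i * b i k)"
        using J by simp
      also have "(\<Sum>i\<in>J. s i * b i k) = (\<Sum>i\<in>J. t i * b p n * b i k)"
        using J(4) by (intro sum.cong) (auto simp: s_def)
      also have "s p * b p k = - (\<Sum>i\<in>J. t i * b i n * b p k)"
        by (simp add: s_def sum_distrib_right)
      also have "- (\<Sum>i\<in>J. t i * b i n * b p k) + (\<Sum>i\<in>J. t i * b p n * b i k)
          = (\<Sum>i\<in>J. t i * c i k)"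
        by (simp add: c_def smul_def vec_apply sum_subtractf[symmetric] algebra_simps sum_negf[symmetric] sum.distrib[symmetric])
      finally show ?thesis using t by simp
    qed
    moreover obtain i where "i \<in> J" "t i \<noteq> 0" using t(1) by auto
    then have "\<exists>i\<in>I. s i \<noteq> 0" using p J by (intro bexI[of _ i]) (auto simp: s_def)
    ultimately show ?thesis by (intro exI[of _ s]) simp
  qed
qed

text \<open>The \<open>n + 1\<close> vectors \<open>y\<close> and \<open>f (unit_vec i)\<close> are
  dependent, and injectivity forbids a relation without \<open>y\<close>, so a nonzero multiple of
  each \<open>y\<close> is a value of \<open>f\<close>. The product of the multipliers of the unit
  vectors then serves for all \<open>y\<close>.\<close>

lemma injective_additive_cofinite:
  assumes f: "additive_on (int_vecs n) f" "\<And>x. x \<in> int_vecs n \<Longrightarrow> f x \<in> int_vecs n"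
    and inj: "\<And>x. x \<in> int_vecs n \<Longrightarrow> f x = 0 \<Longrightarrow> x = 0"
  shows "\<exists>k>0. \<forall>y\<in>int_vecs n. \<exists>x\<in>int_vecs n. f x = smul k y"
proof -
  have ex: "\<exists>k x. k \<noteq> 0 \<and> x \<in> int_vecs n \<and> f x = smul k y" if y: "y \<in> int_vecs n" for y
  proof -
    define b where "b i = (if i = n then y else f (unit_vec i))" for i
    have b: "b i \<in> int_vecs n" if "i \<in> {..n}" for i
      using that y f(2) by (auto simp: b_def)
    have "finite {..n}" "n < card {..n}" by simp_all
    from ex_int_relation[OF this b] obtain t :: "nat \<Rightarrow> int"
      where "(\<exists>i\<in>{..n}. t i \<noteq> 0) \<and> (\<forall>k. (\<Sum>i\<in>{..n}. t i * b i k) = 0)" by (rule exE)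
    then have t: "\<exists>i\<in>{..n}. t i \<noteq> 0" "\<And>k. (\<Sum>i\<in>{..n}. t i * b i k) = 0" by simp_all
    define x where "x i = (if i < n then t i else 0)" for i
    have x: "x \<in> int_vecs n" by (auto simp: x_def int_vecs_def)
    have fx: "f x = smul (- t n) y"
    proof
      fix k
      have "f x k = (\<Sum>i<n. t i * b i k)"
        using additive_on_expand[OF f(1) x] by (simp add: lin_comb_def x_def b_def)
      moreover have "(\<Sum>i\<in>{..n}. t i * b i k) = (\<Sum>i<n. t i * b i k) + t n * y k"
        by (simp add: lessThan_Suc_atMost[symmetric] b_def)
      ultimately show "f x k = smul (- t n) y k" using t(2)[of k] by (simp add: smul_def)
    qed
    have "t n \<noteq> 0"
    proof
      assume "t n = 0"
      with fx inj[OF x] have "x = 0" by simp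
      obtain i where i: "i \<le> n" "t i \<noteq> 0" using t(1) by auto
      then have "i < n" using \<open>t n = 0\<close> by (cases "i = n") auto
      then have "x i = t i" by (simp add: x_def)
      then show False using i(2) \<open>x = 0\<close> by (simp add: vec_apply)
    qed
    then show ?thesis using fx x by (intro exI[of _ "- t n"] exI[of _ x]) simp
  qed
  have "\<forall>i\<in>{..<n}. \<exists>p. fst p \<noteq> 0 \<and> snd p \<in> int_vecs n \<and> f (snd p) = smul (fst p) (unit_vec i)"
  proof
    fix i assume "i \<in> {..<n}"
    then have "unit_vec i \<in> int_vecs n" by simp
    from ex[OF this] show "\<exists>p. fst p \<noteq> 0 \<and> snd p \<in> int_vecs n \<and> f (snd p) = smul (fst p) (unit_vec i)"
      by simp
  qed
  from bchoice[OF this] obtain p where p: "\<forall>i\<in>{..<n}. fst (p i) \<noteq> 0 \<and> snd (p i) \<in> int_vecs n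
    \<and> f (snd (p i)) = smul (fst (p i)) (unit_vec i)" by (rule exE)
  define k x where "k i = fst (p i)" and "x i = snd (p i)" for i
  have kx: "k i \<noteq> 0 \<and> x i \<in> int_vecs n \<and> f (x i) = smul (k i) (unit_vec i)" if "i < n" for i
    using p that by (simp add: k_def x_def)
  define K where "K = (\<Prod>i<n. \<bar>k i\<bar>)"
  have "K > 0" using kx by (auto simp: K_def intro!: prod_pos)
  have "\<exists>x\<in>int_vecs n. f x = smul K y" if y: "y \<in> int_vecs n" for y
  proof -
    have "\<exists>z. z \<in> int_vecs n \<and> f z = smul K (unit_vec i)" if "i < n" for i
    proof -
      have "k i dvd K" unfolding K_def using that
        by (metis abs_dvd_iff dvd_prodI finite_lessThan lessThan_iff)
      then obtain c where c: "K = c * k i" by (metis dvd_def mult.commute)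
      show ?thesis using kx[OF that] additive_on_smul[OF f(1), of "x i" c]
        by (intro exI[of _ "smul c (x i)"]) (auto simp: c smul_smul)
    qed
    then have "\<forall>i\<in>{..<n}. \<exists>z. z \<in> int_vecs n \<and> f z = smul K (unit_vec i)" by simp
    from bchoice[OF this] obtain z
      where "\<forall>i\<in>{..<n}. z i \<in> int_vecs n \<and> f (z i) = smul K (unit_vec i)" by (rule exE)
    then have z: "\<And>i. i < n \<Longrightarrow> z i \<in> int_vecs n \<and> f (z i) = smul K (unit_vec i)" by simp
    have "f (lin_comb n z y) = lin_comb n (\<lambda>i. f (z i)) y"
      using z by (intro additive_on_lin_comb[OF f(1)]) auto
    also have "\<dots> = smul K (lin_comb n unit_vec y)"
      using z by (auto simp: lin_comb_def smul_def sum_distrib_left fun_eq_iff vec_apply algebra_simps intro!: sum.cong)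
    finally show ?thesis using z y lin_comb_in[of n z n y] by (auto simp: lin_comb_unit_vec)
  qed
  with \<open>K > 0\<close> show ?thesis by (intro exI[of _ K]) simp
qed

lemma finite_box: "finite {x \<in> int_vecs n. \<forall>i. 0 \<le> x i \<and> x i < k}"
proof (rule finite_subset)
  show "{x \<in> int_vecs n. \<forall>i. 0 \<le> x i \<and> x i < k} \<subseteq>
    (\<lambda>f i. if i < n then f i else 0) ` PiE {..<n} (\<lambda>_. {0..<k})"
  proof
    fix x assume "x \<in> {x \<in> int_vecs n. \<forall>i. 0 \<le> x i \<and> x i < k}"
    then show "x \<in> (\<lambda>f i. if i < n then f i else 0) ` PiE {..<n} (\<lambda>_. {0..<k})"
      by (intro image_eqI[of _ _ "restrict x {..<n}"]) (auto simp: int_vecs_def fun_eq_iff vec_apply)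
  qed
qed (simp add: finite_PiE)

text \<open>The values of \<open>f\<close> include all multiples of some \<open>k\<close>, so
  coordinates can be reduced modulo \<open>k\<close> and end in a finite box.\<close>

lemma cofinite_image_representatives:
  assumes f: "additive_on (int_vecs n) f" "\<And>x. x \<in> int_vecs n \<Longrightarrow> f x \<in> int_vecs n"
    and inj: "\<And>x. x \<in> int_vecs n \<Longrightarrow> f x = 0 \<Longrightarrow> x = 0"
  shows "\<exists>F. finite F \<and> F \<subseteq> int_vecs n \<and> (\<forall>y\<in>int_vecs n. \<exists>x\<in>int_vecs n. y + f x \<in> F)"
proof -
  from injective_additive_cofinite[OF assms]
  obtain k where "k > 0 \<and> (\<forall>y\<in>int_vecs n. \<exists>x\<in>int_vecs n. f x = smul k y)" by (rule exE)
  then have k: "k > 0" "\<And>y. y \<in> int_vecs n \<Longrightarrow> \<exists>x\<in>int_vecs n. f x = smul k y" by simp_all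
  have "\<exists>x\<in>int_vecs n. y + f x \<in> {x \<in> int_vecs n. \<forall>i. 0 \<le> x i \<and> x i < k}" if y: "y \<in> int_vecs n" for y
  proof -
    have "(\<lambda>i. - (y i div k)) \<in> int_vecs n" using y by (auto simp: int_vecs_def)
    from k(2)[OF this] obtain x where x: "x \<in> int_vecs n" "f x = smul k (\<lambda>i. - (y i div k))" by (rule bexE)
    have "y + f x = (\<lambda>i. y i mod k)"
      by (auto simp: x(2) smul_def fun_eq_iff vec_apply minus_div_mult_eq_mod[symmetric] algebra_simps)
    moreover have "(\<lambda>i. y i mod k) \<in> {x \<in> int_vecs n. \<forall>i. 0 \<le> x i \<and> x i < k}"
      using y k(1) by (auto simp: int_vecs_def)
    ultimately show ?thesis using x(1) by (intro bexI[of _ x]) simp_all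
  qed
  then show ?thesis using finite_box[of n k] by (intro exI[of _ "{x \<in> int_vecs n. \<forall>i. 0 \<le> x i \<and> x i < k}"]) auto
qed

section \<open>Hirsch length\<close>

text \<open>Representatives may lie anywhere in \<open>G\<close>, so that those found factor by
  factor along a series can simply be multiplied.\<close>

definition finite_index :: "('a, 'b) monoid_scheme \<Rightarrow> 'a set \<Rightarrow> 'a set \<Rightarrow> bool" where
  "finite_index G K K' \<longleftrightarrow>
     (\<exists>F. finite F \<and> F \<subseteq> carrier G \<and> (\<forall>x\<in>K'. \<exists>f\<in>F. \<exists>k\<in>K. x = f \<otimes>\<^bsub>G\<^esub> k))"

lemma (in group) finite_factor_iff:
  assumes A: "subgroup A G" and B: "subgroup B G" and n: "A \<lhd> G\<lparr>carrier := B\<rparr>"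
  shows "finite (carrier (G\<lparr>carrier := B\<rparr> Mod A)) \<longleftrightarrow> finite_index G A B"
proof -
  have AB: "A \<subseteq> B"
    using normal_imp_subgroup[OF n] subgroup.subset by fastforce
  have Bc: "B \<subseteq> carrier G" and Ac: "A \<subseteq> carrier G" using A B by (auto simp: subgroup.subset)
  have grpB: "group (G\<lparr>carrier := B\<rparr>)" using B by (simp add: subgroup_imp_group)
  have car: "carrier (G\<lparr>carrier := B\<rparr> Mod A) = (\<lambda>a. A #> a) ` B"
    by (auto simp: FactGroup_def RCOSETS_def r_coset_def)
  have lr: "A #> b = b <# A" if "b \<in> B" for b
    using normal.coset_eq[OF n] that by (auto simp: r_coset_def l_coset_def)
  show ?thesis
  proof
    assume "finite (carrier (G\<lparr>carrier := B\<rparr> Mod A))"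
    then obtain F where F: "F \<subseteq> B" "finite F" "(\<lambda>a. A #> a) ` B = (\<lambda>a. A #> a) ` F"
      unfolding car using finite_subset_image[of "(\<lambda>a. A #> a) ` B" "\<lambda>a. A #> a" B] by auto
    have "\<exists>f\<in>F. \<exists>k\<in>A. x = f \<otimes> k" if x: "x \<in> B" for x
    proof -
      have "A #> x \<in> (\<lambda>a. A #> a) ` F" using F(3) x by auto
      then obtain f where f: "f \<in> F" "A #> x = A #> f" by auto
      have "x \<in> A #> x" using x Bc A by (meson rcos_self subsetD)
      then have "x \<in> f <# A" using f lr F(1) by auto
      then show ?thesis using f by (auto simp: l_coset_def)
    qed
    then show "finite_index G A B" unfolding finite_index_def
      using F(1,2) Bc by (intro exI[of _ F] conjI ballI) auto
  next
    assume "finite_index G A B"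
    then obtain F where F: "finite F" "F \<subseteq> carrier G" "\<And>x. x \<in> B \<Longrightarrow> \<exists>f\<in>F. \<exists>k\<in>A. x = f \<otimes> k"
      unfolding finite_index_def by blast
    have "(\<lambda>a. A #> a) ` B \<subseteq> (\<lambda>f. f <# A) ` F"
    proof
      fix S assume "S \<in> (\<lambda>a. A #> a) ` B"
      then obtain x where x: "x \<in> B" "S = x <# A" using lr by blast
      then obtain f k where fk: "f \<in> F" "k \<in> A" "x = f \<otimes> k" using F(3) by blast
      have c: "f \<in> carrier G" "k \<in> carrier G" using fk F(2) Ac by auto
      have "S = f <# (k <# A)" using x(2) fk(3) c Ac by (simp add: lcos_m_assoc)
      also have "k <# A = A" using c(2) A fk(2) by (rule coset_join3)
      finally show "S \<in> (\<lambda>f. f <# A) ` F" using fk by blast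
    qed
    then show "finite (carrier (G\<lparr>carrier := B\<rparr> Mod A))" unfolding car using F(1) by (meson finite_imageI finite_subset)
  qed
qed

lemma (in group) cyclic_factor_generator:
  assumes A: "subgroup A G" and B: "subgroup B G" and n: "A \<lhd> G\<lparr>carrier := B\<rparr>"
    and cyc: "cyclic_group (G\<lparr>carrier := B\<rparr> Mod A)"
  shows "\<exists>t\<in>B. \<forall>b\<in>B. \<exists>a::int. \<exists>h\<in>A. b = t [^] a \<otimes> h"
proof -
  let ?H = "G\<lparr>carrier := B\<rparr>"
  have AB: "A \<subseteq> B"
    using normal_imp_subgroup[OF n] subgroup.subset by fastforce
  have Bc: "B \<subseteq> carrier G" and Ac: "A \<subseteq> carrier G" using A B by (auto simp: subgroup.subset)
  interpret B: group ?H using B by (simp add: subgroup_imp_group)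
  interpret nA: normal A ?H by (rule n)
  interpret Q: group "?H Mod A" by (rule nA.factorgroup_is_group)
  have car: "carrier (?H Mod A) = (\<lambda>a. A #> a) ` B"
    by (auto simp: FactGroup_def RCOSETS_def r_coset_def)
  have lr: "A #> b = b <# A" if "b \<in> B" for b
    using nA.coset_eq that by (auto simp: r_coset_def l_coset_def)
  obtain S where S: "S \<in> carrier (?H Mod A)" "carrier (?H Mod A) = range (\<lambda>n::int. S [^]\<^bsub>?H Mod A\<^esub> n)"
    using cyc Q.cyclic_group by blast
  obtain t where t: "t \<in> B" "S = A #> t" using S(1) car by blast
  have hom: "(\<lambda>a. A #> a) \<in> hom ?H (?H Mod A)"
    using nA.r_coset_hom_Mod by (simp add: r_coset_def)
  have pw: "S [^]\<^bsub>?H Mod A\<^esub> a = A #> (t [^]\<^bsub>?H\<^esub> a)" for a :: int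
    using hom_int_pow[OF hom, of t a] t by (simp add: B.is_group Q.is_group)
  have tp: "t [^]\<^bsub>?H\<^esub> a = t [^] a" for a :: int
    using int_pow_consistent[OF B t(1), of a] by simp
  have "\<exists>a::int. \<exists>h\<in>A. b = t [^] a \<otimes> h" if b: "b \<in> B" for b
  proof -
    have "A #> b \<in> carrier (?H Mod A)" using car b by auto
    then obtain a :: int where "A #> b = S [^]\<^bsub>?H Mod A\<^esub> a" using S(2) by auto
    then have a: "A #> b = A #> (t [^] a)" using pw tp by simp
    have "t [^] a \<in> B" using tp t B.int_pow_closed[of t a] by simp
    then have "A #> b = t [^] a <# A" using a lr by simp
    moreover have "b \<in> A #> b" using b Bc A by (meson rcos_self subsetD)
    ultimately show ?thesis by (auto simp: l_coset_def)
  qed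
  then show ?thesis using t(1) by (intro bexI[of _ t] ballI)
qed

locale group_with_cyclic_series = group G for G (structure) +
  fixes Hs :: "'a set list"
  assumes series: "cyclic_series G Hs"
begin

lemma last_series: "Hs ! (length Hs - 1) = carrier G" and nonempty_series: "0 < length Hs"
  using series last_conv_nth[of Hs] unfolding cyclic_series_def by auto

lemma sub: "i < length Hs \<Longrightarrow> subgroup (Hs ! i) G"
  using series by (auto simp: cyclic_series_def)

lemma nrm: "Suc i < length Hs \<Longrightarrow> Hs ! i \<lhd> G\<lparr>carrier := Hs ! Suc i\<rparr>"
  using series by (auto simp: cyclic_series_def)

lemma cyc: "Suc i < length Hs \<Longrightarrow> cyclic_group (G\<lparr>carrier := Hs ! Suc i\<rparr> Mod (Hs ! i))"
  using series by (auto simp: cyclic_series_def series_factor_def)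

lemma incl: assumes "Suc i < length Hs" shows "Hs ! i \<subseteq> Hs ! Suc i"
  using normal_imp_subgroup[OF nrm[OF assms]] subgroup.subset by fastforce

lemma infinite_factor_iff:
  "Suc i < length Hs \<Longrightarrow> infinite (carrier (series_factor G Hs i)) \<longleftrightarrow> \<not> finite_index G (Hs ! i) (Hs ! Suc i)"
  using finite_factor_iff[OF sub sub nrm] by (simp add: series_factor_def)

text \<open>Its cardinality is the Hirsch length of \<open>K\<close> measured along the fixed
  series: an infinite cyclic factor counts when the image of \<open>K\<close> in it is nontrivial,
  hence infinite.\<close>

definition infinite_steps :: "'a set \<Rightarrow> nat set" where
  "infinite_steps K = {i. Suc i < length Hs \<and> \<not> finite_index G (Hs ! i) (Hs ! Suc i) \<and> \<not> K \<inter> Hs ! Suc i \<subseteq> Hs ! i}"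

lemma infinite_steps_mono: "K \<subseteq> K' \<Longrightarrow> infinite_steps K \<subseteq> infinite_steps K'"
  by (auto simp: infinite_steps_def)

lemma finite_infinite_steps: "finite (infinite_steps K)"
  by (rule finite_subset[of _ "{..<length Hs}"]) (auto simp: infinite_steps_def)

text \<open>In each factor one of three reasons bounds the index of the image of \<open>K\<close> in
  that of \<open>K'\<close>: the factor is finite, the image of \<open>K'\<close> is trivial, or the
  image of \<open>K\<close> is a nontrivial subgroup of a cyclic group in which the generator has no
  relation smaller than the one used.\<close>

lemma representatives:
  assumes K: "subgroup K G" and K': "subgroup K' G" "K \<subseteq> K'"
    and eq: "infinite_steps K = infinite_steps K'" and i: "Suc i < length Hs"
  shows "\<exists>R. finite R \<and> R \<subseteq> carrier G \<and>
    (\<forall>x\<in>K' \<inter> Hs ! Suc i. \<exists>r\<in>R. \<exists>k\<in>K \<inter> Hs ! Suc i. \<exists>h\<in>Hs ! i. x = r \<otimes> k \<otimes> h)"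
proof -
  interpret K: subgroup K G by fact
  interpret H: subgroup "Hs ! i" G using sub i by simp
  interpret H': subgroup "Hs ! Suc i" G using sub i by simp
  have "i \<in> infinite_steps K \<longleftrightarrow> i \<in> infinite_steps K'" using eq by simp
  then have "finite_index G (Hs ! i) (Hs ! Suc i) \<or> K' \<inter> Hs ! Suc i \<subseteq> Hs ! i \<or> \<not> K \<inter> Hs ! Suc i \<subseteq> Hs ! i"
    using i unfolding infinite_steps_def mem_Collect_eq by argo
  then show ?thesis
  proof (elim disjE)
    assume "finite_index G (Hs ! i) (Hs ! Suc i)"
    then obtain F where F: "finite F" "F \<subseteq> carrier G" "\<And>x. x \<in> Hs ! Suc i \<Longrightarrow> \<exists>f\<in>F. \<exists>k\<in>Hs ! i. x = f \<otimes> k"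
      unfolding finite_index_def by blast
    have "\<forall>x\<in>K' \<inter> Hs ! Suc i. \<exists>r\<in>F. \<exists>k\<in>K \<inter> Hs ! Suc i. \<exists>h\<in>Hs ! i. x = r \<otimes> k \<otimes> h"
    proof
      fix x assume "x \<in> K' \<inter> Hs ! Suc i"
      then obtain f h where "f \<in> F" "h \<in> Hs ! i" "x = f \<otimes> h" using F(3) by blast
      then show "\<exists>r\<in>F. \<exists>k\<in>K \<inter> Hs ! Suc i. \<exists>h\<in>Hs ! i. x = r \<otimes> k \<otimes> h"
        using F(2) by (intro bexI[of _ f] bexI[of _ \<one>] bexI[of _ h]) auto
    qed
    then show ?thesis using F by blast
  next
    assume triv: "K' \<inter> Hs ! Suc i \<subseteq> Hs ! i"
    have "\<forall>x\<in>K' \<inter> Hs ! Suc i. \<exists>r\<in>{\<one>}. \<exists>k\<in>K \<inter> Hs ! Suc i. \<exists>h\<in>Hs ! i. x = r \<otimes> k \<otimes> h"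
    proof (rule ballI)
      fix x assume x: "x \<in> K' \<inter> Hs ! Suc i"
      then have "x \<in> Hs ! i" "x = \<one> \<otimes> \<one> \<otimes> x" using triv by auto
      then show "\<exists>r\<in>{\<one>}. \<exists>k\<in>K \<inter> Hs ! Suc i. \<exists>h\<in>Hs ! i. x = r \<otimes> k \<otimes> h"
        using K.one_closed H'.one_closed by blast
    qed
    then show ?thesis by (intro exI[of _ "{\<one>}"]) simp
  next
    assume "\<not> K \<inter> Hs ! Suc i \<subseteq> Hs ! i"
    then obtain k0 where k0: "k0 \<in> K" "k0 \<in> Hs ! Suc i" "k0 \<notin> Hs ! i" by blast
    obtain t where t: "t \<in> Hs ! Suc i" "\<And>b. b \<in> Hs ! Suc i \<Longrightarrow> \<exists>a::int. \<exists>h\<in>Hs ! i. b = t [^] a \<otimes> h"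
      using cyclic_factor_generator[OF sub sub nrm cyc] i by (metis Suc_lessD)
    have tc: "t \<in> carrier G" using t by simp
    have tp: "t [^] a \<in> Hs ! Suc i" for a :: int
      using t(1) subgroup_int_pow_closed[OF H'.subgroup_axioms] by simp
    obtain c h0 where c: "h0 \<in> Hs ! i" "k0 = t [^] (c::int) \<otimes> h0" using t(2) k0 by blast
    have "c \<noteq> 0" using c k0 by (auto)
    have k0c: "k0 \<in> carrier G" using k0 by simp
    have Hi: "subgroup (Hs ! i) (G\<lparr>carrier := Hs ! Suc i\<rparr>)" using nrm[OF i] normal_imp_subgroup by blast
    interpret Q: normal "Hs ! i" "G\<lparr>carrier := Hs ! Suc i\<rparr>" by (rule nrm[OF i])
    have iv: "inv\<^bsub>G\<lparr>carrier := Hs ! Suc i\<rparr>\<^esub> x = inv x" if "x \<in> Hs ! Suc i" for x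
      using that m_inv_consistent[OF H'.subgroup_axioms] by simp
    have conj: "x \<otimes> h \<otimes> inv x \<in> Hs ! i" if "x \<in> Hs ! Suc i" "h \<in> Hs ! i" for x h
      using Q.inv_op_closed2[of x h] that iv by simp
    have conj': "inv x \<otimes> h \<otimes> x \<in> Hs ! i" if "x \<in> Hs ! Suc i" "h \<in> Hs ! i" for x h
      using Q.inv_op_closed1[of x h] that iv by simp
    have pw: "\<exists>h\<in>Hs ! i. k0 [^] n = (t [^] c) [^] n \<otimes> h" for n :: nat
    proof (induction n)
      case 0
      then show ?case by (auto intro!: bexI[of _ \<one>])
    next
      case (Suc n)
      then obtain h where h: "h \<in> Hs ! i" "k0 [^] n = (t [^] c) [^] n \<otimes> h" by blast
      have hc: "h \<in> carrier G" "h0 \<in> carrier G" "t [^] c \<in> carrier G" using h c tc by auto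
      have "k0 [^] Suc n = (t [^] c) [^] n \<otimes> h \<otimes> (t [^] c \<otimes> h0)" using h c by simp
      also have "\<dots> = (t [^] c) [^] Suc n \<otimes> ((inv (t [^] c) \<otimes> h \<otimes> t [^] c) \<otimes> h0)"
        using hc by (simp add: m_assoc inv_solve_left nat_pow_closed)
          (metis hc(1) hc(3) inv_closed l_one m_assoc m_closed nat_pow_closed r_inv)
      finally show ?case using conj'[OF tp h(1)] c(1) by blast
    qed
    have pwi: "\<exists>h\<in>Hs ! i. t [^] (c * l) = k0 [^] l \<otimes> h" for l :: int
    proof (cases "l \<ge> 0")
      case True
      then obtain n where n: "l = int n" by (metis nonneg_int_cases)
      obtain h where h: "h \<in> Hs ! i" "k0 [^] n = (t [^] c) [^] n \<otimes> h" using pw by blast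
      have "t [^] (c * l) = (t [^] c) [^] n" using tc n by (simp add: int_pow_pow int_pow_int[symmetric])
      also have "\<dots> = k0 [^] n \<otimes> inv h" using h tc by (metis H.mem_carrier int_pow_closed inv_solve_right k0c nat_pow_closed)
      finally show ?thesis using h n by (metis H.m_inv_closed int_pow_int)
    next
      case False
      then obtain n where n: "l = - int n" by (metis linorder_le_cases minus_minus nonneg_int_cases neg_0_le_iff_le)
      obtain h where h: "h \<in> Hs ! i" "k0 [^] n = (t [^] c) [^] n \<otimes> h" using pw by blast
      have hc: "h \<in> carrier G" using h by simp
      have k0n: "k0 [^] l = inv (k0 [^] n)" using n k0c by (simp add: int_pow_neg int_pow_int)
      have "t [^] (c * l) = inv ((t [^] c) [^] n)" using tc n by (simp add: int_pow_pow int_pow_int[symmetric] int_pow_neg[symmetric])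
      also have "(t [^] c) [^] n = k0 [^] n \<otimes> inv h" using h tc by (metis H.mem_carrier int_pow_closed inv_solve_right k0c nat_pow_closed)
      also have "inv (k0 [^] n \<otimes> inv h) = h \<otimes> inv (k0 [^] n)" using hc k0c by (simp add: inv_mult_group)
      also have "\<dots> = inv (k0 [^] n) \<otimes> (k0 [^] n \<otimes> h \<otimes> inv (k0 [^] n))"
        using hc k0c by (simp add: m_assoc[symmetric])
      finally have "t [^] (c * l) = k0 [^] l \<otimes> (k0 [^] n \<otimes> h \<otimes> inv (k0 [^] n))" using k0n by simp
      moreover have "k0 [^] n \<in> Hs ! Suc i" using k0 subgroup_int_pow_closed[OF H'.subgroup_axioms, of k0 "int n"] by (simp add: int_pow_int)
      ultimately show ?thesis using conj[OF _ h(1)] by blast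
    qed
    \<comment> \<open>Division of the exponent by \<open>c\<close>: the multiple of \<open>c\<close>
      becomes a power of \<open>k0\<close>, which lies in \<open>K\<close>, and the remainder is one
      of finitely many.\<close>
    have "\<forall>x\<in>K' \<inter> Hs ! Suc i. \<exists>r\<in>(\<lambda>r::int. t [^] r) ` {0..<\<bar>c\<bar>}. \<exists>k\<in>K \<inter> Hs ! Suc i. \<exists>h\<in>Hs ! i. x = r \<otimes> k \<otimes> h"
    proof
      fix x assume x: "x \<in> K' \<inter> Hs ! Suc i"
      then obtain a h where a: "h \<in> Hs ! i" "x = t [^] (a::int) \<otimes> h" using t(2) by blast
      define r where "r = a mod \<bar>c\<bar>"
      have r: "r \<in> {0..<\<bar>c\<bar>}" using \<open>c \<noteq> 0\<close> by (auto simp: r_def)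
      have "c dvd a - r" unfolding r_def by (metis abs_dvd_iff dvd_minus_mod)
      then obtain l where l: "a = r + c * l" by (metis dvdE add_diff_cancel_left' diff_add_cancel add.commute)
      obtain h1 where h1: "h1 \<in> Hs ! i" "t [^] (c * l) = k0 [^] l \<otimes> h1" using pwi by blast
      have "t [^] a = t [^] r \<otimes> (k0 [^] l \<otimes> h1)"
        unfolding l int_pow_mult[OF tc] h1(2) ..
      then have "x = t [^] r \<otimes> k0 [^] l \<otimes> (h1 \<otimes> h)"
        using a(1,2) h1(1) tc k0c by (simp add: m_assoc)
      moreover have "k0 [^] l \<in> K" using k0 subgroup_int_pow_closed[OF K.subgroup_axioms] by simp
      moreover have "k0 [^] l \<in> Hs ! Suc i" using k0 subgroup_int_pow_closed[OF H'.subgroup_axioms] by simp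
      ultimately show "\<exists>r\<in>(\<lambda>r::int. t [^] r) ` {0..<\<bar>c\<bar>}. \<exists>k\<in>K \<inter> Hs ! Suc i. \<exists>h\<in>Hs ! i. x = r \<otimes> k \<otimes> h"
        using r a(1) h1(1) by blast
    qed
    then show ?thesis using tc by (intro exI[of _ "(\<lambda>r::int. t [^] r) ` {0..<\<bar>c\<bar>}"]) auto
  qed
qed

text \<open>The analogue of the fact that a subspace of full dimension is everything. By induction
  along the series, a representative in the top factor and an element of \<open>K\<close> reduce an
  element of \<open>K'\<close> to the next lower term.\<close>

lemma finite_index_if_same_infinite_steps:
  assumes K: "subgroup K G" and K': "subgroup K' G" "K \<subseteq> K'"
    and eq: "infinite_steps K = infinite_steps K'"
  shows "finite_index G K K'"
proof -
  interpret K: subgroup K G by fact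
  interpret K': subgroup K' G by fact
  have "i < length Hs \<Longrightarrow> finite_index G (K \<inter> Hs ! i) (K' \<inter> Hs ! i)" for i
  proof (induction i)
    case 0
    have "Hs ! 0 = {\<one>}" using series by (auto simp: cyclic_series_def hd_conv_nth)
    then show ?case by (auto simp: finite_index_def intro!: exI[of _ "{\<one>}"])
  next
    case (Suc i)
    interpret H: subgroup "Hs ! i" G using sub Suc by simp
    interpret H': subgroup "Hs ! Suc i" G using sub Suc by simp
    interpret Q: normal "Hs ! i" "G\<lparr>carrier := Hs ! Suc i\<rparr>" by (rule nrm[OF Suc.prems])
    have iv: "inv\<^bsub>G\<lparr>carrier := Hs ! Suc i\<rparr>\<^esub> x = inv x" if "x \<in> Hs ! Suc i" for x
      using that m_inv_consistent[OF H'.subgroup_axioms] by simp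
    have conj: "x \<otimes> h \<otimes> inv x \<in> Hs ! i" if "x \<in> Hs ! Suc i" "h \<in> Hs ! i" for x h
      using Q.inv_op_closed2[of x h] that iv by simp
    have HH: "Hs ! i \<subseteq> Hs ! Suc i" using incl Suc.prems by simp
    obtain F where F': "finite F \<and> F \<subseteq> carrier G \<and> (\<forall>x\<in>K' \<inter> Hs ! i. \<exists>f\<in>F. \<exists>k\<in>K \<inter> Hs ! i. x = f \<otimes> k)"
      using Suc.IH[OF Suc_lessD[OF Suc.prems]] unfolding finite_index_def by (rule exE)
    then have F: "finite F" "F \<subseteq> carrier G" by simp_all
    note F3 = F'[THEN conjunct2, THEN conjunct2, rule_format]
    from representatives[OF K K' eq Suc.prems] obtain R where R': "finite R \<and> R \<subseteq> carrier G \<and>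
      (\<forall>x\<in>K' \<inter> Hs ! Suc i. \<exists>r\<in>R. \<exists>k\<in>K \<inter> Hs ! Suc i. \<exists>h\<in>Hs ! i. x = r \<otimes> k \<otimes> h)" by (rule exE)
    then have R: "finite R" "R \<subseteq> carrier G" by simp_all
    note R3 = R'[THEN conjunct2, THEN conjunct2, rule_format]
    \<comment> \<open>A representative \<open>r\<close> need not lie in \<open>K'\<close>. It is
      replaced by an element \<open>q r\<close> of \<open>K'\<close> with a decomposition of the
      same shape, so that the remainder \<open>g\<close> below stays in \<open>K'\<close> and the
      induction hypothesis applies to it.\<close>
    define P where "P r y \<longleftrightarrow> y \<in> K' \<inter> Hs ! Suc i \<and> (\<exists>k\<in>K \<inter> Hs ! Suc i. \<exists>h\<in>Hs ! i. y = r \<otimes> k \<otimes> h)" for r y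
    define q where "q r = (SOME y. P r y)" for r
    have qP: "P r y \<Longrightarrow> P r (q r)" for r y unfolding q_def by (rule someI)
    define F' where "F' = (\<lambda>(r, f). q r \<otimes> f) ` (R \<times> F) \<inter> carrier G"
    have "\<exists>f\<in>F'. \<exists>k\<in>K \<inter> Hs ! Suc i. x = f \<otimes> k" if x: "x \<in> K' \<inter> Hs ! Suc i" for x
    proof -
      obtain r k h where r: "r \<in> R" "k \<in> K \<inter> Hs ! Suc i" "h \<in> Hs ! i" "x = r \<otimes> k \<otimes> h" using R3[OF x] by auto
      then have "P r x" using x by (auto simp: P_def)
      from qP[OF this] obtain k1 h1 where k1: "q r \<in> K' \<inter> Hs ! Suc i" "k1 \<in> K \<inter> Hs ! Suc i" "h1 \<in> Hs ! i" "q r = r \<otimes> k1 \<otimes> h1"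
        unfolding P_def by blast
      define \<kappa> where "\<kappa> = inv k1 \<otimes> k"
      have \<kappa>: "\<kappa> \<in> K" "\<kappa> \<in> Hs ! Suc i" using r k1 by (auto simp: \<kappa>_def)
      have rc: "r \<in> carrier G" "k \<in> carrier G" "h \<in> carrier G" "k1 \<in> carrier G" "h1 \<in> carrier G" "\<kappa> \<in> carrier G"
        "q r \<in> carrier G" "x \<in> carrier G"
        using r R(2) k1 x \<kappa> by auto
      define g where "g = inv (q r) \<otimes> x \<otimes> inv \<kappa>"
      have "g = inv h1 \<otimes> (\<kappa> \<otimes> h \<otimes> inv \<kappa>)"
        using rc r(4) k1(4) by (simp add: g_def \<kappa>_def inv_mult_group m_assoc)
           (metis inv_closed inv_solve_left' m_assoc m_closed)
      then have "g \<in> Hs ! i" using conj[OF \<kappa>(2) r(3)] k1(3) by simp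
      moreover have "g \<in> K'" using k1(1) x \<kappa>(1) K'(2) by (auto simp: g_def)
      ultimately obtain f k2 where f: "f \<in> F" "k2 \<in> K \<inter> Hs ! i" "g = f \<otimes> k2" using F3[of g] by auto
      have fc: "f \<in> carrier G" "k2 \<in> carrier G" "g \<in> carrier G" using f F(2) \<open>g \<in> K'\<close> by auto
      have "x = q r \<otimes> g \<otimes> \<kappa>" using rc unfolding g_def by (simp add: m_assoc) (simp add: m_assoc[symmetric])
      also have "\<dots> = (q r \<otimes> f) \<otimes> (k2 \<otimes> \<kappa>)" using rc fc f(3) by (simp add: m_assoc)
      finally have "x = (q r \<otimes> f) \<otimes> (k2 \<otimes> \<kappa>)" .
      moreover have "q r \<otimes> f \<in> F'" using r(1) f(1) rc fc by (auto simp: F'_def)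
      moreover have "k2 \<otimes> \<kappa> \<in> K \<inter> Hs ! Suc i" using f(2) \<kappa> HH by auto
      ultimately show ?thesis by blast
    qed
    then show ?case unfolding finite_index_def using F(1) R(1) by (intro exI[of _ F']) (auto simp: F'_def)
  qed
  from this[of "length Hs - 1"] show ?thesis
    using K.subset K'.subset nonempty_series unfolding last_series by (simp add: Int_absorb2)
qed

lemma infinite_steps_carrier:
  "infinite_steps (carrier G) = {i. Suc i < length Hs \<and> infinite (carrier (series_factor G Hs i))}"
proof -
  have ne: "\<not> carrier G \<inter> Hs ! Suc i \<subseteq> Hs ! i" if i: "Suc i < length Hs" "\<not> finite_index G (Hs ! i) (Hs ! Suc i)" for i
  proof
    assume a: "carrier G \<inter> Hs ! Suc i \<subseteq> Hs ! i"
    interpret H': subgroup "Hs ! Suc i" G using sub i by simp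
    have "\<exists>f\<in>{\<one>}. \<exists>k\<in>Hs ! i. x = f \<otimes> k" if "x \<in> Hs ! Suc i" for x
      using a that H'.subset by (intro bexI[of _ \<one>] bexI[of _ x]) auto
    then have "finite_index G (Hs ! i) (Hs ! Suc i)"
      unfolding finite_index_def by (intro exI[of _ "{\<one>}"] conjI ballI) auto
    then show False using i by simp
  qed
  have "i \<in> infinite_steps (carrier G) \<longleftrightarrow> Suc i < length Hs \<and> infinite (carrier (series_factor G Hs i))" for i
    unfolding infinite_steps_def mem_Collect_eq using infinite_factor_iff[of i] ne[of i] by argo
  then show ?thesis by blast
qed

text \<open>Going up \<open>Ks\<close>, each infinite factor enlarges \<open>infinite_steps\<close>,
  since equality would make its index finite. Exchanging the two series gives the independence that
  the definite description in \<open>hirsch_length\<close> requires.\<close>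

lemma num_infinite_factors_le:
  assumes Ks: "cyclic_series G Ks"
  shows "num_infinite_factors G Ks \<le> num_infinite_factors G Hs"
proof -
  interpret K: group_with_cyclic_series G Ks by unfold_locales (rule Ks)
  have "j < length Ks \<Longrightarrow> card {i. i < j \<and> infinite (carrier (series_factor G Ks i))} \<le> card (infinite_steps (Ks ! j))" for j
  proof (induction j)
    case 0
    then show ?case by simp
  next
    case (Suc j)
    have le: "infinite_steps (Ks ! j) \<subseteq> infinite_steps (Ks ! Suc j)" using infinite_steps_mono[OF K.incl[OF Suc.prems]] .
    let ?S = "\<lambda>j. {i. i < j \<and> infinite (carrier (series_factor G Ks i))}"
    show ?case
    proof (cases "infinite (carrier (series_factor G Ks j))")
      case True
      then have "\<not> finite_index G (Ks ! j) (Ks ! Suc j)" using K.infinite_factor_iff Suc.prems by blast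
      then have "infinite_steps (Ks ! j) \<noteq> infinite_steps (Ks ! Suc j)"
        using finite_index_if_same_infinite_steps[OF K.sub K.sub K.incl] Suc.prems by auto
      then have "card (infinite_steps (Ks ! j)) < card (infinite_steps (Ks ! Suc j))"
        using le finite_infinite_steps by (intro psubset_card_mono) auto
      moreover have "?S (Suc j) = insert j (?S j)" using True by (auto simp: less_Suc_eq)
      ultimately show ?thesis using Suc by simp
    next
      case False
      then have "?S (Suc j) = ?S j" by (auto simp: less_Suc_eq)
      moreover have "card (infinite_steps (Ks ! j)) \<le> card (infinite_steps (Ks ! Suc j))"
        using le finite_infinite_steps by (intro card_mono) auto
      ultimately show ?thesis using Suc by simp
    qed
  qed
  from this[of "length Ks - 1"] have "card {i. i < length Ks - 1 \<and> infinite (carrier (series_factor G Ks i))} \<le> card (infinite_steps (carrier G))"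
    using K.nonempty_series unfolding K.last_series by simp
  moreover have "{i. i < length Ks - 1 \<and> infinite (carrier (series_factor G Ks i))} = {i. Suc i < length Ks \<and> infinite (carrier (series_factor G Ks i))}"
    by auto
  ultimately show ?thesis unfolding infinite_steps_carrier num_infinite_factors_def by simp
qed

end

lemma (in group) hirsch_length_eq:
  assumes "cyclic_series G Hs"
  shows "hirsch_length G = num_infinite_factors G Hs"
  unfolding hirsch_length_def
proof (rule the_equality)
  fix n assume "\<exists>Ks. cyclic_series G Ks \<and> num_infinite_factors G Ks = n"
  then obtain Ks where Ks: "cyclic_series G Ks" "num_infinite_factors G Ks = n" by blast
  interpret H: group_with_cyclic_series G Hs by unfold_locales (rule assms)
  interpret K: group_with_cyclic_series G Ks by unfold_locales (rule Ks)
  show "n = num_infinite_factors G Hs"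
    using H.num_infinite_factors_le[OF Ks(1)] K.num_infinite_factors_le[OF assms] Ks(2) by simp
qed (use assms in blast)

section \<open>Central extensions of free abelian groups by bilinear cocycles\<close>

lemma int_vecs_induct:
  assumes x: "x \<in> int_vecs n" and zero: "P 0"
    and plus: "\<And>i y. i < n \<Longrightarrow> y \<in> int_vecs n \<Longrightarrow> P y \<Longrightarrow> P (y + unit_vec i)"
    and minus: "\<And>i y. i < n \<Longrightarrow> y \<in> int_vecs n \<Longrightarrow> P y \<Longrightarrow> P (y - unit_vec i)"
  shows "P x"
proof -
  have "P (y + smul c (unit_vec i))" if i: "i < n" and y: "y \<in> int_vecs n" "P y" for i y c
  proof (induction c rule: int_induct[of _ 0])
    case base
    show ?case using y by (simp only: smul_simps add_0_right)
  next
    case (step1 c)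
    have "P ((y + smul c (unit_vec i)) + unit_vec i)"
      by (rule plus[OF i _ step1(2)]) (use i y in simp)
    then show ?case by (simp only: smul_add smul_simps add.assoc)
  next
    case (step2 c)
    have "P ((y + smul c (unit_vec i)) - unit_vec i)"
      by (rule minus[OF i _ step2(2)]) (use i y in simp)
    then show ?case by (simp only: smul_diff smul_simps add_diff_eq)
  qed
  note step = this
  have "j \<le> n \<Longrightarrow> P (lin_comb j unit_vec x)" for j
  proof (induction j)
    case 0
    have "lin_comb 0 unit_vec x = 0" by (simp add: lin_comb_def fun_eq_iff vec_apply)
    then show ?case using zero by simp
  next
    case (Suc j)
    have "lin_comb j unit_vec x \<in> int_vecs n" using Suc.prems by (intro lin_comb_in) auto
    then show ?case using Suc step[of j "lin_comb j unit_vec x" "x j"] by (simp only: lin_comb_Suc)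
  qed
  from this[of n] show ?thesis using x by (simp add: lin_comb_unit_vec)
qed

definition biadditive_on :: "('a::plus) set \<Rightarrow> ('a \<Rightarrow> 'a \<Rightarrow> 'b::plus) \<Rightarrow> bool" where
  "biadditive_on S \<beta> \<longleftrightarrow> (\<forall>y\<in>S. additive_on S (\<lambda>x. \<beta> x y)) \<and> (\<forall>x\<in>S. additive_on S (\<beta> x))"

lemma biadditive_onD:
  assumes "biadditive_on S \<beta>" "x \<in> S" "y \<in> S" "z \<in> S"
  shows "\<beta> (x + y) z = \<beta> x z + \<beta> y z" "\<beta> z (x + y) = \<beta> z x + \<beta> z y"
  using assms by (simp_all add: biadditive_on_def additive_on_def)

lemma biadditive_on_simps:
  fixes \<beta> :: "(nat \<Rightarrow> int) \<Rightarrow> (nat \<Rightarrow> int) \<Rightarrow> 'b::group_add"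
  assumes "biadditive_on (int_vecs n) \<beta>" "x \<in> int_vecs n" "y \<in> int_vecs n"
  shows "\<beta> 0 y = 0" "\<beta> x 0 = 0" "\<beta> (- x) y = - \<beta> x y" "\<beta> x (- y) = - \<beta> x y"
proof -
  have l: "additive_on (int_vecs n) (\<lambda>x. \<beta> x y)" and r: "additive_on (int_vecs n) (\<beta> x)"
    using assms by (simp_all add: biadditive_on_def)
  show "\<beta> 0 y = 0" "\<beta> x 0 = 0" using additive_on_zero[OF l] additive_on_zero[OF r] .
  show "\<beta> (- x) y = - \<beta> x y" "\<beta> x (- y) = - \<beta> x y"
    using additive_on_uminus[OF l assms(2)] additive_on_uminus[OF r assms(3)] .
qed

text \<open>The coboundary is that of the quadratic map
  \<open>(\<sigma> x x - \<Sum> x i * \<sigma> (e i) (e i)) / 2\<close>.\<close>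
lemma symmetric_biadditive_coboundary:
  fixes \<sigma> :: "(nat \<Rightarrow> int) \<Rightarrow> (nat \<Rightarrow> int) \<Rightarrow> nat \<Rightarrow> int"
  assumes bi: "biadditive_on (int_vecs n) \<sigma>"
    and sym: "\<And>x y. x \<in> int_vecs n \<Longrightarrow> y \<in> int_vecs n \<Longrightarrow> \<sigma> x y = \<sigma> y x"
    and cl: "\<And>x y. x \<in> int_vecs n \<Longrightarrow> y \<in> int_vecs n \<Longrightarrow> \<sigma> x y \<in> int_vecs m"
  shows "\<exists>\<theta>. (\<forall>x\<in>int_vecs n. \<theta> x \<in> int_vecs m) \<and>
    (\<forall>x\<in>int_vecs n. \<forall>y\<in>int_vecs n. \<theta> (x + y) = \<theta> x + \<theta> y + \<sigma> x y)"
proof -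
  define l where "l x = lin_comb n (\<lambda>i. \<sigma> (unit_vec i) (unit_vec i)) x" for x
  define d where "d x = \<sigma> x x - l x" for x
  define \<theta> where "\<theta> x = (\<lambda>k. d x k div 2)" for x
  have l_add: "l (x + y) = l x + l y" for x y by (simp only: l_def lin_comb_add)
  have d_add: "d (x + y) k = d x k + d y k + 2 * \<sigma> x y k" if "x \<in> int_vecs n" "y \<in> int_vecs n" for x y k
  proof -
    have "\<sigma> (x + y) (x + y) = \<sigma> x x + \<sigma> x y + (\<sigma> y x + \<sigma> y y)"
      using that by (simp only: biadditive_onD[OF bi] int_vecs_add ac_simps)
    then show ?thesis unfolding d_def l_add using sym[OF that] by (simp add: vec_apply)
  qed
  have l_unit: "l (unit_vec i) = \<sigma> (unit_vec i) (unit_vec i)" if "i < n" for i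
  proof
    fix k
    have "(\<Sum>j<n. unit_vec i j * \<sigma> (unit_vec j) (unit_vec j) k) = (\<Sum>j<n. if j = i then \<sigma> (unit_vec i) (unit_vec i) k else 0)"
      by (rule sum.cong) (auto simp: unit_vec_def)
    then show "l (unit_vec i) k = \<sigma> (unit_vec i) (unit_vec i) k" using that by (simp add: l_def lin_comb_def)
  qed
  have l_0: "l 0 = 0" by (simp add: l_def)
  have l_neg: "l (- x) = - l x" for x
    by (simp add: l_def lin_comb_def fun_eq_iff vec_apply sum_negf)
  have du: "d (unit_vec i) = 0" if "i < n" for i
    using l_unit[OF that] by (simp add: d_def)
  \<comment> \<open>Modulo 2 the map \<open>d\<close> is additive, because its polarisation is
    \<open>2 * \<sigma> x y\<close>, and it vanishes on the unit vectors.\<close>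
  have ev: "even (d x k)" if "x \<in> int_vecs n" for x k
    using that
  proof (rule int_vecs_induct[where P = "\<lambda>x. even (d x k)"])
    show "even (d 0 k)" using biadditive_on_simps(1)[OF bi, of 0 0] l_0 by (simp add: d_def vec_apply)
  next
    fix i y assume a: "i < n" "y \<in> int_vecs n" "even (d y k)"
    then show "even (d (y + unit_vec i) k)" using d_add[of y "unit_vec i" k] du[of i] by (simp add: vec_apply)
  next
    fix i y assume a: "i < n" "y \<in> int_vecs n" "even (d y k)"
    have u: "unit_vec i \<in> int_vecs n" using a by simp
    have "\<sigma> (- unit_vec i) (- unit_vec i) = \<sigma> (unit_vec i) (unit_vec i)"
      using u by (simp add: biadditive_on_simps[OF bi])
    then have "d (- unit_vec i) k = 2 * \<sigma> (unit_vec i) (unit_vec i) k"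
      using l_unit[OF a(1)] l_neg by (simp add: d_def vec_apply)
    then show "even (d (y - unit_vec i) k)" using a u d_add[of y "- unit_vec i" k] by simp
  qed
  have "\<theta> (x + y) = \<theta> x + \<theta> y + \<sigma> x y" if "x \<in> int_vecs n" "y \<in> int_vecs n" for x y
  proof
    fix k
    show "\<theta> (x + y) k = (\<theta> x + \<theta> y + \<sigma> x y) k"
      using d_add[OF that] ev[OF that(1), of k] ev[OF that(2), of k] by (auto simp: \<theta>_def vec_apply)
  qed
  moreover have "\<theta> x \<in> int_vecs m" if x: "x \<in> int_vecs n" for x
  proof -
    have "l x \<in> int_vecs m" unfolding l_def using cl by (intro lin_comb_in) simp
    then have "d x \<in> int_vecs m" using cl[OF x x] by (simp add: d_def)
    then show ?thesis by (simp add: \<theta>_def int_vecs_def vec_apply)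
  qed
  ultimately show ?thesis by (intro exI[of _ \<theta>]) simp
qed

definition admissible_pair ::
    "nat \<Rightarrow> nat \<Rightarrow> ((nat \<Rightarrow> int) \<Rightarrow> (nat \<Rightarrow> int) \<Rightarrow> nat \<Rightarrow> int) \<Rightarrow> ((nat \<Rightarrow> int) \<Rightarrow> nat \<Rightarrow> int) \<Rightarrow> ((nat \<Rightarrow> int) \<Rightarrow> nat \<Rightarrow> int) \<Rightarrow> bool" where
  "admissible_pair n m \<omega> A B \<longleftrightarrow>
     bij_betw A (int_vecs n) (int_vecs n) \<and> additive_on (int_vecs n) A \<and> (\<forall>x\<in>int_vecs n. A x = x \<longrightarrow> x = 0) \<and>
     bij_betw B (int_vecs m) (int_vecs m) \<and> additive_on (int_vecs m) B \<and> (\<forall>u\<in>int_vecs m. B u = u \<longrightarrow> u = 0) \<and>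
     (\<forall>x\<in>int_vecs n. \<forall>y\<in>int_vecs n. \<omega> (A x) (A y) = B (\<omega> x y))"

text \<open>The elements \<open>\<psi> 0 u\<close> are central. They form the whole centre exactly
  when \<open>\<omega>\<close> is nondegenerate, which is assumed separately where it
  matters.\<close>

locale central_extension = group G for G (structure) +
  fixes n m :: nat and \<beta> :: "(nat \<Rightarrow> int) \<Rightarrow> (nat \<Rightarrow> int) \<Rightarrow> nat \<Rightarrow> int"
    and \<psi> :: "(nat \<Rightarrow> int) \<Rightarrow> (nat \<Rightarrow> int) \<Rightarrow> 'a"
  assumes psi_bij: "bij_betw (\<lambda>(x, u). \<psi> x u) (int_vecs n \<times> int_vecs m) (carrier G)"
    and beta_in: "x \<in> int_vecs n \<Longrightarrow> y \<in> int_vecs n \<Longrightarrow> \<beta> x y \<in> int_vecs m"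
    and beta_biadditive: "biadditive_on (int_vecs n) \<beta>"
    and psi_mult: "x \<in> int_vecs n \<Longrightarrow> u \<in> int_vecs m \<Longrightarrow> y \<in> int_vecs n \<Longrightarrow> w \<in> int_vecs m \<Longrightarrow>
      \<psi> x u \<otimes> \<psi> y w = \<psi> (x + y) (u + w + \<beta> x y)"
begin

definition \<omega> :: "(nat \<Rightarrow> int) \<Rightarrow> (nat \<Rightarrow> int) \<Rightarrow> nat \<Rightarrow> int" where
  "\<omega> x y = \<beta> x y - \<beta> y x"

lemma psi_closed [simp]: "x \<in> int_vecs n \<Longrightarrow> u \<in> int_vecs m \<Longrightarrow> \<psi> x u \<in> carrier G"
  using bij_betw_apply[OF psi_bij, of "(x, u)"] by simp

lemma psi_inj:
  assumes "x \<in> int_vecs n" "u \<in> int_vecs m" "y \<in> int_vecs n" "w \<in> int_vecs m"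
  shows "\<psi> x u = \<psi> y w \<longleftrightarrow> x = y \<and> u = w"
  using inj_onD[OF bij_betw_imp_inj_on[OF psi_bij], of "(x, u)" "(y, w)"] assms by auto

lemma psi_cases:
  assumes "g \<in> carrier G"
  obtains x u where "x \<in> int_vecs n" "u \<in> int_vecs m" "g = \<psi> x u"
proof -
  have "g \<in> (\<lambda>(x, u). \<psi> x u) ` (int_vecs n \<times> int_vecs m)"
    using assms bij_betw_imp_surj_on[OF psi_bij] by simp
  then show ?thesis using that by auto
qed

lemmas beta_simps = biadditive_on_simps[OF beta_biadditive]

lemma psi_zero: "\<psi> 0 0 = \<one>"
proof -
  have "\<psi> 0 0 \<otimes> \<psi> 0 0 = \<psi> 0 0"
    using psi_mult[of 0 0 0 0] beta_simps(1)[of 0 0] by simp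
  then show ?thesis by (simp add: r_cancel_one)
qed

lemma psi_central: "u \<in> int_vecs m \<Longrightarrow> y \<in> int_vecs n \<Longrightarrow> w \<in> int_vecs m \<Longrightarrow> \<psi> 0 u \<otimes> \<psi> y w = \<psi> y (u + w)"
  "u \<in> int_vecs m \<Longrightarrow> y \<in> int_vecs n \<Longrightarrow> w \<in> int_vecs m \<Longrightarrow> \<psi> y w \<otimes> \<psi> 0 u = \<psi> y (w + u)"
  using psi_mult[of 0 u y w] psi_mult[of y w 0 u] beta_simps by simp_all

lemma psi_inv:
  assumes "x \<in> int_vecs n" "u \<in> int_vecs m"
  shows "inv (\<psi> x u) = \<psi> (- x) (\<beta> x x - u)"
proof -
  have "\<psi> x u \<otimes> \<psi> (- x) (\<beta> x x - u) = \<psi> 0 0"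
    using psi_mult[of x u "- x" "\<beta> x x - u"] assms beta_in[of x x] beta_simps(4)[of x x] by simp
  then show ?thesis using assms beta_in[of x x] by (metis psi_zero inv_equality psi_closed int_vecs_uminus int_vecs_diff inv_inv inv_closed r_inv l_inv local.inv_unique')
qed

lemma omega_in: "x \<in> int_vecs n \<Longrightarrow> y \<in> int_vecs n \<Longrightarrow> \<omega> x y \<in> int_vecs m"
  by (simp add: \<omega>_def beta_in)

lemma omega_biadditive: "biadditive_on (int_vecs n) \<omega>"
  unfolding biadditive_on_def additive_on_def \<omega>_def
  by (simp add: biadditive_onD[OF beta_biadditive] fun_eq_iff vec_apply)

lemma omega_alt: "\<omega> x x = 0" "\<omega> y x = - \<omega> x y"
  by (simp_all add: \<omega>_def)

lemma psi_commutator: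
  assumes "x \<in> int_vecs n" "u \<in> int_vecs m" "y \<in> int_vecs n" "w \<in> int_vecs m"
  shows "\<psi> x u \<otimes> \<psi> y w \<otimes> inv (\<psi> x u) \<otimes> inv (\<psi> y w) = \<psi> 0 (\<omega> x y)"
proof -
  have "\<psi> 0 (\<omega> x y) \<otimes> (\<psi> y w \<otimes> \<psi> x u) = \<psi> x u \<otimes> \<psi> y w"
    using assms beta_in[of x y] beta_in[of y x] omega_in[of x y]
    by (simp add: psi_mult beta_simps(1)[where x = 0] add.commute \<omega>_def add.left_commute)
  then have "\<psi> x u \<otimes> \<psi> y w \<otimes> inv (\<psi> x u) \<otimes> inv (\<psi> y w)
     = \<psi> 0 (\<omega> x y) \<otimes> (\<psi> y w \<otimes> \<psi> x u) \<otimes> inv (\<psi> x u) \<otimes> inv (\<psi> y w)" by simp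
  also have "\<dots> = \<psi> 0 (\<omega> x y)"
    using assms omega_in[of x y] by (simp add: m_assoc)
  finally show ?thesis .
qed

lemma psi_pow:
  assumes x: "x \<in> int_vecs n" "u \<in> int_vecs m"
  shows "\<exists>v\<in>int_vecs m. (\<psi> x u) [^] (a::int) = \<psi> (smul a x) v"
proof (induction a rule: int_induct[of _ 0])
  case base
  show ?case using psi_zero by (intro bexI[of _ 0]) (simp_all only: smul_simps int_pow_0 int_vecs_zero)
next
  case (step1 a)
  from this(2) obtain v where v: "v \<in> int_vecs m" "(\<psi> x u) [^] a = \<psi> (smul a x) v" by (rule bexE)
  have "(\<psi> x u) [^] (a + 1) = \<psi> (smul a x) v \<otimes> \<psi> x u"
    using x v by (simp add: int_pow_mult)
  also have "\<dots> = \<psi> (smul a x + x) (v + u + \<beta> (smul a x) x)" using x v by (simp add: psi_mult)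
  also have "smul a x + x = smul (a + 1) x" by (simp only: smul_add smul_simps)
  finally show ?case using x v beta_in[of "smul a x" x]
    by (intro bexI[of _ "v + u + \<beta> (smul a x) x"]) simp_all
next
  case (step2 a)
  from this(2) obtain v where v: "v \<in> int_vecs m" "(\<psi> x u) [^] a = \<psi> (smul a x) v" by (rule bexE)
  have "(\<psi> x u) [^] (a - 1) = \<psi> (smul a x) v \<otimes> inv (\<psi> x u)"
    using x v by (simp add: int_pow_diff)
  also have "\<dots> = \<psi> (smul a x + - x) (v + (\<beta> x x - u) + \<beta> (smul a x) (- x))"
    using x v beta_in[of x x] unfolding psi_inv[OF x] by (intro psi_mult) simp_all
  also have "smul a x + - x = smul (a - 1) x" by (simp only: smul_diff smul_simps add_uminus_conv_diff)
  finally show ?case using x v beta_in[of "smul a x" "- x"] beta_in[of x x]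
    by (intro bexI[of _ "v + (\<beta> x x - u) + \<beta> (smul a x) (- x)"]) simp_all
qed

lemma psi_zero_pow:
  assumes u: "u \<in> int_vecs m"
  shows "(\<psi> 0 u) [^] (a::int) = \<psi> 0 (smul a u)"
proof (induction a rule: int_induct[of _ 0])
  case base
  show ?case using psi_zero by (simp only: smul_simps int_pow_0)
next
  case (step1 a)
  have "(\<psi> 0 u) [^] (a + 1) = \<psi> 0 (smul a u) \<otimes> \<psi> 0 u" using u unfolding step1(2)[symmetric] by (simp add: int_pow_mult)
  also have "\<dots> = \<psi> 0 (smul a u + u)" using u by (simp add: psi_central)
  finally show ?case by (simp only: smul_add smul_simps)
next
  case (step2 a)
  have "(\<psi> 0 u) [^] (a - 1) = \<psi> 0 (smul a u) \<otimes> inv (\<psi> 0 u)" using u unfolding step2(2)[symmetric] by (simp add: int_pow_diff)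
  also have "inv (\<psi> 0 u) = \<psi> 0 (- u)" using psi_inv[of 0 u] u beta_simps(1)[of 0 0] by simp
  also have "\<psi> 0 (smul a u) \<otimes> \<psi> 0 (- u) = \<psi> 0 (smul a u + - u)" using u by (simp add: psi_central)
  finally show ?case by (simp only: smul_diff smul_simps add_uminus_conv_diff)
qed

section \<open>Lifting automorphisms and bounding Reidemeister numbers\<close>

lemma twisted_conj_equiv:
  assumes "\<phi> \<in> hom G G"
  shows "equiv (carrier G) (twisted_conj G \<phi>)"
proof -
  interpret h: group_hom G G \<phi> using assms by unfold_locales
  show ?thesis
  proof (rule equivI)
    show "twisted_conj G \<phi> \<subseteq> carrier G \<times> carrier G" by (auto simp: twisted_conj_def)
    show "refl_on (carrier G) (twisted_conj G \<phi>)"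
      unfolding refl_on_def twisted_conj_def by (auto intro!: bexI[of _ \<one>])
    show "sym (twisted_conj G \<phi>)"
    proof (rule symI)
      fix a b assume "(a, b) \<in> twisted_conj G \<phi>"
      then obtain c where c: "a \<in> carrier G" "b \<in> carrier G" "c \<in> carrier G" "a = c \<otimes> b \<otimes> inv (\<phi> c)"
        by (auto simp: twisted_conj_def)
      have "b = inv c \<otimes> a \<otimes> inv (\<phi> (inv c))"
        using c by (simp add: m_assoc) (simp add: m_assoc[symmetric])
      then show "(b, a) \<in> twisted_conj G \<phi>"
        using c unfolding twisted_conj_def by (auto intro!: bexI[of _ "inv c"])
    qed
    show "trans (twisted_conj G \<phi>)"
    proof (rule transI)
      fix a b d assume "(a, b) \<in> twisted_conj G \<phi>" "(b, d) \<in> twisted_conj G \<phi>"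
      then obtain c c' where c: "a \<in> carrier G" "b \<in> carrier G" "d \<in> carrier G" "c \<in> carrier G" "c' \<in> carrier G"
        "a = c \<otimes> b \<otimes> inv (\<phi> c)" "b = c' \<otimes> d \<otimes> inv (\<phi> c')"
        by (auto simp: twisted_conj_def)
      have "a = (c \<otimes> c') \<otimes> d \<otimes> inv (\<phi> (c \<otimes> c'))"
        unfolding c(6) c(7) using c(3,4,5) by (simp add: inv_mult_group m_assoc)
      then show "(a, d) \<in> twisted_conj G \<phi>"
        using c(1,3,4,5) unfolding twisted_conj_def by (auto intro!: bexI[of _ "c \<otimes> c'"])
    qed
  qed
qed

lemma twisted_conjI:
  assumes "\<phi> \<in> hom G G" "a \<in> carrier G" "b \<in> carrier G" "c \<in> carrier G" "a \<otimes> \<phi> c = c \<otimes> b"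
  shows "(a, b) \<in> twisted_conj G \<phi>"
proof -
  have "\<phi> c \<in> carrier G" using assms(1,4) by (rule hom_in_carrier)
  then have "a = c \<otimes> b \<otimes> inv (\<phi> c)" using assms by (metis inv_solve_right m_closed)
  then show ?thesis using assms unfolding twisted_conj_def by (auto intro!: bexI[of _ c])
qed

text \<open>Compatibility with \<open>\<omega>\<close> makes the defect \<open>\<sigma>\<close>
  between the two transported cocycles symmetric, hence the coboundary of some
  \<open>\<theta>\<close>; adding \<open>\<theta> x\<close> to the central coordinate absorbs
  it.\<close>

lemma admissible_pair_lift:
  assumes "admissible_pair n m \<omega> A B"
  shows "\<exists>\<phi>\<in>auto G. \<exists>\<theta>. \<theta> 0 = 0 \<and> (\<forall>x\<in>int_vecs n. \<theta> x \<in> int_vecs m) \<and>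
    (\<forall>x\<in>int_vecs n. \<forall>u\<in>int_vecs m. \<phi> (\<psi> x u) = \<psi> (A x) (B u + \<theta> x))"
proof -
  have A: "bij_betw A (int_vecs n) (int_vecs n)" "additive_on (int_vecs n) A"
    and B: "bij_betw B (int_vecs m) (int_vecs m)" "additive_on (int_vecs m) B"
    and AB: "\<And>x y. x \<in> int_vecs n \<Longrightarrow> y \<in> int_vecs n \<Longrightarrow> \<omega> (A x) (A y) = B (\<omega> x y)"
    using assms by (simp_all add: admissible_pair_def)
  have Ain: "A x \<in> int_vecs n" if "x \<in> int_vecs n" for x using bij_betw_apply[OF A(1) that] .
  have Bin: "B x \<in> int_vecs m" if "x \<in> int_vecs m" for x using bij_betw_apply[OF B(1) that] .
  define \<sigma> where "\<sigma> x y = \<beta> (A x) (A y) - B (\<beta> x y)" for x y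
  have "\<exists>\<theta>. (\<forall>x\<in>int_vecs n. \<theta> x \<in> int_vecs m) \<and>
    (\<forall>x\<in>int_vecs n. \<forall>y\<in>int_vecs n. \<theta> (x + y) = \<theta> x + \<theta> y + \<sigma> x y)"
  proof (rule symmetric_biadditive_coboundary)
    show "biadditive_on (int_vecs n) \<sigma>"
      unfolding biadditive_on_def additive_on_def
      by (simp add: \<sigma>_def Ain beta_in biadditive_onD[OF beta_biadditive] additive_on_add[OF A(2)] additive_on_add[OF B(2)])
    fix x y assume xy: "x \<in> int_vecs n" "y \<in> int_vecs n"
    have "B (\<beta> x y - \<beta> y x) = B (\<beta> x y) - B (\<beta> y x)"
      using xy by (intro additive_on_diff[OF B(2)] beta_in)
    then show "\<sigma> x y = \<sigma> y x"
      using AB[OF xy] by (simp add: \<sigma>_def \<omega>_def algebra_simps)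
    show "\<sigma> x y \<in> int_vecs m" using xy by (simp add: \<sigma>_def Ain Bin beta_in)
  qed
  then obtain \<theta> where "(\<forall>x\<in>int_vecs n. \<theta> x \<in> int_vecs m) \<and>
    (\<forall>x\<in>int_vecs n. \<forall>y\<in>int_vecs n. \<theta> (x + y) = \<theta> x + \<theta> y + \<sigma> x y)" by (rule exE)
  then have \<theta>: "\<And>x. x \<in> int_vecs n \<Longrightarrow> \<theta> x \<in> int_vecs m"
    "\<And>x y. x \<in> int_vecs n \<Longrightarrow> y \<in> int_vecs n \<Longrightarrow> \<theta> (x + y) = \<theta> x + \<theta> y + \<sigma> x y" by simp_all
  have A0: "A 0 = 0" and B0: "B 0 = 0" using additive_on_zero A(2) B(2) by auto
  have "\<sigma> 0 0 = 0" using beta_simps(1)[of 0 0] by (simp add: \<sigma>_def A0 B0)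
  then have \<theta>0: "\<theta> 0 = 0" using \<theta>(2)[of 0 0] by simp
  define f where "f = (\<lambda>(x, u). \<psi> x u)"
  define F where "F = (\<lambda>(x, u). (A x, B u + \<theta> x))"
  \<comment> \<open>Members of \<open>auto G\<close> are extensional, hence the restriction to the
    carrier.\<close>
  define \<phi> where "\<phi> = restrict (f \<circ> F \<circ> inv_into (int_vecs n \<times> int_vecs m) f) (carrier G)"
  have f: "bij_betw f (int_vecs n \<times> int_vecs m) (carrier G)" using psi_bij by (simp add: f_def)
  have F: "bij_betw F (int_vecs n \<times> int_vecs m) (int_vecs n \<times> int_vecs m)"
    unfolding bij_betw_def
  proof
    show "inj_on F (int_vecs n \<times> int_vecs m)"
      using A(1) B(1) unfolding inj_on_def F_def bij_betw_def by auto
    show "F ` (int_vecs n \<times> int_vecs m) = int_vecs n \<times> int_vecs m"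
    proof (intro equalityI subsetI)
      fix p assume "p \<in> F ` (int_vecs n \<times> int_vecs m)"
      then show "p \<in> int_vecs n \<times> int_vecs m" using Ain Bin \<theta>(1) by (auto simp: F_def)
    next
      fix p assume "p \<in> int_vecs n \<times> int_vecs m"
      then obtain y w where p: "p = (y, w)" "y \<in> int_vecs n" "w \<in> int_vecs m" by auto
      have "y \<in> A ` int_vecs n" using bij_betw_imp_surj_on[OF A(1)] p(2) by simp
      then obtain x where x: "x \<in> int_vecs n" "A x = y" by auto
      have "w - \<theta> x \<in> int_vecs m" using p \<theta>(1) x by simp
      then obtain u where u: "u \<in> int_vecs m" "B u = w - \<theta> x" using B(1) unfolding bij_betw_def by (metis imageE)
      show "p \<in> F ` (int_vecs n \<times> int_vecs m)" using p x u by (intro image_eqI[of _ _ "(x, u)"]) (simp_all add: F_def)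
    qed
  qed
  have \<phi>: "\<phi> (\<psi> x u) = \<psi> (A x) (B u + \<theta> x)" if "x \<in> int_vecs n" "u \<in> int_vecs m" for x u
  proof -
    have "inv_into (int_vecs n \<times> int_vecs m) f (f (x, u)) = (x, u)"
      using that bij_betw_imp_inj_on[OF f] by (intro inv_into_f_f) auto
    then show ?thesis using that psi_closed[OF that] by (simp add: \<phi>_def f_def F_def)
  qed
  have "bij_betw (f \<circ> F \<circ> inv_into (int_vecs n \<times> int_vecs m) f) (carrier G) (carrier G)"
    using bij_betw_trans[OF bij_betw_inv_into[OF f] bij_betw_trans[OF F f]] by (simp add: o_assoc)
  then have "bij_betw \<phi> (carrier G) (carrier G)" by (subst bij_betw_cong[of _ \<phi>]) (auto simp: \<phi>_def)
  moreover have "\<phi> \<in> hom G G"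
  proof (rule homI)
    show "\<phi> g \<in> carrier G" if "g \<in> carrier G" for g
      using calculation that by (rule bij_betw_apply)
    fix g h assume "g \<in> carrier G" "h \<in> carrier G"
    then obtain x u y w where g: "x \<in> int_vecs n" "u \<in> int_vecs m" "g = \<psi> x u"
      and h: "y \<in> int_vecs n" "w \<in> int_vecs m" "h = \<psi> y w" using psi_cases by metis
    have "A x + A y = A (x + y)" using g h additive_on_add[OF A(2)] by simp
    moreover have "B u + \<theta> x + (B w + \<theta> y) + \<beta> (A x) (A y) = B (u + w + \<beta> x y) + \<theta> (x + y)"
      using g h beta_in[of x y] by (simp add: additive_on_add[OF B(2)] \<theta>(2) \<sigma>_def)
    ultimately show "\<phi> (g \<otimes> h) = \<phi> g \<otimes> \<phi> h"
      using g h beta_in[of x y] by (simp add: psi_mult \<phi> Ain Bin \<theta>(1))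
  qed
  ultimately have "\<phi> \<in> auto G" by (auto simp: auto_def Bij_def \<phi>_def)
  then show ?thesis using \<theta>0 \<theta>(1) \<phi> by (intro bexI[of _ \<phi>] exI[of _ \<theta>]) simp_all
qed

text \<open>Two passes: twisting by \<open>\<psi> y 0\<close> moves the first coordinate by
  \<open>A y - y\<close> into a finite set, then twisting by a central \<open>\<psi> 0 w\<close>
  moves the second by \<open>B w - w\<close> and leaves the first alone.\<close>

theorem admissible_pair_imp_not_R_infinity:
  assumes ad: "admissible_pair n m \<omega> A B"
  shows "\<not> R_infinity G"
proof -
  have A: "bij_betw A (int_vecs n) (int_vecs n)" "additive_on (int_vecs n) A" "\<And>x. x \<in> int_vecs n \<Longrightarrow> A x = x \<Longrightarrow> x = 0"
    and B: "bij_betw B (int_vecs m) (int_vecs m)" "additive_on (int_vecs m) B" "\<And>x. x \<in> int_vecs m \<Longrightarrow> B x = x \<Longrightarrow> x = 0"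
    using ad by (simp_all add: admissible_pair_def)
  have Ain: "A x \<in> int_vecs n" if "x \<in> int_vecs n" for x using bij_betw_apply[OF A(1) that] .
  have Bin: "B x \<in> int_vecs m" if "x \<in> int_vecs m" for x using bij_betw_apply[OF B(1) that] .
  from admissible_pair_lift[OF ad] obtain \<phi> where \<phi>: "\<phi> \<in> auto G" and ex: "\<exists>\<theta>. \<theta> 0 = 0 \<and> (\<forall>x\<in>int_vecs n. \<theta> x \<in> int_vecs m) \<and>
    (\<forall>x\<in>int_vecs n. \<forall>u\<in>int_vecs m. \<phi> (\<psi> x u) = \<psi> (A x) (B u + \<theta> x))" by (rule bexE)
  from ex obtain \<theta> where \<theta>: "\<theta> 0 = 0 \<and> (\<forall>x\<in>int_vecs n. \<theta> x \<in> int_vecs m) \<and>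
    (\<forall>x\<in>int_vecs n. \<forall>u\<in>int_vecs m. \<phi> (\<psi> x u) = \<psi> (A x) (B u + \<theta> x))" by (rule exE)
  have hom: "\<phi> \<in> hom G G" using \<phi> by (simp add: auto_def)
  have shift_additive: "additive_on S (\<lambda>x. C x - x)" if "additive_on S C" for S and C :: "(nat \<Rightarrow> int) \<Rightarrow> nat \<Rightarrow> int"
    using that by (auto simp: additive_on_def)
  have "\<exists>F. finite F \<and> F \<subseteq> int_vecs n \<and> (\<forall>y\<in>int_vecs n. \<exists>x\<in>int_vecs n. y + (A x - x) \<in> F)"
    by (rule cofinite_image_representatives[OF shift_additive[OF A(2)]]) (use Ain A(3) in auto)
  then obtain F where F: "finite F \<and> F \<subseteq> int_vecs n \<and> (\<forall>y\<in>int_vecs n. \<exists>x\<in>int_vecs n. y + (A x - x) \<in> F)" by (rule exE)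
  have "\<exists>F. finite F \<and> F \<subseteq> int_vecs m \<and> (\<forall>y\<in>int_vecs m. \<exists>x\<in>int_vecs m. y + (B x - x) \<in> F)"
    by (rule cofinite_image_representatives[OF shift_additive[OF B(2)]]) (use Bin B(3) in auto)
  then obtain F' where F': "finite F' \<and> F' \<subseteq> int_vecs m \<and> (\<forall>y\<in>int_vecs m. \<exists>x\<in>int_vecs m. y + (B x - x) \<in> F')" by (rule exE)
  let ?R = "twisted_conj G \<phi>"
  have eq: "equiv (carrier G) ?R" using twisted_conj_equiv[OF hom] .
  have rep: "\<exists>b\<in>(\<lambda>(x, u). \<psi> x u) ` (F \<times> F'). (a, b) \<in> ?R" if a: "a \<in> carrier G" for a
  proof -
    obtain x u where x: "x \<in> int_vecs n" "u \<in> int_vecs m" "a = \<psi> x u" using psi_cases[OF a] .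
    obtain y where y: "y \<in> int_vecs n" "x + (A y - y) \<in> F" using F x(1) by auto
    define c where "c = \<psi> y 0"
    have c: "c \<in> carrier G" using y by (simp add: c_def)
    define b where "b = inv c \<otimes> (a \<otimes> \<phi> c)"
    have \<phi>c: "\<phi> c \<in> carrier G" using hom c by (rule hom_in_carrier)
    have b: "b \<in> carrier G" using a c \<phi>c by (simp add: b_def)
    have "a \<otimes> \<phi> c = c \<otimes> b" using a c \<phi>c by (simp add: b_def m_assoc[symmetric])
    then have ab: "(a, b) \<in> ?R" using twisted_conjI[OF hom a b c] by simp
    obtain x' v where x': "x' \<in> int_vecs n" "v \<in> int_vecs m" "b = \<psi> x' v" using psi_cases[OF b] .
    have "\<phi> c = \<psi> (A y) (B 0 + \<theta> y)" using \<theta> y by (simp add: c_def)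
    then have "a \<otimes> \<phi> c = \<psi> (x + A y) (u + (B 0 + \<theta> y) + \<beta> x (A y))"
      using x y \<theta> Ain Bin by (simp add: psi_mult)
    moreover have "c \<otimes> b = \<psi> (y + x') (0 + v + \<beta> y x')" unfolding c_def x'(3) using x' y by (intro psi_mult) simp_all
    ultimately have "x + A y = y + x'"
      using \<open>a \<otimes> \<phi> c = c \<otimes> b\<close> x y x' \<theta> Ain Bin by (simp add: psi_inj beta_in)
    then have x'F: "x' \<in> F" using y(2) by (simp add: algebra_simps)
    obtain w where w: "w \<in> int_vecs m" "v + (B w - w) \<in> F'" using F' x'(2) by auto
    have "b \<otimes> \<phi> (\<psi> 0 w) = \<psi> 0 w \<otimes> \<psi> x' (v + (B w - w))"
      using \<theta> w x' Bin A(2) by (simp add: psi_central additive_on_zero)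
    then have "(b, \<psi> x' (v + (B w - w))) \<in> ?R"
      using w x' b Bin by (intro twisted_conjI[OF hom b]) simp_all
    then have "(a, \<psi> x' (v + (B w - w))) \<in> ?R" using ab eq by (meson equiv_def transD)
    then show ?thesis using x'F w(2) by (intro bexI[of _ "\<psi> x' (v + (B w - w))"]) auto
  qed
  have "carrier G // ?R \<subseteq> (\<lambda>b. ?R `` {b}) ` (\<lambda>(x, u). \<psi> x u) ` (F \<times> F')"
  proof
    fix K assume "K \<in> carrier G // ?R"
    then obtain a where a: "a \<in> carrier G" "K = ?R `` {a}" by (auto simp: quotient_def)
    from rep[OF a(1)] obtain b where b: "b \<in> (\<lambda>(x, u). \<psi> x u) ` (F \<times> F')" "(a, b) \<in> ?R" by (rule bexE)
    have "K = ?R `` {b}" using a(2) equiv_class_eq[OF eq b(2)] by simp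
    then show "K \<in> (\<lambda>b. ?R `` {b}) ` (\<lambda>(x, u). \<psi> x u) ` (F \<times> F')" using b(1) by (rule image_eqI)
  qed
  moreover have "finite ((\<lambda>b. ?R `` {b}) ` (\<lambda>(x, u). \<psi> x u) ` (F \<times> F'))" using F F' by simp
  ultimately have "finite (carrier G // ?R)" by (rule finite_subset)
  then have "reidemeister_number G \<phi> \<noteq> \<infinity>" by (simp add: reidemeister_number_def)
  then show ?thesis using \<phi> unfolding R_infinity_def by auto
qed

section \<open>A cyclic series of coordinate subgroups\<close>

text \<open>The first \<open>j\<close> coordinates, with the central ones counted first so that
  every layer is normal in the whole group. Truncated subtraction and \<open>min\<close> make the
  case distinction at \<open>j = m\<close>.\<close>

definition layer :: "nat \<Rightarrow> 'a set" where
  "layer j = (\<lambda>(x, u). \<psi> x u) ` (int_vecs (j - m) \<times> int_vecs (min j m))"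

lemma layer_in_vecs: "j \<le> n + m \<Longrightarrow> x \<in> int_vecs (j - m) \<Longrightarrow> x \<in> int_vecs n"
  "u \<in> int_vecs (min j m) \<Longrightarrow> u \<in> int_vecs m"
  using subsetD[OF int_vecs_mono[of "j - m" n], of x] subsetD[OF int_vecs_mono[of "min j m" m], of u] by auto

lemma layer_beta:
  assumes "j \<le> n + m" "x \<in> int_vecs (j - m)" "y \<in> int_vecs n"
  shows "\<beta> x y \<in> int_vecs (min j m)" "\<beta> y x \<in> int_vecs (min j m)"
proof -
  have "\<beta> x y \<in> int_vecs (min j m) \<and> \<beta> y x \<in> int_vecs (min j m)"
  proof (cases "j \<ge> m")
    case True
    then have "min j m = m" by simp
    then show ?thesis using assms layer_in_vecs(1)[OF assms(1,2)] beta_in by simp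
  next
    case False
    then have "x = 0" using assms by (simp add: int_vecs_0)
    then show ?thesis using assms beta_simps(1)[of y y] beta_simps(2)[of y y] by simp
  qed
  then show "\<beta> x y \<in> int_vecs (min j m)" "\<beta> y x \<in> int_vecs (min j m)" by simp_all
qed

lemma layerI: "x \<in> int_vecs (j - m) \<Longrightarrow> u \<in> int_vecs (min j m) \<Longrightarrow> \<psi> x u \<in> layer j"
  unfolding layer_def by (rule image_eqI[of _ _ "(x, u)"]) auto

lemma layerE:
  assumes "g \<in> layer j"
  obtains x u where "x \<in> int_vecs (j - m)" "u \<in> int_vecs (min j m)" "g = \<psi> x u"
  using assms unfolding layer_def by auto

lemma layer_normal:
  assumes j: "j \<le> n + m"
  shows "layer j \<lhd> G"
proof (rule normal_invI)
  note V = layer_in_vecs(1)[OF j] layer_in_vecs(2)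
  show "subgroup (layer j) G"
  proof (rule subgroupI)
    show "layer j \<subseteq> carrier G" using V by (auto simp: layer_def)
    have "\<psi> 0 0 \<in> layer j" by (rule layerI) auto
    then show "layer j \<noteq> {}" by auto
    fix a assume "a \<in> layer j"
    then obtain x u where a: "x \<in> int_vecs (j - m)" "u \<in> int_vecs (min j m)" "a = \<psi> x u" by (rule layerE)
    have "inv a = \<psi> (- x) (\<beta> x x - u)" using a V psi_inv[of x u] by simp
    then show "inv a \<in> layer j" using a V layer_beta[OF j a(1)] by (auto intro!: layerI)
    fix b assume "b \<in> layer j"
    then obtain y w where b: "y \<in> int_vecs (j - m)" "w \<in> int_vecs (min j m)" "b = \<psi> y w" by (rule layerE)
    have "a \<otimes> b = \<psi> (x + y) (u + w + \<beta> x y)" using a b V psi_mult by simp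
    then show "a \<otimes> b \<in> layer j" using a b V layer_beta[OF j a(1)] by (auto intro!: layerI)
  qed
  fix g h assume "g \<in> carrier G" "h \<in> layer j"
  then obtain y w where g: "y \<in> int_vecs n" "w \<in> int_vecs m" "g = \<psi> y w" using psi_cases by metis
  obtain x u where h: "x \<in> int_vecs (j - m)" "u \<in> int_vecs (min j m)" "h = \<psi> x u" using \<open>h \<in> layer j\<close> by (rule layerE)
  have hV: "x \<in> int_vecs n" "u \<in> int_vecs m" "h \<in> carrier G" using h V by auto
  have "g \<otimes> h \<otimes> inv g = (g \<otimes> h \<otimes> inv g \<otimes> inv h) \<otimes> h"
    using g hV by (simp add: m_assoc)
  also have "\<dots> = \<psi> 0 (\<omega> y x) \<otimes> \<psi> x u" using psi_commutator[OF g(1,2) hV(1,2)] g(3) h(3) by simp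
  also have "\<dots> = \<psi> x (\<omega> y x + u)" using g hV omega_in by (simp add: psi_central)
  finally show "g \<otimes> h \<otimes> inv g \<in> layer j"
    using layer_beta[OF j h(1) g(1)] h by (auto intro!: layerI simp: \<omega>_def)
qed

lemma layer_mono: "j \<le> j' \<Longrightarrow> layer j \<subseteq> layer j'"
proof
  fix g assume j: "j \<le> j'" "g \<in> layer j"
  then obtain x u where "x \<in> int_vecs (j - m)" "u \<in> int_vecs (min j m)" "g = \<psi> x u" by (elim layerE)
  then show "g \<in> layer j'"
    using j subsetD[OF int_vecs_mono[of "j - m" "j' - m"], of x] subsetD[OF int_vecs_mono[of "min j m" "min j' m"], of u]
    by (auto intro!: layerI)
qed

text \<open>The coordinate by which \<open>layer (Suc j)\<close> exceeds \<open>layer j\<close>.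
  Right multiplication by \<open>layer j\<close> does not change it, so it is an integer invariant
  of cosets and shows that the factor is infinite.\<close>

definition coord :: "nat \<Rightarrow> 'a \<Rightarrow> int" where
  "coord j g = (let p = inv_into (int_vecs n \<times> int_vecs m) (\<lambda>(x, u). \<psi> x u) g
     in if j < m then snd p j else fst p (j - m))"

lemma coord_psi:
  assumes "x \<in> int_vecs n" "u \<in> int_vecs m"
  shows "coord j (\<psi> x u) = (if j < m then u j else x (j - m))"
proof -
  have "inv_into (int_vecs n \<times> int_vecs m) (\<lambda>(x, u). \<psi> x u) ((\<lambda>(x, u). \<psi> x u) (x, u)) = (x, u)"
    using assms by (intro inv_into_f_f bij_betw_imp_inj_on[OF psi_bij]) auto
  then show ?thesis by (simp add: coord_def Let_def)
qed

lemma coord_mult_layer: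
  assumes "g \<in> carrier G" "h \<in> layer j" "j < n + m"
  shows "coord j (g \<otimes> h) = coord j g"
proof -
  obtain y w where g: "y \<in> int_vecs n" "w \<in> int_vecs m" "g = \<psi> y w" using assms(1) by (rule psi_cases)
  obtain x u where h: "x \<in> int_vecs (j - m)" "u \<in> int_vecs (min j m)" "h = \<psi> x u" using assms(2) by (rule layerE)
  have hV: "x \<in> int_vecs n" "u \<in> int_vecs m" using h layer_in_vecs[where j = j] assms(3) by auto
  have "g \<otimes> h = \<psi> (y + x) (w + u + \<beta> y x)" using g h hV by (simp add: psi_mult)
  moreover have "u j = 0" "\<beta> y x j = 0" if "j < m"
    using h(2) layer_beta(2)[of j x y] h(1) g(1) assms(3) that by (auto simp: int_vecs_def)
  moreover have "x (j - m) = 0" using h(1) by (auto simp: int_vecs_def)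
  ultimately show ?thesis using g hV beta_in by (simp add: coord_psi vec_apply)
qed

lemma layer_factor_infinite:
  assumes j: "j < n + m"
  shows "\<not> finite_index G (layer j) (layer (Suc j))"
proof
  assume "finite_index G (layer j) (layer (Suc j))"
  then obtain F where F: "finite F \<and> F \<subseteq> carrier G \<and> (\<forall>x\<in>layer (Suc j). \<exists>f\<in>F. \<exists>k\<in>layer j. x = f \<otimes> k)"
    unfolding finite_index_def by (rule exE)
  have "(UNIV :: int set) \<subseteq> coord j ` F"
  proof
    fix a :: int
    define x u where "x = (if j < m then 0 else smul a (unit_vec (j - m)))" and "u = (if j < m then smul a (unit_vec j) else 0)"
    have x: "x \<in> int_vecs (Suc j - m)" and u: "u \<in> int_vecs (min (Suc j) m)" by (auto simp: x_def u_def)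
    have V: "x \<in> int_vecs n" "u \<in> int_vecs m" using x u layer_in_vecs[where j = "Suc j"] j by auto
    have c: "coord j (\<psi> x u) = a" using V by (auto simp: coord_psi x_def u_def smul_def unit_vec_def)
    have "\<psi> x u \<in> layer (Suc j)" using x u by (rule layerI)
    then obtain f k where f: "f \<in> F" "k \<in> layer j" "\<psi> x u = f \<otimes> k" using F by auto
    then have "coord j f = a" using coord_mult_layer[of f k j] F j c by auto
    then show "a \<in> coord j ` F" using f by auto
  qed
  then show False using F by (meson finite_imageI finite_subset infinite_UNIV_int)
qed

lemma layer_factor_cyclic:
  assumes j: "j < n + m"
  shows "cyclic_group (G\<lparr>carrier := layer (Suc j)\<rparr> Mod layer j)"
proof -
  let ?H = "G\<lparr>carrier := layer (Suc j)\<rparr>"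
  have sub: "subgroup (layer (Suc j)) G" using layer_normal[of "Suc j"] j by (simp add: normal_imp_subgroup)
  have subj: "subgroup (layer j) G" using layer_normal[of j] j by (simp add: normal_imp_subgroup)
  interpret H: group ?H using sub by (simp add: subgroup_imp_group)
  have nj: "layer j \<lhd> ?H" using layer_normal[of j] j sub layer_mono[of j "Suc j"] by (intro normal_restrict_supergroup) simp_all
  interpret N: normal "layer j" ?H by (rule nj)
  interpret Q: group "?H Mod layer j" by (rule N.factorgroup_is_group)
  define x u where "x = (if j < m then 0 else unit_vec (j - m))" and "u = (if j < m then unit_vec j else 0)"
  have x: "x \<in> int_vecs (Suc j - m)" and u: "u \<in> int_vecs (min (Suc j) m)" by (auto simp: x_def u_def)
  have V: "x \<in> int_vecs n" "u \<in> int_vecs m" using x u layer_in_vecs[where j = "Suc j"] j by auto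
  define t where "t = \<psi> x u"
  have t: "t \<in> layer (Suc j)" unfolding t_def using x u by (rule layerI)
  have tc: "t \<in> carrier G" using V by (simp add: t_def)
  have hom: "(\<lambda>a. layer j #>\<^bsub>?H\<^esub> a) \<in> hom ?H (?H Mod layer j)" by (rule N.r_coset_hom_Mod)
  let ?T = "layer j #>\<^bsub>?H\<^esub> t"
  have T: "?T \<in> carrier (?H Mod layer j)" using hom t by (auto simp: hom_def)
  have pw: "?T [^]\<^bsub>?H Mod layer j\<^esub> a = layer j #>\<^bsub>?H\<^esub> (t [^] a)" for a :: int
    using hom_int_pow[OF hom, of t a] t int_pow_consistent[OF sub t, of a] by (simp add: H.is_group Q.is_group)
  \<comment> \<open>The exponent of \<open>t\<close> to be divided out is the coordinate number
    \<open>j\<close> of \<open>g\<close>.\<close>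
  have key: "\<exists>a::int. g \<otimes> inv (t [^] a) \<in> layer j" if g: "g \<in> layer (Suc j)" for g
  proof -
    obtain y w where y: "y \<in> int_vecs (Suc j - m)" "w \<in> int_vecs (min (Suc j) m)" "g = \<psi> y w" using g by (rule layerE)
    have yV: "y \<in> int_vecs n" "w \<in> int_vecs m" using y layer_in_vecs[where j = "Suc j"] j by auto
    show ?thesis
    proof (cases "j < m")
      case True
      then have y0: "y = 0" "x = 0" using y by (auto simp: int_vecs_0 x_def)
      have "inv (t [^] w j) = t [^] (- w j)" using tc by (simp add: int_pow_neg)
      also have "\<dots> = \<psi> 0 (smul (- w j) u)" using V psi_zero_pow[of u "- w j"] y0 by (simp add: t_def)
      finally have "g \<otimes> inv (t [^] w j) = \<psi> 0 (w + smul (- w j) u)"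
        using yV V y0 y(3) by (simp add: psi_central)
      moreover have "w + smul (- w j) u \<in> int_vecs (min j m)"
      proof -
        have "(w + smul (- w j) u) i = 0" if i: "i \<ge> j" for i
        proof (cases "i = j")
          case True
          then show ?thesis using \<open>j < m\<close> by (simp add: u_def unit_vec_def smul_def vec_apply)
        next
          case False
          then have "min (Suc j) m \<le> i" using i by simp
          then have "w i = 0" using y(2) by (simp add: int_vecs_def)
          then show ?thesis using False \<open>j < m\<close> by (simp add: u_def unit_vec_def smul_def vec_apply)
        qed
        moreover have "min j m = j" using \<open>j < m\<close> by simp
        ultimately show ?thesis by (simp add: int_vecs_def)
      qed
      ultimately show ?thesis using y0 by (intro exI[of _ "w j"]) (auto intro!: layerI)
    next
      case False
      obtain v where v: "v \<in> int_vecs m" "t [^] (- y (j - m)) = \<psi> (smul (- y (j - m)) x) v"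
        using psi_pow[OF V, of "- y (j - m)"] unfolding t_def by (rule bexE)
      have "inv (t [^] y (j - m)) = t [^] (- y (j - m))" using tc by (simp add: int_pow_neg)
      then have "g \<otimes> inv (t [^] y (j - m)) = \<psi> (y + smul (- y (j - m)) x) (w + v + \<beta> y (smul (- y (j - m)) x))"
        using v yV V y(3) by (simp add: psi_mult)
      moreover have "y + smul (- y (j - m)) x \<in> int_vecs (j - m)"
      proof -
        have "(y + smul (- y (j - m)) x) i = 0" if i: "i \<ge> j - m" for i
        proof (cases "i = j - m")
          case True
          then show ?thesis using False by (simp add: x_def unit_vec_def smul_def vec_apply)
        next
          case neq: False
          then have "i \<ge> Suc j - m" using i False by simp
          then show ?thesis using y(1) neq False by (simp add: int_vecs_def x_def unit_vec_def smul_def vec_apply)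
        qed
        then show ?thesis by (simp add: int_vecs_def)
      qed
      moreover have "w + v + \<beta> y (smul (- y (j - m)) x) \<in> int_vecs (min j m)"
        using False v yV V beta_in by (simp add: min_def)
      ultimately show ?thesis by (intro exI[of _ "y (j - m)"]) (auto intro!: layerI)
    qed
  qed
  have "carrier (?H Mod layer j) = range (\<lambda>a::int. ?T [^]\<^bsub>?H Mod layer j\<^esub> a)"
  proof
    show "range (\<lambda>a::int. ?T [^]\<^bsub>?H Mod layer j\<^esub> a) \<subseteq> carrier (?H Mod layer j)"
      using T Q.int_pow_closed by auto
    show "carrier (?H Mod layer j) \<subseteq> range (\<lambda>a::int. ?T [^]\<^bsub>?H Mod layer j\<^esub> a)"
    proof
      fix K assume "K \<in> carrier (?H Mod layer j)"
      then obtain g where g: "g \<in> layer (Suc j)" "K = layer j #>\<^bsub>?H\<^esub> g"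
        by (auto simp: FactGroup_def RCOSETS_def)
      obtain a :: int where a: "g \<otimes> inv (t [^] a) \<in> layer j" using key[OF g(1)] by (rule exE)
      have gc: "g \<in> carrier G" using g sub by (meson subgroup.mem_carrier)
      have "g = (g \<otimes> inv (t [^] a)) \<otimes> (t [^] a)" using gc tc by (simp add: m_assoc)
      then have "layer j #> g = layer j #> (g \<otimes> inv (t [^] a)) #> (t [^] a)"
        using gc tc subgroup.subset[OF subj] by (simp add: coset_mult_assoc)
      also have "layer j #> (g \<otimes> inv (t [^] a)) = layer j"
        using a gc tc subj by (intro coset_join2) simp_all
      finally have "K = ?T [^]\<^bsub>?H Mod layer j\<^esub> a" using g(2) pw by (simp add: r_coset_def)
      then show "K \<in> range (\<lambda>a::int. ?T [^]\<^bsub>?H Mod layer j\<^esub> a)" by simp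
    qed
  qed
  then show ?thesis using T Q.cyclic_group by blast
qed

theorem hirsch_length_eq_sum: "hirsch_length G = n + m"
proof -
  define Hs where "Hs = map layer [0..<Suc (n + m)]"
  have len: "length Hs = Suc (n + m)" by (simp add: Hs_def)
  have nth: "Hs ! j = layer j" if "j \<le> n + m" for j
    using that by (simp add: Hs_def del: upt_Suc)
  have "layer 0 = {\<one>}" by (auto simp: layer_def int_vecs_0 psi_zero)
  then have "hd Hs = {\<one>}" using nth[of 0] len by (metis hd_conv_nth le0 length_0_conv nat.distinct(1))
  moreover have "layer (n + m) = carrier G"
    using bij_betw_imp_surj_on[OF psi_bij] by (simp add: layer_def)
  then have "last Hs = carrier G" using nth[of "n + m"] len
    by (metis diff_Suc_1 last_conv_nth length_0_conv nat.distinct(1) order_refl)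
  moreover have "subgroup H G" if "H \<in> set Hs" for H
    using that layer_normal by (auto simp: Hs_def normal_imp_subgroup simp del: upt_Suc)
  moreover have "Hs ! i \<lhd> G\<lparr>carrier := Hs ! Suc i\<rparr> \<and> cyclic_group (series_factor G Hs i)" if "Suc i < length Hs" for i
    using that len nth[of i] nth[of "Suc i"] layer_normal[of i] layer_normal[of "Suc i"] layer_factor_cyclic[of i] layer_mono[of i "Suc i"]
    by (auto simp: series_factor_def intro!: normal_restrict_supergroup normal_imp_subgroup)
  ultimately have ser: "cyclic_series G Hs" using len unfolding cyclic_series_def by auto
  have "infinite (carrier (series_factor G Hs i))" if i: "Suc i < length Hs" for i
  proof -
    interpret group_with_cyclic_series G Hs by unfold_locales (rule ser)
    show ?thesis using infinite_factor_iff[OF i] layer_factor_infinite[of i] nth[of i] nth[of "Suc i"] i len by simp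
  qed
  then have "{i. Suc i < length Hs \<and> infinite (carrier (series_factor G Hs i))} = {..<n + m}"
    using len by auto
  then have "num_infinite_factors G Hs = n + m" by (simp add: num_infinite_factors_def)
  then show ?thesis using hirsch_length_eq[OF ser] by simp
qed

end

section \<open>Pencils of alternating forms in four variables\<close>

abbreviation int_prime :: "int \<Rightarrow> bool" where "int_prime \<equiv> Factorial_Ring.prime"

definition form4 :: "(nat \<Rightarrow> int) \<Rightarrow> (nat \<Rightarrow> int) \<Rightarrow> (nat \<Rightarrow> int) \<Rightarrow> int" where
  "form4 a x y = a 0 * (x 0 * y 1 - x 1 * y 0) + a 1 * (x 0 * y 2 - x 2 * y 0) + a 2 * (x 0 * y 3 - x 3 * y 0)
     + a 3 * (x 1 * y 2 - x 2 * y 1) + a 4 * (x 1 * y 3 - x 3 * y 1) + a 5 * (x 2 * y 3 - x 3 * y 2)"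

definition pfaffian :: "(nat \<Rightarrow> int) \<Rightarrow> int" where
  "pfaffian a = a 0 * a 5 - a 1 * a 4 + a 2 * a 3"

text \<open>The pair of functionals \<open>form4 a v\<close>, \<open>form4 b v\<close> maps onto
  \<open>\<int>\<^sup>2\<close> exactly when these minors have no common prime divisor as
  \<open>x\<close> and \<open>y\<close> vary.\<close>

definition form_minor :: "(nat \<Rightarrow> int) \<Rightarrow> (nat \<Rightarrow> int) \<Rightarrow> (nat \<Rightarrow> int) \<Rightarrow> (nat \<Rightarrow> int) \<Rightarrow> (nat \<Rightarrow> int) \<Rightarrow> int" where
  "form_minor a b v x y = form4 a v x * form4 b v y - form4 a v y * form4 b v x"

definition pencil :: "(nat \<Rightarrow> int) \<Rightarrow> (nat \<Rightarrow> int) \<Rightarrow> int \<Rightarrow> int \<Rightarrow> nat \<Rightarrow> int" where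
  "pencil a b s t = smul s a + smul t b"

lemma form4_pencil: "form4 (pencil a b s t) x y = s * form4 a x y + t * form4 b x y"
  by (simp add: form4_def pencil_def smul_def vec_apply algebra_simps)

lemma form4_alt: "form4 a x x = 0" "form4 a y x = - form4 a x y"
  by (simp_all add: form4_def algebra_simps)

lemma form4_linear:
  "form4 a (x + z) y = form4 a x y + form4 a z y" "form4 a y (x + z) = form4 a y x + form4 a y z"
  "form4 a (smul c x) y = c * form4 a x y" "form4 a y (smul c x) = c * form4 a y x"
  "form4 a (- x) y = - form4 a x y" "form4 a y (- x) = - form4 a y x"
  "form4 a (x - z) y = form4 a x y - form4 a z y" "form4 a y (x - z) = form4 a y x - form4 a y z"
  "form4 a 0 y = 0" "form4 a y 0 = 0"
  by (simp_all add: form4_def smul_def vec_apply algebra_simps)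

lemma form4_unit:
  "form4 a (unit_vec 0) (unit_vec 1) = a 0" "form4 a (unit_vec 0) (unit_vec 2) = a 1"
  "form4 a (unit_vec 0) (unit_vec 3) = a 2" "form4 a (unit_vec 1) (unit_vec 2) = a 3"
  "form4 a (unit_vec 1) (unit_vec 3) = a 4" "form4 a (unit_vec 2) (unit_vec 3) = a 5"
  by (simp_all add: form4_def unit_vec_def)

lemma less_6_cases: "i < (6::nat) \<Longrightarrow> i = 0 \<or> i = 1 \<or> i = 2 \<or> i = 3 \<or> i = 4 \<or> i = 5" by auto

lemma less_4_cases: "i < (4::nat) \<Longrightarrow> i = 0 \<or> i = 1 \<or> i = 2 \<or> i = 3" by auto

lemma form4_dvd_coeffs:
  assumes "\<And>x y. p dvd form4 a x y" "i < 6"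
  shows "p dvd a i"
  using less_6_cases[OF assms(2)] assms(1)[of "unit_vec 0" "unit_vec 1"] assms(1)[of "unit_vec 0" "unit_vec 2"]
    assms(1)[of "unit_vec 0" "unit_vec 3"] assms(1)[of "unit_vec 1" "unit_vec 2"]
    assms(1)[of "unit_vec 1" "unit_vec 3"] assms(1)[of "unit_vec 2" "unit_vec 3"]
  unfolding form4_unit by auto

text \<open>Cramer's rule for skew matrices: the Pfaffian replaces the determinant, and the adjugate
  is again skew, with the complementary coefficients up to sign.\<close>

lemma pfaffian_adjugate:
  "pfaffian a * v 0 = a 5 * form4 a v (unit_vec 1) - a 4 * form4 a v (unit_vec 2) + a 3 * form4 a v (unit_vec 3)"
  "pfaffian a * v 1 = - a 5 * form4 a v (unit_vec 0) + a 2 * form4 a v (unit_vec 2) - a 1 * form4 a v (unit_vec 3)"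
  "pfaffian a * v 2 = a 4 * form4 a v (unit_vec 0) - a 2 * form4 a v (unit_vec 1) + a 0 * form4 a v (unit_vec 3)"
  "pfaffian a * v 3 = - a 3 * form4 a v (unit_vec 0) + a 1 * form4 a v (unit_vec 1) - a 0 * form4 a v (unit_vec 2)"
  by (simp_all add: pfaffian_def form4_def unit_vec_def algebra_simps)

lemma prime_dvd_pfaffian:
  fixes p :: int
  assumes p: "int_prime p" and all: "\<And>y. p dvd form4 a v y" and i: "i < 4" "\<not> p dvd v i"
  shows "p dvd pfaffian a"
proof -
  have "p dvd pfaffian a * v i"
    using less_4_cases[OF i(1)]
  proof (elim disjE)
    assume "i = 0" then show ?thesis unfolding \<open>i = 0\<close> pfaffian_adjugate using all by (intro dvd_add dvd_diff dvd_mult)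
  next
    assume "i = 1" then show ?thesis unfolding \<open>i = 1\<close> pfaffian_adjugate using all by (intro dvd_add dvd_diff dvd_mult)
  next
    assume "i = 2" then show ?thesis unfolding \<open>i = 2\<close> pfaffian_adjugate using all by (intro dvd_add dvd_diff dvd_mult)
  next
    assume "i = 3" then show ?thesis unfolding \<open>i = 3\<close> pfaffian_adjugate using all by (intro dvd_add dvd_diff dvd_mult)
  qed
  then show ?thesis using p i(2) by (simp add: prime_dvd_mult_iff)
qed

lemma form4_cong_dvd:
  fixes p :: int
  assumes "\<And>i. i < 4 \<Longrightarrow> p dvd v i - v' i"
  shows "p dvd form4 a v x - form4 a v' x"
proof -
  have d: "p dvd v 0 - v' 0" "p dvd v 1 - v' 1" "p dvd v 2 - v' 2" "p dvd v 3 - v' 3" using assms by auto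
  have "form4 a v x - form4 a v' x =
      (v 0 - v' 0) * (a 0 * x 1 + a 1 * x 2 + a 2 * x 3) + (v 1 - v' 1) * (a 3 * x 2 + a 4 * x 3 - a 0 * x 0)
    + (v 2 - v' 2) * (a 5 * x 3 - a 1 * x 0 - a 3 * x 1) + (v 3 - v' 3) * (- a 2 * x 0 - a 4 * x 1 - a 5 * x 2)"
    unfolding form4_def by (simp add: algebra_simps)
  also have "p dvd \<dots>" using d by (intro dvd_add dvd_mult2)
  finally show ?thesis .
qed

lemma form_minor_cong_dvd:
  fixes p :: int
  assumes "\<And>i. i < 4 \<Longrightarrow> p dvd v i - v' i"
  shows "p dvd form_minor a b v x y \<longleftrightarrow> p dvd form_minor a b v' x y"
proof -
  have "form_minor a b v x y - form_minor a b v' x y =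
     (form4 a v x - form4 a v' x) * form4 b v y + form4 a v' x * (form4 b v y - form4 b v' y)
     - (form4 a v y - form4 a v' y) * form4 b v x - form4 a v' y * (form4 b v x - form4 b v' x)"
    unfolding form_minor_def by (simp add: algebra_simps)
  also have "p dvd \<dots>"
    by (intro dvd_add dvd_diff dvd_mult dvd_mult2 form4_cong_dvd assms)
  finally show ?thesis using dvd_add_right_iff[of p "form_minor a b v x y - form_minor a b v' x y" "form_minor a b v' x y"] by simp
qed

text \<open>The first assumption says that the span of \<open>a\<close> and \<open>b\<close> is
  saturated among integral forms: it keeps rank two modulo every prime. The second keeps the
  Pfaffian from vanishing identically on the pencil.\<close>

locale primitive_pencil =
  fixes a b :: "nat \<Rightarrow> int"
  assumes independent_mod: "int_prime (p::int) \<Longrightarrow> (\<And>i. i < 6 \<Longrightarrow> p dvd s * a i + t * b i) \<Longrightarrow> p dvd s \<and> p dvd t"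
    and generic_pfaffian: "\<exists>s t. pfaffian (pencil a b s t) \<noteq> 0"
begin

definition bad :: "int \<Rightarrow> (nat \<Rightarrow> int) \<Rightarrow> bool" where
  "bad p v \<longleftrightarrow> (\<forall>x y. p dvd form_minor a b v x y)"

text \<open>Let \<open>p\<close> not divide \<open>form4 a v x\<close>, and let \<open>c\<close> be
  the member of the pencil that vanishes at \<open>v, x\<close>. If all vectors were bad,
  \<open>v\<close> and \<open>x\<close> would lie in the radical of \<open>c\<close> modulo
  \<open>p\<close>, and polarisation would put every vector there. Then \<open>c\<close> vanishes
  modulo \<open>p\<close>, against the independence of \<open>a\<close> and
  \<open>b\<close>.\<close>

lemma ex_good_mod:
  fixes p :: int
  assumes p: "int_prime p"
  shows "\<exists>v. \<not> bad p v"
proof (rule ccontr)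
  assume "\<not> (\<exists>v. \<not> bad p v)"
  then have all: "p dvd form_minor a b v x y" for v x y by (simp add: bad_def)
  have "\<exists>v x. \<not> p dvd form4 a v x"
  proof (rule ccontr)
    assume "\<not> (\<exists>v x. \<not> p dvd form4 a v x)"
    then have "p dvd a i" if "i < 6" for i using form4_dvd_coeffs[of p a i] that by simp
    then show False using independent_mod[OF p, of 1 0] p by (simp add: not_prime_unit)
  qed
  then obtain v x where vx: "\<not> p dvd form4 a v x" by (elim exE)
  define c where "c = pencil a b (- form4 b v x) (form4 a v x)"
  have c: "form4 c u w = form4 a v x * form4 b u w - form4 b v x * form4 a u w" for u w
    by (simp add: c_def form4_pencil)
  have c1: "p dvd form4 c v y" for y
  proof -
    have "form4 c v y = form_minor a b v x y" unfolding c form_minor_def by (simp add: algebra_simps)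
    then show ?thesis using all by simp
  qed
  have c2: "p dvd form4 c x y" for y
  proof -
    have "form4 c x y = - form_minor a b x v y" unfolding c form_minor_def form4_alt(2)[of _ v x] by (simp add: algebra_simps)
    then show ?thesis using all by simp
  qed
  have "p dvd form4 c w y" for w y
  proof -
    \<comment> \<open>polarise the quadratic condition at \<open>v\<close> and \<open>w\<close>\<close>
    have "form4 a v x * form4 c w y = form4 a v x * (form_minor a b (v + w) x y - form_minor a b v x y - form_minor a b w x y)
       - form4 a w x * form4 c v y - form4 a v y * form4 c x w"
      unfolding c form_minor_def form4_linear form4_alt(2)[of _ x w] by (simp add: algebra_simps)
    also have "p dvd \<dots>" by (intro dvd_diff dvd_mult all c1 c2)
    finally show ?thesis using p vx by (simp add: prime_dvd_mult_iff)
  qed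
  then have "p dvd c i" if "i < 6" for i using form4_dvd_coeffs[of p c i] that by simp
  then have "p dvd form4 a v x"
    using independent_mod[OF p, of "- form4 b v x" "form4 a v x"] by (simp add: c_def pencil_def smul_def vec_apply)
  then show False using vx by simp
qed

text \<open>The Pfaffian of the member of the pencil that vanishes at \<open>v, f\<close>. Every
  prime at which \<open>v\<close> is bad divides it, and it is constant along
  \<open>v + t f\<close>, so the primes that can be bad somewhere on this line are known in advance
  if it is nonzero.\<close>

definition obstruction :: "(nat \<Rightarrow> int) \<Rightarrow> (nat \<Rightarrow> int) \<Rightarrow> int" where
  "obstruction v f = pfaffian (pencil a b (form4 b v f) (- form4 a v f))"

text \<open>If \<open>v\<close> is nonzero modulo \<open>p\<close>, badness puts it into the radical
  of that member modulo \<open>p\<close>, which is then singular. If \<open>v\<close> is zero modulo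
  \<open>p\<close>, so are the coefficients of the member.\<close>

lemma bad_dvd_obstruction:
  fixes p :: int
  assumes p: "int_prime p" and bad: "bad p v"
  shows "p dvd obstruction v f"
proof -
  let ?c = "pencil a b (form4 b v f) (- form4 a v f)"
  have all: "p dvd form4 ?c v y" for y
  proof -
    have "form4 ?c v y = - form_minor a b v f y" unfolding form4_pencil form_minor_def by (simp add: algebra_simps)
    then show ?thesis using bad by (simp add: bad_def)
  qed
  show ?thesis
  proof (cases "\<exists>i<4. \<not> p dvd v i")
    case True
    then show ?thesis using prime_dvd_pfaffian[OF p all] by (auto simp: obstruction_def)
  next
    case False
    then have "p dvd form4 d v f - form4 d 0 f" for d by (intro form4_cong_dvd) (simp add: vec_apply)
    then have "p dvd form4 d v f" for d by (simp add: form4_linear)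
    then have "p dvd ?c i" for i by (simp add: pencil_def smul_def vec_apply)
    then show ?thesis unfolding obstruction_def pfaffian_def by (intro dvd_add dvd_diff dvd_mult)
  qed
qed

lemma obstruction_shift: "obstruction (v + smul t f) f = obstruction v f"
  by (simp add: obstruction_def form4_linear form4_alt(1))

lemma pfaffian_pencil_quadratic:
  "pfaffian (pencil a b (s0 + T * s) (t0 + T * t)) = pfaffian (pencil a b s0 t0)
     + T * (s0 * s * 2 * pfaffian a + t0 * t * 2 * pfaffian b + (s0 * t + s * t0) * (pfaffian (a + b) - pfaffian a - pfaffian b))
     + T * T * pfaffian (pencil a b s t)"
  unfolding pfaffian_def pencil_def smul_def vec_apply by (simp add: algebra_simps)

text \<open>Along \<open>g - v + p T w\<close> the obstruction is a quadratic polynomial in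
  \<open>T\<close> with nonzero leading coefficient, so it cannot vanish at 0, 1 and -1.\<close>

lemma ex_nonzero_obstruction:
  fixes p :: int
  assumes p: "p \<noteq> 0" and m: "form_minor a b v x y \<noteq> 0"
  shows "\<exists>w. obstruction v (g - v + smul p w) \<noteq> 0"
proof -
  obtain s t where st: "pfaffian (pencil a b s t) \<noteq> 0" using generic_pfaffian by (elim exE)
  define m where "m = form_minor a b v x y"
  \<comment> \<open>Cramer's rule in the span of \<open>x\<close> and \<open>y\<close>:
    \<open>w\<close> solves \<open>form4 a v w = - m * t\<close> and
    \<open>form4 b v w = m * s\<close>, which makes the leading coefficient a multiple of
    \<open>pfaffian (pencil a b s t)\<close>.\<close>
  define w where "w = smul (- t * form4 b v y - s * form4 a v y) x + smul (s * form4 a v x + t * form4 b v x) y"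
  have w: "form4 a v w = - m * t" "form4 b v w = m * s"
    unfolding w_def m_def form_minor_def form4_linear by (simp_all add: algebra_simps)
  have ob: "obstruction v (g - v + smul p (smul T w)) =
      pfaffian (pencil a b (form4 b v g + T * (p * m * s)) (- form4 a v g + T * (p * m * t)))" for T
  proof -
    have "form4 b v (g - v + smul p (smul T w)) = form4 b v g + T * (p * m * s)"
      unfolding form4_linear form4_alt(1) w by (simp add: algebra_simps)
    moreover have "- form4 a v (g - v + smul p (smul T w)) = - form4 a v g + T * (p * m * t)"
      unfolding form4_linear form4_alt(1) w by (simp add: algebra_simps)
    ultimately show ?thesis by (simp only: obstruction_def)
  qed
  have sq: "pfaffian (pencil a b (p * m * s) (p * m * t)) = (p * m) * (p * m) * pfaffian (pencil a b s t)"
    unfolding pfaffian_def pencil_def smul_def vec_apply by (simp add: algebra_simps)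
  have nz: "(p * m) * (p * m) * pfaffian (pencil a b s t) \<noteq> 0" using st p m by (simp add: m_def)
  define A0 A1 where "A0 = pfaffian (pencil a b (form4 b v g) (- form4 a v g))"
    and "A1 = (form4 b v g * (p * m * s) * 2 * pfaffian a + (- form4 a v g) * (p * m * t) * 2 * pfaffian b
      + (form4 b v g * (p * m * t) + (p * m * s) * (- form4 a v g)) * (pfaffian (a + b) - pfaffian a - pfaffian b))"
  define A2 where "A2 = (p * m) * (p * m) * pfaffian (pencil a b s t)"
  have q: "obstruction v (g - v + smul p (smul T w)) = A0 + T * A1 + T * T * A2" for T
    unfolding ob pfaffian_pencil_quadratic sq A0_def A1_def A2_def by simp
  show ?thesis
  proof (rule ccontr)
    assume "\<not> ?thesis"
    then have z: "A0 + T * A1 + T * T * A2 = 0" for T using q by metis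
    show False using z[of 0] z[of 1] z[of "-1"] nz by (simp add: A2_def)
  qed
qed

text \<open>Let \<open>g\<close> be good at \<open>p\<close> and move \<open>v\<close> along
  \<open>f\<close>, which is \<open>g - v\<close> modulo \<open>p\<close>. The parameter
  \<open>t\<close> is 1 modulo \<open>p\<close> and 0 modulo the other primes dividing the
  obstruction: modulo \<open>p\<close> the vector becomes \<open>g\<close>, modulo those it stays
  \<open>v\<close>, and no further prime can be bad.\<close>

lemma remove_bad_prime:
  fixes p :: int
  assumes p: "int_prime p" and m: "form_minor a b v x y \<noteq> 0"
  shows "\<exists>v'. \<not> bad p v' \<and> (\<forall>r. int_prime r \<longrightarrow> bad r v' \<longrightarrow> bad r v)"
proof -
  obtain g where g: "\<not> bad p g" using ex_good_mod[OF p] by (elim exE)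
  have "p \<noteq> 0" using p by auto
  obtain w where w: "obstruction v (g - v + smul p w) \<noteq> 0" using ex_nonzero_obstruction[OF \<open>p \<noteq> 0\<close> m, of g] by (elim exE)
  define f where "f = g - v + smul p w"
  define N where "N = obstruction v f"
  have N: "N \<noteq> 0" using w by (simp add: N_def f_def)
  obtain N' where N': "N = p ^ multiplicity p N * N'" "\<not> p dvd N'"
    using multiplicity_decompose'[of N p] N p by (metis not_prime_unit)
  have "coprime p N'" using p N'(2) by (simp add: prime_imp_coprime)
  then obtain k l where kl: "k * p + l * N' = 1" by (metis bezout_int coprime_imp_gcd_eq_1)
  define t where "t = l * N'"
  define v' where "v' = v + smul t f"
  have "p dvd v' i - g i" for i
  proof -
    have t: "t = 1 - k * p" using kl by (simp add: t_def)
    have "v' i - g i = p * (k * (v i - g i) + w i - k * (p * w i))"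
      by (simp add: v'_def f_def smul_def vec_apply t algebra_simps)
    then show ?thesis by simp
  qed
  then have "\<not> bad p v'" using g form_minor_cong_dvd[of p v' g] by (simp add: bad_def)
  moreover have "bad r v" if r: "int_prime r" "bad r v'" for r
  proof -
    have rp: "r \<noteq> p" using r(2) \<open>\<not> bad p v'\<close> by auto
    have "r dvd N" using bad_dvd_obstruction[OF r, of f] by (simp add: v'_def obstruction_shift N_def)
    then have "r dvd p ^ multiplicity p N \<or> r dvd N'" using r(1) N'(1) by (metis prime_dvd_mult_iff)
    then have "r dvd N'" using rp r(1) p by (metis prime_dvd_power primes_dvd_imp_eq)
    then have "r dvd v' i - v i" for i by (simp add: v'_def smul_def vec_apply t_def)
    then show ?thesis using r(2) form_minor_cong_dvd[of r v' v] by (simp add: bad_def)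
  qed
  ultimately show ?thesis by (intro exI[of _ v']) simp
qed

text \<open>Bad primes divide a nonzero minor, hence are finite in number, and are removed one at a
  time.\<close>

theorem ex_good: "\<exists>v. \<forall>p. int_prime p \<longrightarrow> \<not> bad p v"
proof -
  have "form_minor a b v x y \<noteq> 0 \<Longrightarrow> card {p. int_prime p \<and> bad p v} = N \<Longrightarrow> ?thesis" for v x y N
  proof (induction N arbitrary: v x y rule: less_induct)
    case (less N)
    show ?case
    proof (cases "\<forall>p. int_prime p \<longrightarrow> \<not> bad p v")
      case True
      then show ?thesis by (intro exI[of _ v])
    next
      case False
      then obtain p where p: "int_prime p" "bad p v" by auto
      obtain v' where v': "\<not> bad p v' \<and> (\<forall>r. int_prime r \<longrightarrow> bad r v' \<longrightarrow> bad r v)"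
        using remove_bad_prime[OF p(1) less.prems(1)] by (elim exE)
      have "{p. int_prime p \<and> bad p v} \<subseteq> {p. p dvd form_minor a b v x y}" by (auto simp: bad_def)
      moreover have "finite {p. p dvd form_minor a b v x y}" using less.prems(1) by (rule finite_divisors_int)
      ultimately have fin: "finite {p. int_prime p \<and> bad p v}" by (rule finite_subset)
      have "{p. int_prime p \<and> bad p v'} \<subset> {p. int_prime p \<and> bad p v}" using v' p by auto
      then have lt: "card {p. int_prime p \<and> bad p v'} < N" using fin less.prems(2) psubset_card_mono by metis
      obtain x' y' where "\<not> p dvd form_minor a b v' x' y'" using v' by (auto simp: bad_def)
      then have "form_minor a b v' x' y' \<noteq> 0" by auto
      from less.IH[OF lt this refl] show ?thesis .
    qed
  qed
  \<comment> \<open>A vector that is good at one prime has a nonzero minor, which is all that the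
    descent needs to start.\<close>
  moreover obtain v where "\<not> bad 2 v" using ex_good_mod[of 2] by auto
  then obtain x y where "\<not> 2 dvd form_minor a b v x y" by (auto simp: bad_def)
  then have "form_minor a b v x y \<noteq> 0" by auto
  ultimately show ?thesis by blast
qed

end

section \<open>Vectors and alternating forms in coordinates\<close>

definition vec_of :: "int list \<Rightarrow> nat \<Rightarrow> int" where
  "vec_of xs = (\<lambda>i. if i < length xs then xs ! i else 0)"

lemma vec_of_in [simp]: "length xs \<le> n \<Longrightarrow> vec_of xs \<in> int_vecs n"
  by (auto simp: vec_of_def int_vecs_def)

lemma vec_of_eq: "length xs = length ys \<Longrightarrow> vec_of xs = vec_of ys \<longleftrightarrow> xs = ys"
  by (auto simp: vec_of_def fun_eq_iff list_eq_iff_nth_eq)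

lemma vec_of_add: "vec_of [a, b] + vec_of [a', b'] = vec_of [a + a', b + b']"
  "vec_of [a, b, c] + vec_of [a', b', c'] = vec_of [a + a', b + b', c + c']"
  "vec_of [a, b, c, d] + vec_of [a', b', c', d'] = vec_of [a + a', b + b', c + c', d + d']"
  by (auto simp: vec_of_def fun_eq_iff vec_apply nth_Cons split: nat.splits)

lemma vec_of_nth: "vec_of (x # xs) 0 = x" "vec_of (x # y # xs) (Suc 0) = y" "vec_of (x # y # z # xs) 2 = z"
  "vec_of (x # y # z # w # xs) 3 = w"
  by (auto simp: vec_of_def)

lemma int_vecs_2: "x \<in> int_vecs 2 \<Longrightarrow> x = vec_of [x 0, x 1]"
  by (rule int_vecs_eqI[of _ 2], assumption, simp) (auto simp: vec_of_def less_2_cases_iff)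

lemma int_vecs_3: "x \<in> int_vecs 3 \<Longrightarrow> x = vec_of [x 0, x 1, x 2]"
  by (rule int_vecs_eqI[of _ 3], assumption, simp) (auto simp: vec_of_def eval_nat_numeral less_Suc_eq)

lemma int_vecs_4: "x \<in> int_vecs 4 \<Longrightarrow> x = vec_of [x 0, x 1, x 2, x 3]"
  by (rule int_vecs_eqI[of _ 4], assumption, simp) (auto simp: vec_of_def eval_nat_numeral less_Suc_eq)

lemma bij_betw_inverse:
  assumes "\<And>x. x \<in> S \<Longrightarrow> f x \<in> S" "\<And>x. x \<in> S \<Longrightarrow> g x \<in> S"
    "\<And>x. x \<in> S \<Longrightarrow> g (f x) = x" "\<And>x. x \<in> S \<Longrightarrow> f (g x) = x"
  shows "bij_betw f S S"
  using assms by (intro bij_betw_byWitness[of _ g]) auto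

definition alternating_on :: "nat \<Rightarrow> ((nat \<Rightarrow> int) \<Rightarrow> (nat \<Rightarrow> int) \<Rightarrow> nat \<Rightarrow> int) \<Rightarrow> bool" where
  "alternating_on n \<omega> \<longleftrightarrow> biadditive_on (int_vecs n) \<omega> \<and> (\<forall>x\<in>int_vecs n. \<omega> x x = 0)"

definition nondegenerate_on :: "nat \<Rightarrow> ((nat \<Rightarrow> int) \<Rightarrow> (nat \<Rightarrow> int) \<Rightarrow> nat \<Rightarrow> int) \<Rightarrow> bool" where
  "nondegenerate_on n \<omega> \<longleftrightarrow> (\<forall>x\<in>int_vecs n. (\<forall>y\<in>int_vecs n. \<omega> x y = 0) \<longrightarrow> x = 0)"

lemma alternating_on_swap:
  assumes "alternating_on n \<omega>" "x \<in> int_vecs n" "y \<in> int_vecs n"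
  shows "\<omega> y x = - \<omega> x y"
proof -
  have bi: "biadditive_on (int_vecs n) \<omega>" using assms by (simp add: alternating_on_def)
  have "\<omega> (x + y) (x + y) = \<omega> x x + \<omega> x y + (\<omega> y x + \<omega> y y)"
    using assms(2,3) by (simp only: biadditive_onD[OF bi] int_vecs_add ac_simps)
  moreover have "\<omega> (x + y) (x + y) = 0" "\<omega> x x = 0" "\<omega> y y = 0"
    using assms by (simp_all add: alternating_on_def)
  ultimately have "\<omega> x y + \<omega> y x = 0" by simp
  then show ?thesis by (rule minus_unique[symmetric])
qed

lemma biadditive_on_expand:
  fixes \<omega> :: "(nat \<Rightarrow> int) \<Rightarrow> (nat \<Rightarrow> int) \<Rightarrow> nat \<Rightarrow> int"
  assumes bi: "biadditive_on (int_vecs n) \<omega>" and x: "x \<in> int_vecs n" and y: "y \<in> int_vecs n"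
  shows "\<omega> x y k = (\<Sum>i<n. x i * (\<Sum>j<n. y j * \<omega> (unit_vec i) (unit_vec j) k))"
proof -
  have "\<omega> x y k = lin_comb n (\<lambda>i. \<omega> (unit_vec i) y) x k"
    using additive_on_expand[of n "\<lambda>x. \<omega> x y" x] bi x y by (simp add: biadditive_on_def)
  also have "\<dots> = (\<Sum>i<n. x i * \<omega> (unit_vec i) y k)" by (simp add: lin_comb_def)
  also have "\<dots> = (\<Sum>i<n. x i * (\<Sum>j<n. y j * \<omega> (unit_vec i) (unit_vec j) k))"
  proof (rule sum.cong)
    fix i assume "i \<in> {..<n}"
    then have "\<omega> (unit_vec i) y = lin_comb n (\<lambda>j. \<omega> (unit_vec i) (unit_vec j)) y"
      using bi y by (intro additive_on_expand) (simp_all add: biadditive_on_def)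
    then show "x i * \<omega> (unit_vec i) y k = x i * (\<Sum>j<n. y j * \<omega> (unit_vec i) (unit_vec j) k)"
      by (simp add: lin_comb_def)
  qed simp
  finally show ?thesis .
qed

lemma lessThan_small: "{..<2::nat} = {0, 1}" "{..<3::nat} = {0, 1, 2}" "{..<4::nat} = {0, 1, 2, 3}" by auto

lemma alternating_on_unit:
  assumes "alternating_on n \<omega>" "i < n" "j < n"
  shows "\<omega> (unit_vec i) (unit_vec i) k = 0" "\<omega> (unit_vec j) (unit_vec i) k = - \<omega> (unit_vec i) (unit_vec j) k"
  using assms alternating_on_swap[OF assms(1), of "unit_vec i" "unit_vec j"]
  by (simp_all add: alternating_on_def vec_apply)

lemma alternating_2:
  assumes "alternating_on 2 \<omega>" "x \<in> int_vecs 2" "y \<in> int_vecs 2"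
  shows "\<omega> x y = smul (x 0 * y 1 - x 1 * y 0) (\<omega> (unit_vec 0) (unit_vec 1))"
proof
  fix k
  have "\<omega> x y k = (\<Sum>i<2. x i * (\<Sum>j<2. y j * \<omega> (unit_vec i) (unit_vec j) k))"
    using assms by (intro biadditive_on_expand) (simp_all add: alternating_on_def)
  then show "\<omega> x y k = smul (x 0 * y 1 - x 1 * y 0) (\<omega> (unit_vec 0) (unit_vec 1)) k"
    using alternating_on_unit(1)[OF assms(1), of 0 0 k] alternating_on_unit(1)[OF assms(1), of 1 0 k]
      alternating_on_unit(2)[OF assms(1), of 0 1 k]
    by (simp add: lessThan_small smul_def algebra_simps)
qed

lemma alternating_3:
  assumes "alternating_on 3 \<omega>" "x \<in> int_vecs 3" "y \<in> int_vecs 3"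
  shows "\<omega> x y = smul (x 0 * y 1 - x 1 * y 0) (\<omega> (unit_vec 0) (unit_vec 1))
    + smul (x 0 * y 2 - x 2 * y 0) (\<omega> (unit_vec 0) (unit_vec 2)) + smul (x 1 * y 2 - x 2 * y 1) (\<omega> (unit_vec 1) (unit_vec 2))"
proof
  fix k
  let ?w = "\<lambda>i j. \<omega> (unit_vec i) (unit_vec j) k"
  have a: "?w 0 0 = 0" "?w 1 1 = 0" "?w 2 2 = 0" "?w 1 0 = - ?w 0 1" "?w 2 0 = - ?w 0 2" "?w 2 1 = - ?w 1 2"
    using alternating_on_unit(1)[OF assms(1), of 0 0 k] alternating_on_unit(1)[OF assms(1), of 1 1 k]
      alternating_on_unit(1)[OF assms(1), of 2 2 k] alternating_on_unit(2)[OF assms(1), of 0 1 k]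
      alternating_on_unit(2)[OF assms(1), of 0 2 k] alternating_on_unit(2)[OF assms(1), of 1 2 k]
    by (simp_all del: One_nat_def)
  have "\<omega> x y k = (\<Sum>i<3. x i * (\<Sum>j<3. y j * ?w i j))"
    using assms by (intro biadditive_on_expand) (simp_all add: alternating_on_def)
  also have "\<dots> = x 0 * (y 0 * ?w 0 0 + y 1 * ?w 0 1 + y 2 * ?w 0 2) + x 1 * (y 0 * ?w 1 0 + y 1 * ?w 1 1 + y 2 * ?w 1 2)
      + x 2 * (y 0 * ?w 2 0 + y 1 * ?w 2 1 + y 2 * ?w 2 2)"
    by (simp add: lessThan_small add.assoc del: One_nat_def)
  also have "\<dots> = (x 0 * y 1 - x 1 * y 0) * ?w 0 1 + (x 0 * y 2 - x 2 * y 0) * ?w 0 2 + (x 1 * y 2 - x 2 * y 1) * ?w 1 2"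
    unfolding a by (simp add: algebra_simps del: One_nat_def)
  finally show "\<omega> x y k = (smul (x 0 * y 1 - x 1 * y 0) (\<omega> (unit_vec 0) (unit_vec 1))
    + smul (x 0 * y 2 - x 2 * y 0) (\<omega> (unit_vec 0) (unit_vec 2)) + smul (x 1 * y 2 - x 2 * y 1) (\<omega> (unit_vec 1) (unit_vec 2))) k"
    by (simp only: smul_def vec_apply)
qed

text \<open>A change of basis of \<open>\<int>\<^sup>n\<close> only conjugates \<open>A\<close> and
  leaves \<open>B\<close> alone, so \<open>\<omega>\<close> may be brought to a normal form on the
  arguments.\<close>

lemma admissible_pair_conj:
  assumes P: "bij_betw P (int_vecs n) (int_vecs n)" "additive_on (int_vecs n) P"
    and ad: "admissible_pair n m (\<lambda>x y. \<omega> (P x) (P y)) A B"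
  shows "\<exists>A'. admissible_pair n m \<omega> A' B"
proof -
  define Q where "Q = inv_into (int_vecs n) P"
  have A: "bij_betw A (int_vecs n) (int_vecs n)" "additive_on (int_vecs n) A" "\<And>x. x \<in> int_vecs n \<Longrightarrow> A x = x \<Longrightarrow> x = 0"
    "\<And>x y. x \<in> int_vecs n \<Longrightarrow> y \<in> int_vecs n \<Longrightarrow> \<omega> (P (A x)) (P (A y)) = B (\<omega> (P x) (P y))"
    using ad by (simp_all add: admissible_pair_def)
  have Pin: "P x \<in> int_vecs n" if "x \<in> int_vecs n" for x using bij_betw_apply[OF P(1) that] .
  have Ain: "A x \<in> int_vecs n" if "x \<in> int_vecs n" for x using bij_betw_apply[OF A(1) that] .
  have Qb: "bij_betw Q (int_vecs n) (int_vecs n)" unfolding Q_def by (rule bij_betw_inv_into[OF P(1)])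
  have Qin: "Q x \<in> int_vecs n" if "x \<in> int_vecs n" for x using bij_betw_apply[OF Qb that] .
  have PQ: "P (Q x) = x" if "x \<in> int_vecs n" for x
    unfolding Q_def using that by (rule bij_betw_inv_into_right[OF P(1)])
  have QP: "Q (P x) = x" if "x \<in> int_vecs n" for x
    unfolding Q_def using that by (rule bij_betw_inv_into_left[OF P(1)])
  have Qadd: "Q (x + y) = Q x + Q y" if "x \<in> int_vecs n" "y \<in> int_vecs n" for x y
  proof -
    have "P (Q x + Q y) = x + y" using that additive_on_add[OF P(2) Qin Qin] by (simp add: PQ)
    then have "Q (P (Q x + Q y)) = Q (x + y)" by simp
    then show ?thesis using that by (simp add: QP Qin)
  qed
  define A' where "A' = P \<circ> (A \<circ> Q)"
  have "bij_betw A' (int_vecs n) (int_vecs n)" unfolding A'_def by (intro bij_betw_trans[OF bij_betw_trans[OF Qb A(1)] P(1)])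
  moreover have "additive_on (int_vecs n) A'"
    by (simp add: additive_on_def A'_def Qadd Qin Ain additive_on_add[OF A(2)] additive_on_add[OF P(2)])
  moreover have "x = 0" if x: "x \<in> int_vecs n" "A' x = x" for x
  proof -
    have "Q (P (A (Q x))) = Q x" using x(2) by (simp add: A'_def)
    then have "Q x = 0" using A(3)[of "Q x"] Qin Ain x(1) by (simp add: QP)
    then show ?thesis using PQ[OF x(1)] additive_on_zero[OF P(2)] by simp
  qed
  moreover have "\<omega> (A' x) (A' y) = B (\<omega> x y)" if "x \<in> int_vecs n" "y \<in> int_vecs n" for x y
    using that A(4)[of "Q x" "Q y"] by (simp add: A'_def Qin PQ)
  ultimately show ?thesis using ad unfolding admissible_pair_def by (intro exI[of _ A']) simp
qed

lemma neg_admissible: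
  "bij_betw uminus (int_vecs m) (int_vecs m)" "additive_on (int_vecs m) (uminus :: _ \<Rightarrow> nat \<Rightarrow> int)"
  "\<forall>u\<in>int_vecs m. - u = u \<longrightarrow> u = 0"
proof -
  show "bij_betw uminus (int_vecs m) (int_vecs m)" by (rule bij_betw_inverse[of _ _ uminus]) simp_all
  show "additive_on (int_vecs m) (uminus :: _ \<Rightarrow> nat \<Rightarrow> int)" by (simp add: additive_on_def)
  show "\<forall>u\<in>int_vecs m. - u = u \<longrightarrow> u = 0" by (auto simp: fun_eq_iff vec_apply)
qed

text \<open>The Fibonacci matrix has determinant -1, so that it negates \<open>\<omega>\<close>, and
  its characteristic polynomial \<open>x\<^sup>2 - x - 1\<close> does not vanish at 1.\<close>

lemma ex_admissible_2:
  assumes "alternating_on 2 \<omega>"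
  shows "\<exists>A B. admissible_pair 2 m \<omega> A B"
proof -
  define A where "A x = vec_of [x 0 + x 1, x 0]" for x :: "nat \<Rightarrow> int"
  have "bij_betw A (int_vecs 2) (int_vecs 2)"
  proof (rule bij_betw_inverse[of _ _ "\<lambda>x. vec_of [x 1, x 0 - x 1]"])
    fix x :: "nat \<Rightarrow> int" assume x: "x \<in> int_vecs 2"
    show "vec_of [A x 1, A x 0 - A x 1] = x" "A (vec_of [x 1, x 0 - x 1]) = x"
      by (subst (3) int_vecs_2[OF x]; simp add: A_def vec_of_nth)+
  qed (simp_all add: A_def)
  moreover have "additive_on (int_vecs 2) A"
    by (simp add: additive_on_def A_def vec_of_add vec_apply algebra_simps)
  moreover have "x = 0" if x: "x \<in> int_vecs 2" "A x = x" for x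
  proof -
    have "vec_of [x 0 + x 1, x 0] = vec_of [x 0, x 1]" using x(2) int_vecs_2[OF x(1)] by (simp add: A_def)
    then have "x 0 = 0" "x 1 = 0" by (simp_all add: vec_of_eq)
    then show ?thesis using x(1) by (intro int_vecs_eqI[of _ 2]) (auto simp: less_2_cases_iff vec_apply)
  qed
  moreover have "\<omega> (A x) (A y) = - \<omega> x y" if "x \<in> int_vecs 2" "y \<in> int_vecs 2" for x y
  proof -
    have "\<omega> (A x) (A y) = smul (A x 0 * A y 1 - A x 1 * A y 0) (\<omega> (unit_vec 0) (unit_vec 1))"
      using that by (intro alternating_2[OF assms]) (simp_all add: A_def)
    also have "A x 0 * A y 1 - A x 1 * A y 0 = - (x 0 * y 1 - x 1 * y 0)"
      by (simp add: A_def vec_of_nth algebra_simps)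
    also have "smul \<dots> (\<omega> (unit_vec 0) (unit_vec 1)) = - \<omega> x y"
      using alternating_2[OF assms that] by (simp only: smul_uminus)
    finally show ?thesis .
  qed
  ultimately show ?thesis using neg_admissible[of m] unfolding admissible_pair_def
    by (intro exI[of _ A] exI[of _ uminus]) simp
qed

text \<open>\<open>\<tau>\<close> is \<open>k\<close> times the rational inverse of
  \<open>\<zeta>\<close>, made integral by the finite index of the image.\<close>

lemma finite_index_sublattice:
  assumes \<zeta>: "additive_on (int_vecs m) \<zeta>" "\<And>t. t \<in> int_vecs m \<Longrightarrow> \<zeta> t \<in> int_vecs m"
    and inj: "\<And>t. t \<in> int_vecs m \<Longrightarrow> \<zeta> t = 0 \<Longrightarrow> t = 0"
  obtains k \<tau> where "k > 0" "additive_on (int_vecs m) \<tau>" "\<And>u. u \<in> int_vecs m \<Longrightarrow> \<tau> u \<in> int_vecs m"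
    "\<And>u. u \<in> int_vecs m \<Longrightarrow> \<zeta> (\<tau> u) = smul k u" "\<And>t. t \<in> int_vecs m \<Longrightarrow> \<tau> (\<zeta> t) = smul k t"
proof -
  from injective_additive_cofinite[OF assms]
  obtain k where k: "k > 0 \<and> (\<forall>y\<in>int_vecs m. \<exists>x\<in>int_vecs m. \<zeta> x = smul k y)" by (rule exE)
  define \<tau> where "\<tau> u = (SOME x. x \<in> int_vecs m \<and> \<zeta> x = smul k u)" for u
  have \<tau>: "\<tau> u \<in> int_vecs m \<and> \<zeta> (\<tau> u) = smul k u" if "u \<in> int_vecs m" for u
  proof -
    have "\<exists>x. x \<in> int_vecs m \<and> \<zeta> x = smul k u" using k that by auto
    then show ?thesis unfolding \<tau>_def by (rule someI_ex)
  qed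
  have uniq: "x = y" if "x \<in> int_vecs m" "y \<in> int_vecs m" "\<zeta> x = \<zeta> y" for x y
    using inj[of "x - y"] that additive_on_diff[OF \<zeta>(1) that(1,2)] by simp
  have "\<tau> (u + v) = \<tau> u + \<tau> v" if "u \<in> int_vecs m" "v \<in> int_vecs m" for u v
    by (rule uniq) (use that \<tau> in \<open>simp_all add: additive_on_add[OF \<zeta>(1)] smul_add_right\<close>)
  then have "additive_on (int_vecs m) \<tau>" by (simp add: additive_on_def)
  moreover have "\<tau> (\<zeta> t) = smul k t" if "t \<in> int_vecs m" for t
    by (rule uniq) (use that \<tau> \<zeta>(2) in \<open>simp_all add: additive_on_smul[OF \<zeta>(1)]\<close>)
  ultimately show ?thesis using that[of k \<tau>] k \<tau> by simp
qed

text \<open>The extension of \<open>1 + k D\<close> from the sublattice \<open>\<zeta>(\<int>\<^sup>m)\<close>, which contains \<open>k \<int>\<^sup>m\<close>.\<close>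
lemma extend_congruent_automorphism:
  assumes \<zeta>: "additive_on (int_vecs m) \<zeta>" "\<And>t. t \<in> int_vecs m \<Longrightarrow> \<zeta> t \<in> int_vecs m"
    and \<tau>: "additive_on (int_vecs m) \<tau>" "\<And>u. u \<in> int_vecs m \<Longrightarrow> \<tau> u \<in> int_vecs m"
    "\<And>t. t \<in> int_vecs m \<Longrightarrow> \<tau> (\<zeta> t) = smul k t"
    and D: "additive_on (int_vecs m) D" "\<And>t. t \<in> int_vecs m \<Longrightarrow> D t \<in> int_vecs m"
    and D': "additive_on (int_vecs m) D'" "\<And>t. t \<in> int_vecs m \<Longrightarrow> D' t \<in> int_vecs m"
    and inv: "\<And>t. t \<in> int_vecs m \<Longrightarrow> D t + D' t + smul k (D (D' t)) = 0"
      "\<And>t. t \<in> int_vecs m \<Longrightarrow> D t + D' t + smul k (D' (D t)) = 0"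
  shows "bij_betw (\<lambda>u. u + \<zeta> (D (\<tau> u))) (int_vecs m) (int_vecs m)"
    and "additive_on (int_vecs m) (\<lambda>u. u + \<zeta> (D (\<tau> u)))"
    and "t \<in> int_vecs m \<Longrightarrow> \<zeta> t + \<zeta> (D (\<tau> (\<zeta> t))) = \<zeta> (t + smul k (D t))"
proof -
  \<comment> \<open>The product of \<open>1 + k E'\<close> and \<open>1 + k E\<close> is
    \<open>1 + k (E + E' + k E' E)\<close>; the hypothesis \<open>EE\<close> says that the bracket
    vanishes.\<close>
  have comp: "u + \<zeta> (E (\<tau> u)) + \<zeta> (E' (\<tau> (u + \<zeta> (E (\<tau> u))))) = u"
    if u: "u \<in> int_vecs m" and E: "\<And>t. t \<in> int_vecs m \<Longrightarrow> E t \<in> int_vecs m"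
      and E': "additive_on (int_vecs m) E'" "\<And>t. t \<in> int_vecs m \<Longrightarrow> E' t \<in> int_vecs m"
      and EE: "\<And>t. t \<in> int_vecs m \<Longrightarrow> E t + E' t + smul k (E' (E t)) = 0" for u E E'
  proof -
    have 1: "\<zeta> (E' (\<tau> (u + \<zeta> (E (\<tau> u))))) = \<zeta> (E' (\<tau> u) + smul k (E' (E (\<tau> u))))"
      using u E E' \<zeta> \<tau> by (simp add: additive_on_add[OF \<tau>(1)] additive_on_add[OF E'(1)] additive_on_smul[OF E'(1)])
    have 2: "\<zeta> (E (\<tau> u)) + \<zeta> (E' (\<tau> u) + smul k (E' (E (\<tau> u)))) = \<zeta> (E (\<tau> u) + E' (\<tau> u) + smul k (E' (E (\<tau> u))))"
      using u E E' \<tau> by (simp add: additive_on_add[OF \<zeta>(1)] add.assoc)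
    have 3: "\<zeta> (E (\<tau> u) + E' (\<tau> u) + smul k (E' (E (\<tau> u)))) = 0"
      by (simp only: EE[OF \<tau>(2)[OF u]] additive_on_zero[OF \<zeta>(1)])
    show ?thesis by (simp only: add.assoc 1 2[unfolded 3] add_0_right)
  qed
  show "bij_betw (\<lambda>u. u + \<zeta> (D (\<tau> u))) (int_vecs m) (int_vecs m)"
  proof (rule bij_betw_inverse[of _ _ "\<lambda>u. u + \<zeta> (D' (\<tau> u))"])
    fix u assume u: "u \<in> int_vecs m"
    show "u + \<zeta> (D (\<tau> u)) + \<zeta> (D' (\<tau> (u + \<zeta> (D (\<tau> u))))) = u" using u D D' inv by (intro comp)
    show "u + \<zeta> (D' (\<tau> u)) + \<zeta> (D (\<tau> (u + \<zeta> (D' (\<tau> u))))) = u" using u D D' inv by (intro comp) (simp_all add: add.commute)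
  qed (use \<zeta>(2) \<tau>(2) D(2) D'(2) in auto)
  show "additive_on (int_vecs m) (\<lambda>u. u + \<zeta> (D (\<tau> u)))"
    using \<zeta> \<tau> D by (simp add: additive_on_def ac_simps)
  show "\<zeta> t + \<zeta> (D (\<tau> (\<zeta> t))) = \<zeta> (t + smul k (D t))" if "t \<in> int_vecs m"
    using that \<zeta> \<tau> D by (simp add: additive_on_smul[OF D(1)] additive_on_add[OF \<zeta>(1)])
qed

section \<open>Admissible pairs for small forms\<close>

lemma vec_eqI_2: "x \<in> int_vecs 2 \<Longrightarrow> y \<in> int_vecs 2 \<Longrightarrow> x 0 = y 0 \<Longrightarrow> x 1 = y 1 \<Longrightarrow> x = y"
  by (subst int_vecs_2[of x], assumption, subst int_vecs_2[of y], assumption) simp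

lemma vec_eqI_3: "x \<in> int_vecs 3 \<Longrightarrow> y \<in> int_vecs 3 \<Longrightarrow> x 0 = y 0 \<Longrightarrow> x 1 = y 1 \<Longrightarrow> x 2 = y 2 \<Longrightarrow> x = y"
  by (subst int_vecs_3[of x], assumption, subst int_vecs_3[of y], assumption) simp

lemma vec_eqI_4: "x \<in> int_vecs 4 \<Longrightarrow> y \<in> int_vecs 4 \<Longrightarrow> x 0 = y 0 \<Longrightarrow> x 1 = y 1 \<Longrightarrow> x 2 = y 2 \<Longrightarrow> x 3 = y 3 \<Longrightarrow> x = y"
  by (subst int_vecs_4[of x], assumption, subst int_vecs_4[of y], assumption) simp

lemma lin_comb_small:
  "lin_comb 2 b x = smul (x 0) (b 0) + smul (x 1) (b 1)"
  "lin_comb 3 b x = smul (x 0) (b 0) + smul (x 1) (b 1) + smul (x 2) (b 2)"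
  "lin_comb 4 b x = smul (x 0) (b 0) + smul (x 1) (b 1) + smul (x 2) (b 2) + smul (x 3) (b 3)"
  by (simp_all add: lin_comb_def lessThan_small smul_def fun_eq_iff vec_apply add.assoc)

definition cross :: "(nat \<Rightarrow> int) \<Rightarrow> (nat \<Rightarrow> int) \<Rightarrow> nat \<Rightarrow> int" where
  "cross x y = vec_of [x 1 * y 2 - x 2 * y 1, x 2 * y 0 - x 0 * y 2, x 0 * y 1 - x 1 * y 0]"

text \<open>Indexed by the basis vector that is left out, with the signs that turn
  \<open>\<omega>\<close> into a linear function of the cross product.\<close>

definition edge :: "((nat \<Rightarrow> int) \<Rightarrow> (nat \<Rightarrow> int) \<Rightarrow> nat \<Rightarrow> int) \<Rightarrow> nat \<Rightarrow> nat \<Rightarrow> int" where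
  "edge \<omega> i = (if i = 0 then \<omega> (unit_vec 1) (unit_vec 2) else if i = 1 then - \<omega> (unit_vec 0) (unit_vec 2)
     else \<omega> (unit_vec 0) (unit_vec 1))"

lemma alternating_3_cross:
  assumes "alternating_on 3 \<omega>" "x \<in> int_vecs 3" "y \<in> int_vecs 3"
  shows "\<omega> x y = lin_comb 3 (edge \<omega>) (cross x y)"
  unfolding alternating_3[OF assms]
  by (simp add: lin_comb_small edge_def cross_def vec_of_nth fun_eq_iff smul_def vec_apply algebra_simps)

text \<open>\<open>A\<close> has determinant 1 and is 1 modulo \<open>k\<close>. On cross products
  it induces its cofactor matrix, which is therefore of the form \<open>1 + k D\<close> and extends
  from the image of \<open>\<omega>\<close> to \<open>\<int>\<^sup>3\<close>. Both
  \<open>A - 1\<close> and \<open>D\<close> are injective, so neither \<open>A\<close> nor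
  \<open>B\<close> fixes a nonzero vector.\<close>

lemma ex_admissible_3_independent:
  assumes alt: "alternating_on 3 \<omega>"
    and cl: "\<And>x y. x \<in> int_vecs 3 \<Longrightarrow> y \<in> int_vecs 3 \<Longrightarrow> \<omega> x y \<in> int_vecs 3"
    and indep: "\<And>t. t \<in> int_vecs 3 \<Longrightarrow> lin_comb 3 (edge \<omega>) t = 0 \<Longrightarrow> t = 0"
  shows "\<exists>A B. admissible_pair 3 3 \<omega> A B"
proof -
  let ?\<zeta> = "lin_comb 3 (edge \<omega>)"
  have \<zeta>: "additive_on (int_vecs 3) ?\<zeta>" by (rule additive_lin_comb)
  have \<zeta>in: "?\<zeta> t \<in> int_vecs 3" for t
    using cl by (intro lin_comb_in) (simp add: edge_def)
  obtain k \<tau> where k: "k > 0" and \<tau>: "additive_on (int_vecs 3) \<tau>" "\<And>u. u \<in> int_vecs 3 \<Longrightarrow> \<tau> u \<in> int_vecs 3"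
    "\<And>u. u \<in> int_vecs 3 \<Longrightarrow> ?\<zeta> (\<tau> u) = smul k u" "\<And>t. t \<in> int_vecs 3 \<Longrightarrow> \<tau> (?\<zeta> t) = smul k t"
    using finite_index_sublattice[OF \<zeta> \<zeta>in indep] by metis
  define A A' where "A x = vec_of [(1 + k * k * k) * x 0 + k * x 1 + k * k * x 2, k * k * x 0 + x 1 + k * x 2, k * x 0 + x 2]"
    and "A' x = vec_of [x 0 - k * x 1, x 1 - k * x 2, - k * x 0 + k * k * x 1 + x 2]" for x :: "nat \<Rightarrow> int"
  \<comment> \<open>\<open>1 + k D\<close> is the transpose of \<open>A'\<close>, hence the cofactor
    matrix of \<open>A\<close>, and \<open>1 + k D'\<close> is the transpose of
    \<open>A\<close>.\<close>
  define D D' where "D x = vec_of [- x 2, - x 0 + k * x 2, - x 1]"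
    and "D' x = vec_of [k * k * x 0 + k * x 1 + x 2, x 0, k * x 0 + x 1]" for x :: "nat \<Rightarrow> int"
  have Din: "D t \<in> int_vecs 3" "D' t \<in> int_vecs 3" for t by (simp_all add: D_def D'_def)
  have Dadd: "additive_on (int_vecs 3) D" "additive_on (int_vecs 3) D'"
    by (simp_all add: additive_on_def D_def D'_def vec_of_add vec_apply algebra_simps)
  have DD: "D t + D' t + smul k (D (D' t)) = 0" "D t + D' t + smul k (D' (D t)) = 0" if "t \<in> int_vecs 3" for t
  proof -
    show "D t + D' t + smul k (D (D' t)) = 0"
      by (rule vec_eqI_3, simp add: Din, simp) (simp_all add: D_def D'_def vec_of_nth vec_apply smul_def algebra_simps)
    show "D t + D' t + smul k (D' (D t)) = 0"
      by (rule vec_eqI_3, simp add: Din, simp) (simp_all add: D_def D'_def vec_of_nth vec_apply smul_def algebra_simps)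
  qed
  note ext = extend_congruent_automorphism[OF \<zeta> \<zeta>in \<tau>(1,2,4) Dadd(1) Din(1) Dadd(2) Din(2) DD]
  define B where "B u = u + ?\<zeta> (D (\<tau> u))" for u
  have "bij_betw A (int_vecs 3) (int_vecs 3)"
  proof (rule bij_betw_inverse[of _ _ A'])
    fix x :: "nat \<Rightarrow> int" assume x: "x \<in> int_vecs 3"
    show "A' (A x) = x" "A (A' x) = x"
      by (rule vec_eqI_3; use x in \<open>simp add: A_def A'_def vec_of_nth algebra_simps\<close>)+
  qed (simp_all add: A_def A'_def)
  moreover have "additive_on (int_vecs 3) A"
    by (simp add: additive_on_def A_def vec_of_add vec_apply algebra_simps)
  moreover have "x = 0" if x: "x \<in> int_vecs 3" "A x = x" for x
  proof -
    have "A x 2 = x 2" "A x 1 = x 1" "A x 0 = x 0" using x by simp_all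
    then have e: "k * x 0 = 0" "k * k * x 0 + k * x 2 = 0" "k * k * k * x 0 + k * x 1 + k * k * x 2 = 0"
      by (simp_all add: A_def vec_of_nth algebra_simps)
    then have "x 0 = 0" using k by simp
    moreover then have "x 2 = 0" using e(2) k by simp
    ultimately have "x 1 = 0" using e(3) k by simp
    with \<open>x 0 = 0\<close> \<open>x 2 = 0\<close> x(1) show ?thesis by (intro vec_eqI_3) (simp_all add: vec_apply)
  qed
  moreover have "bij_betw B (int_vecs 3) (int_vecs 3)" "additive_on (int_vecs 3) B"
    using ext(1,2) by (simp_all add: B_def[abs_def])
  moreover have "u = 0" if u: "u \<in> int_vecs 3" "B u = u" for u
  proof -
    have "?\<zeta> (D (\<tau> u)) = 0" using u(2) by (simp add: B_def)
    then have d: "D (\<tau> u) = 0" using indep[OF Din(1)] by simp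
    have "D (\<tau> u) 0 = 0" "D (\<tau> u) 1 = 0" "D (\<tau> u) 2 = 0" unfolding d by (simp_all add: vec_apply)
    then have "\<tau> u 2 = 0" "\<tau> u 0 = 0" "\<tau> u 1 = 0" by (simp_all add: D_def vec_of_nth)
    then have "\<tau> u = 0" using \<tau>(2)[OF u(1)] by (intro vec_eqI_3) (simp_all add: vec_apply)
    then have "smul k u = 0" using \<tau>(3)[OF u(1)] by simp
    then show ?thesis using k by (simp add: smul_eq_0_iff)
  qed
  moreover have "\<omega> (A x) (A y) = B (\<omega> x y)" if xy: "x \<in> int_vecs 3" "y \<in> int_vecs 3" for x y
  proof -
    have c: "cross x y \<in> int_vecs 3" by (simp add: cross_def)
    have "B (\<omega> x y) = ?\<zeta> (cross x y + smul k (D (cross x y)))"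
      unfolding B_def alternating_3_cross[OF alt xy] using ext(3)[of "cross x y"] c by simp
    also have "cross x y + smul k (D (cross x y)) = cross (A x) (A y)"
      by (rule vec_eqI_3, use c Din in simp, simp add: cross_def)
        (simp_all add: cross_def D_def A_def vec_of_nth vec_apply smul_def algebra_simps)
    also have "?\<zeta> \<dots> = \<omega> (A x) (A y)"
      by (rule alternating_3_cross[OF alt, symmetric]) (simp_all add: A_def)
    finally show ?thesis by simp
  qed
  ultimately show ?thesis unfolding admissible_pair_def by (intro exI[of _ A] exI[of _ B]) simp
qed

lemma ex_completion:
  assumes m: "m \<le> 3" and z: "z \<in> int_vecs m" "w \<in> int_vecs m"
    and indep: "\<And>s t. smul s z + smul t w = 0 \<Longrightarrow> s = 0 \<and> t = 0"
  shows "\<exists>b. (\<forall>i<m. b i \<in> int_vecs m) \<and> b 0 = z \<and> b 1 = w \<and> 2 \<le> m \<and>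
    (\<forall>t\<in>int_vecs m. lin_comb m b t = 0 \<longrightarrow> t = 0)"
proof -
  obtain p q where pq: "z p * w q - z q * w p \<noteq> 0"
  proof (rule ccontr)
    assume "\<not> thesis"
    then have eq: "z p * w q - z q * w p = 0" for p q using that by blast
    have "z = 0"
    proof
      fix p
      have "smul (w p) z + smul (- z p) w = 0"
        using eq[of p] by (auto simp: smul_def fun_eq_iff vec_apply algebra_simps)
      from indep[OF this] show "z p = 0 p" by (simp add: vec_apply)
    qed
    then show False using indep[of 1 0] by simp
  qed
  have lt: "p < m" "q < m" "p \<noteq> q"
    using pq z by (auto simp: int_vecs_def intro: leI)
  \<comment> \<open>The index in \<open>{0, 1, 2}\<close> besides \<open>p\<close> and
    \<open>q\<close>. As the minor in the rows \<open>p\<close> and \<open>q\<close> is nonzero,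
    \<open>unit_vec l\<close> is independent of \<open>z\<close> and \<open>w\<close>.\<close>
  define l where "l = 3 - p - q"
  define b where "b i = (if i = 0 then z else if i = 1 then w else unit_vec l)" for i :: nat
  have "(p = 0 \<or> p = 1 \<or> p = 2) \<and> (q = 0 \<or> q = 1 \<or> q = 2)" using lt m by auto
  then have l: "l \<noteq> p" "l \<noteq> q" "m = 3 \<Longrightarrow> l < m" using lt(3) by (auto simp: l_def)
  have m2: "m = 2 \<or> m = 3" using lt m by auto
  have "t = 0" if t: "t \<in> int_vecs m" "lin_comb m b t = 0" for t
  proof -
    define c where "c = (if m = 3 then t 2 else 0)"
    have eq: "t 0 * z i + t 1 * w i + c * unit_vec l i = 0" for i
    proof -
      have "lin_comb m b t i = t 0 * z i + t 1 * w i + c * unit_vec l i"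
        using m2 by (auto simp: lin_comb_small b_def c_def smul_def vec_apply)
      then show ?thesis using t(2) by (simp add: vec_apply)
    qed
    have e: "t 0 * z p + t 1 * w p = 0" "t 0 * z q + t 1 * w q = 0"
      using eq[of p] eq[of q] l by (simp_all add: unit_vec_def)
    have "t 0 * (z p * w q - z q * w p) = (t 0 * z p + t 1 * w p) * w q - (t 0 * z q + t 1 * w q) * w p"
      by (simp add: algebra_simps)
    then have t0: "t 0 = 0" using e pq by simp
    have "t 1 * (z p * w q - z q * w p) = z p * (t 0 * z q + t 1 * w q) - z q * (t 0 * z p + t 1 * w p)"
      by (simp add: algebra_simps)
    then have t1: "t 1 = 0" using e pq by simp
    have "c = 0" using eq[of l] t0 t1 by (simp add: unit_vec_def)
    with m2 show ?thesis
    proof (elim disjE)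
      assume "m = 2" then show ?thesis using t(1) t0 t1 by (intro vec_eqI_2) (simp_all add: vec_apply)
    next
      assume "m = 3" then show ?thesis using t(1) t0 t1 \<open>c = 0\<close> by (intro vec_eqI_3) (simp_all add: c_def vec_apply)
    qed
  qed
  moreover have "b i \<in> int_vecs m" if "i < m" for i
    using that z l m2 by (auto simp: b_def)
  ultimately show ?thesis using m2 by (intro exI[of _ b]) (auto simp: b_def)
qed

text \<open>On the isotropic plane of the first two basis vectors \<open>A\<close> is
  \<open>1 + k D\<close>, with determinant 1 and trace \<open>2 + k * k\<close>, and on the third it
  is -1. It thus induces \<open>- (1 + k D)\<close> on the span of \<open>z\<close> and
  \<open>w\<close>, and \<open>B\<close> is -1 on the remaining direction if \<open>m = 3\<close>.
  There are no fixed vectors because \<open>1 + k D\<close> has neither eigenvalue 1 nor -1.\<close>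

lemma ex_admissible_3_dependent:
  assumes alt: "alternating_on 3 \<omega>" and nd: "nondegenerate_on 3 \<omega>" and m: "m \<le> 3"
    and cl: "\<And>x y. x \<in> int_vecs 3 \<Longrightarrow> y \<in> int_vecs 3 \<Longrightarrow> \<omega> x y \<in> int_vecs m"
    and dep: "\<omega> (unit_vec 0) (unit_vec 1) = 0"
  shows "\<exists>A B. admissible_pair 3 m \<omega> A B"
proof -
  define z w where "z = \<omega> (unit_vec 0) (unit_vec 2)" and "w = \<omega> (unit_vec 1) (unit_vec 2)"
  have zw: "z \<in> int_vecs m" "w \<in> int_vecs m" using cl by (simp_all add: z_def w_def)
  have om: "\<omega> x y = smul (x 0 * y 2 - x 2 * y 0) z + smul (x 1 * y 2 - x 2 * y 1) w"
    if "x \<in> int_vecs 3" "y \<in> int_vecs 3" for x y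
    unfolding alternating_3[OF alt that] dep by (simp add: z_def w_def)
  have indep: "s = 0 \<and> t = 0" if st: "smul s z + smul t w = 0" for s t
  proof -
    have "\<omega> (vec_of [s, t, 0]) y = 0" if y: "y \<in> int_vecs 3" for y
    proof -
      have "\<omega> (vec_of [s, t, 0]) y = smul (y 2) (smul s z + smul t w)"
        using y by (subst om) (simp_all add: vec_of_nth smul_add_right smul_smul mult.commute)
      then show ?thesis using st by simp
    qed
    then have "vec_of [s, t, 0] = 0" using nd by (simp add: nondegenerate_on_def)
    then have "vec_of [s, t, 0] 0 = 0" "vec_of [s, t, 0] 1 = 0" by (simp_all add: vec_apply)
    then show ?thesis by (simp add: vec_of_nth)
  qed
  have "\<exists>b. (\<forall>i<m. b i \<in> int_vecs m) \<and> b 0 = z \<and> b 1 = w \<and> 2 \<le> m \<and>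
    (\<forall>t\<in>int_vecs m. lin_comb m b t = 0 \<longrightarrow> t = 0)"
    by (rule ex_completion[OF m zw], rule indep)
  then obtain b where b: "(\<forall>i<m. b i \<in> int_vecs m) \<and> b 0 = z \<and> b 1 = w \<and> 2 \<le> m \<and>
    (\<forall>t\<in>int_vecs m. lin_comb m b t = 0 \<longrightarrow> t = 0)" by (elim exE)
  have m2: "m = 2 \<or> m = 3" using b m by auto
  let ?\<zeta> = "lin_comb m b"
  have \<zeta>: "additive_on (int_vecs m) ?\<zeta>" by (rule additive_lin_comb)
  have \<zeta>in: "?\<zeta> t \<in> int_vecs m" for t using b by (intro lin_comb_in) simp
  have \<zeta>2: "?\<zeta> (vec_of [s, t]) = smul s z + smul t w" for s t
    using m2 b by (elim disjE) (simp_all add: lin_comb_small vec_of_nth, simp add: vec_of_def)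
  have inj: "t = 0" if "t \<in> int_vecs m" "?\<zeta> t = 0" for t using b that by simp
  obtain k \<tau> where k: "k > 0" and \<tau>: "additive_on (int_vecs m) \<tau>" "\<And>u. u \<in> int_vecs m \<Longrightarrow> \<tau> u \<in> int_vecs m"
    "\<And>u. u \<in> int_vecs m \<Longrightarrow> ?\<zeta> (\<tau> u) = smul k u" "\<And>t. t \<in> int_vecs m \<Longrightarrow> \<tau> (?\<zeta> t) = smul k t"
    using finite_index_sublattice[OF \<zeta> \<zeta>in inj] by metis
  define A A' where "A x = vec_of [(1 + k * k) * x 0 + k * x 1, k * x 0 + x 1, - x 2]"
    and "A' x = vec_of [x 0 - k * x 1, (1 + k * k) * x 1 - k * x 0, - x 2]" for x :: "nat \<Rightarrow> int"
  define D D' where "D x = vec_of [k * x 0 + x 1, x 0]" and "D' x = vec_of [- x 1, - x 0 + k * x 1]" for x :: "nat \<Rightarrow> int"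
  have Din: "D t \<in> int_vecs m" "D' t \<in> int_vecs m" for t using b by (simp_all add: D_def D'_def)
  have Dadd: "additive_on (int_vecs m) D" "additive_on (int_vecs m) D'"
    by (simp_all add: additive_on_def D_def D'_def vec_of_add vec_apply algebra_simps)
  have DD: "D t + D' t + smul k (D (D' t)) = 0" "D t + D' t + smul k (D' (D t)) = 0" for t
  proof -
    have in2: "D t \<in> int_vecs 2" "D' t \<in> int_vecs 2" for t by (simp_all add: D_def D'_def)
    show "D t + D' t + smul k (D (D' t)) = 0"
      by (rule vec_eqI_2, simp add: in2, simp) (simp_all add: D_def D'_def vec_of_nth vec_apply smul_def algebra_simps)
    show "D t + D' t + smul k (D' (D t)) = 0"
      by (rule vec_eqI_2, simp add: in2, simp) (simp_all add: D_def D'_def vec_of_nth vec_apply smul_def algebra_simps)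
  qed
  note ext = extend_congruent_automorphism[OF \<zeta> \<zeta>in \<tau>(1,2,4) Dadd(1) Din(1) Dadd(2) Din(2) DD]
  define B where "B u = - (u + ?\<zeta> (D (\<tau> u)))" for u
  have "bij_betw A (int_vecs 3) (int_vecs 3)"
  proof (rule bij_betw_inverse[of _ _ A'])
    fix x :: "nat \<Rightarrow> int" assume x: "x \<in> int_vecs 3"
    show "A' (A x) = x" "A (A' x) = x"
      by (rule vec_eqI_3; use x in \<open>simp add: A_def A'_def vec_of_nth algebra_simps\<close>)+
  qed (simp_all add: A_def A'_def)
  moreover have "additive_on (int_vecs 3) A"
    by (simp add: additive_on_def A_def vec_of_add vec_apply algebra_simps)
  moreover have "x = 0" if x: "x \<in> int_vecs 3" "A x = x" for x
  proof -
    have "A x 2 = x 2" "A x 1 = x 1" "A x 0 = x 0" using x by simp_all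
    then have e: "x 2 = 0" "k * x 0 = 0" "k * k * x 0 + k * x 1 = 0"
      by (simp_all add: A_def vec_of_nth algebra_simps)
    then have "x 0 = 0" using k by simp
    moreover then have "x 1 = 0" using e(3) k by simp
    ultimately show ?thesis using e(1) x(1) by (intro vec_eqI_3) (simp_all add: vec_apply)
  qed
  moreover have "bij_betw B (int_vecs m) (int_vecs m)"
    using bij_betw_trans[OF ext(1) neg_admissible(1)] by (simp add: B_def[abs_def] comp_def)
  moreover have "additive_on (int_vecs m) B"
    using ext(2) by (simp add: additive_on_def B_def)
  moreover have "u = 0" if u: "u \<in> int_vecs m" "B u = u" for u
  proof -
    let ?t = "\<tau> u"
    have t: "?t \<in> int_vecs m" using \<tau> u by simp
    have "u + u + ?\<zeta> (D ?t) = 0"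
      using u(2) unfolding B_def by (metis add.assoc add.commute add.right_inverse)
    moreover have "smul 2 u = u + u" using smul_add[of 1 1 u] by simp
    ultimately have "smul k (smul 2 u + ?\<zeta> (D ?t)) = 0" by simp
    moreover have "smul k (smul 2 u + ?\<zeta> (D ?t)) = ?\<zeta> (smul 2 ?t + smul k (D ?t))"
    proof -
      have "smul k (smul 2 u) = smul 2 (?\<zeta> ?t)" by (simp add: \<tau>(3)[OF u(1)] smul_smul mult.commute)
      then show ?thesis
        using t Din by (simp add: smul_add_right additive_on_add[OF \<zeta>] additive_on_smul[OF \<zeta>])
    qed
    ultimately have "?\<zeta> (smul 2 ?t + smul k (D ?t)) = 0" by simp
    moreover have "smul 2 ?t + smul k (D ?t) \<in> int_vecs m" using t Din by simp
    ultimately have "smul 2 ?t + smul k (D ?t) = 0" by (rule inj[rotated])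
    from fun_cong[OF this] have e: "2 * ?t i + k * D ?t i = 0" for i by (simp add: vec_apply smul_def)
    have e0: "(2 + k * k) * ?t 0 + k * ?t 1 = 0" "k * ?t 0 + 2 * ?t 1 = 0"
      using e[of 0] e[of 1] by (simp_all add: D_def vec_of_nth algebra_simps)
    \<comment> \<open>Elimination; \<open>4 + k * k\<close> is the determinant of
      \<open>2 + k D\<close>.\<close>
    have "(4 + k * k) * ?t 0 = 2 * ((2 + k * k) * ?t 0 + k * ?t 1) - k * (k * ?t 0 + 2 * ?t 1)"
      by (simp add: algebra_simps)
    then have "(4 + k * k) * ?t 0 = 0" unfolding e0 by simp
    moreover have "4 + k * k > 0" using zero_le_square[of k] by linarith
    ultimately have t0: "?t 0 = 0" by simp
    then have t1: "?t 1 = 0" using e0(2) by simp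
    have t2: "?t 2 = 0" using e[of 2] by (simp add: D_def vec_of_def)
    from m2 have "?t = 0"
    proof (elim disjE)
      assume "m = 2" then show ?thesis using t t0 t1 by (intro vec_eqI_2) (simp_all add: vec_apply)
    next
      assume "m = 3" then show ?thesis using t t0 t1 t2 by (intro vec_eqI_3) (simp_all add: vec_apply)
    qed
    then have "smul k u = 0" using \<tau>(3)[OF u(1)] additive_on_zero[OF \<zeta>] by simp
    then show ?thesis using k by (simp add: smul_eq_0_iff)
  qed
  moreover have "\<omega> (A x) (A y) = B (\<omega> x y)" if xy: "x \<in> int_vecs 3" "y \<in> int_vecs 3" for x y
  proof -
    define c where "c = vec_of [x 0 * y 2 - x 2 * y 0, x 1 * y 2 - x 2 * y 1]"
    have c: "c \<in> int_vecs m" using b by (simp add: c_def)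
    have c': "\<omega> x y = ?\<zeta> c" unfolding om[OF xy] by (simp add: c_def \<zeta>2)
    have "B (\<omega> x y) = - ?\<zeta> (c + smul k (D c))" unfolding B_def c' using ext(3)[of c] c by simp
    also have "c + smul k (D c) = vec_of [- (A x 0 * A y 2 - A x 2 * A y 0), - (A x 1 * A y 2 - A x 2 * A y 1)]"
      by (rule vec_eqI_2, simp add: c_def D_def, simp) (simp_all add: c_def D_def A_def vec_of_nth vec_apply smul_def algebra_simps)
    also have "- ?\<zeta> \<dots> = \<omega> (A x) (A y)"
      unfolding \<zeta>2 by (subst om) (simp_all add: A_def smul_uminus smul_diff)
    finally show ?thesis by simp
  qed
  ultimately show ?thesis unfolding admissible_pair_def by (intro exI[of _ A] exI[of _ B]) simp
qed

section \<open>Changes of basis\<close>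

definition frame :: "nat \<Rightarrow> (nat \<Rightarrow> nat \<Rightarrow> int) \<Rightarrow> bool" where
  "frame n b \<longleftrightarrow> (\<forall>i<n. b i \<in> int_vecs n) \<and> bij_betw (lin_comb n b) (int_vecs n) (int_vecs n)"

lemma frame_unit_vec: "frame n unit_vec"
proof -
  have "bij_betw (lin_comb n unit_vec) (int_vecs n) (int_vecs n)"
    by (rule bij_betw_inverse[of _ _ "lin_comb n unit_vec"]) (simp_all add: lin_comb_unit_vec)
  then show ?thesis by (simp add: frame_def)
qed

lemma lin_comb_of_unit_vec:
  assumes "i < n"
  shows "lin_comb n b (unit_vec i) = b i"
proof
  fix k
  have "(\<Sum>j<n. unit_vec i j * b j k) = (\<Sum>j<n. if j = i then b i k else 0)"
    by (rule sum.cong) (auto simp: unit_vec_def)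
  then show "lin_comb n b (unit_vec i) k = b i k" using assms by (simp add: lin_comb_def)
qed

text \<open>Coordinates transform by \<open>E\<close>, the transpose of the matrix acting on the
  basis vectors. Its inverse is \<open>\<delta>\<close> times the adjugate, as
  \<open>\<delta>\<close> is a sign.\<close>

lemma frame_mix:
  assumes b: "frame n b" and ij: "i < n" "j < n" "i \<noteq> j" and \<delta>: "p * s - q * r = \<delta>" "\<delta> * \<delta> = 1"
  shows "frame n (b(i := smul p (b i) + smul q (b j), j := smul r (b i) + smul s (b j)))"
proof -
  let ?b = "b(i := smul p (b i) + smul q (b j), j := smul r (b i) + smul s (b j))"
  define E where "E x = x(i := p * x i + r * x j, j := q * x i + s * x j)" for x :: "nat \<Rightarrow> int"
  define E' where "E' x = x(i := \<delta> * (s * x i - r * x j), j := \<delta> * (p * x j - q * x i))" for x :: "nat \<Rightarrow> int"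
  have Ein: "E x \<in> int_vecs n" "E' x \<in> int_vecs n" if "x \<in> int_vecs n" for x
    using that ij by (auto simp: int_vecs_def E_def E'_def)
  have c: "\<delta> * (p * s) - \<delta> * (q * r) = 1" using \<delta> by (simp add: right_diff_distrib[symmetric])
  have c': "c * (\<delta> * (p * s)) - c * (\<delta> * (q * r)) = c" for c
    using c by (simp add: right_diff_distrib[symmetric])
  have E1: "E' (E x) = x" for x
  proof
    fix k
    have "\<delta> * (s * (p * x i + r * x j) - r * (q * x i + s * x j)) = x i * (\<delta> * (p * s)) - x i * (\<delta> * (q * r))"
      "\<delta> * (p * (q * x i + s * x j) - q * (p * x i + r * x j)) = x j * (\<delta> * (p * s)) - x j * (\<delta> * (q * r))"
      by (simp_all add: algebra_simps)
    then show "E' (E x) k = x k" using ij(3) c' by (simp add: E_def E'_def)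
  qed
  have E2: "E (E' x) = x" for x
  proof
    fix k
    have "p * (\<delta> * (s * x i - r * x j)) + r * (\<delta> * (p * x j - q * x i)) = x i * (\<delta> * (p * s)) - x i * (\<delta> * (q * r))"
      "q * (\<delta> * (s * x i - r * x j)) + s * (\<delta> * (p * x j - q * x i)) = x j * (\<delta> * (p * s)) - x j * (\<delta> * (q * r))"
      by (simp_all add: algebra_simps)
    then show "E (E' x) k = x k" using ij(3) c' by (simp add: E_def E'_def)
  qed
  have Eb: "bij_betw E (int_vecs n) (int_vecs n)"
    by (rule bij_betw_inverse[of _ _ E']) (simp_all add: Ein E1 E2)
  have "lin_comb n ?b x = lin_comb n b (E x)" for x
  proof
    fix k
    let ?S = "{..<n} - {i} - {j}"
    have split: "(\<Sum>l<n. g l) = g i + (g j + (\<Sum>l\<in>?S. g l))" for g :: "nat \<Rightarrow> int"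
      using ij by (simp add: sum.remove[of "{..<n}" i] sum.remove[of "{..<n} - {i}" j])
    have "(\<Sum>l\<in>?S. x l * ?b l k) = (\<Sum>l\<in>?S. E x l * b l k)"
      by (rule sum.cong) (auto simp: E_def)
    then show "lin_comb n ?b x k = lin_comb n b (E x) k"
      unfolding lin_comb_def split using ij(3) by (simp add: E_def smul_def vec_apply algebra_simps)
  qed
  then have "lin_comb n ?b = lin_comb n b \<circ> E" by auto
  moreover have "bij_betw (lin_comb n b) (int_vecs n) (int_vecs n)" using b by (simp add: frame_def)
  ultimately have "bij_betw (lin_comb n ?b) (int_vecs n) (int_vecs n)"
    using bij_betw_trans[OF Eb] by simp
  moreover have "\<forall>l<n. ?b l \<in> int_vecs n" using b ij by (simp add: frame_def)
  ultimately show ?thesis by (simp add: frame_def)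
qed

text \<open>With \<open>g\<close> the gcd, \<open>(c / g, - a / g)\<close> is orthogonal to
  \<open>(a, c)\<close> and primitive, so Bezout completes it to determinant 1.\<close>

lemma unimodular_annihilator:
  fixes a c :: int
  shows "\<exists>p q r s. p * s - q * r = 1 \<and> p * a + q * c = 0"
proof (cases "a = 0 \<and> c = 0")
  case True
  then show ?thesis by (intro exI[of _ 1] exI[of _ 0]) simp
next
  case False
  define g where "g = gcd a c"
  have g: "g \<noteq> 0" using False by (simp add: g_def)
  obtain a' c' where ac: "a = g * a'" "c = g * c'" unfolding g_def by (metis dvd_def gcd_dvd1 gcd_dvd2)
  obtain r s where "r * a + s * c = g" unfolding g_def using bezout_int by metis
  then have "g * (r * a' + s * c') = g * 1" by (simp add: ac algebra_simps)
  then have "r * a' + s * c' = 1" using g by (simp only: mult_cancel_left) simp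
  then have "c' * s - (- a') * r = 1" by (simp add: algebra_simps)
  moreover have "c' * a + (- a') * c = 0" by (simp add: ac)
  ultimately show ?thesis by (intro exI[of _ c'] exI[of _ "- a'"] exI[of _ r] exI[of _ s]) simp
qed

text \<open>The last clause records that the new pair lies in the span of the old one, so that
  linear conditions achieved before on both \<open>b i\<close> and \<open>b j\<close>
  survive.\<close>

lemma frame_annihilate:
  fixes f :: "(nat \<Rightarrow> int) \<Rightarrow> int"
  assumes b: "frame n b" and f: "additive_on (int_vecs n) f" and ij: "i < n" "j < n" "i \<noteq> j"
  shows "\<exists>b'. frame n b' \<and> (\<forall>k. k \<noteq> i \<longrightarrow> k \<noteq> j \<longrightarrow> b' k = b k) \<and> f (b' i) = 0 \<and>
    (\<exists>p q r s. b' i = smul p (b i) + smul q (b j) \<and> b' j = smul r (b i) + smul s (b j))"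
proof -
  obtain p q r s where u: "p * s - q * r = 1" "p * f (b i) + q * f (b j) = 0" using unimodular_annihilator by metis
  let ?b = "b(i := smul p (b i) + smul q (b j), j := smul r (b i) + smul s (b j))"
  have "b i \<in> int_vecs n" "b j \<in> int_vecs n" using b ij by (simp_all add: frame_def)
  then have "f (smul p (b i) + smul q (b j)) = 0"
    using u(2) by (simp add: additive_on_add[OF f] additive_on_smul_int[OF f])
  moreover have "frame n ?b" using u(1) by (intro frame_mix[OF b ij, of p s q r 1]) simp_all
  ultimately show ?thesis using ij(3) by (intro exI[of _ ?b]) auto
qed

context
  fixes n :: nat and b :: "nat \<Rightarrow> nat \<Rightarrow> int"
  assumes fr: "frame n b"
begin

lemma frame_in: "lin_comb n b x \<in> int_vecs n"
  using fr by (intro lin_comb_in) (simp add: frame_def)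

lemma frame_alternating:
  assumes "alternating_on n \<omega>"
  shows "alternating_on n (\<lambda>x y. \<omega> (lin_comb n b x) (lin_comb n b y))"
proof -
  have "biadditive_on (int_vecs n) \<omega>" using assms by (simp add: alternating_on_def)
  then show ?thesis using assms frame_in
    by (simp add: alternating_on_def biadditive_on_def additive_on_def lin_comb_add)
qed

lemma frame_nondegenerate:
  assumes "nondegenerate_on n \<omega>"
  shows "nondegenerate_on n (\<lambda>x y. \<omega> (lin_comb n b x) (lin_comb n b y))"
  unfolding nondegenerate_on_def
proof (intro ballI impI)
  fix x assume x: "x \<in> int_vecs n" "\<forall>y\<in>int_vecs n. \<omega> (lin_comb n b x) (lin_comb n b y) = 0"
  have bij: "bij_betw (lin_comb n b) (int_vecs n) (int_vecs n)" using fr by (simp add: frame_def)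
  have "\<omega> (lin_comb n b x) z = 0" if z: "z \<in> int_vecs n" for z
  proof -
    have "z \<in> lin_comb n b ` int_vecs n" using z bij_betw_imp_surj_on[OF bij] by simp
    then show ?thesis using x(2) by auto
  qed
  then have "lin_comb n b x = lin_comb n b 0" using assms frame_in by (simp add: nondegenerate_on_def)
  then show "x = 0" using bij_betw_imp_inj_on[OF bij] x(1) by (simp add: inj_on_def)
qed

lemma frame_admissible:
  assumes "admissible_pair n m (\<lambda>x y. \<omega> (lin_comb n b x) (lin_comb n b y)) A B"
  shows "\<exists>A'. admissible_pair n m \<omega> A' B"
  using assms fr by (intro admissible_pair_conj[OF _ additive_lin_comb]) (simp_all add: frame_def)

end

lemma parallel_of_orthogonal:
  fixes t x y :: "nat \<Rightarrow> int"
  assumes "t 0 * x 0 + t 1 * x 1 + t 2 * x 2 = 0" "t 0 * y 0 + t 1 * y 1 + t 2 * y 2 = 0"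
    and "i < 3" "j < 3"
  shows "t i * cross x y j = t j * cross x y i"
proof -
  have "t 0 * (x 2 * y 0 - x 0 * y 2) - t 1 * (x 1 * y 2 - x 2 * y 1)
      = x 2 * (t 0 * y 0 + t 1 * y 1 + t 2 * y 2) - y 2 * (t 0 * x 0 + t 1 * x 1 + t 2 * x 2)"
    "t 0 * (x 0 * y 1 - x 1 * y 0) - t 2 * (x 1 * y 2 - x 2 * y 1)
      = y 1 * (t 0 * x 0 + t 1 * x 1 + t 2 * x 2) - x 1 * (t 0 * y 0 + t 1 * y 1 + t 2 * y 2)"
    "t 1 * (x 0 * y 1 - x 1 * y 0) - t 2 * (x 2 * y 0 - x 0 * y 2)
      = x 0 * (t 0 * y 0 + t 1 * y 1 + t 2 * y 2) - y 0 * (t 0 * x 0 + t 1 * x 1 + t 2 * x 2)"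
    by (simp_all add: algebra_simps)
  then have "t 0 * (x 2 * y 0 - x 0 * y 2) = t 1 * (x 1 * y 2 - x 2 * y 1)"
    "t 0 * (x 0 * y 1 - x 1 * y 0) = t 2 * (x 1 * y 2 - x 2 * y 1)"
    "t 1 * (x 0 * y 1 - x 1 * y 0) = t 2 * (x 2 * y 0 - x 0 * y 2)" using assms(1,2) by simp_all
  moreover have "i = 0 \<or> i = 1 \<or> i = 2" "j = 0 \<or> j = 1 \<or> j = 2" using assms(3,4) by auto
  ultimately show ?thesis by (elim disjE) (simp_all add: cross_def vec_of_nth)
qed

text \<open>A relation \<open>t\<close> between the edges yields an isotropic plane, the one
  orthogonal to \<open>t\<close>, because the cross product of two of its vectors is parallel to
  \<open>t\<close>. A basis adapted to this plane leads to the dependent case. Without a relation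
  the image has rank three, which forces \<open>m = 3\<close>.\<close>

lemma ex_admissible_3:
  assumes alt: "alternating_on 3 \<omega>" and nd: "nondegenerate_on 3 \<omega>" and m: "m \<le> 3"
    and cl: "\<And>x y. x \<in> int_vecs 3 \<Longrightarrow> y \<in> int_vecs 3 \<Longrightarrow> \<omega> x y \<in> int_vecs m"
  shows "\<exists>A B. admissible_pair 3 m \<omega> A B"
proof (cases "\<forall>t\<in>int_vecs 3. lin_comb 3 (edge \<omega>) t = 0 \<longrightarrow> t = 0")
  case True
  have "m = 3"
  proof (rule ccontr)
    assume "m \<noteq> 3"
    then have "m < card {..<3::nat}" using m by simp
    moreover have "edge \<omega> i \<in> int_vecs m" for i using cl by (simp add: edge_def)
    ultimately have "\<exists>t::nat \<Rightarrow> int. (\<exists>i\<in>{..<3}. t i \<noteq> 0) \<and> (\<forall>k. (\<Sum>i\<in>{..<3}. t i * edge \<omega> i k) = 0)"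
      by (intro ex_int_relation) auto
    then obtain t :: "nat \<Rightarrow> int" where t: "(\<exists>i\<in>{..<3}. t i \<noteq> 0) \<and> (\<forall>k. (\<Sum>i\<in>{..<3}. t i * edge \<omega> i k) = 0)" by (rule exE)
    define t' where "t' i = (if i < 3 then t i else 0)" for i :: nat
    have "t' \<in> int_vecs 3" by (auto simp: t'_def int_vecs_def)
    moreover have "lin_comb 3 (edge \<omega>) t' = 0"
    proof
      fix k
      have "(\<Sum>i<3. t' i * edge \<omega> i k) = (\<Sum>i<3. t i * edge \<omega> i k)" by (rule sum.cong) (auto simp: t'_def)
      then show "lin_comb 3 (edge \<omega>) t' k = 0 k" using t by (simp add: lin_comb_def vec_apply)
    qed
    ultimately have "t' = 0" using True by simp
    obtain i where i: "i < 3" "t i \<noteq> 0" using t by auto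
    have "t' i = t i" using i by (simp add: t'_def)
    then show False using i \<open>t' = 0\<close> by (simp add: vec_apply)
  qed
  then show ?thesis using ex_admissible_3_independent[OF alt] cl True by simp
next
  case False
  then obtain t where t: "t \<in> int_vecs 3" "lin_comb 3 (edge \<omega>) t = 0" "t \<noteq> 0" by auto
  define f where "f x = t 0 * x 0 + t 1 * x 1 + t 2 * x 2" for x :: "nat \<Rightarrow> int"
  have f: "additive_on (int_vecs 3) f" by (simp add: additive_on_def f_def vec_apply algebra_simps)
  from frame_annihilate[OF frame_unit_vec f, of 0 1] obtain b where b: "frame 3 b" "f (b 0) = 0" by auto
  have "\<exists>b'. frame 3 b' \<and> (\<forall>k. k \<noteq> 1 \<longrightarrow> k \<noteq> 2 \<longrightarrow> b' k = b k) \<and> f (b' 1) = 0 \<and>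
    (\<exists>p q r s. b' 1 = smul p (b 1) + smul q (b 2) \<and> b' 2 = smul r (b 1) + smul s (b 2))"
    by (rule frame_annihilate[OF b(1) f]) simp_all
  then obtain b' where "frame 3 b' \<and> (\<forall>k. k \<noteq> 1 \<longrightarrow> k \<noteq> 2 \<longrightarrow> b' k = b k) \<and> f (b' 1) = 0 \<and>
    (\<exists>p q r s. b' 1 = smul p (b 1) + smul q (b 2) \<and> b' 2 = smul r (b 1) + smul s (b 2))" by (rule exE)
  then have b': "frame 3 b'" "f (b' 0) = 0" "f (b' 1) = 0" using b(2) by simp_all
  have bin: "b' 0 \<in> int_vecs 3" "b' 1 \<in> int_vecs 3" using b'(1) by (simp_all add: frame_def)
  let ?c = "cross (b' 0) (b' 1)"
  obtain i where i: "i < 3" "t i \<noteq> 0"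
  proof (rule ccontr)
    assume "\<not> thesis"
    then have "t i = 0" if "i < 3" for i using that \<open>\<And>i. i < 3 \<Longrightarrow> t i \<noteq> 0 \<Longrightarrow> thesis\<close> by blast
    then have "t = 0" using t(1) by (intro int_vecs_eqI[of _ 3]) (simp_all add: vec_apply)
    then show False using t(3) by simp
  qed
  have "smul (t i) ?c = smul (?c i) t"
  proof (rule int_vecs_eqI[of _ 3])
    show "smul (t i) ?c \<in> int_vecs 3" "smul (?c i) t \<in> int_vecs 3" using t(1) by (simp_all add: cross_def)
    fix j :: nat assume "j < 3"
    then show "smul (t i) ?c j = smul (?c i) t j"
      using parallel_of_orthogonal[of t "b' 0" "b' 1" i j] b'(2,3) i by (simp add: f_def smul_def mult.commute)
  qed
  then have "lin_comb 3 (edge \<omega>) (smul (t i) ?c) = lin_comb 3 (edge \<omega>) (smul (?c i) t)" by simp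
  then have "smul (t i) (lin_comb 3 (edge \<omega>) ?c) = smul (?c i) (lin_comb 3 (edge \<omega>) t)"
    using t(1) by (simp add: additive_on_smul[OF additive_lin_comb, of _ 3] cross_def)
  then have "\<omega> (b' 0) (b' 1) = 0"
    using t(2) i(2) alternating_3_cross[OF alt bin] by (simp add: smul_eq_0_iff)
  then have "\<exists>A B. admissible_pair 3 m (\<lambda>x y. \<omega> (lin_comb 3 b' x) (lin_comb 3 b' y)) A B"
    using cl frame_in[OF b'(1)] by (intro ex_admissible_3_dependent frame_alternating[OF b'(1)] frame_nondegenerate[OF b'(1)])
      (simp_all add: alt nd m lin_comb_of_unit_vec)
  then obtain A B where "admissible_pair 3 m (\<lambda>x y. \<omega> (lin_comb 3 b' x) (lin_comb 3 b' y)) A B" by (elim exE)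
  from frame_admissible[OF b'(1) this] show ?thesis by (elim exE) (intro exI)
qed

section \<open>Pairs of forms in rank four\<close>

definition pair_form :: "(nat \<Rightarrow> int) \<Rightarrow> (nat \<Rightarrow> int) \<Rightarrow> (nat \<Rightarrow> int) \<Rightarrow> (nat \<Rightarrow> int) \<Rightarrow> nat \<Rightarrow> int" where
  "pair_form a b x y = vec_of [form4 a x y, form4 b x y]"

lemma vec_of_nth_45: "vec_of (x # y # z # w # u # xs) 4 = u" "vec_of (x # y # z # w # u # v # xs) 5 = v"
  by (auto simp: vec_of_def)

lemma pair_form_zero_iff: "pair_form a b x y = 0 \<longleftrightarrow> form4 a x y = 0 \<and> form4 b x y = 0"
proof -
  have "vec_of [0, 0] = 0" by (auto simp: vec_of_def fun_eq_iff vec_apply less_Suc_eq)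
  then have "pair_form a b x y = 0 \<longleftrightarrow> vec_of [form4 a x y, form4 b x y] = vec_of [0, 0]" by (simp add: pair_form_def)
  then show ?thesis by (simp add: vec_of_eq)
qed

lemma zero_of_2x2:
  fixes x y :: int
  assumes "a * x + b * y = 0" "c * x + d * y = 0" "a * d - b * c \<noteq> 0"
  shows "x = 0" "y = 0"
proof -
  have "(a * d - b * c) * x = d * (a * x + b * y) - b * (c * x + d * y)"
    "(a * d - b * c) * y = a * (c * x + d * y) - c * (a * x + b * y)"
    by (simp_all add: algebra_simps)
  then show "x = 0" "y = 0" using assms(3) unfolding assms(1,2) by simp_all
qed

text \<open>In the basis \<open>v, v', f\<^sub>1, f\<^sub>2\<close> both forms pair \<open>\<langle>v, v'\<rangle>\<close> with \<open>\<langle>f\<^sub>1, f\<^sub>2\<rangle>\<close>. The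
  automorphism is \<open>diag 1 (-1)\<close> composed with two opposite unipotent isometries, which remove
  the eigenvalue \<open>1\<close>.\<close>
lemma ex_antisymplectic_normal_form:
  assumes a: "a 0 = 0" "a 1 = 1" "a 2 = 0" "a 5 = 0" and b: "b 0 = 0" "b 1 = 0" "b 2 = 1" "b 5 = 0"
    and nd: "\<not> (b 3 = 0 \<and> a 4 = 0 \<and> a 3 = b 4)"
  shows "\<exists>M. admissible_pair 4 2 (pair_form a b) M uminus"
proof -
  \<comment> \<open>The two expressions are the determinants of the off-diagonal blocks of
    \<open>U g h\<close> and \<open>L p q\<close>. As binary quadratic forms they have the
    coefficients \<open>b 3\<close>, \<open>- a 4\<close> and, up to sign, \<open>a 3 - b 4\<close>,
    not all zero by \<open>nd\<close>; the three cases pick arguments according to the first nonzero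
    one.\<close>
  obtain p q g h :: int where dets: "(g * b 3 - h * b 4) * g - (h * a 4 - g * a 3) * h \<noteq> 0"
    "p * (p * b 3 + q * b 4) - (p * a 3 + q * a 4) * q \<noteq> 0"
  proof (cases "b 3 \<noteq> 0")
    case True
    then show ?thesis using that[of 1 0 1 0] by simp
  next
    case b3: False
    show ?thesis
    proof (cases "a 4 \<noteq> 0")
      case True
      then show ?thesis using that[of 0 1 0 1] b3 by simp
    next
      case False
      then show ?thesis using that[of 1 1 1 1] b3 nd by simp
    qed
  qed
  \<comment> \<open>Unipotent isometries of both forms: \<open>U\<close> adds to the first plane a
    linear image of the second, and \<open>L\<close> does the reverse. Given \<open>s\<close> and
    \<open>t\<close>, invariance of the two forms determines the other entries.\<close>
  define U where "U s t x = vec_of [x 0 + (s * b 3 - t * b 4) * x 2 + (t * a 4 - s * a 3) * x 3, x 1 + t * x 2 + s * x 3, x 2, x 3]"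
    for s t :: int and x :: "nat \<Rightarrow> int"
  define L where "L s t x = vec_of [x 0, x 1, x 2 + s * x 0 + (s * a 3 + t * a 4) * x 1, x 3 + t * x 0 + (s * b 3 + t * b 4) * x 1]"
    for s t :: int and x :: "nat \<Rightarrow> int"
  define S where "S x = vec_of [x 0, x 1, - x 2, - x 3]" for x :: "nat \<Rightarrow> int"
  have Xb: "bij_betw (U g h) (int_vecs 4) (int_vecs 4)"
  proof (rule bij_betw_inverse[of _ _ "U (- g) (- h)"])
    fix x :: "nat \<Rightarrow> int" assume x: "x \<in> int_vecs 4"
    show "U (- g) (- h) (U g h x) = x" "U g h (U (- g) (- h) x) = x"
      by (rule vec_eqI_4; use x in \<open>simp add: U_def vec_of_nth algebra_simps\<close>)+
  qed (simp_all add: U_def)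
  have Yb: "bij_betw (L p q) (int_vecs 4) (int_vecs 4)"
  proof (rule bij_betw_inverse[of _ _ "L (- p) (- q)"])
    fix x :: "nat \<Rightarrow> int" assume x: "x \<in> int_vecs 4"
    show "L (- p) (- q) (L p q x) = x" "L p q (L (- p) (- q) x) = x"
      by (rule vec_eqI_4; use x in \<open>simp add: L_def vec_of_nth algebra_simps\<close>)+
  qed (simp_all add: L_def)
  have Sb: "bij_betw S (int_vecs 4) (int_vecs 4)"
  proof (rule bij_betw_inverse[of _ _ S])
    fix x :: "nat \<Rightarrow> int" assume x: "x \<in> int_vecs 4"
    show "S (S x) = x" "S (S x) = x"
      by (rule vec_eqI_4; use x in \<open>simp add: S_def vec_of_nth\<close>)+
  qed (simp_all add: S_def)
  define M where "M = S \<circ> (U g h \<circ> L p q)"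
  have "bij_betw M (int_vecs 4) (int_vecs 4)" unfolding M_def by (intro bij_betw_trans[OF bij_betw_trans[OF Yb Xb] Sb])
  moreover have "additive_on (int_vecs 4) M"
    by (simp add: additive_on_def M_def S_def U_def L_def vec_of_nth vec_of_add vec_apply algebra_simps)
  moreover have "x = 0" if x: "x \<in> int_vecs 4" "M x = x" for x
  proof -
    \<comment> \<open>The last two coordinates of \<open>L p q x\<close>. For a fixed vector the
      block of \<open>U g h\<close> kills them, and then the block of \<open>L p q\<close> kills
      \<open>x 0\<close> and \<open>x 1\<close>.\<close>
    define w2 w3 where "w2 = x 2 + p * x 0 + (p * a 3 + q * a 4) * x 1" and "w3 = x 3 + q * x 0 + (p * b 3 + q * b 4) * x 1"
    have Mx: "M x = vec_of [x 0 + (g * b 3 - h * b 4) * w2 + (h * a 4 - g * a 3) * w3, x 1 + h * w2 + g * w3, - w2, - w3]"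
      by (simp add: M_def S_def U_def L_def vec_of_nth w2_def w3_def)
    have "M x 0 = x 0" "M x 1 = x 1" "M x 2 = x 2" "M x 3 = x 3" using x(2) by simp_all
    then have e: "(g * b 3 - h * b 4) * w2 + (h * a 4 - g * a 3) * w3 = 0" "h * w2 + g * w3 = 0" "x 2 = - w2" "x 3 = - w3"
      by (simp_all add: Mx vec_of_nth)
    have w: "w2 = 0" "w3 = 0" using zero_of_2x2[OF e(1,2)] dets(1) by simp_all
    have x23: "x 2 = 0" "x 3 = 0" using e(3,4) w by simp_all
    have "p * x 0 + (p * a 3 + q * a 4) * x 1 = 0" using w(1) x23(1) unfolding w2_def by simp
    moreover have "q * x 0 + (p * b 3 + q * b 4) * x 1 = 0" using w(2) x23(2) unfolding w3_def by simp
    ultimately have "x 0 = 0" "x 1 = 0" using zero_of_2x2 dets(2) by blast+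
    with x23 x(1) show ?thesis by (intro vec_eqI_4) (simp_all add: vec_apply)
  qed
  moreover have "pair_form a b (M x) (M y) = - pair_form a b x y" for x y
  proof -
    have fX: "form4 a (U g h x) (U g h y) = form4 a x y" "form4 b (U g h x) (U g h y) = form4 b x y" for x y
      by (simp_all only: form4_def U_def vec_of_nth One_nat_def) (simp_all add: a[simplified] b[simplified] algebra_simps)
    have fY: "form4 a (L p q x) (L p q y) = form4 a x y" "form4 b (L p q x) (L p q y) = form4 b x y" for x y
      by (simp_all only: form4_def L_def vec_of_nth One_nat_def) (simp_all add: a[simplified] b[simplified] algebra_simps)
    have fS: "form4 a (S x) (S y) = - form4 a x y" "form4 b (S x) (S y) = - form4 b x y" for x y
      by (simp_all only: form4_def S_def vec_of_nth One_nat_def) (simp_all add: a[simplified] b[simplified] algebra_simps)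
    have "- vec_of [s, t] = vec_of [- s, - t]" for s t
      by (auto simp: vec_of_def fun_eq_iff vec_apply less_Suc_eq)
    then show ?thesis by (simp add: pair_form_def M_def fX fY fS)
  qed
  ultimately show ?thesis using neg_admissible[of 2] unfolding admissible_pair_def by (intro exI[of _ M]) simp
qed

definition form4_coeffs :: "(nat \<Rightarrow> int) \<Rightarrow> (nat \<Rightarrow> nat \<Rightarrow> int) \<Rightarrow> nat \<Rightarrow> int" where
  "form4_coeffs a b = vec_of [form4 a (b 0) (b 1), form4 a (b 0) (b 2), form4 a (b 0) (b 3),
     form4 a (b 1) (b 2), form4 a (b 1) (b 3), form4 a (b 2) (b 3)]"

lemma form4_lin_comb:
  "form4 a (lin_comb 4 b x) (lin_comb 4 b y) = form4 (form4_coeffs a b) x y"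
proof -
  have sw: "form4 a (b 1) (b 0) = - form4 a (b 0) (b 1)" "form4 a (b 2) (b 0) = - form4 a (b 0) (b 2)"
    "form4 a (b 3) (b 0) = - form4 a (b 0) (b 3)" "form4 a (b 2) (b 1) = - form4 a (b 1) (b 2)"
    "form4 a (b 3) (b 1) = - form4 a (b 1) (b 3)" "form4 a (b 3) (b 2) = - form4 a (b 2) (b 3)"
    by (rule form4_alt(2))+
  have c: "form4_coeffs a b 0 = form4 a (b 0) (b 1)" "form4_coeffs a b 1 = form4 a (b 0) (b 2)"
    "form4_coeffs a b 2 = form4 a (b 0) (b 3)" "form4_coeffs a b 3 = form4 a (b 1) (b 2)"
    "form4_coeffs a b 4 = form4 a (b 1) (b 3)" "form4_coeffs a b 5 = form4 a (b 2) (b 3)"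
    by (simp_all add: form4_coeffs_def vec_of_nth vec_of_nth_45)
  show ?thesis
    unfolding lin_comb_small form4_linear form4_alt(1) sw form4_def[of "form4_coeffs a b"] c
    by (simp add: algebra_simps)
qed

lemma unit_square:
  fixes n :: int
  assumes "\<And>p. int_prime p \<Longrightarrow> \<not> p dvd n"
  shows "n * n = 1"
proof -
  have "n \<noteq> 0" using assms[of 2] by auto
  have "is_unit n"
  proof (rule ccontr)
    assume "\<not> is_unit n"
    from prime_divisor_exists[OF \<open>n \<noteq> 0\<close> this] show False using assms by auto
  qed
  then have "\<bar>n\<bar> = 1" by simp
  then show ?thesis by (metis abs_mult_self_eq mult_1)
qed

text \<open>Three Bezout steps clear \<open>f\<close> from all but the last vector. Two more clear
  \<open>g\<close> among the first three, where every combination keeps \<open>f\<close>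
  zero.\<close>

lemma ex_triangular_frame:
  fixes f g :: "(nat \<Rightarrow> int) \<Rightarrow> int"
  assumes f: "additive_on (int_vecs 4) f" and g: "additive_on (int_vecs 4) g"
  shows "\<exists>b. frame 4 b \<and> f (b 0) = 0 \<and> f (b 1) = 0 \<and> f (b 2) = 0 \<and> g (b 0) = 0 \<and> g (b 1) = 0"
proof -
  have comb: "f (smul p x + smul q y) = p * f x + q * f y" "g (smul p x + smul q y) = p * g x + q * g y"
    if "x \<in> int_vecs 4" "y \<in> int_vecs 4" for p q x y
    using that by (simp_all add: additive_on_add[OF f] additive_on_add[OF g] additive_on_smul_int[OF f] additive_on_smul_int[OF g])
  have fin: "b i \<in> int_vecs 4" if "frame 4 b" "i < 4" for b i using that by (simp add: frame_def)
  from frame_annihilate[OF frame_unit_vec f, of 0 1] obtain b1 where b1: "frame 4 b1" "f (b1 0) = 0" by auto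
  from frame_annihilate[OF b1(1) f, of 1 2] obtain b2 where b2: "frame 4 b2" "f (b2 0) = 0" "f (b2 1) = 0" using b1 by auto
  from frame_annihilate[OF b2(1) f, of 2 3] obtain b3 where b3: "frame 4 b3" "f (b3 0) = 0" "f (b3 1) = 0" "f (b3 2) = 0"
    using b2 by auto
  have "\<exists>b'. frame 4 b' \<and> (\<forall>k. k \<noteq> 0 \<longrightarrow> k \<noteq> 1 \<longrightarrow> b' k = b3 k) \<and> g (b' 0) = 0 \<and>
    (\<exists>p q r s. b' 0 = smul p (b3 0) + smul q (b3 1) \<and> b' 1 = smul r (b3 0) + smul s (b3 1))"
    by (rule frame_annihilate[OF b3(1) g]) simp_all
  then obtain b4 p q r s where b4: "frame 4 b4" "\<forall>k. k \<noteq> 0 \<longrightarrow> k \<noteq> 1 \<longrightarrow> b4 k = b3 k" "g (b4 0) = 0"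
    "b4 0 = smul p (b3 0) + smul q (b3 1)" "b4 1 = smul r (b3 0) + smul s (b3 1)" by (elim exE conjE)
  have f4: "f (b4 0) = 0" "f (b4 1) = 0" "f (b4 2) = 0"
    using b4 b3 fin[OF b3(1)] by (simp_all add: comb del: One_nat_def)
  have "\<exists>b'. frame 4 b' \<and> (\<forall>k. k \<noteq> 1 \<longrightarrow> k \<noteq> 2 \<longrightarrow> b' k = b4 k) \<and> g (b' 1) = 0 \<and>
    (\<exists>p q r s. b' 1 = smul p (b4 1) + smul q (b4 2) \<and> b' 2 = smul r (b4 1) + smul s (b4 2))"
    by (rule frame_annihilate[OF b4(1) g]) simp_all
  then obtain b5 p q r s where b5: "frame 4 b5" "\<forall>k. k \<noteq> 1 \<longrightarrow> k \<noteq> 2 \<longrightarrow> b5 k = b4 k" "g (b5 1) = 0"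
    "b5 1 = smul p (b4 1) + smul q (b4 2)" "b5 2 = smul r (b4 1) + smul s (b4 2)" by (elim exE conjE)
  have "f (b5 0) = 0" "f (b5 1) = 0" "f (b5 2) = 0" "g (b5 0) = 0"
    using b5 b4(3) f4 fin[OF b4(1)] by (simp_all add: comb del: One_nat_def)
  then show ?thesis using b5 by (intro exI[of _ b5]) simp
qed

text \<open>A vector \<open>v\<close> that is good at all primes pairs onto
  \<open>\<int>\<^sup>2\<close>. The common kernel of its two functionals is a plane containing
  \<open>v\<close>; this is the first isotropic plane up to a change of basis, and dual vectors for
  the pairing with \<open>v\<close>, suitably corrected, span the second.\<close>

lemma (in primitive_pencil) ex_antisymplectic:
  assumes nd: "nondegenerate_on 4 (pair_form a b)"
  shows "\<exists>M. admissible_pair 4 2 (pair_form a b) M uminus"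
proof -
  obtain v0 where v0: "\<forall>p. int_prime p \<longrightarrow> \<not> bad p v0" using ex_good by (elim exE)
  define v where "v = vec_of [v0 0, v0 1, v0 2, v0 3]"
  have trunc: "form4 c (vec_of [x 0, x 1, x 2, x 3]) y = form4 c x y" "form4 c y (vec_of [x 0, x 1, x 2, x 3]) = form4 c y x" for c x y
    by (simp_all add: form4_def vec_of_nth)
  have v: "v \<in> int_vecs 4" by (simp add: v_def)
  have good: "\<exists>x\<in>int_vecs 4. \<exists>y\<in>int_vecs 4. \<not> p dvd form_minor a b v x y" if p: "int_prime p" for p
  proof -
    have "\<exists>x y. \<not> p dvd form_minor a b v0 x y" using v0 p unfolding bad_def by simp
    then obtain x y where "\<not> p dvd form_minor a b v0 x y" by (elim exE)
    then have "\<not> p dvd form_minor a b v (vec_of [x 0, x 1, x 2, x 3]) (vec_of [y 0, y 1, y 2, y 3])"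
      by (simp only: form_minor_def v_def trunc not_False_eq_True)
    then show ?thesis by (intro bexI[of _ "vec_of [x 0, x 1, x 2, x 3]"] bexI[of _ "vec_of [y 0, y 1, y 2, y 3]"]) simp_all
  qed
  have "\<exists>b'. frame 4 b' \<and> form4 a v (b' 0) = 0 \<and> form4 a v (b' 1) = 0 \<and> form4 a v (b' 2) = 0
    \<and> form4 b v (b' 0) = 0 \<and> form4 b v (b' 1) = 0"
    by (rule ex_triangular_frame) (simp_all add: additive_on_def form4_linear)
  then obtain e where e: "frame 4 e" "form4 a v (e 0) = 0" "form4 a v (e 1) = 0" "form4 a v (e 2) = 0"
    "form4 b v (e 0) = 0" "form4 b v (e 1) = 0" by (elim exE conjE)
  have ex_coords: "\<exists>t. x = lin_comb 4 e t" if "x \<in> int_vecs 4" for x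
  proof -
    have "bij_betw (lin_comb 4 e) (int_vecs 4) (int_vecs 4)" using e(1) by (simp add: frame_def)
    then have "x \<in> lin_comb 4 e ` int_vecs 4" using that by (simp add: bij_betw_imp_surj_on)
    then show ?thesis by auto
  qed
  define \<alpha> \<beta> where "\<alpha> = form4 a v (e 3)" and "\<beta> = form4 b v (e 2)"
  have fa: "form4 a v (lin_comb 4 e t) = t 3 * \<alpha>" for t
    unfolding lin_comb_small form4_linear e \<alpha>_def by simp
  have fb: "form4 b v (lin_comb 4 e t) = t 2 * \<beta> + t 3 * form4 b v (e 3)" for t
    unfolding lin_comb_small form4_linear e \<beta>_def by simp
  \<comment> \<open>In the triangular frame every minor at \<open>v\<close> is a multiple of
    \<open>\<alpha> * \<beta>\<close>, so goodness at all primes makes both factors units.\<close>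
  have minor: "form_minor a b v (lin_comb 4 e t) (lin_comb 4 e u) = \<alpha> * \<beta> * (t 3 * u 2 - u 3 * t 2)" for t u
    unfolding form_minor_def fa fb by (simp add: algebra_simps)
  have nab: "\<not> p dvd \<alpha> * \<beta>" if pp: "int_prime p" for p
  proof
    assume d: "p dvd \<alpha> * \<beta>"
    obtain x y where "x \<in> int_vecs 4" "y \<in> int_vecs 4" "\<not> p dvd form_minor a b v x y" using good[OF pp] by auto
    then show False using ex_coords[of x] ex_coords[of y] minor d by (auto simp: dvd_mult2)
  qed
  have "\<not> p dvd \<alpha>" "\<not> p dvd \<beta>" if "int_prime p" for p
    using nab[OF that] dvd_mult2[of p \<alpha> \<beta>] dvd_mult[of p \<beta> \<alpha>] by auto
  then have \<alpha>\<beta>: "\<alpha> * \<alpha> = 1" "\<beta> * \<beta> = 1" using unit_square by auto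
  have "\<alpha> \<noteq> 0" "\<beta> \<noteq> 0" using \<alpha>\<beta> by auto
  obtain t where t: "v = lin_comb 4 e t" using ex_coords[OF v] by (elim exE)
  have "t 3 = 0" using fa[of t] \<open>\<alpha> \<noteq> 0\<close> by (simp add: t[symmetric] form4_alt(1))
  moreover then have "t 2 = 0" using fb[of t] \<open>\<beta> \<noteq> 0\<close> by (simp add: t[symmetric] form4_alt(1))
  ultimately have vt: "v = smul (t 0) (e 0) + smul (t 1) (e 1)" using t by (simp add: lin_comb_small)
  \<comment> \<open>Being orthogonal to \<open>(t 1, - t 0)\<close>, the primitive vector
    \<open>(p, q)\<close> lies on the line of \<open>(t 0, t 1)\<close>. So \<open>v\<close> becomes
    a multiple of the first basis vector.\<close>
  obtain p q r s where pqrs: "p * s - q * r = 1" "p * t 1 + q * (- t 0) = 0" using unimodular_annihilator by metis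
  define e' where "e' = e(0 := smul p (e 0) + smul q (e 1), 1 := smul r (e 0) + smul s (e 1))"
  have e': "frame 4 e'" unfolding e'_def using pqrs(1) by (intro frame_mix[OF e(1), where \<delta> = 1]) simp_all
  have e'n: "e' 0 = smul p (e 0) + smul q (e 1)" "e' 1 = smul r (e 0) + smul s (e 1)" "e' 2 = e 2" "e' 3 = e 3"
    by (simp_all add: e'_def)
  define \<tau> where "\<tau> = t 0 * s - t 1 * r"
  have "\<tau> * p = t 0 * (p * s - q * r) - r * (p * t 1 + q * (- t 0))" "\<tau> * q = t 1 * (p * s - q * r) - s * (p * t 1 + q * (- t 0))"
    by (simp_all add: \<tau>_def algebra_simps)
  then have "\<tau> * p = t 0" "\<tau> * q = t 1" unfolding pqrs by simp_all
  then have v\<tau>: "v = smul \<tau> (e' 0)" unfolding vt e'n by (simp add: smul_add_right smul_smul)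
  have sc: "form4 c v x = \<tau> * form4 c (e' 0) x" for c x unfolding v\<tau> form4_linear ..
  have "\<tau> \<noteq> 0" using \<open>\<alpha> \<noteq> 0\<close> sc[of a "e 3"] by (auto simp: \<alpha>_def)
  have z: "form4 a (e' 0) (e' 1) = 0" "form4 b (e' 0) (e' 1) = 0" "form4 a (e' 0) (e' 2) = 0"
    using sc[of a "e' 1"] sc[of b "e' 1"] sc[of a "e' 2"] e \<open>\<tau> \<noteq> 0\<close> by (simp_all add: e'n form4_linear del: One_nat_def)
  define \<alpha>1 \<beta>1 \<gamma> where "\<alpha>1 = form4 a (e' 0) (e' 3)" and "\<beta>1 = form4 b (e' 0) (e' 2)" and "\<gamma> = form4 b (e' 0) (e' 3)"
  have "\<alpha> = \<tau> * \<alpha>1" "\<beta> = \<tau> * \<beta>1" using sc by (simp_all add: \<alpha>_def \<beta>_def \<alpha>1_def \<beta>1_def e'n)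
  then have "\<alpha>1 dvd 1" "\<beta>1 dvd 1" using \<alpha>\<beta> by (metis dvd_mult2 dvd_triv_right dvd_refl mult.commute)+
  then have "\<bar>\<alpha>1\<bar> = 1" "\<bar>\<beta>1\<bar> = 1" by simp_all
  then have u1: "\<alpha>1 * \<alpha>1 = 1" "\<beta>1 * \<beta>1 = 1" by (metis abs_mult_self_eq mult_1)+
  \<comment> \<open>The pairing of \<open>e' 0\<close> with \<open>e' 2\<close>, \<open>e' 3\<close>
    under \<open>a\<close> and \<open>b\<close> is anti-triangular with the units
    \<open>\<alpha>1\<close> and \<open>\<beta>1\<close> on the antidiagonal; this integral base
    change turns it into the identity.\<close>
  define f where "f = e'(2 := smul (- (\<alpha>1 * \<beta>1 * \<gamma>)) (e' 2) + smul \<alpha>1 (e' 3), 3 := smul \<beta>1 (e' 2) + smul 0 (e' 3))"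
  have f: "frame 4 f" unfolding f_def
  proof (rule frame_mix[OF e', where \<delta> = "- (\<alpha>1 * \<beta>1)"])
    have "- (\<alpha>1 * \<beta>1) * - (\<alpha>1 * \<beta>1) = (\<alpha>1 * \<alpha>1) * (\<beta>1 * \<beta>1)" by (simp add: algebra_simps)
    then show "- (\<alpha>1 * \<beta>1) * - (\<alpha>1 * \<beta>1) = 1" unfolding u1 by simp
  qed simp_all
  have fn: "f 0 = e' 0" "f 1 = e' 1" "f 2 = smul (- (\<alpha>1 * \<beta>1 * \<gamma>)) (e' 2) + smul \<alpha>1 (e' 3)" "f 3 = smul \<beta>1 (e' 2)"
    by (simp_all add: f_def)
  have g1: "form4 a (f 0) (f 1) = 0" "form4 b (f 0) (f 1) = 0" using z by (simp_all only: fn)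
  have g2: "form4 a (f 0) (f 2) = 1" "form4 a (f 0) (f 3) = 0" "form4 b (f 0) (f 3) = 1"
    using z u1 by (simp_all add: fn form4_linear \<alpha>1_def[symmetric] \<beta>1_def[symmetric] del: One_nat_def)
  have "form4 b (f 0) (f 2) = \<alpha>1 * \<gamma> - \<alpha>1 * \<gamma> * (\<beta>1 * \<beta>1)"
    by (simp add: fn form4_linear \<alpha>1_def[symmetric] \<beta>1_def[symmetric] \<gamma>_def[symmetric] algebra_simps del: One_nat_def)
  then have g3: "form4 b (f 0) (f 2) = 0" unfolding u1 by simp
  \<comment> \<open>The values to be removed to make the second plane isotropic. Under
    \<open>a\<close> the vector \<open>f 0\<close> pairs only with \<open>f 2\<close>, under
    \<open>b\<close> only with \<open>f 3\<close>, so multiples of \<open>f 0\<close> correct the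
    two values independently.\<close>
  define ca cb where "ca = form4 a (f 2) (f 3)" and "cb = form4 b (f 2) (f 3)"
  define f' where "f' = f(2 := smul 1 (f 2) + smul (- cb) (f 0), 0 := smul 0 (f 2) + smul 1 (f 0))"
  have f': "frame 4 f'" unfolding f'_def by (rule frame_mix[OF f, where \<delta> = 1]) simp_all
  have f'n: "f' 0 = f 0" "f' 1 = f 1" "f' 2 = f 2 + smul (- cb) (f 0)" "f' 3 = f 3" by (simp_all add: f'_def)
  define h where "h = f'(3 := smul 1 (f' 3) + smul ca (f' 0), 0 := smul 0 (f' 3) + smul 1 (f' 0))"
  have h: "frame 4 h" unfolding h_def by (rule frame_mix[OF f', where \<delta> = 1]) simp_all
  have hn: "h 0 = f 0" "h 1 = f 1" "h 2 = f 2 + smul (- cb) (f 0)" "h 3 = f 3 + smul ca (f 0)" by (simp_all add: h_def f'n del: One_nat_def)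
  have sw: "form4 c (f 2) (f 0) = - form4 c (f 0) (f 2)" for c by (rule form4_alt(2))
  have T: "form4 a (h 0) (h 1) = 0" "form4 a (h 0) (h 2) = 1" "form4 a (h 0) (h 3) = 0" "form4 a (h 2) (h 3) = 0"
    "form4 b (h 0) (h 1) = 0" "form4 b (h 0) (h 2) = 0" "form4 b (h 0) (h 3) = 1" "form4 b (h 2) (h 3) = 0"
    by (simp_all add: hn form4_linear form4_alt(1) g1 g2 g3 sw ca_def cb_def del: One_nat_def)
  let ?a = "form4_coeffs a h" and ?b = "form4_coeffs b h"
  have co: "?a 0 = 0" "?a 1 = 1" "?a 2 = 0" "?a 5 = 0" "?b 0 = 0" "?b 1 = 0" "?b 2 = 1" "?b 5 = 0"
    using T by (simp_all add: form4_coeffs_def vec_of_nth vec_of_nth_45)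
  have pull: "pair_form a b (lin_comb 4 h x) (lin_comb 4 h y) = pair_form ?a ?b x y" for x y
    by (simp add: pair_form_def form4_lin_comb)
  have nd': "nondegenerate_on 4 (pair_form ?a ?b)" using frame_nondegenerate[OF h nd] by (simp add: pull)
  have "\<not> (?b 3 = 0 \<and> ?a 4 = 0 \<and> ?a 3 = ?b 4)"
  proof
    assume c: "?b 3 = 0 \<and> ?a 4 = 0 \<and> ?a 3 = ?b 4"
    \<comment> \<open>In this case both functionals of \<open>h 1\<close> are \<open>?a 3\<close>
      times those of \<open>h 0\<close>, which gives a common radical vector.\<close>
    let ?x = "vec_of [- ?a 3, 1, 0, 0]"
    have "form4 ?a ?x y = 0" "form4 ?b ?x y = 0" for y
      unfolding form4_def co using c by (simp_all add: vec_of_nth)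
    then have "?x = 0" using nd' by (simp add: nondegenerate_on_def pair_form_zero_iff)
    from fun_cong[OF this, of 1] show False by (simp add: vec_of_nth vec_apply)
  qed
  from ex_antisymplectic_normal_form[OF co this] obtain M where "admissible_pair 4 2 (pair_form ?a ?b) M uminus" by (elim exE)
  then have "admissible_pair 4 2 (\<lambda>x y. pair_form a b (lin_comb 4 h x) (lin_comb 4 h y)) M uminus" by (simp only: pull)
  from frame_admissible[OF h this] show ?thesis .
qed

section \<open>Saturating the pencil of two forms\<close>

text \<open>Membership in the rational span, with a common denominator \<open>d\<close>.\<close>

definition spanned_by :: "(nat \<Rightarrow> int) \<Rightarrow> (nat \<Rightarrow> int) \<Rightarrow> (nat \<Rightarrow> int) \<Rightarrow> (nat \<Rightarrow> int) \<Rightarrow> bool" where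
  "spanned_by a' b' a b \<longleftrightarrow> (\<exists>d s t u v. d \<noteq> 0 \<and> smul d a = pencil a' b' s t \<and> smul d b = pencil a' b' u v)"

lemma spanned_by_swap: "spanned_by a' b' a b \<Longrightarrow> spanned_by b' a' a b"
  unfolding spanned_by_def pencil_def by (metis add.commute)

text \<open>Replacing one of two independent forms by a \<open>p\<close>-th part of a combination which is divisible
  by \<open>p\<close> makes every minor smaller.\<close>
lemma shrink_pencil:
  assumes a: "a' \<in> int_vecs 6" "b' \<in> int_vecs 6" and sp: "spanned_by a' b' a b"
    and m: "a' i * b' j - a' j * b' i \<noteq> 0"
    and p: "int_prime p" "\<And>k. k < 6 \<Longrightarrow> p dvd s * a' k + t * b' k" "\<not> p dvd t"
  shows "\<exists>z. z \<in> int_vecs 6 \<and> spanned_by a' z a b \<and> a' i * z j - a' j * z i \<noteq> 0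
    \<and> \<bar>a' i * z j - a' j * z i\<bar> < \<bar>a' i * b' j - a' j * b' i\<bar>"
proof -
  have p0: "p > 0" using p(1) by (simp add: prime_gt_0_int)
  \<comment> \<open>Reduction modulo \<open>p\<close> gives \<open>0 < t1 < p\<close>, and the new
    minor is \<open>t1 / p\<close> times the old one.\<close>
  define s1 t1 where "s1 = s mod p" and "t1 = t mod p"
  define z where "z k = (s1 * a' k + t1 * b' k) div p" for k
  have t1: "0 < t1" "t1 < p" using p(3) p0 pos_mod_bound[of p t] pos_mod_sign[of p t]
    by (auto simp: t1_def dvd_eq_mod_eq_0 less_le)
  have dv: "p dvd s1 * a' k + t1 * b' k" for k
  proof (cases "k < 6")
    case True
    have "s1 * a' k + t1 * b' k = (s * a' k + t * b' k) - p * ((s div p) * a' k + (t div p) * b' k)"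
      unfolding s1_def t1_def minus_mult_div_eq_mod[symmetric] by (simp add: algebra_simps)
    then show ?thesis using p(2)[OF True] by simp
  next
    case False
    then show ?thesis using a by (simp add: int_vecs_def)
  qed
  have pz: "p * z k = s1 * a' k + t1 * b' k" for k unfolding z_def using dv by simp
  have "z \<in> int_vecs 6" using a by (simp add: int_vecs_def z_def)
  obtain d s0 t0 u0 v0 where d: "d \<noteq> 0" "smul d a = pencil a' b' s0 t0" "smul d b = pencil a' b' u0 v0"
    using sp unfolding spanned_by_def by (elim exE conjE)
  have tr: "smul (t1 * d) c = pencil a' z (x * t1 - y * s1) (y * p)" if "smul d c = pencil a' b' x y" for c x y
  proof
    fix k
    have "d * c k = x * a' k + y * b' k" using fun_cong[OF that, of k] by (simp add: pencil_def smul_def vec_apply)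
    then have "t1 * d * c k = t1 * (x * a' k + y * b' k)" by (simp only: mult.assoc)
    also have "\<dots> = t1 * (x * a' k) + y * (t1 * b' k)" by (simp add: algebra_simps)
    also have "t1 * b' k = p * z k - s1 * a' k" using pz by simp
    finally show "smul (t1 * d) c k = pencil a' z (x * t1 - y * s1) (y * p) k"
      by (simp add: pencil_def smul_def vec_apply algebra_simps)
  qed
  have spz: "spanned_by a' z a b" unfolding spanned_by_def
    using tr[OF d(2)] tr[OF d(3)] d(1) t1(1) by (intro exI[of _ "t1 * d"] exI conjI) simp_all
  define n0 n1 where "n0 = a' i * b' j - a' j * b' i" and "n1 = a' i * z j - a' j * z i"
  have "p * n1 = a' i * (p * z j) - a' j * (p * z i)" by (simp add: n1_def algebra_simps)
  also have "\<dots> = t1 * n0" unfolding pz by (simp add: n0_def algebra_simps)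
  finally have eq: "p * n1 = t1 * n0" .
  have n0: "n0 \<noteq> 0" using m by (simp add: n0_def)
  have n1: "n1 \<noteq> 0" using eq n0 t1(1) by auto
  have "p * \<bar>n1\<bar> = t1 * \<bar>n0\<bar>" using eq p0 t1(1) by (metis abs_mult abs_of_pos)
  then have "p * \<bar>n1\<bar> < p * \<bar>n0\<bar>" using t1(2) n0 by simp
  then have "\<bar>n1\<bar> < \<bar>n0\<bar>" using p0 by simp
  then show ?thesis using \<open>z \<in> int_vecs 6\<close> spz n1 unfolding n0_def n1_def by (intro exI[of _ z]) simp
qed

text \<open>Proportional forms, which include the case that one of them is zero, are completed by a
  unit vector that is independent of a nonzero one. The added form restricts the automorphism
  further but makes a pencil available.\<close>

lemma ex_independent_pencil:
  assumes a: "a \<in> int_vecs 6" "b \<in> int_vecs 6" and ne: "a \<noteq> 0 \<or> b \<noteq> 0"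
  shows "\<exists>a' b' i j. a' \<in> int_vecs 6 \<and> b' \<in> int_vecs 6 \<and> spanned_by a' b' a b \<and> a' i * b' j - a' j * b' i \<noteq> 0"
proof (cases "\<exists>i j. a i * b j - a j * b i \<noteq> 0")
  case True
  have "spanned_by a b a b" unfolding spanned_by_def
    by (rule exI[of _ 1], rule exI[of _ 1], rule exI[of _ 0], rule exI[of _ 0], rule exI[of _ 1]) (simp add: pencil_def)
  with True a show ?thesis by blast
next
  case False
  then have eq: "a i * b j = a j * b i" for i j by simp
  have gen: "\<exists>a' b' i j. a' \<in> int_vecs 6 \<and> b' \<in> int_vecs 6 \<and> spanned_by a' b' c d \<and> a' i * b' j - a' j * b' i \<noteq> 0"
    if c: "c \<in> int_vecs 6" "c \<noteq> 0" and cd: "\<And>i j. c i * d j = c j * d i" for c d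
  proof -
    obtain i where i: "c i \<noteq> 0" using c(2) by (auto simp: fun_eq_iff vec_apply)
    then have "i < 6" using c(1) by (auto simp: int_vecs_def intro: leI)
    define j :: nat where "j = (if i = 0 then 1 else 0)"
    have "j < 6" "j \<noteq> i" by (auto simp: j_def)
    have "smul (c i) c = pencil c (unit_vec j) (c i) 0" by (simp add: pencil_def)
    moreover have "smul (c i) d = pencil c (unit_vec j) (d i) 0"
      using cd[of i] by (simp add: pencil_def) (simp add: smul_def fun_eq_iff mult.commute)
    ultimately have "spanned_by c (unit_vec j) c d" unfolding spanned_by_def using i by blast
    then show ?thesis using c(1) \<open>j < 6\<close> \<open>j \<noteq> i\<close> i
      by (intro exI[of _ c] exI[of _ "unit_vec j"] exI[of _ i] exI[of _ j]) (simp add: unit_vec_def[of j])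
  qed
  show ?thesis
  proof (cases "a = 0")
    case False
    then show ?thesis using gen[OF a(1) False eq] by simp
  next
    case True
    then have "b \<noteq> 0" using ne by simp
    have "b i * a j = b j * a i" for i j using eq[of j i] by (simp add: mult.commute)
    from gen[OF a(2) \<open>b \<noteq> 0\<close> this] obtain a' b' i j where *: "a' \<in> int_vecs 6" "b' \<in> int_vecs 6"
      "spanned_by a' b' b a" "a' i * b' j - a' j * b' i \<noteq> 0" by (elim exE conjE)
    then have "spanned_by a' b' a b" unfolding spanned_by_def by blast
    with * show ?thesis by blast
  qed
qed

text \<open>A pencil with a nonzero minor of least absolute value is saturated: a combination
  divisible by \<open>p\<close> with a coefficient prime to \<open>p\<close> would allow it to
  shrink. Exchanging the two forms handles the other coefficient.\<close>

lemma ex_saturated_pencil: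
  assumes a: "a \<in> int_vecs 6" "b \<in> int_vecs 6" and ne: "a \<noteq> 0 \<or> b \<noteq> 0"
  shows "\<exists>a' b'. spanned_by a' b' a b \<and>
    (\<forall>p s t. int_prime p \<longrightarrow> (\<forall>i<6. p dvd s * a' i + t * b' i) \<longrightarrow> p dvd s \<and> p dvd t)"
proof -
  define P where "P N a' b' i j \<longleftrightarrow> a' \<in> int_vecs 6 \<and> b' \<in> int_vecs 6 \<and> spanned_by a' b' a b
     \<and> a' i * b' j - a' j * b' i \<noteq> 0 \<and> nat \<bar>a' i * b' j - a' j * b' i\<bar> = N" for N a' b' and i j :: nat
  have ex: "\<exists>N a' b' i j. P N a' b' i j" using ex_independent_pencil[OF assms] unfolding P_def by blast
  define N where "N = (LEAST N. \<exists>a' b' i j. P N a' b' i j)"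
  have "\<exists>a' b' i j. P N a' b' i j" unfolding N_def by (rule LeastI_ex[OF ex])
  then obtain a' b' i j where P: "P N a' b' i j" by (elim exE)
  have min: "\<not> P N' c d i j" if "N' < N" for N' c d i j
    using not_less_Least[of N' "\<lambda>N. \<exists>a' b' i j. P N a' b' i j"] that unfolding N_def by blast
  have step: "p dvd t" if c: "P N c d i j" and p: "int_prime p" "\<And>k. k < 6 \<Longrightarrow> p dvd s * c k + t * d k" for c d i j p s t
  proof (rule ccontr)
    assume "\<not> p dvd t"
    have "\<exists>z. z \<in> int_vecs 6 \<and> spanned_by c z a b \<and> c i * z j - c j * z i \<noteq> 0
      \<and> \<bar>c i * z j - c j * z i\<bar> < \<bar>c i * d j - c j * d i\<bar>"
      by (rule shrink_pencil[OF _ _ _ _ p \<open>\<not> p dvd t\<close>]) (use c in \<open>simp_all add: P_def\<close>)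
    then obtain z where z: "z \<in> int_vecs 6" "spanned_by c z a b" "c i * z j - c j * z i \<noteq> 0"
      "\<bar>c i * z j - c j * z i\<bar> < \<bar>c i * d j - c j * d i\<bar>" by (elim exE conjE)
    then have "P (nat \<bar>c i * z j - c j * z i\<bar>) c z i j" using c by (simp add: P_def)
    moreover have "nat \<bar>c i * z j - c j * z i\<bar> < N" using z(4) c by (auto simp: P_def)
    ultimately show False using min by simp
  qed
  have P': "P N b' a' j i" using P spanned_by_swap by (auto simp: P_def algebra_simps)
  have dv: "p dvd s \<and> p dvd t" if p: "int_prime p" "\<forall>i<6. p dvd s * a' i + t * b' i" for p s t
    using step[OF P p(1), of s t] step[OF P' p(1), of t s] p(2) by (simp add: add.commute)
  have "spanned_by a' b' a b" using P by (simp only: P_def)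
  moreover have "\<forall>p s t. int_prime p \<longrightarrow> (\<forall>i<6. p dvd s * a' i + t * b' i) \<longrightarrow> p dvd s \<and> p dvd t"
    by (rule allI, rule allI, rule allI, rule impI, rule impI, rule dv)
  ultimately show ?thesis by (intro exI[of _ a'] exI[of _ b'] conjI)
qed

text \<open>Inverse to \<open>row4 a\<close> up to the factor \<open>pfaffian a\<close>.\<close>

definition adjugate4 :: "(nat \<Rightarrow> int) \<Rightarrow> (nat \<Rightarrow> int) \<Rightarrow> nat \<Rightarrow> int" where
  "adjugate4 a y = vec_of [a 5 * y 1 - a 4 * y 2 + a 3 * y 3, - a 5 * y 0 + a 2 * y 2 - a 1 * y 3,
     a 4 * y 0 - a 2 * y 1 + a 0 * y 3, - a 3 * y 0 + a 1 * y 1 - a 0 * y 2]"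

text \<open>The functional \<open>form4 b z\<close> as a coefficient vector.\<close>

definition row4 :: "(nat \<Rightarrow> int) \<Rightarrow> (nat \<Rightarrow> int) \<Rightarrow> nat \<Rightarrow> int" where
  "row4 b z = vec_of [- (b 0 * z 1 + b 1 * z 2 + b 2 * z 3), b 0 * z 0 - b 3 * z 2 - b 4 * z 3,
     b 1 * z 0 + b 3 * z 1 - b 5 * z 3, b 2 * z 0 + b 4 * z 1 + b 5 * z 2]"

lemma adjugate4_simps:
  "form4 a (adjugate4 a y) z = pfaffian a * (y 0 * z 0 + y 1 * z 1 + y 2 * z 2 + y 3 * z 3)"
  "form4 b (adjugate4 a y) z + form4 a (adjugate4 b y) z =
     (pfaffian (a + b) - pfaffian a - pfaffian b) * (y 0 * z 0 + y 1 * z 1 + y 2 * z 2 + y 3 * z 3)"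
  "form4 a (adjugate4 b (row4 b y)) z = pfaffian b * form4 a y z"
  "form4 b (adjugate4 a y) z = y 0 * adjugate4 a (row4 b z) 0 + y 1 * adjugate4 a (row4 b z) 1
     + y 2 * adjugate4 a (row4 b z) 2 + y 3 * adjugate4 a (row4 b z) 3"
  by (simp_all add: form4_def adjugate4_def row4_def pfaffian_def vec_of_nth vec_apply algebra_simps)

text \<open>If the Pfaffian vanished on the whole pencil, the columns of the products of one form with
  the Pfaffian adjugate of the other would be common radical vectors.\<close>
lemma ex_nonzero_pfaffian:
  assumes nd: "nondegenerate_on 4 (pair_form a b)" and ne: "\<exists>i<6. a i \<noteq> 0"
  shows "\<exists>s t. pfaffian (pencil a b s t) \<noteq> 0"
proof (rule ccontr)
  assume "\<not> ?thesis"
  then have z: "pfaffian (pencil a b s t) = 0" for s t by simp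
  have pf: "pfaffian a = 0" "pfaffian b = 0" "pfaffian (a + b) = 0"
    using z[of 1 0] z[of 0 1] z[of 1 1] by (simp_all add: pencil_def)
  have rad: "x = 0" if "x \<in> int_vecs 4" "\<And>y. form4 a x y = 0" "\<And>y. form4 b x y = 0" for x
    using nd that by (simp add: nondegenerate_on_def pair_form_zero_iff)
  have adj_in: "adjugate4 a y \<in> int_vecs 4" for y by (simp add: adjugate4_def)
  have row0: "adjugate4 a (row4 b y) = 0" for y
  proof (rule rad[OF adj_in])
    fix w
    show "form4 a (adjugate4 a (row4 b y)) w = 0" by (simp only: adjugate4_simps(1) pf mult_zero_left)
    show "form4 b (adjugate4 a (row4 b y)) w = 0"
      using adjugate4_simps(2)[of b a "row4 b y" w] adjugate4_simps(3)[of a b y w] by (simp add: pf)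
  qed
  have "adjugate4 a y = 0" for y
  proof (rule rad[OF adj_in])
    fix w
    show "form4 a (adjugate4 a y) w = 0" by (simp only: adjugate4_simps(1) pf mult_zero_left)
    show "form4 b (adjugate4 a y) w = 0" unfolding adjugate4_simps(4) row0 by (simp add: vec_apply)
  qed
  then have c: "adjugate4 a (unit_vec 0) k = 0" "adjugate4 a (unit_vec 1) k = 0" "adjugate4 a (unit_vec 3) k = 0" for k
    by (simp_all add: vec_apply)
  have "a 5 = 0" "a 4 = 0" "a 3 = 0" "a 2 = 0" "a 1 = 0" "a 0 = 0"
    using c(1)[of 1] c(1)[of 2] c(1)[of 3] c(2)[of 2] c(2)[of 3] c(3)[of 2]
    by (simp_all add: adjugate4_def unit_vec_def vec_of_nth)
  then show False using ne by (auto dest!: less_6_cases)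
qed

lemma alternating_4:
  assumes alt: "alternating_on 4 \<omega>" and xy: "x \<in> int_vecs 4" "y \<in> int_vecs 4"
  shows "\<omega> x y k = form4 (vec_of [\<omega> (unit_vec 0) (unit_vec 1) k, \<omega> (unit_vec 0) (unit_vec 2) k, \<omega> (unit_vec 0) (unit_vec 3) k,
    \<omega> (unit_vec 1) (unit_vec 2) k, \<omega> (unit_vec 1) (unit_vec 3) k, \<omega> (unit_vec 2) (unit_vec 3) k]) x y"
proof -
  let ?w = "\<lambda>i j. \<omega> (unit_vec i) (unit_vec j) k"
  have a: "?w 0 0 = 0" "?w 1 1 = 0" "?w 2 2 = 0" "?w 3 3 = 0"
    using alternating_on_unit(1)[OF alt, of _ 0 k] by (simp_all del: One_nat_def)
  have s: "?w 1 0 = - ?w 0 1" "?w 2 0 = - ?w 0 2" "?w 2 1 = - ?w 1 2" "?w 3 0 = - ?w 0 3" "?w 3 1 = - ?w 1 3" "?w 3 2 = - ?w 2 3"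
    using alternating_on_unit(2)[OF alt, of 0 1 k] alternating_on_unit(2)[OF alt, of 0 2 k] alternating_on_unit(2)[OF alt, of 1 2 k]
      alternating_on_unit(2)[OF alt, of 0 3 k] alternating_on_unit(2)[OF alt, of 1 3 k] alternating_on_unit(2)[OF alt, of 2 3 k]
    by (simp_all del: One_nat_def)
  have "\<omega> x y k = (\<Sum>i<4. x i * (\<Sum>j<4. y j * ?w i j))"
    using alt xy by (intro biadditive_on_expand) (simp_all add: alternating_on_def)
  also have "\<dots> = x 0 * (y 0 * ?w 0 0 + y 1 * ?w 0 1 + y 2 * ?w 0 2 + y 3 * ?w 0 3)
      + x 1 * (y 0 * ?w 1 0 + y 1 * ?w 1 1 + y 2 * ?w 1 2 + y 3 * ?w 1 3)
      + x 2 * (y 0 * ?w 2 0 + y 1 * ?w 2 1 + y 2 * ?w 2 2 + y 3 * ?w 2 3)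
      + x 3 * (y 0 * ?w 3 0 + y 1 * ?w 3 1 + y 2 * ?w 3 2 + y 3 * ?w 3 3)"
    by (simp add: lessThan_small add.assoc del: One_nat_def)
  also have "\<dots> = form4 (vec_of [?w 0 1, ?w 0 2, ?w 0 3, ?w 1 2, ?w 1 3, ?w 2 3]) x y"
  proof -
    have c: "vec_of [?w 0 1, ?w 0 2, ?w 0 3, ?w 1 2, ?w 1 3, ?w 2 3] 0 = ?w 0 1"
      "vec_of [?w 0 1, ?w 0 2, ?w 0 3, ?w 1 2, ?w 1 3, ?w 2 3] 1 = ?w 0 2"
      "vec_of [?w 0 1, ?w 0 2, ?w 0 3, ?w 1 2, ?w 1 3, ?w 2 3] 2 = ?w 0 3"
      "vec_of [?w 0 1, ?w 0 2, ?w 0 3, ?w 1 2, ?w 1 3, ?w 2 3] 3 = ?w 1 2"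
      "vec_of [?w 0 1, ?w 0 2, ?w 0 3, ?w 1 2, ?w 1 3, ?w 2 3] 4 = ?w 1 3"
      "vec_of [?w 0 1, ?w 0 2, ?w 0 3, ?w 1 2, ?w 1 3, ?w 2 3] 5 = ?w 2 3"
      by (simp_all add: vec_of_nth vec_of_nth_45)
    show ?thesis unfolding form4_def c a s by (simp add: algebra_simps del: One_nat_def)
  qed
  finally show ?thesis .
qed

text \<open>A missing second coordinate counts as the zero form, so \<open>m = 1\<close> and
  \<open>m = 2\<close> are treated alike. \<open>M\<close> negates the saturated pencil, hence its
  rational combinations, hence \<open>\<omega>\<close>; so \<open>B = -1\<close> works whatever the
  saturation has added.\<close>

lemma ex_admissible_4:
  assumes alt: "alternating_on 4 \<omega>" and nd: "nondegenerate_on 4 \<omega>" and m: "m \<le> 2"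
    and cl: "\<And>x y. x \<in> int_vecs 4 \<Longrightarrow> y \<in> int_vecs 4 \<Longrightarrow> \<omega> x y \<in> int_vecs m"
  shows "\<exists>A B. admissible_pair 4 m \<omega> A B"
proof -
  define c where "c k = vec_of [\<omega> (unit_vec 0) (unit_vec 1) k, \<omega> (unit_vec 0) (unit_vec 2) k, \<omega> (unit_vec 0) (unit_vec 3) k,
    \<omega> (unit_vec 1) (unit_vec 2) k, \<omega> (unit_vec 1) (unit_vec 3) k, \<omega> (unit_vec 2) (unit_vec 3) k]" for k
  have c: "\<omega> x y k = form4 (c k) x y" if "x \<in> int_vecs 4" "y \<in> int_vecs 4" for x y k
    unfolding c_def by (rule alternating_4[OF alt that])
  have big: "\<omega> x y k = 0" if "x \<in> int_vecs 4" "y \<in> int_vecs 4" "k \<ge> 2" for x y k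
    using cl[OF that(1,2)] that(3) m by (auto simp: int_vecs_def)
  have om0: "\<omega> x y = 0 \<longleftrightarrow> form4 (c 0) x y = 0 \<and> form4 (c 1) x y = 0" if "x \<in> int_vecs 4" "y \<in> int_vecs 4" for x y
  proof
    assume "\<omega> x y = 0"
    then show "form4 (c 0) x y = 0 \<and> form4 (c 1) x y = 0" using c[OF that] by (metis zero_fun_apply)
  next
    assume z: "form4 (c 0) x y = 0 \<and> form4 (c 1) x y = 0"
    have "\<omega> x y k = 0" for k
    proof (cases "k < 2")
      case True
      then show ?thesis using z c[OF that, of k] by (auto simp: less_2_cases_iff)
    next
      case False
      then show ?thesis using big[OF that] by simp
    qed
    then show "\<omega> x y = 0" by (simp add: fun_eq_iff vec_apply)
  qed
  have rad: "x = 0" if "x \<in> int_vecs 4" "\<And>y. form4 (c 0) x y = 0" "\<And>y. form4 (c 1) x y = 0" for x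
    using nd that by (simp add: nondegenerate_on_def om0)
  have "c 0 \<noteq> 0 \<or> c 1 \<noteq> 0"
  proof (rule ccontr)
    assume "\<not> ?thesis"
    then have "unit_vec 0 = (0 :: nat \<Rightarrow> int)" by (intro rad) (simp_all add: form4_def vec_apply)
    from fun_cong[OF this, of 0] show False by (simp add: unit_vec_def vec_apply)
  qed
  moreover have "c k \<in> int_vecs 6" for k by (simp add: c_def)
  ultimately have "\<exists>a' b'. spanned_by a' b' (c 0) (c 1) \<and>
    (\<forall>p s t. int_prime p \<longrightarrow> (\<forall>i<6. p dvd s * a' i + t * b' i) \<longrightarrow> p dvd s \<and> p dvd t)"
    by (intro ex_saturated_pencil)
  then obtain a b where sp: "spanned_by a b (c 0) (c 1)"
    and ind: "\<forall>p s t. int_prime p \<longrightarrow> (\<forall>i<6. p dvd s * a i + t * b i) \<longrightarrow> p dvd s \<and> p dvd t" by (elim exE conjE)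
  obtain d s t u v where d: "d \<noteq> 0" "smul d (c 0) = pencil a b s t" "smul d (c 1) = pencil a b u v"
    using sp unfolding spanned_by_def by (elim exE conjE)
  have scale: "form4 (smul d e) x y = d * form4 e x y" for d e x y
    by (simp add: form4_def smul_def algebra_simps)
  have dc: "d * form4 (c 0) x y = s * form4 a x y + t * form4 b x y" "d * form4 (c 1) x y = u * form4 a x y + v * form4 b x y" for x y
    by (simp_all only: scale[symmetric] d form4_pencil)
  have "x = 0" if "x \<in> int_vecs 4" "\<forall>y\<in>int_vecs 4. pair_form a b x y = 0" for x
  proof -
    have "form4 (c 0) x y = 0" "form4 (c 1) x y = 0" if "y \<in> int_vecs 4" for y
      using dc[of x y] d(1) \<open>\<forall>y\<in>int_vecs 4. pair_form a b x y = 0\<close> that by (simp_all add: pair_form_zero_iff)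
    then show ?thesis using nd that(1) by (simp add: nondegenerate_on_def om0)
  qed
  then have nd': "nondegenerate_on 4 (pair_form a b)" by (simp add: nondegenerate_on_def)
  have "\<exists>i<6. a i \<noteq> 0"
  proof (rule ccontr)
    assume "\<not> ?thesis"
    then show False using ind[rule_format, of 2 1 0] by simp
  qed
  from ex_nonzero_pfaffian[OF nd' this] have pf: "\<exists>s t. pfaffian (pencil a b s t) \<noteq> 0" .
  interpret primitive_pencil a b
  proof (unfold_locales, goal_cases)
    case (1 p s t)
    from 1(2) have "\<forall>i<6. p dvd s * a i + t * b i" by simp
    then show ?case by (rule ind[THEN spec, THEN spec, THEN spec, THEN mp, THEN mp, OF 1(1)])
  next
    case 2
    show ?case by (rule pf)
  qed
  obtain M where M: "admissible_pair 4 2 (pair_form a b) M uminus" using ex_antisymplectic[OF nd'] by (elim exE)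
  have Min: "M x \<in> int_vecs 4" if "x \<in> int_vecs 4" for x
    using M that bij_betw_apply unfolding admissible_pair_def by metis
  have "\<omega> (M x) (M y) = - \<omega> x y" if xy: "x \<in> int_vecs 4" "y \<in> int_vecs 4" for x y
  proof
    fix k
    have "pair_form a b (M x) (M y) = - pair_form a b x y" using M xy by (simp add: admissible_pair_def)
    then have "pair_form a b (M x) (M y) i = - pair_form a b x y i" for i by (simp add: vec_apply)
    from this[of 0] this[of 1] have "form4 a (M x) (M y) = - form4 a x y" "form4 b (M x) (M y) = - form4 b x y"
      by (simp_all add: pair_form_def vec_of_nth)
    then have "d * form4 (c 0) (M x) (M y) = d * (- form4 (c 0) x y)" "d * form4 (c 1) (M x) (M y) = d * (- form4 (c 1) x y)"
      using dc[of "M x" "M y"] dc[of x y] by simp_all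
    then have f: "form4 (c 0) (M x) (M y) = - form4 (c 0) x y" "form4 (c 1) (M x) (M y) = - form4 (c 1) x y"
      using d(1) by (simp_all only: mult_cancel_left) simp_all
    show "\<omega> (M x) (M y) k = (- \<omega> x y) k"
    proof (cases "k < 2")
      case True
      then show ?thesis using f c[OF xy, of k] c[OF Min[OF xy(1)] Min[OF xy(2)], of k] by (auto simp: less_2_cases_iff vec_apply)
    next
      case False
      then show ?thesis using big[OF xy] big[OF Min[OF xy(1)] Min[OF xy(2)]] by (simp add: vec_apply)
    qed
  qed
  then show ?thesis using M neg_admissible[of m] unfolding admissible_pair_def
    by (intro exI[of _ M] exI[of _ uminus]) simp
qed

text \<open>The Pfaffians of the five principal minors are the coordinates of a radical vector. If they all
  vanish, the form has rank two and every triple of basis vectors yields a radical vector.\<close>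
lemma skew_5_singular:
  fixes w01 w02 w03 w04 w12 w13 w14 w23 w24 w34 :: int
  assumes rad: "\<And>x0 x1 x2 x3 x4. - (x1 * w01) - x2 * w02 - x3 * w03 - x4 * w04 = 0 \<Longrightarrow>
      x0 * w01 - x2 * w12 - x3 * w13 - x4 * w14 = 0 \<Longrightarrow> x0 * w02 + x1 * w12 - x3 * w23 - x4 * w24 = 0 \<Longrightarrow>
      x0 * w03 + x1 * w13 + x2 * w23 - x4 * w34 = 0 \<Longrightarrow> x0 * w04 + x1 * w14 + x2 * w24 + x3 * w34 = 0 \<Longrightarrow>
      x0 = 0 \<and> x1 = 0 \<and> x2 = 0 \<and> x3 = 0 \<and> x4 = 0"
  shows False
proof -
  have r: "w12 * w34 - w13 * w24 + w14 * w23 = 0 \<and> - (w02 * w34 - w03 * w24 + w04 * w23) = 0 \<and>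
      w01 * w34 - w03 * w14 + w04 * w13 = 0 \<and> - (w01 * w24 - w02 * w14 + w04 * w12) = 0 \<and>
      w01 * w23 - w02 * w13 + w03 * w12 = 0"
    by (rule rad) (simp_all add: algebra_simps)
  then have P: "w12 * w34 - w13 * w24 + w14 * w23 = 0" "w02 * w34 - w03 * w24 + w04 * w23 = 0"
      "w01 * w34 - w03 * w14 + w04 * w13 = 0" "w01 * w24 - w02 * w14 + w04 * w12 = 0"
      "w01 * w23 - w02 * w13 + w03 * w12 = 0" by linarith+
  have "w12 = 0 \<and> - w02 = 0 \<and> w01 = 0 \<and> (0::int) = 0 \<and> (0::int) = 0"
    by (rule rad) (use P in \<open>simp_all add: algebra_simps\<close>)
  then have z: "w12 = 0" "w02 = 0" "w01 = 0" by simp_all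
  have "w34 = 0 \<and> (0::int) = 0 \<and> (0::int) = 0 \<and> - w04 = 0 \<and> w03 = 0"
    by (rule rad) (use P z in \<open>simp_all add: algebra_simps\<close>)
  then have z2: "w34 = 0" "w04 = 0" "w03 = 0" by simp_all
  have "(0::int) = 0 \<and> - w23 = 0 \<and> w13 = 0 \<and> - w12 = 0 \<and> (0::int) = 0"
    by (rule rad) (use P z z2 in \<open>simp_all add: algebra_simps\<close>)
  then have z3: "w23 = 0" "w13 = 0" by simp_all
  have "(0::int) = 0 \<and> - w24 = 0 \<and> w14 = 0 \<and> (0::int) = 0 \<and> - w12 = 0"
    by (rule rad) (use P z z2 z3 in \<open>simp_all add: algebra_simps\<close>)
  then have z4: "w24 = 0" "w14 = 0" by simp_all
  have "(1::int) = 0 \<and> (0::int) = 0 \<and> (0::int) = 0 \<and> (0::int) = 0 \<and> (0::int) = 0"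
    by (rule rad) (simp_all add: z z2 z3 z4)
  then show False by simp
qed

lemma not_nondegenerate_5:
  assumes alt: "alternating_on 5 \<omega>" and nd: "nondegenerate_on 5 \<omega>"
    and cl: "\<And>x y. x \<in> int_vecs 5 \<Longrightarrow> y \<in> int_vecs 5 \<Longrightarrow> \<omega> x y \<in> int_vecs 1"
  shows False
proof -
  define w where "w i j = \<omega> (unit_vec i) (unit_vec j) 0" for i j
  have w0: "w i i = 0" if "i < 5" for i using alternating_on_unit(1)[OF alt that that] by (simp add: w_def)
  have ws: "w j i = - w i j" if "i < 5" "j < 5" for i j using alternating_on_unit(2)[OF alt that] by (simp add: w_def)
  have bi: "biadditive_on (int_vecs 5) \<omega>" using alt by (simp add: alternating_on_def)
  have set5: "{..<5::nat} = {0, 1, 2, 3, 4}" by auto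
  have rad: "x = 0" if x: "x \<in> int_vecs 5"
    and z: "\<And>l. l < 5 \<Longrightarrow> x 0 * w 0 l + x 1 * w 1 l + x 2 * w 2 l + x 3 * w 3 l + x 4 * w 4 l = 0" for x
  proof -
    have "\<omega> x (unit_vec l) = 0" if l: "l < 5" for l
    proof (rule int_vecs_eqI[of _ 1])
      show "\<omega> x (unit_vec l) \<in> int_vecs 1" using x l by (intro cl) simp_all
      have ad: "additive_on (int_vecs 5) (\<lambda>x. \<omega> x (unit_vec l))" using bi l by (simp add: biadditive_on_def)
      have "\<omega> x (unit_vec l) 0 = (\<Sum>i<5. x i * w i l)"
        using fun_cong[OF additive_on_expand[OF ad x], of 0] by (simp add: lin_comb_def w_def)
      also have "\<dots> = 0" using z[OF l] by (simp add: set5 add.assoc)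
      finally show "\<omega> x (unit_vec l) i = 0 i" if "i < 1" for i using that by (simp add: vec_apply)
    qed simp
    then have "\<omega> x y = 0" if "y \<in> int_vecs 5" for y
      using additive_on_expand[of 5 "\<omega> x" y] bi x that
      by (simp add: biadditive_on_def lin_comb_def fun_eq_iff vec_apply)
    then show ?thesis using nd x by (simp add: nondegenerate_on_def)
  qed
  have n5: "vec_of [x0, x1, x2, x3, x4] 4 = x4" for x0 x1 x2 x3 x4 by (simp add: vec_of_nth_45)
  show False
  proof (rule skew_5_singular[of "w 0 1" "w 0 2" "w 0 3" "w 0 4" "w 1 2" "w 1 3" "w 1 4" "w 2 3" "w 2 4" "w 3 4"])
    fix x0 x1 x2 x3 x4
    assume e: "- (x1 * w 0 1) - x2 * w 0 2 - x3 * w 0 3 - x4 * w 0 4 = 0"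
      "x0 * w 0 1 - x2 * w 1 2 - x3 * w 1 3 - x4 * w 1 4 = 0" "x0 * w 0 2 + x1 * w 1 2 - x3 * w 2 3 - x4 * w 2 4 = 0"
      "x0 * w 0 3 + x1 * w 1 3 + x2 * w 2 3 - x4 * w 3 4 = 0" "x0 * w 0 4 + x1 * w 1 4 + x2 * w 2 4 + x3 * w 3 4 = 0"
    let ?x = "vec_of [x0, x1, x2, x3, x4]"
    have s: "w 1 0 = - w 0 1" "w 2 0 = - w 0 2" "w 3 0 = - w 0 3" "w 4 0 = - w 0 4" "w 2 1 = - w 1 2" "w 3 1 = - w 1 3"
      "w 4 1 = - w 1 4" "w 3 2 = - w 2 3" "w 4 2 = - w 2 4" "w 4 3 = - w 3 4"
      by (rule ws; simp)+
    have d: "w 0 0 = 0" "w 1 1 = 0" "w 2 2 = 0" "w 3 3 = 0" "w 4 4 = 0" by (rule w0; simp)+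
    have v: "?x 0 = x0" "?x 1 = x1" "?x 2 = x2" "?x 3 = x3" "?x 4 = x4" by (simp_all add: vec_of_nth n5)
    have "?x = 0"
    proof (rule rad)
      fix l :: nat assume "l < 5"
      then have "l = 0 \<or> l = 1 \<or> l = 2 \<or> l = 3 \<or> l = 4" by auto
      then show "?x 0 * w 0 l + ?x 1 * w 1 l + ?x 2 * w 2 l + ?x 3 * w 3 l + ?x 4 * w 4 l = 0"
        unfolding v using e by (elim disjE; simp add: s d del: One_nat_def)
    qed simp
    then show "x0 = 0 \<and> x1 = 0 \<and> x2 = 0 \<and> x3 = 0 \<and> x4 = 0" using v by (simp only: zero_fun_apply)
  qed
qed

theorem ex_admissible_pair:
  assumes alt: "alternating_on n \<omega>" and nd: "nondegenerate_on n \<omega>"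
    and cl: "\<And>x y. x \<in> int_vecs n \<Longrightarrow> y \<in> int_vecs n \<Longrightarrow> \<omega> x y \<in> int_vecs m"
    and nz: "x0 \<in> int_vecs n" "y0 \<in> int_vecs n" "\<omega> x0 y0 \<noteq> 0" and nm: "n + m \<le> 6"
  shows "\<exists>A B. admissible_pair n m \<omega> A B"
proof -
  have "m \<noteq> 0" using cl[OF nz(1,2)] nz(3) by (auto simp: int_vecs_0)
  moreover have "n \<noteq> 0"
  proof
    assume "n = 0"
    then have "x0 = 0" "y0 = 0" using nz by (simp_all add: int_vecs_0)
    then show False using alt nz(3) by (simp add: alternating_on_def)
  qed
  moreover have "n \<noteq> 1"
  proof
    assume n: "n = 1"
    have "\<omega> x0 y0 k = 0" for k
      using biadditive_on_expand[of 1 \<omega> x0 y0 k] alternating_on_unit(1)[of 1 \<omega> 0 0 k] alt nz n by (simp add: alternating_on_def)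
    then show False using nz(3) by (simp add: fun_eq_iff vec_apply)
  qed
  moreover have "n \<noteq> 5 \<or> m \<noteq> 1" using not_nondegenerate_5 alt nd cl by blast
  ultimately consider "n = 2" | "n = 3" "m \<le> 3" | "n = 4" "m \<le> 2" using nm by linarith
  then show ?thesis
  proof cases
    case 1
    then show ?thesis using ex_admissible_2 alt by simp
  next
    case 2
    then show ?thesis using ex_admissible_3[of \<omega> m] alt nd cl by simp
  next
    case 3
    then show ?thesis using ex_admissible_4[of \<omega> m] alt nd cl by simp
  qed
qed

section \<open>Free abelian groups and central extensions inside nilpotent groups\<close>

text \<open>The ordered product of the powers \<open>g i [^] x i\<close>. In a group of class two
  such products, up to central factors, are the normal form of the elements.\<close>

definition (in monoid) mpow :: "(nat \<Rightarrow> 'a) \<Rightarrow> nat \<Rightarrow> (nat \<Rightarrow> int) \<Rightarrow> 'a" where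
  "mpow g n x = rec_nat \<one> (\<lambda>i p. p \<otimes> g i [^] x i) n"

context group
begin

lemma mpow_0 [simp]: "mpow g 0 x = \<one>"
  and mpow_Suc: "mpow g (Suc n) x = mpow g n x \<otimes> g n [^] x n"
  by (simp_all add: mpow_def)

lemma mpow_closed [simp]: "\<forall>i<n. g i \<in> carrier G \<Longrightarrow> mpow g n x \<in> carrier G"
  by (induction n) (simp_all add: mpow_Suc)

lemma mpow_zero: "\<forall>i<n. g i \<in> carrier G \<Longrightarrow> mpow g n 0 = \<one>"
  by (induction n) (simp_all add: mpow_Suc vec_apply)

lemma mpow_cong: "(\<And>i. i < n \<Longrightarrow> x i = y i) \<Longrightarrow> (\<And>i. i < n \<Longrightarrow> g i = h i) \<Longrightarrow> mpow g n x = mpow h n y"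
  by (induction n) (simp_all add: mpow_Suc)

lemma mpow_subgroup: "subgroup H G \<Longrightarrow> (\<And>i. i < n \<Longrightarrow> g i \<in> H) \<Longrightarrow> mpow g n x \<in> H"
proof (induction n)
  case (Suc n)
  have "g n [^] x n \<in> H" using Suc.prems by (intro subgroup_int_pow_closed) auto
  then show ?case using Suc by (simp add: mpow_Suc subgroup.m_closed)
qed (simp add: subgroup.one_closed)

lemma mpow_hom:
  assumes "h \<in> hom G K" "group K" "\<forall>i<n. g i \<in> carrier G"
  shows "h (mpow g n x) = monoid.mpow K (\<lambda>i. h (g i)) n x"
proof -
  interpret K: group K by fact
  show ?thesis
    using assms(3)
  proof (induction n)
    case 0
    then show ?case using hom_one[OF assms(1)] K.is_group by (simp add: is_group)
  next
    case (Suc n)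
    have "h (mpow g n x \<otimes> g n [^] x n) = h (mpow g n x) \<otimes>\<^bsub>K\<^esub> h (g n [^] x n)"
      using Suc.prems by (intro hom_mult[OF assms(1)]) simp_all
    also have "h (g n [^] x n) = h (g n) [^]\<^bsub>K\<^esub> x n"
      using Suc.prems by (intro hom_int_pow[OF assms(1)]) (simp_all add: is_group K.is_group)
    finally show ?case using Suc by (simp add: mpow_Suc K.mpow_Suc)
  qed
qed

end

context comm_group
begin

lemma mpow_add:
  assumes "\<forall>i<n. g i \<in> carrier G"
  shows "mpow g n (x + y) = mpow g n x \<otimes> mpow g n y"
  using assms
proof (induction n)
  case (Suc n)
  have "g n [^] (x n + y n) = g n [^] x n \<otimes> g n [^] y n" using Suc.prems by (simp add: int_pow_mult)
  then show ?case using Suc by (simp add: mpow_Suc vec_apply m_ac)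
qed simp

lemma mpow_uminus:
  assumes "\<forall>i<n. g i \<in> carrier G"
  shows "mpow g n (- x) = inv (mpow g n x)"
proof -
  have "mpow g n (- x) \<otimes> mpow g n x = \<one>" using mpow_add[OF assms, of "- x" x] mpow_zero[OF assms] by simp
  then show ?thesis using assms by (intro inv_equality[symmetric]) simp_all
qed

lemma mpow_unit_vec:
  assumes "\<forall>i<n. g i \<in> carrier G" "j < n"
  shows "mpow g n (unit_vec j) = g j"
proof -
  have "mpow g k (unit_vec j) = (if j < k then g j else \<one>)" if "k \<le> n" for k
    using that
  proof (induction k)
    case (Suc k)
    then show ?case using assms by (auto simp: mpow_Suc unit_vec_def less_Suc_eq)
  qed simp
  then show ?thesis using assms(2) by simp
qed

lemma generate_eq_mpow:
  assumes "\<forall>i<n. g i \<in> carrier G"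
  shows "generate G (g ` {..<n}) = mpow g n ` int_vecs n"
proof
  have sub: "subgroup (mpow g n ` int_vecs n) G"
  proof (rule subgroupI)
    show "mpow g n ` int_vecs n \<subseteq> carrier G" using assms by auto
    show "mpow g n ` int_vecs n \<noteq> {}" by (metis empty_iff image_is_empty int_vecs_zero)
    fix a assume "a \<in> mpow g n ` int_vecs n"
    then obtain x where x: "x \<in> int_vecs n" "a = mpow g n x" by auto
    show "inv a \<in> mpow g n ` int_vecs n" using x mpow_uminus[OF assms, of x] by (intro image_eqI[of _ _ "- x"]) simp_all
    fix b assume "b \<in> mpow g n ` int_vecs n"
    then obtain y where y: "y \<in> int_vecs n" "b = mpow g n y" by auto
    show "a \<otimes> b \<in> mpow g n ` int_vecs n" using x y mpow_add[OF assms, of x y] by (intro image_eqI[of _ _ "x + y"]) simp_all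
  qed
  show "generate G (g ` {..<n}) \<subseteq> mpow g n ` int_vecs n"
  proof (rule generate_subgroup_incl[OF _ sub], rule subsetI)
    fix a assume "a \<in> g ` {..<n}"
    then obtain j where "j < n" "a = g j" by auto
    then show "a \<in> mpow g n ` int_vecs n" using mpow_unit_vec[OF assms, of j] by (intro image_eqI[of _ _ "unit_vec j"]) simp_all
  qed
  have c: "g ` {..<n} \<subseteq> carrier G" using assms by auto
  show "mpow g n ` int_vecs n \<subseteq> generate G (g ` {..<n})"
  proof
    fix a assume "a \<in> mpow g n ` int_vecs n"
    then obtain x where "a = mpow g n x" by auto
    then show "a \<in> generate G (g ` {..<n})"
      using mpow_subgroup[OF generate_is_subgroup[OF c], of n g x] by (simp add: generate.incl)
  qed
qed

lemma mpow_finprod: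
  assumes "\<forall>i<n. g i \<in> carrier G"
  shows "mpow g n x = (\<Otimes>i\<in>{..<n}. g i [^] x i)"
  using assms
proof (induction n)
  case (Suc n)
  have "(\<Otimes>i\<in>insert n {..<n}. g i [^] x i) = g n [^] x n \<otimes> (\<Otimes>i\<in>{..<n}. g i [^] x i)"
    using Suc.prems by (intro finprod_insert) auto
  then show ?case using Suc by (simp add: mpow_Suc lessThan_Suc m_comm)
qed simp

text \<open>Descent on \<open>\<Sum> \<bar>x i\<bar>\<close>: as long as a relation among minimally many generators involves two of
  them, a Nielsen transformation of the generators shortens it.\<close>
lemma minimal_generators_independent:
  assumes g: "\<forall>i<n. g i \<in> carrier G" "generate G (g ` {..<n}) = carrier G"
    and minimal: "\<And>S. finite S \<Longrightarrow> S \<subseteq> carrier G \<Longrightarrow> generate G S = carrier G \<Longrightarrow> n \<le> card S"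
    and tf: "torsion_free G"
    and x: "x \<in> int_vecs n" "mpow g n x = \<one>"
  shows "x = 0"
  using g x
proof (induction "nat (\<Sum>i<n. \<bar>x i\<bar>)" arbitrary: g x rule: less_induct)
  case less
  note g = less.prems(1,2) and x = less.prems(3,4)
  show ?case
  proof (rule ccontr)
    assume "x \<noteq> 0"
    then obtain i where i: "x i \<noteq> 0" by (auto simp: fun_eq_iff vec_apply)
    then have "i < n" using x(1) by (auto simp: int_vecs_def intro: leI)
    show False
    proof (cases "\<exists>j. j \<noteq> i \<and> x j \<noteq> 0")
      case False
      \<comment> \<open>A relation in a single generator: torsion-freeness makes this generator
        trivial, against the minimality of \<open>n\<close>.\<close>
      have "mpow g n x = (\<Otimes>k\<in>{..<n}. if i = k then g i [^] x i else \<one>)"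
        unfolding mpow_finprod[OF g(1)]
        by (rule finprod_cong') (use g(1) False \<open>i < n\<close> in auto)
      also have "\<dots> = g i [^] x i" using \<open>i < n\<close> g(1) by (subst finprod_singleton) auto
      finally have p: "g i [^] x i = \<one>" using x(2) by simp
      have "g i [^] nat \<bar>x i\<bar> = \<one>"
      proof (cases "x i \<ge> 0")
        case True
        then show ?thesis using p by (simp add: int_pow_int[symmetric])
      next
        case False
        then have "g i [^] (- x i) = \<one>" using p \<open>i < n\<close> g(1) by (simp add: int_pow_neg)
        then show ?thesis using False by (simp add: int_pow_int[symmetric])
      qed
      then have "g i = \<one>" using tf g(1) \<open>i < n\<close> i unfolding torsion_free_def by (metis zero_less_abs_iff zero_less_nat_eq)
      then have "generate G (g ` {..<n}) \<subseteq> generate G (g ` ({..<n} - {i}))"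
      proof -
        have "g ` ({..<n} - {i}) \<subseteq> carrier G" using g(1) by auto
        then have sub: "subgroup (generate G (g ` ({..<n} - {i}))) G" by (rule generate_is_subgroup)
        show ?thesis
        proof (rule generate_subgroup_incl[OF _ sub], rule subsetI)
          fix a assume "a \<in> g ` {..<n}"
          then obtain k where "k < n" "a = g k" by auto
          then show "a \<in> generate G (g ` ({..<n} - {i}))"
            using \<open>g i = \<one>\<close> by (cases "k = i") (auto intro: generate.incl generate.one)
        qed
      qed
      then have "generate G (g ` ({..<n} - {i})) = carrier G"
        using g generate_incl[of "g ` ({..<n} - {i})"] by auto
      then have "n \<le> card (g ` ({..<n} - {i}))" using g(1) by (intro minimal) auto
      also have "\<dots> \<le> card ({..<n} - {i})" by (rule card_image_le) simp
      finally show False using \<open>i < n\<close> by simp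
    next
      case True
      then obtain j where j: "j \<noteq> i" "x j \<noteq> 0" by auto
      then have "j < n" using x(1) by (auto simp: int_vecs_def intro: leI)
      obtain a b where ab: "a \<noteq> b" "a < n" "b < n" "\<bar>x b\<bar> \<le> \<bar>x a\<bar>" "x b \<noteq> 0"
        using i j \<open>i < n\<close> \<open>j < n\<close> that[of i j] that[of j i] by linarith
      \<comment> \<open>With this sign, subtracting \<open>\<epsilon> * x b\<close> shortens
        \<open>x a\<close>. Multiplying \<open>g b\<close> by \<open>g a [^] \<epsilon>\<close>
        compensates, and \<open>x b\<close> stays nonzero, which contradicts the induction
        hypothesis for the new generators.\<close>
      define \<epsilon> where "\<epsilon> = sgn (x a * x b)"
      define h where "h = g(b := g b \<otimes> g a [^] \<epsilon>)"
      define y where "y = x(a := x a - \<epsilon> * x b)"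
      have h: "\<forall>k<n. h k \<in> carrier G" using g(1) ab by (simp add: h_def)
      have "x a \<noteq> 0" using ab by auto
      have lt: "\<bar>x a - \<epsilon> * x b\<bar> < \<bar>x a\<bar>"
        using ab(4,5) \<open>x a \<noteq> 0\<close> unfolding \<epsilon>_def sgn_mult by (auto simp: sgn_if abs_if split: if_splits)
      have "generate G (g ` {..<n}) \<subseteq> generate G (h ` {..<n})"
      proof -
        have "h ` {..<n} \<subseteq> carrier G" using h by auto
        then have sub: "subgroup (generate G (h ` {..<n})) G" by (rule generate_is_subgroup)
        show ?thesis
        proof (rule generate_subgroup_incl[OF _ sub], rule subsetI)
          fix c assume "c \<in> g ` {..<n}"
          then obtain k where k: "k < n" "c = g k" by auto
          have hin: "h l \<in> generate G (h ` {..<n})" if "l < n" for l using that by (simp add: generate.incl)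
          show "c \<in> generate G (h ` {..<n})"
          proof (cases "k = b")
            case True
            have "g b = h b \<otimes> inv (h a [^] \<epsilon>)" using ab g(1) by (simp add: h_def m_assoc)
            moreover have "inv (h a [^] \<epsilon>) \<in> generate G (h ` {..<n})"
              using subgroup.m_inv_closed[OF sub subgroup_int_pow_closed[OF sub hin[OF ab(2)]]] .
            ultimately show ?thesis using True k hin[OF ab(3)] subgroup.m_closed[OF sub] by simp
          next
            case False
            then show ?thesis using k hin[of k] by (simp add: h_def)
          qed
        qed
      qed
      moreover have "generate G (h ` {..<n}) \<subseteq> carrier G" using h by (intro generate_incl) auto
      ultimately have gen: "generate G (h ` {..<n}) = carrier G" using g(2) by auto
      have yin: "y \<in> int_vecs n" using x(1) ab by (auto simp: int_vecs_def y_def)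
      have split: "(\<Otimes>k\<in>{..<n}. f k) = f a \<otimes> (f b \<otimes> (\<Otimes>k\<in>{..<n} - {a} - {b}. f k))" if f: "\<And>k. k < n \<Longrightarrow> f k \<in> carrier G" for f
      proof -
        have "{..<n} = insert a ({..<n} - {a})" "{..<n} - {a} = insert b ({..<n} - {a} - {b})" using ab by auto
        then have "finprod G f {..<n} = f a \<otimes> finprod G f ({..<n} - {a})" "finprod G f ({..<n} - {a}) = f b \<otimes> finprod G f ({..<n} - {a} - {b})"
          using f ab by (metis (no_types, lifting) DiffE Pi_I finite_Diff finite_lessThan finprod_insert insertI1 lessThan_iff)+
        then show ?thesis by simp
      qed
      let ?R = "{..<n} - {a} - {b}"
      have "mpow h n y = h a [^] y a \<otimes> (h b [^] y b \<otimes> (\<Otimes>k\<in>?R. h k [^] y k))"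
        unfolding mpow_finprod[OF h] using h by (intro split) simp
      also have "(\<Otimes>k\<in>?R. h k [^] y k) = (\<Otimes>k\<in>?R. g k [^] x k)"
        using g(1) by (intro finprod_cong') (auto simp: h_def y_def)
      also have "h b [^] y b = g b [^] x b \<otimes> g a [^] (\<epsilon> * x b)"
        using ab g(1) by (simp add: h_def y_def int_pow_distrib int_pow_pow)
      also have "h a [^] y a = g a [^] x a \<otimes> inv (g a [^] (\<epsilon> * x b))"
        using ab g(1) by (simp add: h_def y_def int_pow_diff)
      also have "g a [^] x a \<otimes> inv (g a [^] (\<epsilon> * x b)) \<otimes> (g b [^] x b \<otimes> g a [^] (\<epsilon> * x b) \<otimes> (\<Otimes>k\<in>?R. g k [^] x k))
          = g a [^] x a \<otimes> (g b [^] x b \<otimes> (\<Otimes>k\<in>?R. g k [^] x k))"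
      proof -
        have c: "g a \<in> carrier G" "g b \<in> carrier G" "(\<Otimes>k\<in>?R. g k [^] x k) \<in> carrier G"
          using g(1) ab by (auto intro!: finprod_closed)
        have cancel: "inv u \<otimes> (v \<otimes> (u \<otimes> w)) = v \<otimes> w" if "u \<in> carrier G" "v \<in> carrier G" "w \<in> carrier G" for u v w
          using that by (metis inv_closed inv_solve_left' m_closed m_lcomm)
        show ?thesis using c by (simp add: m_assoc cancel)
      qed
      also have "\<dots> = mpow g n x"
        unfolding mpow_finprod[OF g(1)] using g(1) by (intro split[symmetric]) simp
      finally have "mpow h n y = \<one>" using x(2) by simp
      moreover have "nat (\<Sum>k<n. \<bar>y k\<bar>) < nat (\<Sum>k<n. \<bar>x k\<bar>)"
      proof -
        have "(\<Sum>k<n. \<bar>y k\<bar>) < (\<Sum>k<n. \<bar>x k\<bar>)"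
        proof (rule sum_strict_mono_ex1)
          show "\<forall>k\<in>{..<n}. \<bar>y k\<bar> \<le> \<bar>x k\<bar>" using lt by (simp add: y_def)
          show "\<exists>k\<in>{..<n}. \<bar>y k\<bar> < \<bar>x k\<bar>" using lt ab by (intro bexI[of _ a]) (simp_all add: y_def)
        qed simp
        moreover have "0 \<le> (\<Sum>k<n. \<bar>y k\<bar>)" by (simp add: sum_nonneg)
        ultimately show ?thesis by linarith
      qed
      ultimately have "y = 0" using less.hyps[of y h] h gen yin by simp
      then have "y b = 0" by (simp add: vec_apply)
      then show False using ab by (simp add: y_def)
    qed
  qed
qed

text \<open>A generating set of least cardinality is a basis.\<close>

theorem finitely_generated_torsion_free_basis:
  assumes "finitely_generated G" and tf: "torsion_free G"
  shows "\<exists>n g. (\<forall>i<n. g i \<in> carrier G) \<and> bij_betw (mpow g n) (int_vecs n) (carrier G)"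
proof -
  define P where "P n \<longleftrightarrow> (\<exists>S. finite S \<and> S \<subseteq> carrier G \<and> generate G S = carrier G \<and> card S = n)" for n
  have "\<exists>n. P n" using assms(1) by (auto simp: finitely_generated_def P_def)
  then have "P (LEAST n. P n)" by (rule LeastI_ex)
  then obtain n S where S: "finite S" "S \<subseteq> carrier G" "generate G S = carrier G" "card S = n" "n = (LEAST n. P n)"
    by (auto simp: P_def)
  obtain g where g: "bij_betw g {0..<n} S" using ex_bij_betw_nat_finite[OF S(1)] S(4) by auto
  have gS: "g ` {..<n} = S" using bij_betw_imp_surj_on[OF g] by (simp add: lessThan_atLeast0)
  have gc: "\<forall>i<n. g i \<in> carrier G" using gS S(2) by auto
  have min: "n \<le> card T" if "finite T" "T \<subseteq> carrier G" "generate G T = carrier G" for T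
    unfolding S(5) by (rule Least_le) (use that in \<open>auto simp: P_def\<close>)
  have "inj_on (mpow g n) (int_vecs n)"
  proof (rule inj_onI)
    fix x y assume xy: "x \<in> int_vecs n" "y \<in> int_vecs n" "mpow g n x = mpow g n y"
    have "mpow g n (x + - y) = mpow g n x \<otimes> inv (mpow g n y)"
      by (simp only: mpow_add[OF gc] mpow_uminus[OF gc])
    also have "\<dots> = \<one>" using xy(3) gc by simp
    finally have one: "mpow g n (x + - y) = \<one>" .
    have "x + - y = 0"
    proof (rule minimal_generators_independent[OF gc])
      show "generate G (g ` {..<n}) = carrier G" using gS S(3) by simp
      show "n \<le> card T" if "finite T" "T \<subseteq> carrier G" "generate G T = carrier G" for T using min that by simp
      show "x + - y \<in> int_vecs n" using xy by simp
    qed (rule tf, rule one)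
    then show "x = y" by simp
  qed
  moreover have "mpow g n ` int_vecs n = carrier G" using generate_eq_mpow[OF gc] gS S(3) by simp
  ultimately show ?thesis using gc by (intro exI[of _ n] exI[of _ g]) (simp add: bij_betw_def)
qed

end

section \<open>Groups of class two\<close>

definition (in monoid) centre :: "'a set" where
  "centre = {z \<in> carrier G. \<forall>x\<in>carrier G. z \<otimes> x = x \<otimes> z}"

definition (in monoid) commutator :: "'a \<Rightarrow> 'a \<Rightarrow> 'a" where
  "commutator a b = a \<otimes> b \<otimes> inv a \<otimes> inv b"

context group
begin

lemma centreI: "z \<in> carrier G \<Longrightarrow> (\<And>x. x \<in> carrier G \<Longrightarrow> z \<otimes> x = x \<otimes> z) \<Longrightarrow> z \<in> centre"
  by (simp add: centre_def)

lemma centre_closed [simp]: "z \<in> centre \<Longrightarrow> z \<in> carrier G"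
  and centre_comm: "z \<in> centre \<Longrightarrow> x \<in> carrier G \<Longrightarrow> z \<otimes> x = x \<otimes> z"
  by (simp_all add: centre_def)

lemma centre_left_comm: "z \<in> centre \<Longrightarrow> x \<in> carrier G \<Longrightarrow> y \<in> carrier G \<Longrightarrow> x \<otimes> (z \<otimes> y) = z \<otimes> (x \<otimes> y)"
proof -
  assume a: "z \<in> centre" "x \<in> carrier G" "y \<in> carrier G"
  have "x \<otimes> (z \<otimes> y) = (x \<otimes> z) \<otimes> y" using a by (simp add: m_assoc)
  also have "x \<otimes> z = z \<otimes> x" using centre_comm[OF a(1,2)] by simp
  also have "z \<otimes> x \<otimes> y = z \<otimes> (x \<otimes> y)" using a by (simp add: m_assoc)
  finally show ?thesis .
qed

lemma centre_subgroup: "subgroup centre G"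
proof (rule subgroupI)
  show "centre \<subseteq> carrier G" by (rule subsetI) simp
  have "\<one> \<in> centre" by (rule centreI) simp_all
  then show "centre \<noteq> {}" using empty_iff by metis
  fix a assume a: "a \<in> centre"
  show "inv a \<in> centre"
  proof (rule centreI)
    fix x assume x: "x \<in> carrier G"
    have "inv (inv x \<otimes> a) = inv (a \<otimes> inv x)" using a x centre_comm[of a "inv x"] by simp
    then show "inv a \<otimes> x = x \<otimes> inv a" using a x by (simp add: inv_mult_group)
  qed (use a in simp)
  fix b assume b: "b \<in> centre"
  show "a \<otimes> b \<in> centre"
  proof (rule centreI)
    fix x assume x: "x \<in> carrier G"
    show "a \<otimes> b \<otimes> x = x \<otimes> (a \<otimes> b)"
      using a b x centre_comm[of b x] centre_left_comm[of a x b] by (simp add: m_assoc)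
  qed (use a b in simp)
qed

lemma centre_normal: "centre \<lhd> G"
proof (rule normal_invI[OF centre_subgroup])
  fix x h assume "x \<in> carrier G" "h \<in> centre"
  then have "x \<otimes> h \<otimes> inv x = h \<otimes> x \<otimes> inv x" using centre_comm[of h x] by simp
  also have "\<dots> = h" using \<open>x \<in> carrier G\<close> \<open>h \<in> centre\<close> by (simp add: m_assoc)
  finally show "x \<otimes> h \<otimes> inv x \<in> centre" using \<open>h \<in> centre\<close> by simp
qed

lemma commutator_closed [simp]: "a \<in> carrier G \<Longrightarrow> b \<in> carrier G \<Longrightarrow> commutator a b \<in> carrier G"
  by (simp add: commutator_def)

lemma commutator_mult: "a \<in> carrier G \<Longrightarrow> b \<in> carrier G \<Longrightarrow> commutator a b \<otimes> (b \<otimes> a) = a \<otimes> b"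
proof -
  assume ab: "a \<in> carrier G" "b \<in> carrier G"
  have "inv b \<otimes> (b \<otimes> a) = a" using ab by (simp add: m_assoc[symmetric])
  then show ?thesis using ab by (simp add: commutator_def m_assoc)
qed

lemma commutator_mult_assoc:
  assumes "a \<in> carrier G" "b \<in> carrier G" "c \<in> carrier G"
  shows "commutator a b \<otimes> (b \<otimes> (a \<otimes> c)) = a \<otimes> (b \<otimes> c)"
proof -
  have "commutator a b \<otimes> (b \<otimes> (a \<otimes> c)) = commutator a b \<otimes> (b \<otimes> a) \<otimes> c" using assms by (simp add: m_assoc)
  then show ?thesis using assms by (simp add: commutator_mult m_assoc)
qed

lemma commutator_unique:
  assumes "a \<in> carrier G" "b \<in> carrier G" "c \<in> carrier G" "c \<otimes> (b \<otimes> a) = a \<otimes> b"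
  shows "commutator a b = c"
proof -
  have "commutator a b \<otimes> (b \<otimes> a) = c \<otimes> (b \<otimes> a)" using assms(4) commutator_mult[OF assms(1,2)] by simp
  then show ?thesis using assms right_cancel[of "b \<otimes> a" "commutator a b" c] by simp
qed

lemma commutator_one_iff: "a \<in> carrier G \<Longrightarrow> b \<in> carrier G \<Longrightarrow> commutator a b = \<one> \<longleftrightarrow> a \<otimes> b = b \<otimes> a"
  using commutator_mult[of a b] commutator_unique[of a b \<one>] by auto

lemma two_step_nilpotent_commutator:
  assumes "two_step_nilpotent G" "a \<in> carrier G" "b \<in> carrier G"
  shows "commutator a b \<in> centre"
proof (rule centreI)
  have three: "lower_central G 3 = commutator_subgroup G (lower_central G 2) (carrier G)"
    and two: "lower_central G 2 = commutator_subgroup G (carrier G) (carrier G)"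
    by (simp_all add: eval_nat_numeral)
  have c2: "commutator a b \<in> lower_central G 2"
    unfolding two commutator_subgroup_def commutator_def using assms by (intro generate.incl) auto
  fix x assume x: "x \<in> carrier G"
  have "commutator (commutator a b) x \<in> lower_central G 3"
    unfolding three commutator_subgroup_def commutator_def[of "commutator a b" x] using c2 x by (intro generate.incl) auto
  then have "commutator (commutator a b) x = \<one>" using assms(1) by (simp add: two_step_nilpotent_def)
  then show "commutator a b \<otimes> x = x \<otimes> commutator a b" using commutator_one_iff[of "commutator a b" x] assms(2,3) x by simp
qed (use assms in simp)

lemma two_step_nilpotent_nonabelian:
  assumes "two_step_nilpotent G"
  shows "\<exists>a\<in>carrier G. \<exists>b\<in>carrier G. commutator a b \<noteq> \<one>"
proof (rule ccontr)
  assume "\<not> ?thesis"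
  then have all: "commutator a b = \<one>" if "a \<in> carrier G" "b \<in> carrier G" for a b using that by blast
  have "lower_central G 2 = commutator_subgroup G (carrier G) (carrier G)" by (simp add: eval_nat_numeral)
  also have "(\<Union>h\<in>carrier G. \<Union>k\<in>carrier G. {h \<otimes> k \<otimes> inv h \<otimes> inv k}) = {\<one>}"
    using all by (auto simp: commutator_def)
  then have "commutator_subgroup G (carrier G) (carrier G) = generate G {\<one>}" by (simp add: commutator_subgroup_def)
  finally have "lower_central G 2 = {\<one>}" by (simp add: generate_one)
  then show False using assms by (simp add: two_step_nilpotent_def)
qed

end

locale class_two = group G for G (structure) +
  assumes commutator_central: "a \<in> carrier G \<Longrightarrow> b \<in> carrier G \<Longrightarrow> commutator a b \<in> centre"
begin

lemma commutator_mult_left: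
  assumes "a \<in> carrier G" "b \<in> carrier G" "c \<in> carrier G"
  shows "commutator (a \<otimes> b) c = commutator a c \<otimes> commutator b c"
proof (rule commutator_unique)
  have "commutator a c \<otimes> commutator b c \<otimes> (c \<otimes> (a \<otimes> b)) = commutator b c \<otimes> (commutator a c \<otimes> (c \<otimes> a)) \<otimes> b"
    using assms centre_comm[OF commutator_central[of b c], of "commutator a c"] by (simp add: m_assoc[symmetric])
  also have "\<dots> = a \<otimes> (commutator b c \<otimes> (c \<otimes> b))"
    using assms centre_left_comm[OF commutator_central[of b c], of a "c \<otimes> b"] by (simp add: commutator_mult m_assoc)
  also have "\<dots> = a \<otimes> b \<otimes> c" using assms by (simp add: commutator_mult m_assoc)
  finally show "commutator a c \<otimes> commutator b c \<otimes> (c \<otimes> (a \<otimes> b)) = a \<otimes> b \<otimes> c" .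
qed (use assms in simp_all)

lemma commutator_mult_right:
  assumes "a \<in> carrier G" "b \<in> carrier G" "c \<in> carrier G"
  shows "commutator a (b \<otimes> c) = commutator a b \<otimes> commutator a c"
proof (rule commutator_unique)
  have "commutator a b \<otimes> commutator a c \<otimes> (b \<otimes> c \<otimes> a) = commutator a b \<otimes> (b \<otimes> (commutator a c \<otimes> (c \<otimes> a)))"
    using assms centre_left_comm[OF commutator_central[of a c], of b "c \<otimes> a"] by (simp add: m_assoc)
  also have "\<dots> = a \<otimes> (b \<otimes> c)" using assms by (simp add: commutator_mult commutator_mult_assoc)
  finally show "commutator a b \<otimes> commutator a c \<otimes> (b \<otimes> c \<otimes> a) = a \<otimes> (b \<otimes> c)" .
qed (use assms in simp_all)

lemma commutator_hom: "a \<in> carrier G \<Longrightarrow> (\<lambda>b. commutator b a) \<in> hom G G" "a \<in> carrier G \<Longrightarrow> commutator a \<in> hom G G"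
  by (auto intro!: homI simp: commutator_mult_left commutator_mult_right)

lemma commutator_pow_left: "a \<in> carrier G \<Longrightarrow> b \<in> carrier G \<Longrightarrow> commutator (a [^] (k::int)) b = commutator a b [^] k"
  using hom_int_pow[OF commutator_hom(1)[of b], of a k] by (simp add: is_group)

lemma commutator_mpow_right:
  "a \<in> carrier G \<Longrightarrow> \<forall>i<n. g i \<in> carrier G \<Longrightarrow> commutator a (mpow g n y) = mpow (\<lambda>i. commutator a (g i)) n y"
  using mpow_hom[OF commutator_hom(2), of a n g y] by (simp add: is_group)

lemma commutator_centre:
  assumes "z \<in> centre" "a \<in> carrier G"
  shows "commutator z a = \<one>" "commutator a z = \<one>"
  using assms centre_comm[OF assms] commutator_one_iff[of z a] commutator_one_iff[of a z] by simp_all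

text \<open>The cost of collecting two ordered products into one: each \<open>g i [^] x i\<close>
  has to pass the factors of the second product with smaller index.\<close>

definition cocycle :: "(nat \<Rightarrow> 'a) \<Rightarrow> nat \<Rightarrow> (nat \<Rightarrow> int) \<Rightarrow> (nat \<Rightarrow> int) \<Rightarrow> 'a" where
  "cocycle g n x y = rec_nat \<one> (\<lambda>i c. c \<otimes> commutator (g i [^] x i) (mpow g i y)) n"

lemma cocycle_0 [simp]: "cocycle g 0 x y = \<one>"
  and cocycle_Suc: "cocycle g (Suc n) x y = cocycle g n x y \<otimes> commutator (g n [^] x n) (mpow g n y)"
  by (simp_all add: cocycle_def)

lemma cocycle_in:
  assumes "\<forall>i<n. g i \<in> carrier G" "subgroup H G" "\<forall>i<n. \<forall>j<n. commutator (g i) (g j) \<in> H"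
  shows "cocycle g n x y \<in> H"
  using assms(1,3)
proof (induction n)
  case 0
  then show ?case using assms(2) by (simp add: subgroup.one_closed)
next
  case (Suc n)
  have "commutator (g n [^] x n) (mpow g n y) = commutator (g n) (mpow g n y) [^] x n"
    using Suc.prems by (intro commutator_pow_left) simp_all
  also have "commutator (g n) (mpow g n y) = mpow (\<lambda>i. commutator (g n) (g i)) n y"
    using Suc.prems by (intro commutator_mpow_right) simp_all
  finally have "commutator (g n [^] x n) (mpow g n y) \<in> H"
    using Suc.prems by (auto intro!: subgroup_int_pow_closed[OF assms(2)] mpow_subgroup[OF assms(2)])
  then show ?case using Suc assms(2) by (simp add: cocycle_Suc subgroup.m_closed)
qed

lemma cocycle_central: "\<forall>i<n. g i \<in> carrier G \<Longrightarrow> cocycle g n x y \<in> centre"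
  by (rule cocycle_in[OF _ centre_subgroup]) (simp_all add: commutator_central)

lemma mpow_mult:
  assumes "\<forall>i<n. g i \<in> carrier G"
  shows "mpow g n x \<otimes> mpow g n y = mpow g n (x + y) \<otimes> cocycle g n x y"
  using assms
proof (induction n)
  case (Suc n)
  let ?c = "commutator (g n [^] x n) (mpow g n y)"
  have c: "mpow g n x \<in> carrier G" "mpow g n y \<in> carrier G" "g n \<in> carrier G" "mpow g n (x + y) \<in> carrier G"
    using Suc.prems by simp_all
  have z: "?c \<in> centre" "cocycle g n x y \<in> centre" using c Suc.prems by (simp_all add: commutator_central cocycle_central)
  have "mpow g (Suc n) x \<otimes> mpow g (Suc n) y = mpow g n x \<otimes> (g n [^] x n \<otimes> mpow g n y) \<otimes> g n [^] y n"
    using c by (simp add: mpow_Suc m_assoc)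
  also have "g n [^] x n \<otimes> mpow g n y = ?c \<otimes> (mpow g n y \<otimes> g n [^] x n)" using c by (simp add: commutator_mult)
  also have "mpow g n x \<otimes> (?c \<otimes> (mpow g n y \<otimes> g n [^] x n)) \<otimes> g n [^] y n
      = ?c \<otimes> ((mpow g n x \<otimes> mpow g n y) \<otimes> (g n [^] x n \<otimes> g n [^] y n))"
    using c z centre_left_comm[OF z(1), of "mpow g n x"] by (simp add: m_assoc)
  also have "mpow g n x \<otimes> mpow g n y = mpow g n (x + y) \<otimes> cocycle g n x y" using Suc by simp
  also have "g n [^] x n \<otimes> g n [^] y n = g n [^] (x + y) n" using c by (simp add: int_pow_mult vec_apply)
  also have "?c \<otimes> (mpow g n (x + y) \<otimes> cocycle g n x y \<otimes> g n [^] (x + y) n)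
      = mpow g n (x + y) \<otimes> g n [^] (x + y) n \<otimes> (cocycle g n x y \<otimes> ?c)"
  proof -
    have "cocycle g n x y \<otimes> g n [^] (x + y) n = g n [^] (x + y) n \<otimes> cocycle g n x y" using c z by (intro centre_comm) simp_all
    moreover have "?c \<otimes> (mpow g n (x + y) \<otimes> g n [^] (x + y) n \<otimes> cocycle g n x y) = mpow g n (x + y) \<otimes> g n [^] (x + y) n \<otimes> cocycle g n x y \<otimes> ?c"
      using c z by (intro centre_comm) simp_all
    ultimately show ?thesis using c z by (simp add: m_assoc)
  qed
  finally show ?case by (simp add: mpow_Suc cocycle_Suc)
qed simp

lemma cocycle_add:
  assumes g: "\<forall>i<n. g i \<in> carrier G"
  shows "cocycle g n (x + x') y = cocycle g n x y \<otimes> cocycle g n x' y"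
    and "cocycle g n x (y + y') = cocycle g n x y \<otimes> cocycle g n x y'"
proof -
  have swap: "a \<otimes> b \<otimes> (c \<otimes> d) = a \<otimes> c \<otimes> (b \<otimes> d)" if "a \<in> centre" "b \<in> centre" "c \<in> centre" "d \<in> centre" for a b c d
    using that centre_comm[of b c] centre_left_comm[of c b d] by (simp add: m_assoc)
  show "cocycle g n (x + x') y = cocycle g n x y \<otimes> cocycle g n x' y"
    using g
  proof (induction n)
    case (Suc n)
    have c: "g n \<in> carrier G" "mpow g n y \<in> carrier G" "\<forall>i<n. g i \<in> carrier G" using Suc.prems by simp_all
    have "commutator (g n [^] (x + x') n) (mpow g n y)
        = commutator (g n [^] x n) (mpow g n y) \<otimes> commutator (g n [^] x' n) (mpow g n y)"
      using c by (simp add: vec_apply int_pow_mult commutator_mult_left)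
    then show ?case using Suc.IH[OF c(3)] c by (simp add: cocycle_Suc swap cocycle_central commutator_central)
  qed simp
  show "cocycle g n x (y + y') = cocycle g n x y \<otimes> cocycle g n x y'"
    using g
  proof (induction n)
    case (Suc n)
    have c: "g n \<in> carrier G" "g n [^] x n \<in> carrier G" "mpow g n y \<in> carrier G" "mpow g n y' \<in> carrier G"
      "mpow g n (y + y') \<in> carrier G" "\<forall>i<n. g i \<in> carrier G" using Suc.prems by simp_all
    have z: "cocycle g n y y' \<in> centre" using c by (simp add: cocycle_central)
    \<comment> \<open>\<open>mpow g n (y + y')\<close> differs from the product of the two factors
      by a central element, which commutators do not see.\<close>
    have "commutator (g n [^] x n) (mpow g n (y + y')) = commutator (g n [^] x n) (mpow g n (y + y') \<otimes> cocycle g n y y')"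
      using c z by (simp add: commutator_mult_right commutator_centre)
    also have "\<dots> = commutator (g n [^] x n) (mpow g n y) \<otimes> commutator (g n [^] x n) (mpow g n y')"
      using c by (simp add: mpow_mult[OF c(6), symmetric] commutator_mult_right)
    finally show ?case using Suc.IH[OF c(6)] c by (simp add: cocycle_Suc swap cocycle_central commutator_central)
  qed simp
qed

lemma central_quotient_comm_group: "comm_group (G Mod centre)"
proof -
  interpret Z: normal centre G by (rule centre_normal)
  interpret Q: group "G Mod centre" by (rule Z.factorgroup_is_group)
  show ?thesis
  proof (rule Q.group_comm_groupI)
    fix A B assume "A \<in> carrier (G Mod centre)" "B \<in> carrier (G Mod centre)"
    then obtain a b where ab: "a \<in> carrier G" "b \<in> carrier G" "A = centre #> a" "B = centre #> b"
      by (auto simp: FactGroup_def RCOSETS_def)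
    have "centre #> (a \<otimes> b) = centre #> commutator a b #> (b \<otimes> a)"
      using ab Z.subset by (simp add: coset_mult_assoc commutator_mult)
    also have "centre #> commutator a b = centre" using ab commutator_central by (intro coset_join2) (simp_all add: centre_subgroup)
    finally show "A \<otimes>\<^bsub>G Mod centre\<^esub> B = B \<otimes>\<^bsub>G Mod centre\<^esub> A" using ab by (simp add: FactGroup_def Z.rcos_sum)
  qed
qed

lemma coset_eq_iff:
  assumes "a \<in> carrier G" "b \<in> carrier G"
  shows "centre #> a = centre #> b \<longleftrightarrow> (\<exists>z\<in>centre. a = b \<otimes> z)"
proof
  assume "centre #> a = centre #> b"
  then have "a \<in> centre #> b" using rcos_self[OF assms(1) centre_subgroup] by simp
  then show "\<exists>z\<in>centre. a = b \<otimes> z" using assms(2) centre_comm by (auto simp: r_coset_def)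
next
  assume "\<exists>z\<in>centre. a = b \<otimes> z"
  then obtain z where z: "z \<in> centre" "a = z \<otimes> b" using centre_comm[OF _ assms(2)] by auto
  then have "centre #> a = centre #> z #> b" using assms subgroup.subset[OF centre_subgroup] by (simp add: coset_mult_assoc)
  also have "centre #> z = centre" using z by (intro coset_join2) (simp_all add: centre_subgroup)
  finally show "centre #> a = centre #> b" .
qed

text \<open>If \<open>a [^] k\<close> is central, then
  \<open>commutator a x [^] k = commutator (a [^] k) x\<close> is trivial, and so is
  \<open>commutator a x\<close>.\<close>

lemma central_quotient_torsion_free:
  assumes tf: "torsion_free G"
  shows "torsion_free (G Mod centre)"
  unfolding torsion_free_def
proof (intro ballI allI impI, elim conjE)
  interpret Z: normal centre G by (rule centre_normal)
  interpret Q: group "G Mod centre" by (rule Z.factorgroup_is_group)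
  fix A k assume A: "A \<in> carrier (G Mod centre)" and k: "(0::nat) < k" "A [^]\<^bsub>G Mod centre\<^esub> k = \<one>\<^bsub>G Mod centre\<^esub>"
  obtain a where a: "a \<in> carrier G" "A = centre #> a" using A by (auto simp: FactGroup_def RCOSETS_def)
  have one: "\<one>\<^bsub>G Mod centre\<^esub> = centre #> \<one>" using Z.subset by (simp add: FactGroup_def coset_mult_one)
  have "A [^]\<^bsub>G Mod centre\<^esub> k = centre #> (a [^] k)"
    using hom_nat_pow[OF Z.r_coset_hom_Mod a(1), of k] a by (simp add: is_group Q.is_group)
  then have "centre #> (a [^] k) = centre #> \<one>" using k one by simp
  then have ak: "a [^] k \<in> centre" using coset_eq_iff[of "a [^] k" \<one>] a by auto
  have "a \<in> centre"
  proof (rule centreI[OF a(1)])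
    fix x assume x: "x \<in> carrier G"
    have "commutator a x [^] k = commutator (a [^] k) x"
      using commutator_pow_left[of a x "int k"] a x by (simp add: int_pow_int)
    then have "commutator a x [^] k = \<one>" using commutator_centre(1)[OF ak x] by simp
    then have "commutator a x = \<one>" using tf k a x unfolding torsion_free_def by auto
    then show "a \<otimes> x = x \<otimes> a" using commutator_one_iff a x by simp
  qed
  then show "A = \<one>\<^bsub>G Mod centre\<^esub>" unfolding one a(2) using a coset_eq_iff[of a \<one>] by auto
qed

end

lemma (in group) mpow_subgroup_structure:
  assumes H: "subgroup H G" and g: "\<forall>i<n. g i \<in> H"
  shows "monoid.mpow (G\<lparr>carrier := H\<rparr>) g n x = mpow g n x"
proof -
  interpret H: group "G\<lparr>carrier := H\<rparr>" using H by (rule subgroup_imp_group)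
  show ?thesis
    using g
  proof (induction n)
    case (Suc n)
    have "g n \<in> H" using Suc.prems by simp
    then show ?case using Suc int_pow_consistent[OF H, of "g n" "x n"] by (simp add: mpow_Suc H.mpow_Suc)
  qed simp
qed

context class_two
begin

lemma ex_basis_mod_centre:
  assumes fg: "finitely_generated G" and tf: "torsion_free G"
  shows "\<exists>n g. (\<forall>i<n. g i \<in> carrier G) \<and> (\<forall>a\<in>carrier G. \<exists>x\<in>int_vecs n. \<exists>z\<in>centre. a = mpow g n x \<otimes> z) \<and>
    (\<forall>x\<in>int_vecs n. \<forall>y\<in>int_vecs n. centre #> mpow g n x = centre #> mpow g n y \<longrightarrow> x = y)"
proof -
  interpret Z: normal centre G by (rule centre_normal)
  interpret Q: comm_group "G Mod centre" by (rule central_quotient_comm_group)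
  interpret h: group_hom G "G Mod centre" "\<lambda>a. centre #> a"
    using Z.r_coset_hom_Mod by unfold_locales
  have car: "carrier (G Mod centre) = (\<lambda>a. centre #> a) ` carrier G" by (auto simp: FactGroup_def RCOSETS_def)
  have "finitely_generated (G Mod centre)"
  proof -
    obtain S where S: "finite S" "S \<subseteq> carrier G" "generate G S = carrier G" using fg by (auto simp: finitely_generated_def)
    have "generate (G Mod centre) ((\<lambda>a. centre #> a) ` S) = carrier (G Mod centre)"
      using h.generate_img[OF S(2)] S(3) car by simp
    moreover have "(\<lambda>a. centre #> a) ` S \<subseteq> carrier (G Mod centre)" using S(2) car by auto
    ultimately show ?thesis using S(1) unfolding finitely_generated_def by (intro exI[of _ "(\<lambda>a. centre #> a) ` S"]) simp
  qed
  from Q.finitely_generated_torsion_free_basis[OF this central_quotient_torsion_free[OF tf]]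
  obtain n q where q: "\<forall>i<n. q i \<in> carrier (G Mod centre)" "bij_betw (Q.mpow q n) (int_vecs n) (carrier (G Mod centre))"
    by (elim exE conjE)
  have "\<forall>i\<in>{..<n}. \<exists>a. a \<in> carrier G \<and> q i = centre #> a" using q(1) car by auto
  from bchoice[OF this] obtain g where "\<forall>i\<in>{..<n}. g i \<in> carrier G \<and> q i = centre #> g i" by (elim exE)
  then have g: "\<forall>i<n. g i \<in> carrier G" "\<forall>i<n. q i = centre #> g i" by simp_all
  have mp: "centre #> mpow g n x = Q.mpow q n x" for x
  proof -
    have "centre #> mpow g n x = Q.mpow (\<lambda>i. centre #> g i) n x"
      using g(1) by (intro mpow_hom[OF Z.r_coset_hom_Mod Q.is_group]) simp
    also have "\<dots> = Q.mpow q n x" using g(2) by (intro Q.mpow_cong) simp_all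
    finally show ?thesis .
  qed
  have "\<exists>x\<in>int_vecs n. \<exists>z\<in>centre. a = mpow g n x \<otimes> z" if a: "a \<in> carrier G" for a
  proof -
    have "centre #> a \<in> Q.mpow q n ` int_vecs n" using a car bij_betw_imp_surj_on[OF q(2)] by auto
    then obtain x where x: "x \<in> int_vecs n" "centre #> a = Q.mpow q n x" by auto
    then have "centre #> a = centre #> mpow g n x" using mp by simp
    then have "\<exists>z\<in>centre. a = mpow g n x \<otimes> z" using coset_eq_iff[OF a] g(1) by simp
    then show ?thesis using x(1) by auto
  qed
  moreover have "x = y" if "x \<in> int_vecs n" "y \<in> int_vecs n" "centre #> mpow g n x = centre #> mpow g n y" for x y
    using that bij_betw_imp_inj_on[OF q(2)] unfolding mp by (simp add: inj_on_def)
  ultimately show ?thesis using g(1) by (intro exI[of _ n] exI[of _ g]) simp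
qed

text \<open>Let \<open>Y\<close> be generated by the commutators of the \<open>g i\<close> and the
  central parts of the generators. The products of an \<open>mpow\<close> with an element of
  \<open>Y\<close> form a subgroup containing all generators, hence everything. A central element
  has trivial exponents, so it already lies in \<open>Y\<close>.\<close>

lemma finitely_generated_centre:
  assumes fg: "finitely_generated G" and g: "\<forall>i<n. g i \<in> carrier G"
    and ex: "\<forall>a\<in>carrier G. \<exists>x\<in>int_vecs n. \<exists>z\<in>centre. a = mpow g n x \<otimes> z"
    and inj: "\<forall>x\<in>int_vecs n. \<forall>y\<in>int_vecs n. centre #> mpow g n x = centre #> mpow g n y \<longrightarrow> x = y"
  shows "finitely_generated (G\<lparr>carrier := centre\<rparr>)"
proof -
  obtain S where S: "finite S" "S \<subseteq> carrier G" "generate G S = carrier G" using fg by (auto simp: finitely_generated_def)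
  have "\<forall>s\<in>S. \<exists>z. z \<in> centre \<and> (\<exists>x\<in>int_vecs n. s = mpow g n x \<otimes> z)" using ex S(2) by blast
  from bchoice[OF this] obtain z where z: "\<forall>s\<in>S. z s \<in> centre \<and> (\<exists>x\<in>int_vecs n. s = mpow g n x \<otimes> z s)" by (rule exE)
  define F where "F = z ` S \<union> (\<lambda>(i, j). commutator (g i) (g j)) ` ({..<n} \<times> {..<n})"
  have F: "finite F" "F \<subseteq> centre" using S(1) z g by (auto simp: F_def commutator_central)
  have Fc: "F \<subseteq> carrier G" using F(2) by auto
  define Y where "Y = generate G F"
  have Y: "subgroup Y G" unfolding Y_def by (rule generate_is_subgroup[OF Fc])
  have YZ: "Y \<subseteq> centre" unfolding Y_def by (rule generate_subgroup_incl[OF F(2) centre_subgroup])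
  have Yc: "y \<in> carrier G" if "y \<in> Y" for y using that subgroup.subset[OF Y] by auto
  have coc: "cocycle g n x y \<in> Y" for x y
    by (rule cocycle_in[OF g Y]) (auto simp: Y_def F_def intro!: generate.incl)
  define H where "H = (\<lambda>(x, y). mpow g n x \<otimes> y) ` (int_vecs n \<times> Y)"
  have HI: "mpow g n x \<otimes> y \<in> H" if "x \<in> int_vecs n" "y \<in> Y" for x y
    unfolding H_def using that by (intro image_eqI[of _ _ "(x, y)"]) simp_all
  have mc: "mpow g n x \<in> carrier G" for x using g by simp
  have "subgroup H G"
  proof (rule subgroupI)
    show "H \<subseteq> carrier G" using Yc mc by (auto simp: H_def)
    show "H \<noteq> {}" using HI[OF int_vecs_zero subgroup.one_closed[OF Y]] by auto
    fix a assume "a \<in> H"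
    then obtain x y where a: "x \<in> int_vecs n" "y \<in> Y" "a = mpow g n x \<otimes> y" by (auto simp: H_def)
    have "mpow g n x \<otimes> (mpow g n (- x) \<otimes> inv (cocycle g n x (- x))) = \<one>"
      using mpow_mult[OF g, of x "- x"] mpow_zero[OF g] mc Yc[OF coc] by (simp add: m_assoc[symmetric])
    then have "inv (mpow g n x) = mpow g n (- x) \<otimes> inv (cocycle g n x (- x))"
      using mc Yc[OF coc] by (metis inv_closed m_closed inv_equality inv_inv inv_unique' l_inv r_inv m_assoc l_one r_one)
    moreover have "inv a = inv (mpow g n x) \<otimes> inv y"
      using a mc[of x] Yc[OF a(2)] YZ centre_comm[of y "mpow g n x"] by (simp add: inv_mult_group[symmetric]) (metis centre_comm subsetD)
    ultimately have "inv a = mpow g n (- x) \<otimes> (inv (cocycle g n x (- x)) \<otimes> inv y)"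
      using mc Yc coc a(2) by (simp add: m_assoc)
    moreover have "inv (cocycle g n x (- x)) \<otimes> inv y \<in> Y" using a(2) coc Y by (simp add: subgroup.m_closed subgroup.m_inv_closed)
    ultimately show "inv a \<in> H" using HI[of "- x"] a(1) by simp
    fix b assume "b \<in> H"
    then obtain x' y' where b: "x' \<in> int_vecs n" "y' \<in> Y" "b = mpow g n x' \<otimes> y'" by (auto simp: H_def)
    have "a \<otimes> b = (mpow g n x \<otimes> mpow g n x') \<otimes> (y \<otimes> y')"
      using a b mc[of x] mc[of x'] Yc YZ centre_comm[of y "mpow g n x'"] centre_left_comm[of y "mpow g n x'" y'] by (simp add: m_assoc subset_iff)
    also have "\<dots> = mpow g n (x + x') \<otimes> (cocycle g n x x' \<otimes> (y \<otimes> y'))"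
      using a b mc Yc coc by (simp add: mpow_mult[OF g] m_assoc)
    finally show "a \<otimes> b \<in> H" using HI[of "x + x'"] a b coc Y by (simp add: subgroup.m_closed)
  qed
  moreover have "S \<subseteq> H"
  proof
    fix s assume s: "s \<in> S"
    then obtain x where x: "x \<in> int_vecs n" "s = mpow g n x \<otimes> z s" using z by auto
    have "z s \<in> Y" unfolding Y_def F_def using s by (auto intro!: generate.incl)
    then show "s \<in> H" using HI[OF x(1)] x(2) by metis
  qed
  ultimately have H: "carrier G \<subseteq> H" using generate_subgroup_incl[of S H] S(3) by simp
  have "centre \<subseteq> Y"
  proof
    fix c assume c: "c \<in> centre"
    then have "c \<in> H" using H by auto
    then obtain x y where xy: "x \<in> int_vecs n" "y \<in> Y" "c = mpow g n x \<otimes> y" by (auto simp: H_def)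
    have y: "y \<in> centre" using xy(2) YZ by auto
    have "mpow g n x = c \<otimes> inv y" using xy(3) y mc[of x] by (simp add: m_assoc)
    then have "mpow g n x \<in> centre" using c y centre_subgroup by (simp add: subgroup.m_closed subgroup.m_inv_closed)
    then have "centre #> mpow g n x = centre #> mpow g n 0"
      using coset_eq_iff[of "mpow g n x" "\<one>"] mpow_zero[OF g] mc by auto
    then have "x = 0" using inj xy(1) by simp
    then show "c \<in> Y" using xy y mpow_zero[OF g] by simp
  qed
  then have "generate G F = centre" using YZ by (auto simp: Y_def)
  then have "generate (G\<lparr>carrier := centre\<rparr>) F = centre" using generate_consistent[OF F(2) centre_subgroup] by simp
  then show ?thesis using F unfolding finitely_generated_def by (intro exI[of _ F]) simp
qed

text \<open>A lifted basis of the central quotient and a basis of the centre give the coordinates,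
  and \<open>\<beta>\<close> is the collection cocycle written in the basis of the centre. A radical
  vector of \<open>\<omega>\<close> would yield a central element with nonzero exponents.\<close>

theorem ex_central_extension:
  assumes fg: "finitely_generated G" and tf: "torsion_free G"
  shows "\<exists>n m \<beta> \<psi>. central_extension G n m \<beta> \<psi> \<and> nondegenerate_on n (central_extension.\<omega> \<beta>)"
proof -
  obtain n g where g: "\<forall>i<n. g i \<in> carrier G"
    and ex: "\<forall>a\<in>carrier G. \<exists>x\<in>int_vecs n. \<exists>z\<in>centre. a = mpow g n x \<otimes> z"
    and inj: "\<forall>x\<in>int_vecs n. \<forall>y\<in>int_vecs n. centre #> mpow g n x = centre #> mpow g n y \<longrightarrow> x = y"
    using ex_basis_mod_centre[OF fg tf] by (elim exE conjE)
  let ?Z = "G\<lparr>carrier := centre\<rparr>"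
  interpret Z: group ?Z by (rule subgroup_imp_group[OF centre_subgroup])
  interpret Z: comm_group ?Z by (rule Z.group_comm_groupI) (simp add: centre_comm)
  have "torsion_free ?Z" unfolding torsion_free_def
  proof (intro ballI allI impI, elim conjE)
    fix a k assume "a \<in> carrier ?Z" "(0::nat) < k" "a [^]\<^bsub>?Z\<^esub> k = \<one>\<^bsub>?Z\<^esub>"
    then show "a = \<one>\<^bsub>?Z\<^esub>" using tf nat_pow_consistent[of a k centre] unfolding torsion_free_def by auto
  qed
  from Z.finitely_generated_torsion_free_basis[OF finitely_generated_centre[OF fg g ex inj] this]
  obtain m z where z: "\<forall>i<m. z i \<in> centre" "bij_betw (Z.mpow z m) (int_vecs m) centre" by auto
  have zm: "Z.mpow z m u = mpow z m u" for u by (rule mpow_subgroup_structure[OF centre_subgroup z(1)])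
  have zc: "mpow z m u \<in> centre" for u using mpow_subgroup[OF centre_subgroup] z(1) by simp
  have zadd: "mpow z m (u + v) = mpow z m u \<otimes> mpow z m v" for u v
    using Z.mpow_add[of m z u v] z(1) zm by simp
  have zb: "bij_betw (mpow z m) (int_vecs m) centre" using z(2) zm by (simp cong: bij_betw_cong)
  have zinj: "mpow z m u = mpow z m v \<longleftrightarrow> u = v" if "u \<in> int_vecs m" "v \<in> int_vecs m" for u v
    using bij_betw_imp_inj_on[OF zb] that by (auto simp: inj_on_def)
  define \<beta> where "\<beta> x y = inv_into (int_vecs m) (mpow z m) (cocycle g n x y)" for x y
  have \<beta>: "mpow z m (\<beta> x y) = cocycle g n x y" "\<beta> x y \<in> int_vecs m" for x y
  proof -
    have c: "cocycle g n x y \<in> centre" by (rule cocycle_central[OF g])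
    show "mpow z m (\<beta> x y) = cocycle g n x y" unfolding \<beta>_def by (rule bij_betw_inv_into_right[OF zb c])
    show "\<beta> x y \<in> int_vecs m" unfolding \<beta>_def using bij_betw_apply[OF bij_betw_inv_into[OF zb] c] .
  qed
  define \<psi> where "\<psi> x u = mpow g n x \<otimes> mpow z m u" for x u
  have gc: "mpow g n x \<in> carrier G" for x using g by simp
  have coset: "centre #> \<psi> x u = centre #> mpow g n x" for x u
    using coset_eq_iff[of "\<psi> x u" "mpow g n x"] gc zc by (auto simp: \<psi>_def)
  have CE: "central_extension G n m \<beta> \<psi>"
  proof unfold_locales
    show "bij_betw (\<lambda>(x, u). \<psi> x u) (int_vecs n \<times> int_vecs m) (carrier G)"
      unfolding bij_betw_def
    proof
      show "inj_on (\<lambda>(x, u). \<psi> x u) (int_vecs n \<times> int_vecs m)"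
      proof (rule inj_onI, clarify)
        fix x u y v assume a: "x \<in> int_vecs n" "u \<in> int_vecs m" "y \<in> int_vecs n" "v \<in> int_vecs m" "\<psi> x u = \<psi> y v"
        have "centre #> mpow g n x = centre #> mpow g n y" using coset[of x u] coset[of y v] a(5) by simp
        then have xy: "x = y" using inj a by simp
        then have "mpow z m u = mpow z m v" using a(5) gc[of y] zc by (simp add: \<psi>_def)
        then show "x = y \<and> u = v" using xy zinj a by simp
      qed
      show "(\<lambda>(x, u). \<psi> x u) ` (int_vecs n \<times> int_vecs m) = carrier G"
      proof (intro equalityI subsetI)
        fix a assume "a \<in> (\<lambda>(x, u). \<psi> x u) ` (int_vecs n \<times> int_vecs m)"
        then show "a \<in> carrier G" using gc zc by (auto simp: \<psi>_def)
      next
        fix a assume "a \<in> carrier G"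
        then obtain x c where x: "x \<in> int_vecs n" "c \<in> centre" "a = mpow g n x \<otimes> c" using ex by auto
        have "c \<in> mpow z m ` int_vecs m" using x(2) bij_betw_imp_surj_on[OF zb] by simp
        then obtain u where "u \<in> int_vecs m" "c = mpow z m u" by auto
        then show "a \<in> (\<lambda>(x, u). \<psi> x u) ` (int_vecs n \<times> int_vecs m)" using x by (intro image_eqI[of _ _ "(x, u)"]) (simp_all add: \<psi>_def)
      qed
    qed
    show "\<beta> x y \<in> int_vecs m" for x y by (rule \<beta>(2))
    have "\<beta> (x + x') y = \<beta> x y + \<beta> x' y" "\<beta> x (y + y') = \<beta> x y + \<beta> x y'" for x x' y y'
    proof -
      have "mpow z m (\<beta> (x + x') y) = mpow z m (\<beta> x y + \<beta> x' y)" "mpow z m (\<beta> x (y + y')) = mpow z m (\<beta> x y + \<beta> x y')"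
        by (simp_all add: zadd \<beta>(1) cocycle_add[OF g])
      then show "\<beta> (x + x') y = \<beta> x y + \<beta> x' y" "\<beta> x (y + y') = \<beta> x y + \<beta> x y'" using zinj \<beta>(2) by simp_all
    qed
    then show "biadditive_on (int_vecs n) \<beta>" by (simp add: biadditive_on_def additive_on_def)
    fix x y u w
    have zc': "mpow z m u \<in> carrier G" "mpow z m w \<in> carrier G" "mpow z m (\<beta> x y) \<in> carrier G" using zc by simp_all
    have "\<psi> x u \<otimes> \<psi> y w = (mpow g n x \<otimes> mpow g n y) \<otimes> (mpow z m u \<otimes> mpow z m w)"
      using gc[of x] gc[of y] zc' centre_left_comm[OF zc[of u], of "mpow g n y" "mpow z m w"] by (simp add: \<psi>_def m_assoc)
    also have "\<dots> = mpow g n (x + y) \<otimes> (mpow z m (\<beta> x y) \<otimes> (mpow z m u \<otimes> mpow z m w))"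
      using gc zc' by (simp add: mpow_mult[OF g] \<beta>(1)[symmetric] m_assoc)
    also have "mpow z m (\<beta> x y) \<otimes> (mpow z m u \<otimes> mpow z m w) = mpow z m (u + w + \<beta> x y)"
      using zc' centre_comm[OF zc, of "mpow z m u \<otimes> mpow z m w"] by (simp add: zadd)
    finally show "\<psi> x u \<otimes> \<psi> y w = \<psi> (x + y) (u + w + \<beta> x y)" by (simp add: \<psi>_def)
  qed
  interpret E: central_extension G n m \<beta> \<psi> by (rule CE)
  have "x = 0" if x: "x \<in> int_vecs n" "\<forall>y\<in>int_vecs n. E.\<omega> x y = 0" for x
  proof -
    have "\<psi> x 0 \<in> centre"
    proof (rule centreI)
      fix a assume "a \<in> carrier G"
      then obtain y w where a: "y \<in> int_vecs n" "w \<in> int_vecs m" "a = \<psi> y w" by (rule E.psi_cases)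
      have "commutator (\<psi> x 0) a = \<one>"
        using E.psi_commutator[OF x(1) int_vecs_zero a(1,2)] x(2) a E.psi_zero by (simp add: commutator_def)
      then show "\<psi> x 0 \<otimes> a = a \<otimes> \<psi> x 0" using a x(1) by (simp add: commutator_one_iff)
    qed (use x(1) in simp)
    then have "centre #> \<psi> x 0 = centre #> \<one>" using coset_eq_iff[of "\<psi> x 0" \<one>] by auto
    then have "centre #> mpow g n x = centre #> mpow g n 0" unfolding coset mpow_zero[OF g] .
    then show ?thesis using inj x(1) by simp
  qed
  then have "nondegenerate_on n E.\<omega>" by (simp add: nondegenerate_on_def)
  with CE show ?thesis by (intro exI conjI)
qed

end

theorem (in group) not_R_infinity_if_small:
  assumes fg: "finitely_generated G" and tf: "torsion_free G" and two: "two_step_nilpotent G" and h: "hirsch_length G \<le> 6"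
  shows "\<not> R_infinity G"
proof -
  interpret class_two G by unfold_locales (rule two_step_nilpotent_commutator[OF two])
  obtain n m \<beta> \<psi> where CE: "central_extension G n m \<beta> \<psi>" and nd: "nondegenerate_on n (central_extension.\<omega> \<beta>)"
    using ex_central_extension[OF fg tf] by (elim exE conjE)
  interpret E: central_extension G n m \<beta> \<psi> by (rule CE)
  obtain a b where ab: "a \<in> carrier G" "b \<in> carrier G" "commutator a b \<noteq> \<one>" using two_step_nilpotent_nonabelian[OF two] by auto
  obtain x u where x: "x \<in> int_vecs n" "u \<in> int_vecs m" "a = \<psi> x u" using ab(1) by (rule E.psi_cases)
  obtain y w where y: "y \<in> int_vecs n" "w \<in> int_vecs m" "b = \<psi> y w" using ab(2) by (rule E.psi_cases)
  have "E.\<omega> x y \<noteq> 0"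
  proof
    assume "E.\<omega> x y = 0"
    then show False using ab(3) E.psi_commutator[OF x(1,2) y(1,2)] x(3) y(3) E.psi_zero by (simp add: commutator_def)
  qed
  moreover have "alternating_on n E.\<omega>" by (simp add: alternating_on_def E.omega_biadditive E.omega_alt(1))
  ultimately have "\<exists>A B. admissible_pair n m E.\<omega> A B"
    using ex_admissible_pair[OF _ nd E.omega_in x(1) y(1)] h E.hirsch_length_eq_sum by simp
  then obtain A B where "admissible_pair n m E.\<omega> A B" by (elim exE)
  then show ?thesis by (rule E.admissible_pair_imp_not_R_infinity)
qed

section \<open>Groups with the R-infinity property\<close>

lemma (in group) reidemeister_infiniteI:
  fixes a :: "int \<Rightarrow> 'a"
  assumes "\<phi> \<in> hom G G" and a: "\<And>i. a i \<in> carrier G"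
    and sep: "\<And>i j c. c \<in> carrier G \<Longrightarrow> a i \<otimes> \<phi> c = c \<otimes> a j \<Longrightarrow> i = j"
  shows "reidemeister_number G \<phi> = \<infinity>"
proof -
  interpret h: group_hom G G \<phi> using assms(1) by unfold_locales
  let ?R = "twisted_conj G \<phi>"
  have refl: "(x, x) \<in> ?R" if "x \<in> carrier G" for x
    using that unfolding twisted_conj_def by (auto intro!: bexI[of _ \<one>])
  have "inj (\<lambda>i. ?R `` {a i})"
  proof (rule injI)
    fix i j assume "?R `` {a i} = ?R `` {a j}"
    then have "(a i, a j) \<in> ?R" using refl[OF a[of j]] by auto
    then obtain c where c: "c \<in> carrier G" "a i = c \<otimes> a j \<otimes> inv (\<phi> c)" by (auto simp: twisted_conj_def)
    have "a i \<otimes> \<phi> c = c \<otimes> a j" using c a[of j] by (simp add: m_assoc)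
    then show "i = j" using sep c(1) by simp
  qed
  then have "infinite (range (\<lambda>i. ?R `` {a i}))" using infinite_UNIV_int finite_imageD by blast
  moreover have "range (\<lambda>i. ?R `` {a i}) \<subseteq> carrier G // ?R" using a by (auto simp: quotient_def)
  ultimately have "infinite (carrier G // ?R)" using finite_subset by auto
  then show ?thesis by (simp add: reidemeister_number_def)
qed

context central_extension
begin

lemma psi_mult_eq:
  assumes "x \<in> int_vecs n" "u \<in> int_vecs m" "y \<in> int_vecs n" "w \<in> int_vecs m"
    and "x' \<in> int_vecs n" "u' \<in> int_vecs m" "y' \<in> int_vecs n" "w' \<in> int_vecs m"
    and "\<psi> x u \<otimes> \<psi> y w = \<psi> x' u' \<otimes> \<psi> y' w'"
  shows "x + y = x' + y'" "u + w + \<beta> x y = u' + w' + \<beta> x' y'"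
proof -
  have "\<psi> (x + y) (u + w + \<beta> x y) = \<psi> (x' + y') (u' + w' + \<beta> x' y')" using assms by (simp add: psi_mult)
  then show "x + y = x' + y'" "u + w + \<beta> x y = u' + w' + \<beta> x' y'"
    using assms by (simp_all add: psi_inj beta_in)
qed

lemma torsion_free: "torsion_free G"
  unfolding torsion_free_def
proof (intro ballI allI impI, elim conjE)
  fix g and k :: nat assume g: "g \<in> carrier G" and k: "0 < k" "g [^] k = \<one>"
  obtain x u where x: "x \<in> int_vecs n" "u \<in> int_vecs m" "g = \<psi> x u" using g by (rule psi_cases)
  have k': "g [^] int k = \<psi> 0 0" using k(2) psi_zero by (simp add: int_pow_int)
  obtain v where "v \<in> int_vecs m" "g [^] int k = \<psi> (smul (int k) x) v" using psi_pow[OF x(1,2)] x(3) by auto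
  then have "smul (int k) x = 0" using k' x(1) psi_inj by simp
  then have x0: "x = 0" using k(1) by (simp add: smul_eq_0_iff)
  then have "\<psi> 0 (smul (int k) u) = \<psi> 0 0" using psi_zero_pow[OF x(2), of "int k"] k' x(3) by simp
  then have "smul (int k) u = 0" using x(2) by (simp add: psi_inj)
  then have "u = 0" using k(1) by (simp add: smul_eq_0_iff)
  then show "g = \<one>" using x(3) x0 psi_zero by simp
qed

lemma finitely_generated: "finitely_generated G"
proof -
  define S where "S = (\<lambda>i. \<psi> (unit_vec i) 0) ` {..<n} \<union> (\<lambda>i. \<psi> 0 (unit_vec i)) ` {..<m}"
  have S: "finite S" "S \<subseteq> carrier G" by (auto simp: S_def)
  have H: "subgroup (generate G S) G" using S(2) by (rule generate_is_subgroup)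
  note cl = subgroup.m_closed[OF H] subgroup.m_inv_closed[OF H]
  have inv0: "inv (\<psi> 0 u) = \<psi> 0 (- u)" if "u \<in> int_vecs m" for u
    using psi_inv[of 0 u] that beta_simps(1)[of 0 0] by simp
  have c: "\<psi> 0 u \<in> generate G S" if "u \<in> int_vecs m" for u
    using that
  proof (rule int_vecs_induct[where P = "\<lambda>u. \<psi> 0 u \<in> generate G S"])
    show "\<psi> 0 0 \<in> generate G S" using psi_zero by (simp add: generate.one)
  next
    fix i y assume i: "i < m" "y \<in> int_vecs m" "\<psi> 0 y \<in> generate G S"
    have e: "\<psi> 0 (unit_vec i) \<in> generate G S" using i(1) by (auto simp: S_def intro!: generate.incl)
    show "\<psi> 0 (y + unit_vec i) \<in> generate G S" using cl(1)[OF i(3) e] i psi_central(1)[of y 0 "unit_vec i"] by simp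
    have "\<psi> 0 y \<otimes> inv (\<psi> 0 (unit_vec i)) = \<psi> 0 (y - unit_vec i)"
      using i psi_central(1)[of y 0 "- unit_vec i"] by (simp add: inv0)
    then show "\<psi> 0 (y - unit_vec i) \<in> generate G S" using cl(1)[OF i(3) cl(2)[OF e]] by simp
  qed
  \<comment> \<open>One generated element over \<open>y\<close> suffices, because the central
    coordinate is free over \<open>x\<close>.\<close>
  have add: "\<forall>w\<in>int_vecs m. \<psi> (x + y) w \<in> generate G S"
    if x: "x \<in> int_vecs n" "\<forall>u\<in>int_vecs m. \<psi> x u \<in> generate G S" and y: "y \<in> int_vecs n" "v \<in> int_vecs m" "\<psi> y v \<in> generate G S" for x y v
  proof
    fix w assume w: "w \<in> int_vecs m"
    have "w - v - \<beta> x y \<in> int_vecs m" using w x y by (simp add: beta_in)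
    then have "\<psi> x (w - v - \<beta> x y) \<otimes> \<psi> y v \<in> generate G S" using cl(1) x(2) y(3) by simp
    then show "\<psi> (x + y) w \<in> generate G S" using w x y by (simp add: psi_mult beta_in)
  qed
  have d: "\<forall>u\<in>int_vecs m. \<psi> x u \<in> generate G S" if "x \<in> int_vecs n" for x
    using that
  proof (rule int_vecs_induct[where P = "\<lambda>x. \<forall>u\<in>int_vecs m. \<psi> x u \<in> generate G S"])
    show "\<forall>u\<in>int_vecs m. \<psi> 0 u \<in> generate G S" using c by simp
  next
    fix i y assume i: "i < n" "y \<in> int_vecs n" "\<forall>u\<in>int_vecs m. \<psi> y u \<in> generate G S"
    have e: "\<psi> (unit_vec i) 0 \<in> generate G S" using i(1) by (auto simp: S_def intro!: generate.incl)
    show "\<forall>u\<in>int_vecs m. \<psi> (y + unit_vec i) u \<in> generate G S" using i e by (intro add[where v = 0]) simp_all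
    have "\<psi> (- unit_vec i) (\<beta> (unit_vec i) (unit_vec i)) \<in> generate G S"
      using cl(2)[OF e] i(1) psi_inv[of "unit_vec i" 0] by simp
    then have "\<forall>u\<in>int_vecs m. \<psi> (y + - unit_vec i) u \<in> generate G S"
      using i by (intro add[where v = "\<beta> (unit_vec i) (unit_vec i)"]) (simp_all add: beta_in)
    then show "\<forall>u\<in>int_vecs m. \<psi> (y - unit_vec i) u \<in> generate G S" by simp
  qed
  have "carrier G \<subseteq> generate G S"
  proof
    fix g assume "g \<in> carrier G"
    then obtain x u where "x \<in> int_vecs n" "u \<in> int_vecs m" "g = \<psi> x u" by (rule psi_cases)
    then show "g \<in> generate G S" using d by simp
  qed
  then show ?thesis using S generate_incl[OF S(2)] unfolding finitely_generated_def by (intro exI[of _ S]) auto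
qed

lemma two_step_nilpotent:
  assumes xy: "x \<in> int_vecs n" "y \<in> int_vecs n" "\<omega> x y \<noteq> 0"
  shows "two_step_nilpotent G"
proof -
  have three: "lower_central G 3 = commutator_subgroup G (lower_central G 2) (carrier G)"
    and two: "lower_central G 2 = commutator_subgroup G (carrier G) (carrier G)"
    by (simp_all add: eval_nat_numeral)
  have "\<psi> 0 (\<omega> x y) \<in> lower_central G 2"
    unfolding two commutator_subgroup_def
  proof (rule generate.incl, intro UN_I)
    show "\<psi> 0 (\<omega> x y) \<in> {\<psi> x 0 \<otimes> \<psi> y 0 \<otimes> inv \<psi> x 0 \<otimes> inv \<psi> y 0}"
      using psi_commutator[OF xy(1) int_vecs_zero xy(2) int_vecs_zero] by simp
  qed (use xy in simp_all)
  moreover have "\<psi> 0 (\<omega> x y) \<noteq> \<one>" using xy by (simp add: psi_zero[symmetric] psi_inj omega_in)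
  ultimately have ne: "lower_central G 2 \<noteq> {\<one>}" by auto
  have sub: "subgroup (layer m) G" using layer_normal[of m] by (simp add: normal_imp_subgroup)
  have lay: "layer m = \<psi> 0 ` int_vecs m" by (auto simp: layer_def int_vecs_0)
  have "lower_central G 2 \<subseteq> layer m"
    unfolding two commutator_subgroup_def
  proof (rule generate_subgroup_incl[OF _ sub], clarify)
    fix g h assume "g \<in> carrier G" "h \<in> carrier G"
    then obtain a u b w where "a \<in> int_vecs n" "u \<in> int_vecs m" "g = \<psi> a u" "b \<in> int_vecs n" "w \<in> int_vecs m" "h = \<psi> b w"
      using psi_cases by metis
    then show "g \<otimes> h \<otimes> inv g \<otimes> inv h \<in> layer m" by (simp add: psi_commutator lay omega_in)
  qed
  then have "lower_central G 3 \<subseteq> {\<one>}"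
    unfolding three commutator_subgroup_def
  proof (intro generate_subgroup_incl[OF _ triv_subgroup] subsetI)
    fix c assume L: "lower_central G 2 \<subseteq> layer m"
      and "c \<in> (\<Union>h\<in>lower_central G 2. \<Union>k\<in>carrier G. {h \<otimes> k \<otimes> inv h \<otimes> inv k})"
    then obtain h k where hk: "h \<in> lower_central G 2" "k \<in> carrier G" "c = h \<otimes> k \<otimes> inv h \<otimes> inv k" by auto
    obtain u where u: "u \<in> int_vecs m" "h = \<psi> 0 u" using hk(1) L lay by auto
    obtain b w where b: "b \<in> int_vecs n" "w \<in> int_vecs m" "k = \<psi> b w" using hk(2) by (rule psi_cases)
    have "c = \<psi> 0 (\<omega> 0 b)" using hk(3) u b by (simp add: psi_commutator)
    then show "c \<in> {\<one>}" using biadditive_on_simps(1)[OF omega_biadditive b(1) b(1)] psi_zero by simp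
  qed
  moreover have "\<one> \<in> lower_central G 3" unfolding three commutator_subgroup_def by (rule generate.one)
  ultimately have "lower_central G 3 = {\<one>}" by auto
  with ne show ?thesis by (simp add: two_step_nilpotent_def)
qed

text \<open>Nondegeneracy makes the elements \<open>\<psi> 0 u\<close> the whole centre, which every
  automorphism preserves.\<close>

lemma automorphism_components:
  assumes \<phi>: "\<phi> \<in> auto G" and nd: "\<forall>x\<in>int_vecs n. (\<forall>y\<in>int_vecs n. \<omega> x y = 0) \<longrightarrow> x = 0"
  shows "\<exists>A B t. additive_on (int_vecs n) A \<and> bij_betw B (int_vecs m) (int_vecs m) \<and> additive_on (int_vecs m) B \<and>
    (\<forall>x\<in>int_vecs n. A x \<in> int_vecs n \<and> t x \<in> int_vecs m) \<and> (\<forall>x\<in>int_vecs n. \<forall>y\<in>int_vecs n. \<omega> (A x) (A y) = B (\<omega> x y)) \<and>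
    (\<forall>u\<in>int_vecs m. \<phi> (\<psi> 0 u) = \<psi> 0 (B u)) \<and> (\<forall>x\<in>int_vecs n. \<forall>u\<in>int_vecs m. \<phi> (\<psi> x u) = \<psi> (A x) (B u + t x))"
proof -
  have hom: "\<phi> \<in> hom G G" and bij: "bij_betw \<phi> (carrier G) (carrier G)" using \<phi> by (auto simp: auto_def Bij_def)
  interpret h: group_hom G G \<phi> using hom by unfold_locales
  define p where "p g = inv_into (int_vecs n \<times> int_vecs m) (\<lambda>(x, u). \<psi> x u) g" for g
  have p: "fst (p g) \<in> int_vecs n" "snd (p g) \<in> int_vecs m" "\<psi> (fst (p g)) (snd (p g)) = g" if "g \<in> carrier G" for g
  proof -
    have "p g \<in> int_vecs n \<times> int_vecs m" unfolding p_def by (rule bij_betw_apply[OF bij_betw_inv_into[OF psi_bij] that])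
    then show "fst (p g) \<in> int_vecs n" "snd (p g) \<in> int_vecs m" by auto
    have "(\<lambda>(x, u). \<psi> x u) (p g) = g" unfolding p_def by (rule bij_betw_inv_into_right[OF psi_bij that])
    then show "\<psi> (fst (p g)) (snd (p g)) = g" by (simp add: case_prod_beta)
  qed
  define A t B where "A x = fst (p (\<phi> (\<psi> x 0)))" and "t x = snd (p (\<phi> (\<psi> x 0)))" and "B u = snd (p (\<phi> (\<psi> 0 u)))" for x u
  have At: "A x \<in> int_vecs n" "t x \<in> int_vecs m" "\<phi> (\<psi> x 0) = \<psi> (A x) (t x)" if "x \<in> int_vecs n" for x
    using p[of "\<phi> (\<psi> x 0)"] that by (simp_all add: A_def t_def)
  have central: "a = 0" if a: "a \<in> int_vecs n" "b \<in> int_vecs m"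
    and comm: "\<And>g. g \<in> carrier G \<Longrightarrow> \<psi> a b \<otimes> g = g \<otimes> \<psi> a b" for a b
  proof (rule nd[rule_format, OF a(1)])
    fix y assume y: "y \<in> int_vecs n"
    have "\<psi> a b \<otimes> \<psi> y 0 = \<psi> y 0 \<otimes> \<psi> a b" using comm y by simp
    from psi_mult_eq(2)[OF _ _ _ _ _ _ _ _ this] a y have "\<beta> a y = \<beta> y a" by simp
    then show "\<omega> a y = 0" by (simp add: \<omega>_def)
  qed
  have comm: "\<phi> g \<otimes> k = k \<otimes> \<phi> g" if g: "g \<in> carrier G" "\<And>h. h \<in> carrier G \<Longrightarrow> g \<otimes> h = h \<otimes> g" and k: "k \<in> carrier G" for g k
  proof -
    have "k \<in> \<phi> ` carrier G" using k bij_betw_imp_surj_on[OF bij] by simp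
    then obtain h where "h \<in> carrier G" "k = \<phi> h" by auto
    then show ?thesis using g h.hom_mult[of g h] h.hom_mult[of h g] by simp
  qed
  have z: "\<psi> 0 u \<otimes> g = g \<otimes> \<psi> 0 u" if u: "u \<in> int_vecs m" "g \<in> carrier G" for u g
  proof -
    obtain y w where "y \<in> int_vecs n" "w \<in> int_vecs m" "g = \<psi> y w" using u(2) by (rule psi_cases)
    then show ?thesis using u(1) by (simp add: psi_central add.commute)
  qed
  have B: "B u \<in> int_vecs m" "\<phi> (\<psi> 0 u) = \<psi> 0 (B u)" if u: "u \<in> int_vecs m" for u
  proof -
    have c: "\<phi> (\<psi> 0 u) \<in> carrier G" using u by simp
    show "B u \<in> int_vecs m" using p(2)[OF c] by (simp add: B_def)
    have "fst (p (\<phi> (\<psi> 0 u))) = 0"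
    proof (rule central[OF p(1)[OF c] p(2)[OF c]])
      fix g assume "g \<in> carrier G"
      then show "\<psi> (fst (p (\<phi> (\<psi> 0 u)))) (snd (p (\<phi> (\<psi> 0 u)))) \<otimes> g = g \<otimes> \<psi> (fst (p (\<phi> (\<psi> 0 u)))) (snd (p (\<phi> (\<psi> 0 u))))"
        unfolding p(3)[OF c] using u z by (intro comm) simp_all
    qed
    then show "\<phi> (\<psi> 0 u) = \<psi> 0 (B u)" using p(3)[OF c] by (simp add: B_def)
  qed
  have full: "\<phi> (\<psi> x u) = \<psi> (A x) (B u + t x)" if "x \<in> int_vecs n" "u \<in> int_vecs m" for x u
  proof -
    have "\<psi> x u = \<psi> 0 u \<otimes> \<psi> x 0" using that psi_central(1)[of u x 0] by simp
    then have "\<phi> (\<psi> x u) = \<psi> 0 (B u) \<otimes> \<psi> (A x) (t x)" using that B At by simp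
    then show ?thesis using that B At by (simp add: psi_central)
  qed
  have Badd: "B (u + v) = B u + B v" if "u \<in> int_vecs m" "v \<in> int_vecs m" for u v
  proof -
    have "\<psi> 0 (u + v) = \<psi> 0 u \<otimes> \<psi> 0 v" using that by (simp add: psi_central)
    then have "\<psi> 0 (B (u + v)) = \<psi> 0 (B u) \<otimes> \<psi> 0 (B v)" using that B(2)[of "u + v"] B by simp
    then show ?thesis using that B(1) by (simp add: psi_central psi_inj)
  qed
  have Aadd: "A (x + y) = A x + A y" if "x \<in> int_vecs n" "y \<in> int_vecs n" for x y
  proof -
    have "\<psi> x 0 \<otimes> \<psi> y 0 = \<psi> (x + y) (\<beta> x y)" using that psi_mult[of x 0 y 0] by simp
    then have "\<phi> (\<psi> x 0) \<otimes> \<phi> (\<psi> y 0) = \<phi> (\<psi> (x + y) (\<beta> x y))" using that by (metis h.hom_mult int_vecs_zero psi_closed)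
    then have "\<psi> (A x) (t x) \<otimes> \<psi> (A y) (t y) = \<psi> (A (x + y)) (B (\<beta> x y) + t (x + y))" using that At full beta_in by simp
    then show ?thesis using that At B beta_in by (simp add: psi_mult psi_inj)
  qed
  have om: "\<omega> (A x) (A y) = B (\<omega> x y)" if xy: "x \<in> int_vecs n" "y \<in> int_vecs n" for x y
  proof -
    have "\<phi> (\<psi> 0 (\<omega> x y)) = \<phi> (\<psi> x 0) \<otimes> \<phi> (\<psi> y 0) \<otimes> inv (\<phi> (\<psi> x 0)) \<otimes> inv (\<phi> (\<psi> y 0))"
      using psi_commutator[OF xy(1) int_vecs_zero xy(2) int_vecs_zero, symmetric] xy by simp
    then have "\<psi> 0 (B (\<omega> x y)) = \<psi> 0 (\<omega> (A x) (A y))" using xy At B omega_in by (simp add: psi_commutator)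
    then show ?thesis using xy At B omega_in by (simp add: psi_inj)
  qed
  have "bij_betw B (int_vecs m) (int_vecs m)"
    unfolding bij_betw_def
  proof
    show "inj_on B (int_vecs m)"
    proof (rule inj_onI)
      fix u v assume uv: "u \<in> int_vecs m" "v \<in> int_vecs m" "B u = B v"
      then have "\<phi> (\<psi> 0 u) = \<phi> (\<psi> 0 v)" using B by simp
      then have "\<psi> 0 u = \<psi> 0 v" using bij_betw_imp_inj_on[OF bij] uv by (simp add: inj_on_def)
      then show "u = v" using uv by (simp add: psi_inj)
    qed
    show "B ` int_vecs m = int_vecs m"
    proof (intro equalityI subsetI)
      fix w assume "w \<in> B ` int_vecs m" then show "w \<in> int_vecs m" using B by auto
    next
      fix w assume w: "w \<in> int_vecs m"
      have "\<psi> 0 w \<in> \<phi> ` carrier G" using w bij_betw_imp_surj_on[OF bij] by simp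
      then obtain g where g: "g \<in> carrier G" "\<psi> 0 w = \<phi> g" by auto
      obtain x u where x: "x \<in> int_vecs n" "u \<in> int_vecs m" "g = \<psi> x u" using g(1) by (rule psi_cases)
      have "x = 0"
      proof (rule central[OF x(1,2)])
        fix k assume k: "k \<in> carrier G"
        have "\<phi> (g \<otimes> k) = \<phi> (k \<otimes> g)" using g k z[OF w, of "\<phi> k"] by simp
        then have "g \<otimes> k = k \<otimes> g" using bij_betw_imp_inj_on[OF bij] g(1) k by (simp add: inj_on_def)
        then show "\<psi> x u \<otimes> k = k \<otimes> \<psi> x u" using x(3) by simp
      qed
      then have "\<psi> 0 w = \<psi> 0 (B u)" using g(2) x B by simp
      then have "w = B u" using w x(2) B by (simp add: psi_inj)
      then show "w \<in> B ` int_vecs m" using x(2) by simp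
    qed
  qed
  moreover have "additive_on (int_vecs n) A" "additive_on (int_vecs m) B" using Aadd Badd by (simp_all add: additive_on_def)
  ultimately show ?thesis using At(1,2) om B(2) full by (intro exI[of _ A] exI[of _ B] exI[of _ t]) simp
qed

text \<open>If \<open>B\<close> fixes the functional \<open>f\<close>, then either \<open>f\<close> separates twisted classes of central elements,
  or \<open>A\<close> fixes some \<open>x \<noteq> 0\<close> and then also the functional \<open>y \<mapsto> f (\<omega> x y)\<close>.\<close>
lemma R_infinityI:
  assumes nd: "\<forall>x\<in>int_vecs n. (\<forall>y\<in>int_vecs n. \<omega> x y = 0) \<longrightarrow> x = 0"
    and ex: "\<And>A B. additive_on (int_vecs n) A \<Longrightarrow> bij_betw B (int_vecs m) (int_vecs m) \<Longrightarrow> additive_on (int_vecs m) B \<Longrightarrow>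
      (\<And>x. x \<in> int_vecs n \<Longrightarrow> A x \<in> int_vecs n) \<Longrightarrow>
      (\<And>x y. x \<in> int_vecs n \<Longrightarrow> y \<in> int_vecs n \<Longrightarrow> \<omega> (A x) (A y) = B (\<omega> x y)) \<Longrightarrow>
      \<exists>f. additive_on (int_vecs m) f \<and> (\<forall>u\<in>int_vecs m. f (B u) = (f u :: int)) \<and> (\<exists>u\<in>int_vecs m. f u \<noteq> 0) \<and>
        (\<forall>x\<in>int_vecs n. x \<noteq> 0 \<longrightarrow> (\<exists>y\<in>int_vecs n. f (\<omega> x y) \<noteq> 0))"
  shows "R_infinity G"
  unfolding R_infinity_def
proof
  fix \<phi> assume \<phi>: "\<phi> \<in> auto G"
  have hom: "\<phi> \<in> hom G G" using \<phi> by (simp add: auto_def)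
  obtain A B t where A: "additive_on (int_vecs n) A" and B: "bij_betw B (int_vecs m) (int_vecs m)" "additive_on (int_vecs m) B"
    and At': "\<forall>x\<in>int_vecs n. A x \<in> int_vecs n \<and> t x \<in> int_vecs m" and om: "\<forall>x\<in>int_vecs n. \<forall>y\<in>int_vecs n. \<omega> (A x) (A y) = B (\<omega> x y)"
    and \<phi>z: "\<forall>u\<in>int_vecs m. \<phi> (\<psi> 0 u) = \<psi> 0 (B u)" and \<phi>x: "\<forall>x\<in>int_vecs n. \<forall>u\<in>int_vecs m. \<phi> (\<psi> x u) = \<psi> (A x) (B u + t x)"
    using automorphism_components[OF \<phi> nd] by (elim exE conjE)
  have At: "A x \<in> int_vecs n" "t x \<in> int_vecs m" if "x \<in> int_vecs n" for x using At' that by simp_all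
  have Bin: "B u \<in> int_vecs m" if "u \<in> int_vecs m" for u using B(1) that by (rule bij_betw_apply)
  have "\<exists>f. additive_on (int_vecs m) f \<and> (\<forall>u\<in>int_vecs m. f (B u) = (f u :: int)) \<and> (\<exists>u\<in>int_vecs m. f u \<noteq> 0) \<and>
        (\<forall>x\<in>int_vecs n. x \<noteq> 0 \<longrightarrow> (\<exists>y\<in>int_vecs n. f (\<omega> x y) \<noteq> 0))"
    by (rule ex[OF A B At(1)]) (simp_all add: om)
  then obtain f :: "(nat \<Rightarrow> int) \<Rightarrow> int" where f: "additive_on (int_vecs m) f" "\<forall>u\<in>int_vecs m. f (B u) = f u" "\<exists>u\<in>int_vecs m. f u \<noteq> 0"
    "\<forall>x\<in>int_vecs n. x \<noteq> 0 \<longrightarrow> (\<exists>y\<in>int_vecs n. f (\<omega> x y) \<noteq> 0)" by (elim exE conjE)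
  show "reidemeister_number G \<phi> = \<infinity>"
  proof (cases "\<exists>x\<in>int_vecs n. x \<noteq> 0 \<and> A x = x")
    case False
    obtain u0 where u0: "u0 \<in> int_vecs m" "f u0 \<noteq> 0" using f(3) by auto
    show ?thesis
    proof (rule reidemeister_infiniteI[OF hom])
      fix i show "\<psi> 0 (smul i u0) \<in> carrier G" using u0 by simp
    next
      fix i j c assume c: "c \<in> carrier G" "\<psi> 0 (smul i u0) \<otimes> \<phi> c = c \<otimes> \<psi> 0 (smul j u0)"
      obtain x u where x: "x \<in> int_vecs n" "u \<in> int_vecs m" "c = \<psi> x u" using c(1) by (rule psi_cases)
      have "\<psi> (A x) (smul i u0 + (B u + t x)) = \<psi> x (u + smul j u0)"
        using c(2) x u0 At Bin \<phi>x by (simp add: psi_central)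
      then have e: "A x = x" "smul i u0 + (B u + t x) = u + smul j u0" using x u0 At Bin by (simp_all add: psi_inj)
      then have x0: "x = 0" using False x(1) by auto
      have "\<psi> (A 0) (B u + t 0) = \<psi> 0 (B u)" using \<phi>x \<phi>z x(2) by (metis int_vecs_zero)
      then have "t 0 = 0" using x(2) At[of 0] Bin by (simp add: psi_inj)
      then have "smul i u0 + B u = u + smul j u0" using e(2) x0 by simp
      then have "f (smul i u0 + B u) = f (u + smul j u0)" by simp
      then have "i * f u0 + f u = f u + j * f u0"
        using u0 x(2) Bin f(2) by (simp add: additive_on_add[OF f(1)] additive_on_smul_int[OF f(1)])
      then show "i = j" using u0(2) by simp
    qed
  next
    case True
    then obtain x0 where x0: "x0 \<in> int_vecs n" "x0 \<noteq> 0" "A x0 = x0" by auto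
    obtain y0 where y0: "y0 \<in> int_vecs n" "f (\<omega> x0 y0) \<noteq> 0" using f(4) x0 by auto
    define g where "g y = f (\<omega> x0 y)" for y
    have g: "additive_on (int_vecs n) g"
      using x0(1) by (simp add: additive_on_def g_def biadditive_onD[OF omega_biadditive] additive_on_add[OF f(1)] omega_in)
    have gA: "g (A y) = g y" if "y \<in> int_vecs n" for y
    proof -
      have "\<omega> x0 (A y) = B (\<omega> x0 y)" using om x0 that by metis
      then show ?thesis using f(2) x0(1) that by (simp add: g_def omega_in)
    qed
    show ?thesis
    proof (rule reidemeister_infiniteI[OF hom])
      fix i show "\<psi> (smul i y0) 0 \<in> carrier G" using y0 by simp
    next
      fix i j c assume c: "c \<in> carrier G" "\<psi> (smul i y0) 0 \<otimes> \<phi> c = c \<otimes> \<psi> (smul j y0) 0"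
      obtain x u where x: "x \<in> int_vecs n" "u \<in> int_vecs m" "c = \<psi> x u" using c(1) by (rule psi_cases)
      have "\<psi> (smul i y0) 0 \<otimes> \<psi> (A x) (B u + t x) = \<psi> x u \<otimes> \<psi> (smul j y0) 0" using c(2) x \<phi>x by simp
      then have "smul i y0 + A x = x + smul j y0" by (rule psi_mult_eq(1)[rotated 8]) (use x y0 At Bin in simp_all)
      then have "g (smul i y0 + A x) = g (x + smul j y0)" by simp
      then have "i * g y0 + g x = g x + j * g y0"
        using y0 x(1) At gA by (simp add: additive_on_add[OF g] additive_on_smul_int[OF g])
      then show "i = j" using y0(2) by (simp add: g_def)
    qed
  qed
qed

end

section \<open>Integral rotations and the quaternion bracket\<close>

lemma unit_norm_cases:
  fixes a b c :: int
  assumes "a * a + b * b + c * c = 1"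
  shows "(a, b, c) \<in> {(1, 0, 0), (-1, 0, 0), (0, 1, 0), (0, -1, 0), (0, 0, 1), (0, 0, -1)}"
proof -
  have sq: "x * x = 0 \<or> x * x \<ge> 1" for x :: int using zero_le_square[of x] by linarith
  have "x = 0 \<or> x = 1 \<or> x = -1" if "x * x \<le> 1" for x :: int
    using that abs_square_le_1[of x] by (auto simp: power2_eq_square)
  then have "a = 0 \<or> a = 1 \<or> a = -1" "b = 0 \<or> b = 1 \<or> b = -1" "c = 0 \<or> c = 1 \<or> c = -1"
    using assms zero_le_square[of a] zero_le_square[of b] zero_le_square[of c] by (smt (verit))+
  then show ?thesis using assms by (elim disjE) simp_all
qed

text \<open>The antisymmetric part of a rotation gives its axis unless the rotation is symmetric. A
  symmetric one is the identity or a half-turn, and then a nonzero row of the matrix plus 1 fixes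
  the axis. For integral matrices the rows are signed unit vectors, so these candidates are checked
  case by case.\<close>

lemma rotation_fixes_row:
  fixes a b c d e f g h k :: int
  assumes n: "a * a + b * b + c * c = 1" "d * d + e * e + f * f = 1" "g * g + h * h + k * k = 1"
    and o: "a * d + b * e + c * f = 0" "a * g + b * h + c * k = 0" "d * g + e * h + f * k = 0"
    and det: "a * (e * k - f * h) - b * (d * k - f * g) + c * (d * h - e * g) \<ge> 0"
  shows "\<exists>x y z. (x, y, z) \<noteq> (0, 0, 0) \<and> x * a + y * d + z * g = x \<and> x * b + y * e + z * h = y \<and> x * c + y * f + z * k = z"
proof -
  define P where "P x y z \<longleftrightarrow> (x, y, z) \<noteq> (0, 0, 0) \<and> x * a + y * d + z * g = x \<and> x * b + y * e + z * h = y \<and> x * c + y * f + z * k = z" for x y z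
  have r: "(a, b, c) \<in> {(1, 0, 0), (-1, 0, 0), (0, 1, 0), (0, -1, 0), (0, 0, 1), (0, 0, -1)}"
    "(d, e, f) \<in> {(1, 0, 0), (-1, 0, 0), (0, 1, 0), (0, -1, 0), (0, 0, 1), (0, 0, -1)}"
    "(g, h, k) \<in> {(1, 0, 0), (-1, 0, 0), (0, 1, 0), (0, -1, 0), (0, 0, 1), (0, 0, -1)}"
    by (rule unit_norm_cases, fact)+
  have "P (h - f) (c - g) (d - b) \<or> P (a + 1) b c \<or> P d (e + 1) f \<or> P g h (k + 1)"
    using r(1)[unfolded insert_iff empty_iff prod.inject] r(2)[unfolded insert_iff empty_iff prod.inject] r(3)[unfolded insert_iff empty_iff prod.inject] o det
    unfolding P_def by (elim disjE conjE FalseE) simp_all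
  then show ?thesis unfolding P_def by blast
qed

definition dot3 :: "(nat \<Rightarrow> int) \<Rightarrow> (nat \<Rightarrow> int) \<Rightarrow> int" where
  "dot3 u v = u 0 * v 0 + u 1 * v 1 + u 2 * v 2"

text \<open>An integral bilinear cocycle for the bracket below: from each antisymmetric pair of
  monomials one is kept.\<close>

definition quat_form :: "(nat \<Rightarrow> int) \<Rightarrow> (nat \<Rightarrow> int) \<Rightarrow> nat \<Rightarrow> int" where
  "quat_form x y = vec_of [x 0 * y 1 - x 2 * y 3, x 0 * y 2 - x 3 * y 1, x 0 * y 3 - x 1 * y 2]"

text \<open>The imaginary part of \<open>x\<^sup>* y\<close> for quaternions \<open>x\<close> and \<open>y\<close>.\<close>
definition quat_bracket :: "(nat \<Rightarrow> int) \<Rightarrow> (nat \<Rightarrow> int) \<Rightarrow> nat \<Rightarrow> int" where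
  "quat_bracket x y = quat_form x y - quat_form y x"

text \<open>The anti-self-dual forms on \<open>\<int>\<^sup>4\<close>, on which the Pfaffian is
  negative definite.\<close>

definition quat_coeffs :: "(nat \<Rightarrow> int) \<Rightarrow> nat \<Rightarrow> int" where
  "quat_coeffs v = vec_of [v 0, v 1, v 2, - v 2, v 1, - v 0]"

lemma quat_bracket_nth:
  "quat_bracket x y 0 = x 0 * y 1 - x 1 * y 0 - x 2 * y 3 + x 3 * y 2"
  "quat_bracket x y 1 = x 0 * y 2 - x 2 * y 0 - x 3 * y 1 + x 1 * y 3"
  "quat_bracket x y 2 = x 0 * y 3 - x 3 * y 0 - x 1 * y 2 + x 2 * y 1"
  by (simp_all add: quat_bracket_def quat_form_def vec_of_nth vec_apply)

lemma dot3_quat_bracket: "dot3 v (quat_bracket x y) = form4 (quat_coeffs v) x y"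
  by (simp add: dot3_def quat_bracket_nth form4_def quat_coeffs_def vec_of_nth vec_of_nth_45 algebra_simps del: One_nat_def)
     (simp add: vec_of_nth algebra_simps)

lemma pfaffian_quat_coeffs: "pfaffian (quat_coeffs v) = - dot3 v v"
  by (simp add: pfaffian_def quat_coeffs_def dot3_def vec_of_nth vec_of_nth_45)

lemma dot3_self_eq_0:
  assumes "v \<in> int_vecs 3" shows "dot3 v v = 0 \<longleftrightarrow> v = 0"
proof
  assume "dot3 v v = 0"
  then have "v 0 * v 0 = 0 \<and> v 1 * v 1 = 0 \<and> v 2 * v 2 = 0"
    using zero_le_square[of "v 0"] zero_le_square[of "v 1"] zero_le_square[of "v 2"] unfolding dot3_def by linarith
  then show "v = 0" using assms by (intro vec_eqI_3) (simp_all add: vec_apply)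
qed (simp add: dot3_def vec_apply)

text \<open>The norm is definite, so every nonzero functional \<open>v\<close> turns the bracket
  into a form with nonzero Pfaffian. Nondegeneracy for each single functional is what the case of a
  fixed vector of \<open>A\<close> requires.\<close>

lemma quat_bracket_nondegenerate:
  assumes v: "v \<in> int_vecs 3" "v \<noteq> 0" and x: "x \<in> int_vecs 4" "x \<noteq> 0"
  shows "\<exists>y\<in>int_vecs 4. dot3 v (quat_bracket x y) \<noteq> 0"
proof (rule ccontr)
  assume "\<not> (\<exists>y\<in>int_vecs 4. dot3 v (quat_bracket x y) \<noteq> 0)"
  then have z: "form4 (quat_coeffs v) x (unit_vec i) = 0" if "i < 4" for i using that by (simp add: dot3_quat_bracket)
  have "pfaffian (quat_coeffs v) \<noteq> 0" using v dot3_self_eq_0 by (simp add: pfaffian_quat_coeffs)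
  then have "x 0 = 0" "x 1 = 0" "x 2 = 0" "x 3 = 0"
    using pfaffian_adjugate[of "quat_coeffs v" x] z[of 0] z[of 1] z[of 2] z[of 3] by simp_all
  then have "x = 0" using x(1) by (intro vec_eqI_4) (simp_all add: vec_apply)
  then show False using x(2) by simp
qed

text \<open>Laplace expansion along the first two rows.\<close>

definition det4 :: "(nat \<Rightarrow> nat \<Rightarrow> int) \<Rightarrow> int" where
  "det4 a = (a 0 0 * a 1 1 - a 0 1 * a 1 0) * (a 2 2 * a 3 3 - a 2 3 * a 3 2) - (a 0 0 * a 1 2 - a 0 2 * a 1 0) * (a 2 1 * a 3 3 - a 2 3 * a 3 1)
   + (a 0 0 * a 1 3 - a 0 3 * a 1 0) * (a 2 1 * a 3 2 - a 2 2 * a 3 1) + (a 0 1 * a 1 2 - a 0 2 * a 1 1) * (a 2 0 * a 3 3 - a 2 3 * a 3 0)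
   - (a 0 1 * a 1 3 - a 0 3 * a 1 1) * (a 2 0 * a 3 2 - a 2 2 * a 3 0) + (a 0 2 * a 1 3 - a 0 3 * a 1 2) * (a 2 0 * a 3 1 - a 2 1 * a 3 0)"

text \<open>As a quadratic form in \<open>c\<close> the left-hand side has the coefficients \<open>S i j k l\<close>, the determinants of
  the columns \<open>i, j, k, l\<close> of \<open>a\<close>, which vanish unless \<open>i, j, k, l\<close> are distinct.\<close>
lemma pfaffian_form4_coeffs: "pfaffian (form4_coeffs c a) = det4 a * pfaffian c"
proof -
  define P where "P i j r s = a r i * a s j - a r j * a s i" for i j r s
  define S where "S i j k l = P i j 0 1 * P k l 2 3 - P i j 0 2 * P k l 1 3 + P i j 0 3 * P k l 1 2
    + P k l 0 1 * P i j 2 3 - P k l 0 2 * P i j 1 3 + P k l 0 3 * P i j 1 2" for i j k l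
  have rep: "S i j i l = 0" "S i j j l = 0" "S i j l j = 0" for i j l
    unfolding S_def P_def by (simp_all add: algebra_simps)
  have det: "S 0 1 2 3 = det4 a" "S 0 2 1 3 = - det4 a" "S 0 3 1 2 = det4 a"
    unfolding S_def P_def det4_def by (simp_all add: algebra_simps)
  have f: "form4 c (a r) (a s) = c 0 * P 0 1 r s + c 1 * P 0 2 r s + c 2 * P 0 3 r s + c 3 * P 1 2 r s + c 4 * P 1 3 r s + c 5 * P 2 3 r s" for r s
    by (simp add: form4_def P_def mult.commute)
  have e: "pfaffian (form4_coeffs c a) = form4 c (a 0) (a 1) * form4 c (a 2) (a 3) - form4 c (a 0) (a 2) * form4 c (a 1) (a 3)
     + form4 c (a 0) (a 3) * form4 c (a 1) (a 2)"
    by (simp add: pfaffian_def form4_coeffs_def vec_of_nth vec_of_nth_45)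
  have "2 * pfaffian (form4_coeffs c a) =
      c 0 * (c 0 * S 0 1 0 1 + 2 * c 1 * S 0 1 0 2 + 2 * c 2 * S 0 1 0 3 + 2 * c 3 * S 0 1 1 2 + 2 * c 4 * S 0 1 1 3 + 2 * c 5 * S 0 1 2 3)
    + c 1 * (c 1 * S 0 2 0 2 + 2 * c 2 * S 0 2 0 3 + 2 * c 3 * S 1 2 0 2 + 2 * c 4 * S 0 2 1 3 + 2 * c 5 * S 0 2 2 3)
    + c 2 * (c 2 * S 0 3 0 3 + 2 * c 3 * S 0 3 1 2 + 2 * c 4 * S 0 3 1 3 + 2 * c 5 * S 0 3 2 3)
    + c 3 * (c 3 * S 1 2 1 2 + 2 * c 4 * S 1 2 1 3 + 2 * c 5 * S 1 2 2 3)
    + c 4 * (c 4 * S 1 3 1 3 + 2 * c 5 * S 1 3 2 3) + c 5 * c 5 * S 2 3 2 3"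
    unfolding e f S_def by (simp only: distrib_left distrib_right left_diff_distrib right_diff_distrib) (simp add: ac_simps)
  also have "\<dots> = 2 * (det4 a * pfaffian c)"
    unfolding rep det pfaffian_def by (simp add: algebra_simps)
  finally show ?thesis by simp
qed

definition det3 :: "int \<Rightarrow> int \<Rightarrow> int \<Rightarrow> int \<Rightarrow> int \<Rightarrow> int \<Rightarrow> int \<Rightarrow> int \<Rightarrow> int \<Rightarrow> int" where
  "det3 a b c d e f g h k = a * (e * k - f * h) - b * (d * k - f * g) + c * (d * h - e * g)"

text \<open>The determinant is minus the sum of the squares of the 3 by 3 minors of
  \<open>x, y, z\<close>, which by Cauchy-Binet is their Gram determinant.\<close>

lemma quat_bracket_orientation:
  "det3 (quat_bracket x y 0) (quat_bracket x y 1) (quat_bracket x y 2) (quat_bracket x z 0) (quat_bracket x z 1) (quat_bracket x z 2)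
     (quat_bracket y z 0) (quat_bracket y z 1) (quat_bracket y z 2) \<le> 0" (is "?d \<le> 0")
proof -
  define m where "m i j k = det3 (x i) (x j) (x k) (y i) (y j) (y k) (z i) (z j) (z k)" for i j k
  have "?d = - (m 0 1 2 * m 0 1 2 + m 0 1 3 * m 0 1 3 + m 0 2 3 * m 0 2 3 + m 1 2 3 * m 1 2 3)"
    unfolding quat_bracket_nth m_def det3_def by (simp add: algebra_simps)
  then show ?thesis
    using zero_le_square[of "m 0 1 2"] zero_le_square[of "m 0 1 3"] zero_le_square[of "m 0 2 3"] zero_le_square[of "m 1 2 3"] by linarith
qed

lemma dot3_unit_vec: "i < 3 \<Longrightarrow> dot3 (unit_vec i) w = w i"
  by (auto simp: dot3_def unit_vec_def eval_nat_numeral less_Suc_eq)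

lemma quat_bracket_unit_vec:
  "quat_bracket (unit_vec 0) (unit_vec 1) = unit_vec 0" "quat_bracket (unit_vec 0) (unit_vec 2) = unit_vec 1"
  "quat_bracket (unit_vec 1) (unit_vec 2) = - unit_vec 2"
proof -
  have "quat_bracket x y \<in> int_vecs 3" for x y by (simp add: quat_bracket_def quat_form_def)
  note eqI = vec_eqI_3[OF this]
  show "quat_bracket (unit_vec 0) (unit_vec 1) = unit_vec 0" "quat_bracket (unit_vec 0) (unit_vec 2) = unit_vec 1"
    "quat_bracket (unit_vec 1) (unit_vec 2) = - unit_vec 2"
    by (rule eqI; simp add: quat_bracket_nth[unfolded One_nat_def] unit_vec_def vec_apply)+
qed

text \<open>By the Pfaffian, the transpose of \<open>B\<close> multiplies the norm of \<open>\<int>\<^sup>3\<close> by \<open>det A\<close>. Hence \<open>B\<close> is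
  orthogonal, and the orientation of \<open>quat_bracket\<close> makes it a rotation.\<close>
lemma quat_bracket_automorphism:
  assumes A: "additive_on (int_vecs 4) A" "\<And>x. x \<in> int_vecs 4 \<Longrightarrow> A x \<in> int_vecs 4"
    and B: "additive_on (int_vecs 3) B" "bij_betw B (int_vecs 3) (int_vecs 3)"
    and AB: "\<And>x y. x \<in> int_vecs 4 \<Longrightarrow> y \<in> int_vecs 4 \<Longrightarrow> quat_bracket (A x) (A y) = B (quat_bracket x y)"
  shows "\<exists>v\<in>int_vecs 3. v \<noteq> 0 \<and> (\<forall>u\<in>int_vecs 3. dot3 v (B u) = dot3 v u)"
proof -
  define p where "p i = B (unit_vec i)" for i
  define a where "a i = A (unit_vec i)" for i
  \<comment> \<open>The transpose of \<open>B\<close>.\<close>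
  define T where "T v = vec_of [dot3 v (p 0), dot3 v (p 1), dot3 v (p 2)]" for v
  have Bin: "B u \<in> int_vecs 3" if "u \<in> int_vecs 3" for u using B(2) that by (rule bij_betw_apply)
  have qin: "quat_bracket x y \<in> int_vecs 3" for x y by (simp add: quat_bracket_def quat_form_def)
  have Bu: "B u = lin_comb 3 p u" if "u \<in> int_vecs 3" for u
    unfolding p_def by (rule additive_on_expand[OF B(1) that])
  have adj: "dot3 v (B u) = dot3 (T v) u" if "u \<in> int_vecs 3" for u v
    unfolding Bu[OF that] lin_comb_small by (simp add: dot3_def T_def vec_of_nth smul_def vec_apply algebra_simps)
  \<comment> \<open>Pulling the form of \<open>v\<close> back along \<open>A\<close> gives the form
    of \<open>T v\<close>, so that their Pfaffians can be compared.\<close>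
  have co: "form4 (quat_coeffs v) (a i) (a j) = form4 (quat_coeffs (T v)) (unit_vec i) (unit_vec j)" if "i < 4" "j < 4" for v i j
    using that by (simp add: dot3_quat_bracket[symmetric] a_def AB adj qin)
  have "form4_coeffs (quat_coeffs v) a = vec_of [quat_coeffs (T v) 0, quat_coeffs (T v) 1, quat_coeffs (T v) 2,
      quat_coeffs (T v) 3, quat_coeffs (T v) 4, quat_coeffs (T v) 5]" for v
    unfolding form4_coeffs_def using co[of 0 1 v] co[of 0 2 v] co[of 0 3 v] co[of 1 2 v] co[of 1 3 v] co[of 2 3 v]
    unfolding form4_unit by simp
  then have "pfaffian (form4_coeffs (quat_coeffs v) a) = pfaffian (quat_coeffs (T v))" for v
    by (simp add: pfaffian_def vec_of_nth vec_of_nth_45)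
  then have norm: "dot3 (T v) (T v) = det4 a * dot3 v v" for v
    by (simp add: pfaffian_form4_coeffs pfaffian_quat_coeffs)
  define r where "r i = T (unit_vec i)" for i
  have rB: "dot3 (r i) u = B u i" if "i < 3" "u \<in> int_vecs 3" for i u
    using that by (simp add: r_def adj[symmetric] dot3_unit_vec)
  have r: "r i j = p j i" if "i < 3" "j < 3" for i j
    using rB[OF that(1), of "unit_vec j"] that dot3_unit_vec[of j "r i"] by (simp add: p_def dot3_def mult.commute)
  \<comment> \<open>Polarisation of \<open>norm\<close>: the rows of \<open>B\<close> are orthogonal
    with common norm \<open>det4 a\<close>.\<close>
  have orth: "dot3 (r i) (r j) = (if i = j then det4 a else 0)" if "i < 3" "j < 3" for i j
  proof -
    have "T (unit_vec i + unit_vec j) = r i + r j"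
      unfolding r_def T_def vec_of_add by (simp add: dot3_def vec_apply algebra_simps)
    then have "dot3 (r i + r j) (r i + r j) = det4 a * dot3 (unit_vec i + unit_vec j) (unit_vec i + unit_vec j)"
      using norm[of "unit_vec i + unit_vec j"] by simp
    moreover have "dot3 (x + y) (x + y) = dot3 x x + 2 * dot3 x y + dot3 y y" for x y
      by (simp add: dot3_def vec_apply algebra_simps)
    moreover have "dot3 (unit_vec i) (unit_vec j) = (if i = j then 1 else 0)" if "i < 3" for i j
      using that by (simp add: dot3_unit_vec) (simp add: unit_vec_def)
    moreover have "dot3 (r i) (r i) = det4 a * dot3 (unit_vec i) (unit_vec i)" for i
      unfolding r_def by (rule norm)
    ultimately show ?thesis using that by (auto simp: distrib_left)
  qed
  \<comment> \<open>So far \<open>B\<close> is a similarity. Surjectivity makes it an isometry: if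
    \<open>B c\<close> is the first unit vector, then \<open>det4 a * dot3 c c = 1\<close>.\<close>
  have "unit_vec 0 \<in> B ` int_vecs 3" using bij_betw_imp_surj_on[OF B(2)] by simp
  then obtain c where c: "c \<in> int_vecs 3" "B c = unit_vec 0" by auto
  have rin: "r i \<in> int_vecs 3" for i by (simp add: r_def T_def)
  have "B (smul (det4 a) c) = B (r 0)"
  proof (rule int_vecs_eqI[of _ 3])
    fix i :: nat assume i: "i < 3"
    have "B (smul (det4 a) c) i = det4 a * unit_vec 0 i"
      using additive_on_smul[OF B(1) c(1)] c(2) by (simp add: smul_def)
    also have "\<dots> = B (r 0) i" using rB[OF i rin[of 0]] orth[OF i, of 0] by (auto simp: unit_vec_def split: if_splits)
    finally show "B (smul (det4 a) c) i = B (r 0) i" .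
  qed (use c rin Bin in simp_all)
  then have Dc: "smul (det4 a) c = r 0" using bij_betw_imp_inj_on[OF B(2)] c(1) rin by (simp add: inj_on_def)
  have "dot3 (r 0) c = 1" using rB[of 0 c] c by (simp add: unit_vec_def)
  then have "det4 a * dot3 c c = 1" unfolding Dc[symmetric] by (simp add: dot3_def smul_def algebra_simps)
  moreover have "dot3 c c \<ge> 0" by (simp add: dot3_def)
  ultimately have D: "det4 a = 1" by (auto simp: zmult_eq_1_iff)
  \<comment> \<open>The brackets of the images of three unit vectors are the columns of
    \<open>B\<close>, the last one negated; the orientation inequality therefore makes the
    determinant of \<open>B\<close> nonnegative.\<close>
  have "quat_bracket (a 0) (a 1) = p 0" "quat_bracket (a 0) (a 2) = p 1" "quat_bracket (a 1) (a 2) = - p 2"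
    using AB[of "unit_vec 0" "unit_vec 1"] AB[of "unit_vec 0" "unit_vec 2"] AB[of "unit_vec 1" "unit_vec 2"]
      additive_on_uminus[OF B(1), of "unit_vec 2"]
    by (simp_all add: a_def p_def quat_bracket_unit_vec[unfolded One_nat_def])
  then have det: "det3 (p 0 0) (p 0 1) (p 0 2) (p 1 0) (p 1 1) (p 1 2) (- p 2 0) (- p 2 1) (- p 2 2) \<le> 0"
    using quat_bracket_orientation[of "a 0" "a 1" "a 2"] by (simp add: vec_apply)
  have "\<exists>x y z. (x, y, z) \<noteq> (0, 0, 0) \<and> x * p 0 0 + y * p 0 1 + z * p 0 2 = x \<and>
    x * p 1 0 + y * p 1 1 + z * p 1 2 = y \<and> x * p 2 0 + y * p 2 1 + z * p 2 2 = z"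
  proof (rule rotation_fixes_row)
    show "p 0 0 * (p 1 1 * p 2 2 - p 2 1 * p 1 2) - p 1 0 * (p 0 1 * p 2 2 - p 2 1 * p 0 2) + p 2 0 * (p 0 1 * p 1 2 - p 1 1 * p 0 2) \<ge> 0"
      using det unfolding det3_def by (simp add: algebra_simps)
  qed (use orth[of 0 0] orth[of 1 1] orth[of 2 2] orth[of 0 1] orth[of 0 2] orth[of 1 2] D in \<open>simp_all add: dot3_def r\<close>)
  then obtain x y z where v: "(x, y, z) \<noteq> (0, 0, 0)" "x * p 0 0 + y * p 0 1 + z * p 0 2 = x"
    "x * p 1 0 + y * p 1 1 + z * p 1 2 = y" "x * p 2 0 + y * p 2 1 + z * p 2 2 = z" by (elim exE conjE)
  have "vec_of [x, y, z] \<noteq> vec_of [0, 0, 0]" using v(1) by (simp add: vec_of_eq)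
  moreover have "vec_of [0, 0, 0] = 0" by (rule vec_eqI_3) (simp_all add: vec_of_nth vec_apply)
  moreover have "T (vec_of [x, y, z]) = vec_of [x, y, z]"
    using v(2-4) by (simp add: T_def dot3_def vec_of_nth vec_of_eq)
  ultimately show ?thesis using adj by (intro bexI[of _ "vec_of [x, y, z]"]) simp_all
qed

section \<open>The quaternionic Heisenberg group on the natural numbers\<close>

text \<open>The example is sought on the type \<open>nat\<close>, so the pairs of vectors, a
  countably infinite set, are enumerated.\<close>

definition quat_code :: "(nat \<Rightarrow> int) \<Rightarrow> (nat \<Rightarrow> int) \<Rightarrow> nat" where
  "quat_code x u = to_nat_on (int_vecs 4 \<times> int_vecs 3) (x, u)"

definition quat_group :: "nat monoid" where
  "quat_group = \<lparr>carrier = UNIV,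
     monoid.mult = (\<lambda>g h. let (x, u) = from_nat_into (int_vecs 4 \<times> int_vecs 3) g; (y, w) = from_nat_into (int_vecs 4 \<times> int_vecs 3) h
       in quat_code (x + y) (u + w + quat_form x y)),
     monoid.one = quat_code 0 0\<rparr>"

lemma countable_int_vecs: "countable (int_vecs n)"
proof -
  have "int_vecs n \<subseteq> range vec_of"
  proof
    fix x assume "x \<in> int_vecs n"
    then have "x = vec_of (map x [0..<n])" by (auto simp: vec_of_def int_vecs_def fun_eq_iff)
    then show "x \<in> range vec_of" by (rule range_eqI)
  qed
  then show ?thesis by (rule countable_subset) simp
qed

lemma infinite_int_vecs:
  assumes "0 < n" shows "infinite (int_vecs n)"
proof -
  have "inj (\<lambda>c. smul c (unit_vec 0))"
  proof (rule injI)
    fix c d assume "smul c (unit_vec 0) = smul d (unit_vec 0)"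
    then have "smul c (unit_vec 0) 0 = smul d (unit_vec 0) 0" by simp
    then show "c = d" by (simp add: smul_def unit_vec_def)
  qed
  then have "infinite (range (\<lambda>c. smul c (unit_vec 0)))" using infinite_UNIV_int finite_imageD by blast
  moreover have "range (\<lambda>c. smul c (unit_vec 0)) \<subseteq> int_vecs n" using assms by auto
  ultimately show ?thesis using finite_subset by blast
qed

lemma quat_carrier: "countable (int_vecs 4 \<times> int_vecs 3)" "infinite (int_vecs 4 \<times> int_vecs 3)"
proof -
  show "countable (int_vecs 4 \<times> int_vecs 3)" by (intro countable_SIGMA countable_int_vecs)
  have "int_vecs 3 \<noteq> {}" using int_vecs_zero by blast
  then show "infinite (int_vecs 4 \<times> int_vecs 3)" using infinite_int_vecs[of 4] by (auto simp: finite_cartesian_product_iff)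
qed

lemma quat_code_bij: "bij_betw (\<lambda>(x, u). quat_code x u) (int_vecs 4 \<times> int_vecs 3) UNIV"
  using to_nat_on_infinite[OF quat_carrier] by (simp add: quat_code_def case_prod_beta)

lemma quat_code_cases:
  obtains x u where "x \<in> int_vecs 4" "u \<in> int_vecs 3" "g = quat_code x u"
proof -
  have "g \<in> (\<lambda>(x, u). quat_code x u) ` (int_vecs 4 \<times> int_vecs 3)" using bij_betw_imp_surj_on[OF quat_code_bij] by simp
  then show ?thesis using that by auto
qed

lemma quat_mult:
  assumes "x \<in> int_vecs 4" "u \<in> int_vecs 3" "y \<in> int_vecs 4" "w \<in> int_vecs 3"
  shows "quat_code x u \<otimes>\<^bsub>quat_group\<^esub> quat_code y w = quat_code (x + y) (u + w + quat_form x y)"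
  using assms from_nat_into_to_nat_on[OF quat_carrier(1), of "(x, u)"] from_nat_into_to_nat_on[OF quat_carrier(1), of "(y, w)"]
  by (simp add: quat_group_def quat_code_def)

lemma quat_form_in: "quat_form x y \<in> int_vecs 3"
  by (simp add: quat_form_def)

lemma quat_form_add: "quat_form (x + y) z = quat_form x z + quat_form y z" "quat_form z (x + y) = quat_form z x + quat_form z y"
  by (rule ext; simp add: quat_form_def vec_of_add; simp add: vec_apply algebra_simps)+

lemma quat_form_biadditive: "biadditive_on (int_vecs 4) quat_form"
  by (simp add: biadditive_on_def additive_on_def quat_form_add)

lemma quat_form_zero: "quat_form 0 y = 0" "quat_form x 0 = 0"
  using quat_form_add(1)[of 0 0 y] quat_form_add(2)[of x 0 0] by simp_all

lemma quat_one: "\<one>\<^bsub>quat_group\<^esub> = quat_code 0 0"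
  by (simp add: quat_group_def)

lemma quat_group: "group quat_group"
proof (rule groupI)
  fix g h k
  obtain x u where g: "x \<in> int_vecs 4" "u \<in> int_vecs 3" "g = quat_code x u" by (rule quat_code_cases)
  obtain y w where h: "y \<in> int_vecs 4" "w \<in> int_vecs 3" "h = quat_code y w" by (rule quat_code_cases)
  obtain z v where k: "z \<in> int_vecs 4" "v \<in> int_vecs 3" "k = quat_code z v" by (rule quat_code_cases)
  show "g \<otimes>\<^bsub>quat_group\<^esub> h \<otimes>\<^bsub>quat_group\<^esub> k = g \<otimes>\<^bsub>quat_group\<^esub> (h \<otimes>\<^bsub>quat_group\<^esub> k)"
    using g h k by (simp add: quat_mult quat_form_in quat_form_add add_ac)
next
  fix g
  obtain x u where g: "x \<in> int_vecs 4" "u \<in> int_vecs 3" "g = quat_code x u" by (rule quat_code_cases)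
  show "\<one>\<^bsub>quat_group\<^esub> \<otimes>\<^bsub>quat_group\<^esub> g = g" using g by (simp add: quat_one quat_mult quat_form_zero)
  have "- u - quat_form (- x) x \<in> int_vecs 3" using g quat_form_in by simp
  then have "quat_code (- x) (- u - quat_form (- x) x) \<otimes>\<^bsub>quat_group\<^esub> g = \<one>\<^bsub>quat_group\<^esub>"
    using g by (simp add: quat_one quat_mult)
  then show "\<exists>h\<in>carrier quat_group. h \<otimes>\<^bsub>quat_group\<^esub> g = \<one>\<^bsub>quat_group\<^esub>" by (auto simp: quat_group_def)
qed (simp_all add: quat_group_def)

interpretation quat: central_extension quat_group 4 3 quat_form quat_code
proof (intro central_extension.intro central_extension_axioms.intro)
  show "bij_betw (\<lambda>(x, u). quat_code x u) (int_vecs 4 \<times> int_vecs 3) (carrier quat_group)"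
    using quat_code_bij by (simp add: quat_group_def)
qed (simp_all add: quat_group quat_form_in quat_form_biadditive quat_mult)

lemma quat_omega: "quat.\<omega> = quat_bracket"
  by (simp add: fun_eq_iff quat.\<omega>_def quat_bracket_def)

lemma quat_two_step_nilpotent: "two_step_nilpotent quat_group"
proof (rule quat.two_step_nilpotent)
  have "unit_vec 0 0 \<noteq> (0 :: nat \<Rightarrow> int) 0" by (simp add: unit_vec_def vec_apply)
  then show "quat.\<omega> (unit_vec 0) (unit_vec 1) \<noteq> 0" unfolding quat_omega quat_bracket_unit_vec by metis
qed simp_all

lemma quat_R_infinity: "R_infinity quat_group"
proof (rule quat.R_infinityI)
  have unit: "unit_vec 0 \<noteq> (0 :: nat \<Rightarrow> int)"
  proof
    assume "unit_vec 0 = (0 :: nat \<Rightarrow> int)"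
    from fun_cong[OF this, of 0] show False by (simp add: unit_vec_def vec_apply)
  qed
  show "\<forall>x\<in>int_vecs 4. (\<forall>y\<in>int_vecs 4. quat.\<omega> x y = 0) \<longrightarrow> x = 0"
  proof (intro ballI impI, rule ccontr)
    fix x assume x: "x \<in> int_vecs 4" "\<forall>y\<in>int_vecs 4. quat.\<omega> x y = 0" "x \<noteq> 0"
    obtain y where "y \<in> int_vecs 4" "dot3 (unit_vec 0) (quat_bracket x y) \<noteq> 0"
      using quat_bracket_nondegenerate[OF _ unit x(1,3)] by auto
    then show False using x(2) by (simp add: quat_omega dot3_def vec_apply)
  qed
next
  fix A B
  assume A: "additive_on (int_vecs 4) A" "\<And>x. x \<in> int_vecs 4 \<Longrightarrow> A x \<in> int_vecs 4"
    and B: "bij_betw B (int_vecs 3) (int_vecs 3)" "additive_on (int_vecs 3) B"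
    and AB: "\<And>x y. x \<in> int_vecs 4 \<Longrightarrow> y \<in> int_vecs 4 \<Longrightarrow> quat.\<omega> (A x) (A y) = B (quat.\<omega> x y)"
  have "\<exists>v\<in>int_vecs 3. v \<noteq> 0 \<and> (\<forall>u\<in>int_vecs 3. dot3 v (B u) = dot3 v u)"
    by (rule quat_bracket_automorphism[OF A B(2,1) AB[unfolded quat_omega]])
  then obtain v where v: "v \<in> int_vecs 3" "v \<noteq> 0" "\<forall>u\<in>int_vecs 3. dot3 v (B u) = dot3 v u" by (elim bexE conjE)
  have "additive_on (int_vecs 3) (dot3 v)" by (simp add: additive_on_def dot3_def vec_apply algebra_simps)
  moreover have "\<exists>u\<in>int_vecs 3. dot3 v u \<noteq> 0" using v dot3_self_eq_0 by auto
  moreover have "\<forall>x\<in>int_vecs 4. x \<noteq> 0 \<longrightarrow> (\<exists>y\<in>int_vecs 4. dot3 v (quat.\<omega> x y) \<noteq> 0)"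
    using quat_bracket_nondegenerate[OF v(1,2)] by (simp add: quat_omega)
  ultimately show "\<exists>f. additive_on (int_vecs 3) f \<and> (\<forall>u\<in>int_vecs 3. f (B u) = (f u :: int)) \<and> (\<exists>u\<in>int_vecs 3. f u \<noteq> 0) \<and>
      (\<forall>x\<in>int_vecs 4. x \<noteq> 0 \<longrightarrow> (\<exists>y\<in>int_vecs 4. f (quat.\<omega> x y) \<noteq> 0))"
    using v(3) by - (intro exI[of _ "dot3 v"] conjI)
qed

theorem theorem5p1:
  shows "(\<forall>G :: ('a, 'b) monoid_scheme.
            group G \<and> finitely_generated G \<and> torsion_free G \<and> two_step_nilpotent G \<and>
            hirsch_length G \<le> 6 \<longrightarrow> \<not> R_infinity G)
       \<and> (\<exists>G :: nat monoid.
            group G \<and> finitely_generated G \<and> torsion_free G \<and> two_step_nilpotent G \<and>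
            hirsch_length G = 7 \<and> R_infinity G)"
proof
  show "\<forall>G :: ('a, 'b) monoid_scheme. group G \<and> finitely_generated G \<and> torsion_free G \<and> two_step_nilpotent G \<and>
      hirsch_length G \<le> 6 \<longrightarrow> \<not> R_infinity G"
    using group.not_R_infinity_if_small by blast
  have "hirsch_length quat_group = 7" using quat.hirsch_length_eq_sum by simp
  then show "\<exists>G :: nat monoid. group G \<and> finitely_generated G \<and> torsion_free G \<and> two_step_nilpotent G \<and>
      hirsch_length G = 7 \<and> R_infinity G"
    using quat_group quat.finitely_generated quat.torsion_free quat_two_step_nilpotent quat_R_infinity by blast
qed

end
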